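(* Suppose that for some $q\in[0,1]$, $$\lim_{N\to\infty}\mathbb{E}\bigl\langle(R_{1,2}-q)^2\bigr\rangle=0,$$ and let $m=(\langle\sigma_1\rangle,\dots,\langle\sigma_N\rangle)$. Then $$\lim_{N\to\infty}\mathbb{E}\bigl(F_N^{\mathrm{TAP}}(m)-F_N\bigr)^2=0.$$
   Context: Let $(\beta_p)_{p\ge2}$ be a real sequence with $\sum_{p\ge2}2^p\beta_p^2<\infty$, $\xi(s)=\sum_{p\ge2}\beta_p^2s^p$, and $h\in\mathbb{R}$. For $m\in[-1,1]^N$ let $$X_N(m)=\sum_{p\ge2}\frac{\beta_p}{N^{(p-1)/2}}\sum_{1\le i_1,\dots,i_p\le N}g_{i_1,\dots,i_p}m_{i_1}\cdots m_{i_p},\qquad H_N(m)=X_N(m)+h\sum_{i=1}^Nm_i,$$ where the $g_{i_1,\dots,i_p}$ are i.i.d. standard Gaussians; $\mathbb{E}$ is expectation over them. Let $\Sigma_N=\{-1,+1\}^N$, $F_N=\frac1N\log\sum_{\sigma\in\Sigma_N}\exp H_N(\sigma)$, and let $G_N(\sigma)=\exp H_N(\sigma)/\sum_{\sigma'\in\Sigma_N}\exp H_N(\sigma')$ be the Gibbs measure. $\langle\cdot\rangle$ denotes the average with respect to $G_N$ and its products (i.e. over independent replicas $\sigma^1,\sigma^2,\dots$ sampled from $G_N$), and $R_{1,2}=\frac1N\sum_{i=1}^N\sigma^1_i\sigma^2_i$ is the overlap of two replicas. The TAP free energy is $$F_N^{\mathrm{TAP}}(m)=\frac{H_N(m)}N-\frac1N\sum_{i=1}^NI(m_i)+C\Bigl(\frac1N\sum_{i=1}^Nm_i^2\Bigr),\qquad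 m\in[-1,1]^N,$$ with $I(x)=\frac{1+x}2\log\frac{1+x}2+\frac{1-x}2\log\frac{1-x}2$ for $x\in[-1,1]$ and $C(u)=\frac12\bigl(\xi(1)-\xi(u)-\xi'(u)(1-u)\bigr)$ for $u\in[0,1]$. *)

theory Defs
  imports "HOL-Probability.Probability"
begin

text \<open>
  A realisation of the disorder is a function \<open>g :: nat list \<Rightarrow> real\<close>: the coefficient
  \<open>g\<^bsub>i1,\<dots>,ip\<^esub>\<close> is the value at the list \<open>[i1, \<dots>, ip]\<close>, so that the length of the list
  determines \<open>p\<close>. Vectors indexed by \<open>{1..N}\<close> are functions \<open>nat \<Rightarrow> real\<close>, of which only the
  values on \<open>{1..N}\<close> are used. Sequences \<open>\<beta>\<close> are indexed by \<open>p \<ge> 2\<close>; the values \<open>\<beta> 0\<close> and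
  \<open>\<beta> 1\<close> are never used.
\<close>

definition multi_indices :: "nat \<Rightarrow> nat \<Rightarrow> nat list set" where
  "multi_indices N p = {js. set js \<subseteq> {1..N} \<and> length js = p}"

definition xi :: "(nat \<Rightarrow> real) \<Rightarrow> real \<Rightarrow> real" where
  "xi \<beta> s = (\<Sum>k. (\<beta> (k + 2))\<^sup>2 * s ^ (k + 2))"

definition pure_hamiltonian ::
    "(nat \<Rightarrow> real) \<Rightarrow> (nat list \<Rightarrow> real) \<Rightarrow> nat \<Rightarrow> nat \<Rightarrow> (nat \<Rightarrow> real) \<Rightarrow> real" where
  "pure_hamiltonian \<beta> g N p m =
     \<beta> p / real N powr ((real p - 1) / 2) *
       (\<Sum>js\<in>multi_indices N p. g js * prod_list (map m js))"

text \<open>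
  For a fixed \<open>N\<close>, if \<open>\<Sum>p. 2 ^ p * (\<beta> p)\<^sup>2\<close> converges, then for almost every realisation \<open>g\<close> of
  i.i.d. standard Gaussians the following series converges for all \<open>m\<close> in \<open>[-1,1]\<^sup>N\<close>
  simultaneously, hence also for disorder-dependent \<open>m\<close>.
\<close>

definition mixed_hamiltonian ::
    "(nat \<Rightarrow> real) \<Rightarrow> (nat list \<Rightarrow> real) \<Rightarrow> nat \<Rightarrow> (nat \<Rightarrow> real) \<Rightarrow> real" where
  "mixed_hamiltonian \<beta> g N m = (\<Sum>k. pure_hamiltonian \<beta> g N (k + 2) m)"

definition hamiltonian ::
    "(nat \<Rightarrow> real) \<Rightarrow> real \<Rightarrow> (nat list \<Rightarrow> real) \<Rightarrow> nat \<Rightarrow> (nat \<Rightarrow> real) \<Rightarrow> real" where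
  "hamiltonian \<beta> h g N m = mixed_hamiltonian \<beta> g N m + h * (\<Sum>i=1..N. m i)"

definition spin_configs :: "nat \<Rightarrow> (nat \<Rightarrow> real) set" where
  "spin_configs N = {1..N} \<rightarrow>\<^sub>E {-1, 1}"

definition partition_function ::
    "(nat \<Rightarrow> real) \<Rightarrow> real \<Rightarrow> (nat list \<Rightarrow> real) \<Rightarrow> nat \<Rightarrow> real" where
  "partition_function \<beta> h g N = (\<Sum>\<sigma>\<in>spin_configs N. exp (hamiltonian \<beta> h g N \<sigma>))"

definition free_energy ::
    "(nat \<Rightarrow> real) \<Rightarrow> real \<Rightarrow> (nat list \<Rightarrow> real) \<Rightarrow> nat \<Rightarrow> real" where
  "free_energy \<beta> h g N = ln (partition_function \<beta> h g N) / real N"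

definition gibbs_weight ::
    "(nat \<Rightarrow> real) \<Rightarrow> real \<Rightarrow> (nat list \<Rightarrow> real) \<Rightarrow> nat \<Rightarrow> (nat \<Rightarrow> real) \<Rightarrow> real" where
  "gibbs_weight \<beta> h g N \<sigma> = exp (hamiltonian \<beta> h g N \<sigma>) / partition_function \<beta> h g N"

definition gibbs_avg ::
    "(nat \<Rightarrow> real) \<Rightarrow> real \<Rightarrow> (nat list \<Rightarrow> real) \<Rightarrow> nat \<Rightarrow> ((nat \<Rightarrow> real) \<Rightarrow> real) \<Rightarrow> real" where
  "gibbs_avg \<beta> h g N f = (\<Sum>\<sigma>\<in>spin_configs N. gibbs_weight \<beta> h g N \<sigma> * f \<sigma>)"

definition gibbs_avg2 ::
    "(nat \<Rightarrow> real) \<Rightarrow> real \<Rightarrow> (nat list \<Rightarrow> real) \<Rightarrow> nat \<Rightarrow>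
      ((nat \<Rightarrow> real) \<Rightarrow> (nat \<Rightarrow> real) \<Rightarrow> real) \<Rightarrow> real" where
  "gibbs_avg2 \<beta> h g N f =
     (\<Sum>\<sigma>\<in>spin_configs N. \<Sum>\<tau>\<in>spin_configs N.
        gibbs_weight \<beta> h g N \<sigma> * gibbs_weight \<beta> h g N \<tau> * f \<sigma> \<tau>)"

definition overlap :: "nat \<Rightarrow> (nat \<Rightarrow> real) \<Rightarrow> (nat \<Rightarrow> real) \<Rightarrow> real" where
  "overlap N \<sigma> \<tau> = (\<Sum>i=1..N. \<sigma> i * \<tau> i) / real N"

definition magnetization ::
    "(nat \<Rightarrow> real) \<Rightarrow> real \<Rightarrow> (nat list \<Rightarrow> real) \<Rightarrow> nat \<Rightarrow> nat \<Rightarrow> real" where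
  "magnetization \<beta> h g N i = gibbs_avg \<beta> h g N (\<lambda>\<sigma>. \<sigma> i)"

text \<open>At \<open>x = \<plusminus>1\<close> the usual convention \<open>0 log 0 = 0\<close> holds automatically.\<close>

definition entropy_term :: "real \<Rightarrow> real" where
  "entropy_term x = (1 + x) / 2 * ln ((1 + x) / 2) + (1 - x) / 2 * ln ((1 - x) / 2)"

definition tap_correction :: "(nat \<Rightarrow> real) \<Rightarrow> real \<Rightarrow> real" where
  "tap_correction \<beta> u = (xi \<beta> 1 - xi \<beta> u - deriv (xi \<beta>) u * (1 - u)) / 2"

definition tap_free_energy ::
    "(nat \<Rightarrow> real) \<Rightarrow> real \<Rightarrow> (nat list \<Rightarrow> real) \<Rightarrow> nat \<Rightarrow> (nat \<Rightarrow> real) \<Rightarrow> real" where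
  "tap_free_energy \<beta> h g N m =
     hamiltonian \<beta> h g N m / real N
     - (\<Sum>i=1..N. entropy_term (m i)) / real N
     + tap_correction \<beta> ((\<Sum>i=1..N. (m i)\<^sup>2) / real N)"

end

theory Submission
  imports Defs "HOL-Real_Asymp.Real_Asymp"
begin

text \<open>The free energy is bounded above by the TAP free energy of the magnetization by a first
  moment computation with a fixed number \<open>n\<close> of replicas. Let \<open>b\<close> be the barycentre of \<open>n\<close> replicas.
  The Gaussian variable \<open>\<Sum>\<^sub>l X(\<sigma>\<^sup>l) - n X(b)\<close> has variance at most \<open>2 n N C(q)\<close> when all overlaps are
  close to \<open>q\<close> (\<open>replica_variance_le\<close>), and the weights \<open>exp (n \<Sum>\<^sub>i I(b\<^sub>i))\<close> of all \<open>n\<close>-tuples add up to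
  at most \<open>(n + 1)\<^sup>N\<close> (\<open>sum_entropy_weights\<close>). Jensen's inequality under the replicated Gibbs measure
  then shows that \<open>F\<^sub>N\<close> is at most \<open>ln (n + 1) / n\<close> plus the average of the TAP free energy at \<open>b\<close>, up to
  the fluctuation of the overlap. Convexity of \<open>I\<close> replaces \<open>I(b\<^sub>i)\<close> by \<open>I(m\<^sub>i)\<close>, and \<open>X(b)\<close> has the
  average \<open>X(m)\<close> up to \<open>O(1 / n)\<close>, because only tuples of indices with a repeated replica contribute to
  the difference. Letting first \<open>N\<close> and then \<open>n\<close> tend to infinity, the negative part of
  \<open>F\<^sup>T\<^sup>A\<^sup>P(m) - F\<^sub>N\<close> tends to \<open>0\<close> in mean (\<open>tap_gap_lower_mean\<close>).

  The opposite inequality is only needed for expectations, where both sides are compared with the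
  value \<open>E log (2 cosh (h + \<surd>\<xi>'(q) z)) + C(q)\<close>, \<open>z\<close> standard normal. The tool is the cavity method.
  Given the part of the Hamiltonian without the spin \<open>i\<close>, the cavity field of that spin is a
  Gaussian process whose covariances are close to \<open>\<xi>'(q)\<close> off the diagonal and to \<open>\<xi>'(1)\<close> on it, so
  that its exponential averages concentrate (\<open>site_defect_mean\<close>). Therefore \<open>m\<^sub>i = tanh y\<close> with \<open>y\<close> close in law
  to \<open>h + \<surd>\<xi>'(q) z\<close> (\<open>local_field_law\<close>). That the overlap of the system without the spin concentrates
  as well follows from a change of measure (\<open>site_dev_mean\<close>).

  For the TAP free energy, this gives the limits of the entropy and of the field energy, and it
  forces \<open>q = E tanh\<^sup>2 (h + \<surd>\<xi>'(q) z)\<close> (\<open>fixed_point\<close>). Gaussian integration by parts gives the energy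
  \<open>\<xi>'(q) (1 - q)\<close> of the magnetization (\<open>magnetization_energy_mean\<close>), which cancels against the same term
  in the entropy (\<open>tap_value_mean\<close>). For the free energy, the spins are added one at a time. Each
  spin increases \<open>E log Z\<close> by at least the same value up to a vanishing error (\<open>free_energy_increment\<close>);
  the change of the normalization of the couplings is controlled through convexity of the
  log-partition function, so that only a lower bound is obtained, which is the one needed.

  Together, \<open>E \<bar>F\<^sup>T\<^sup>A\<^sup>P(m) - F\<^sub>N\<bar>\<close> tends to \<open>0\<close>, and bounded fourth moments turn this into convergence in
  mean square.\<close>

section \<open>Gaussian random variables\<close>

lemma prob_space_std_normal: "prob_space std_normal_distribution"
  by (rule prob_space_normal_density) simp

lemma std_normal_exp:
  "integrable std_normal_distribution (\<lambda>x. exp (a * x))"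
  "(\<integral>x. exp (a * x) \<partial>std_normal_distribution) = exp (a\<^sup>2 / 2)"
proof -
  have eq: "std_normal_density x * exp (a * x) = exp (a\<^sup>2 / 2) * normal_density a 1 x" for x
    unfolding normal_density_def
    by (simp add: exp_add[symmetric] power2_eq_square field_simps)
  have "prob_space (density lborel (normal_density a 1))"
    by (rule prob_space_normal_density) simp
  have int: "integrable lborel (normal_density a 1)" and one: "(\<integral>x. normal_density a 1 x \<partial>lborel) = 1"
    by auto
  show "integrable std_normal_distribution (\<lambda>x. exp (a * x))"
    by (subst integrable_density) (auto simp: eq int)
  show "(\<integral>x. exp (a * x) \<partial>std_normal_distribution) = exp (a\<^sup>2 / 2)"
    by (subst integral_density) (auto simp: eq int one)
qed

lemma std_normal_moments:
  "integrable std_normal_distribution (\<lambda>x. x)" "(\<integral>x. x \<partial>std_normal_distribution) = 0"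
  "integrable std_normal_distribution (\<lambda>x. x\<^sup>2)" "(\<integral>x. x\<^sup>2 \<partial>std_normal_distribution) = 1"
  using integrable_std_normal_distribution_moment[of 1] integral_std_normal_distribution_moment_odd[of 1]
    integrable_std_normal_distribution_moment[of 2] std_normal_distribution_even_moments[of 1]
  by (simp_all add: has_bochner_integral_iff)

lemma (in prob_space) integral_abs_le_sqrt:
  fixes X :: "'a => real"
  assumes [measurable]: "X \<in> borel_measurable M" and int: "integrable M (\<lambda>x. (X x)\<^sup>2)"
  shows "integrable M X" "(\<integral>x. \<bar>X x\<bar> \<partial>M) \<le> sqrt (\<integral>x. (X x)\<^sup>2 \<partial>M)" (is ?two)
proof -
  have le: "\<bar>x\<bar> \<le> 1 + x\<^sup>2" for x :: real
    using zero_le_power2[of "\<bar>x\<bar> - 1/2"] by (simp add: power2_eq_square algebra_simps)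
  show i: "integrable M X"
    by (rule Bochner_Integration.integrable_bound[of _ "\<lambda>x. 1 + (X x)\<^sup>2"]) (use int le in auto)
  have "0 \<le> (\<integral>x. (\<bar>X x\<bar> - (\<integral>x. \<bar>X x\<bar> \<partial>M))\<^sup>2 \<partial>M)" by (rule integral_nonneg_AE) simp
  also have "\<dots> = (\<integral>x. (X x)\<^sup>2 \<partial>M) - (\<integral>x. \<bar>X x\<bar> \<partial>M)\<^sup>2"
    using i int by (subst variance_eq) auto
  finally show ?two
    by (intro real_le_rsqrt) simp
qed

text \<open>Gaussian integration by parts on the line, by integrating the derivative of
  \<open>f\<close> times the density, which vanishes at both ends.\<close>

lemma std_normal_integration_by_parts:
  fixes f f' :: "real => real"
  assumes der: "\<And>x. (f has_real_derivative f' x) (at x)" and cont: "\<And>x. isCont f' x"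
    and bound: "\<And>x. \<bar>f x\<bar> \<le> B" "\<And>x. \<bar>f' x\<bar> \<le> B"
  shows "(\<integral>x. x * f x \<partial>std_normal_distribution) = (\<integral>x. f' x \<partial>std_normal_distribution)"
proof -
  let ?d = std_normal_density
  have [measurable]: "f \<in> borel_measurable borel"
    by (intro borel_measurable_continuous_onI)
       (meson der DERIV_isCont continuous_at_imp_continuous_on)
  have [measurable]: "f' \<in> borel_measurable borel"
    by (intro borel_measurable_continuous_onI continuous_at_imp_continuous_on) (auto simp: cont)
  have B: "0 \<le> B" using bound(1)[of 0] by linarith
  have i1: "integrable lborel (\<lambda>x. ?d x * (x * f x))"
  proof (rule Bochner_Integration.integrable_bound[of _ "\<lambda>x. B * (?d x * \<bar>x\<bar>^1)"])
    show "integrable lborel (\<lambda>x. B * (?d x * \<bar>x\<bar>^1))"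
      using integrable_std_normal_moment_abs[of 1] by (rule integrable_mult_right)
    have "\<bar>f x\<bar> * (?d x * \<bar>x\<bar>) \<le> B * (?d x * \<bar>x\<bar>)" for x
      by (intro mult_right_mono bound) auto
    then show "AE x in lborel. norm (?d x * (x * f x)) \<le> norm (B * (?d x * \<bar>x\<bar>^1))"
      using B by (auto simp: abs_mult mult_ac)
  qed simp
  have i2: "integrable lborel (\<lambda>x. ?d x * f' x)"
  proof (rule Bochner_Integration.integrable_bound[of _ "\<lambda>x. B * ?d x"])
    have "\<bar>f' x\<bar> * ?d x \<le> B * ?d x" for x
      by (intro mult_right_mono bound) auto
    then show "AE x in lborel. norm (?d x * f' x) \<le> norm (B * ?d x)"
      using B by (auto simp: abs_mult mult_ac)
  qed auto
  have dd: "(?d has_real_derivative - x * ?d x) (at x)" for x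
  proof -
    have "((\<lambda>x. exp (- x\<^sup>2 / 2)) has_real_derivative exp (- x\<^sup>2 / 2) * (- x)) (at x)"
      by (auto intro!: derivative_eq_intros)
    from DERIV_cmult[OF this, of "1 / sqrt (2 * pi)"] show ?thesis
      unfolding std_normal_density_def[abs_def] by (simp add: mult_ac)
  qed
  have dF: "((\<lambda>x. f x * ?d x) has_real_derivative (?d x * f' x - ?d x * (x * f x))) (at x)" for x
    by (rule derivative_eq_intros der dd)+ (simp add: algebra_simps)
  have lim: "((\<lambda>x. f x * ?d x) \<longlongrightarrow> 0) F" if "(?d \<longlongrightarrow> 0) F" for F
  proof (rule tendsto_0_le[OF that, of _ B])
    have "\<bar>f x\<bar> * \<bar>?d x\<bar> \<le> B * \<bar>?d x\<bar>" for x
      by (intro mult_right_mono bound) auto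
    then show "\<forall>\<^sub>F x in F. norm (f x * ?d x) \<le> norm (?d x) * B"
      by (intro always_eventually allI) (simp only: real_norm_def abs_mult mult.commute[of B])
  qed
  have e0: "((\<lambda>x::real. exp (- x\<^sup>2 / 2)) \<longlongrightarrow> 0) F" if "filterlim (\<lambda>x::real. x\<^sup>2) at_top F" for F
  proof -
    have "filterlim (\<lambda>x::real. (1/2) * x\<^sup>2) at_top F"
      by (rule filterlim_tendsto_pos_mult_at_top[OF tendsto_const _ that]) simp
    then have "filterlim (\<lambda>x::real. - x\<^sup>2 / 2) at_bot F"
      by (simp add: filterlim_uminus_at_top)
    then show ?thesis by (rule filterlim_compose[OF exp_at_bot])
  qed
  have d0: "(?d \<longlongrightarrow> 0) F" if "filterlim (\<lambda>x::real. x\<^sup>2) at_top F" for F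
    unfolding std_normal_density_def[abs_def]
    using tendsto_mult[OF tendsto_const[of "1 / sqrt (2 * pi)"] e0[OF that]] by simp
  have t: "(?d \<longlongrightarrow> 0) at_top"
    by (rule d0) (simp add: filterlim_pow_at_top filterlim_ident)
  have b: "(?d \<longlongrightarrow> 0) at_bot"
    by (rule d0) (simp add: filterlim_pow_at_bot_even filterlim_ident)
  have "(LBINT x=-\<infinity>..\<infinity>. ?d x * f' x - ?d x * (x * f x)) = 0 - 0"
  proof (rule interval_integral_FTC_integrable[where F = "\<lambda>x. f x * ?d x"])
    show "((\<lambda>x. f x * ?d x) has_vector_derivative ?d x * f' x - ?d x * (x * f x)) (at x)" for x
      using dF by (simp add: has_real_derivative_iff_has_vector_derivative)
    show "isCont (\<lambda>x. ?d x * f' x - ?d x * (x * f x)) x" for x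
      using der dd cont by (intro continuous_intros) (auto dest: DERIV_isCont)
    show "set_integrable lborel (einterval (- \<infinity>) \<infinity>) (\<lambda>x. ?d x * f' x - ?d x * (x * f x))"
      using i1 i2 by (simp add: set_integrable_def)
    show "(((\<lambda>x. f x * ?d x) \<circ> real_of_ereal) \<longlongrightarrow> 0) (at_right (- \<infinity>))"
      by (simp add: ereal_tendsto_simps lim b)
    show "(((\<lambda>x. f x * ?d x) \<circ> real_of_ereal) \<longlongrightarrow> 0) (at_left \<infinity>)"
      by (simp add: ereal_tendsto_simps lim t)
  qed simp
  then have "(\<integral>x. ?d x * f' x - ?d x * (x * f x) \<partial>lborel) = 0"
    by (simp add: interval_lebesgue_integral_def set_lebesgue_integral_def)
  then have "(\<integral>x. ?d x * f' x \<partial>lborel) = (\<integral>x. ?d x * (x * f x) \<partial>lborel)"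
    using i1 i2 by simp
  then show ?thesis
    by (subst (1 2) integral_density) auto
qed

text \<open>Centred Gaussian variables of variance \<open>v\<close>, degenerate ones included: the law is the one of
  \<open>\<surd>v\<close> times a standard normal variable.\<close>

definition gaussian_rv :: "'a measure => ('a => real) => real => bool" where
  "gaussian_rv M Y v \<longleftrightarrow> 0 \<le> v \<and> Y \<in> borel_measurable M \<and>
     distr M borel Y = distr std_normal_distribution borel (\<lambda>x. sqrt v * x)"

context prob_space
begin

lemma char_scaled_std_normal:
  assumes "0 \<le> v"
  shows "char (distr std_normal_distribution borel (\<lambda>x. sqrt v * x)) t = exp (- (v * t\<^sup>2) / 2)"
proof -
  have "char (distr std_normal_distribution borel (\<lambda>x. sqrt v * x)) t
    = char std_normal_distribution (t * sqrt v)"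
    unfolding char_def by (subst integral_distr) (auto simp: mult_ac)
  also have "\<dots> = exp (- (v * t\<^sup>2) / 2)"
    using assms by (simp add: char_std_normal_distribution power_mult_distrib mult_ac)
  finally show ?thesis .
qed

lemma gaussian_rv_iff_char:
  assumes "0 \<le> v" and [measurable]: "Y \<in> borel_measurable M"
  shows "gaussian_rv M Y v \<longleftrightarrow> (\<forall>t. char (distr M borel Y) t = exp (- (v * t\<^sup>2) / 2))"
proof
  assume "gaussian_rv M Y v"
  then show "\<forall>t. char (distr M borel Y) t = exp (- (v * t\<^sup>2) / 2)"
    using char_scaled_std_normal[OF assms(1)] by (simp add: gaussian_rv_def)
next
  assume *: "\<forall>t. char (distr M borel Y) t = exp (- (v * t\<^sup>2) / 2)"
  interpret N: prob_space std_normal_distribution by (rule prob_space_std_normal)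
  have "distr M borel Y = distr std_normal_distribution borel (\<lambda>x. sqrt v * x)"
  proof (rule Levy_uniqueness)
    show "real_distribution (distr M borel Y)" by (rule real_distribution_distr) simp
    show "real_distribution (distr std_normal_distribution borel (\<lambda>x. sqrt v * x))"
      by (rule N.real_distribution_distr) simp
    show "char (distr M borel Y) = char (distr std_normal_distribution borel (\<lambda>x. sqrt v * x))"
      using * char_scaled_std_normal[OF assms(1)] by (simp add: fun_eq_iff)
  qed
  with assms show "gaussian_rv M Y v" by (simp add: gaussian_rv_def)
qed

lemma gaussian_rv_limit:
  assumes Y: "\<And>n. gaussian_rv M (Y n) (v n)" and v: "v \<longlonglongrightarrow> wt"
    and [measurable]: "Z \<in> borel_measurable M" and AE: "AE x in M. (\<lambda>n. Y n x) \<longlonglongrightarrow> Z x"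
  shows "gaussian_rv M Z wt"
proof -
  have [measurable]: "Y n \<in> borel_measurable M" for n using Y by (simp add: gaussian_rv_def)
  have "0 \<le> v n" for n using Y by (simp add: gaussian_rv_def)
  then have wt: "0 \<le> wt" using v by (auto intro: LIMSEQ_le_const)
  have "char (distr M borel Z) t = exp (- (wt * t\<^sup>2) / 2)" for t
  proof (rule LIMSEQ_unique)
    have "(\<lambda>n. char (distr M borel (Y n)) t) = (\<lambda>n. complex_of_real (exp (- (v n * t\<^sup>2) / 2)))"
      using Y \<open>\<And>n. 0 \<le> v n\<close> by (auto simp: gaussian_rv_iff_char)
    moreover have "(\<lambda>n. complex_of_real (exp (- (v n * t\<^sup>2) / 2))) \<longlonglongrightarrow> exp (- (wt * t\<^sup>2) / 2)"
      by (intro tendsto_intros v) simp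
    ultimately show "(\<lambda>n. char (distr M borel (Y n)) t) \<longlonglongrightarrow> exp (- (wt * t\<^sup>2) / 2)" by simp
    have "(\<lambda>n. \<integral>x. iexp (t * Y n x) \<partial>M) \<longlonglongrightarrow> (\<integral>x. iexp (t * Z x) \<partial>M)"
    proof (rule integral_dominated_convergence[where w = "\<lambda>_. 1"])
      show "AE x in M. (\<lambda>n. iexp (t * Y n x)) \<longlonglongrightarrow> iexp (t * Z x)"
        using AE by eventually_elim (auto intro!: tendsto_intros)
    qed auto
    then show "(\<lambda>n. char (distr M borel (Y n)) t) \<longlonglongrightarrow> char (distr M borel Z) t"
      by (simp add: char_def integral_distr)
  qed
  then show ?thesis using wt by (simp add: gaussian_rv_iff_char)
qed

lemma gaussian_rv_expectation:
  assumes "gaussian_rv M Y v" and [measurable]: "f \<in> borel_measurable borel"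
  shows "integrable M (\<lambda>x. f (Y x)) \<longleftrightarrow> integrable std_normal_distribution (\<lambda>x. f (sqrt v * x) :: real)"
    and "(\<integral>x. f (Y x) \<partial>M) = (\<integral>x. f (sqrt v * x) \<partial>std_normal_distribution)" (is ?two)
proof -
  have [measurable]: "Y \<in> borel_measurable M"
    and d: "distr M borel Y = distr std_normal_distribution borel (\<lambda>x. sqrt v * x)"
    using assms by (auto simp: gaussian_rv_def)
  have m: "(\<lambda>x. sqrt v * x) \<in> borel_measurable std_normal_distribution" by simp
  have "integrable (distr M borel Y) f \<longleftrightarrow> integrable M (\<lambda>x. f (Y x))"
    by (rule integrable_distr_eq) auto
  moreover have "integrable (distr std_normal_distribution borel (\<lambda>x. sqrt v * x)) f \<longleftrightarrow>
      integrable std_normal_distribution (\<lambda>x. f (sqrt v * x))"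
    by (rule integrable_distr_eq) auto
  ultimately show "integrable M (\<lambda>x. f (Y x)) \<longleftrightarrow>
      integrable std_normal_distribution (\<lambda>x. f (sqrt v * x))"
    using d by simp
  have "(\<integral>x. f (Y x) \<partial>M) = integral\<^sup>L (distr M borel Y) f"
    by (rule integral_distr[symmetric]) auto
  also have "\<dots> = (\<integral>x. f (sqrt v * x) \<partial>std_normal_distribution)"
    unfolding d by (rule integral_distr) auto
  finally show ?two .
qed

lemma gaussian_rv_exp:
  assumes "gaussian_rv M Y v"
  shows "integrable M (\<lambda>x. exp (a * Y x))" (is ?one) "(\<integral>x. exp (a * Y x) \<partial>M) = exp (a\<^sup>2 * v / 2)" (is ?two)
proof -
  have v: "0 \<le> v" using assms by (simp add: gaussian_rv_def)
  show ?one
    using gaussian_rv_expectation(1)[OF assms, of "\<lambda>y. exp (a * y)"] std_normal_exp(1)[of "a * sqrt v"]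
    by (simp add: mult_ac)
  have "(\<integral>x. exp (a * Y x) \<partial>M) = exp ((a * sqrt v)\<^sup>2 / 2)"
    using gaussian_rv_expectation(2)[OF assms, of "\<lambda>y. exp (a * y)"] std_normal_exp(2)[of "a * sqrt v"]
    by (simp add: mult_ac)
  then show ?two
    using v by (simp add: power_mult_distrib)
qed

lemma gaussian_rv_square:
  assumes "gaussian_rv M Y v"
  shows "integrable M (\<lambda>x. (Y x)\<^sup>2)" (is ?one) "(\<integral>x. (Y x)\<^sup>2 \<partial>M) = v" (is ?two)
proof -
  have "0 \<le> v" using assms by (simp add: gaussian_rv_def)
  then have eq: "(sqrt v * x)\<^sup>2 = v * x\<^sup>2" for x
    by (simp add: power_mult_distrib)
  have "integrable std_normal_distribution (\<lambda>x. v * x\<^sup>2)"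
    using std_normal_moments(3) by (rule integrable_mult_right)
  then show ?one
    by (subst gaussian_rv_expectation(1)[OF assms, of "\<lambda>y. y\<^sup>2"]) (simp_all only: eq, simp)
  have "(\<integral>x. v * x\<^sup>2 \<partial>std_normal_distribution) = v * 1"
    by (subst integral_mult_right_zero) (simp only: std_normal_moments(4))
  then show ?two
    by (subst gaussian_rv_expectation(2)[OF assms, of "\<lambda>y. y\<^sup>2"]) (simp_all only: eq, simp_all)
qed

lemma gaussian_rv_abs:
  assumes "gaussian_rv M Y v"
  shows "integrable M Y" (is ?one) "(\<integral>x. \<bar>Y x\<bar> \<partial>M) \<le> sqrt v"
proof -
  have [measurable]: "Y \<in> borel_measurable M" using assms by (simp add: gaussian_rv_def)
  show ?one "(\<integral>x. \<bar>Y x\<bar> \<partial>M) \<le> sqrt v"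
    using integral_abs_le_sqrt[of Y] gaussian_rv_square[OF assms] by auto
qed

lemma gaussian_rv_sum:
  assumes ind: "indep_vars (\<lambda>_. borel) X I" and I: "finite I"
    and X: "\<And>i. i \<in> I ==> distributed M lborel (X i) std_normal_density"
  shows "gaussian_rv M (\<lambda>w. \<Sum>i\<in>I. a i * X i w) (\<Sum>i\<in>I. (a i)\<^sup>2)"
proof -
  have [measurable]: "X i \<in> borel_measurable M" if "i \<in> I" for i
    using X[OF that] by (auto dest: distributed_measurable)
  have "char (distr M borel (\<lambda>w. a i * X i w)) t = exp (- ((a i)\<^sup>2 * t\<^sup>2) / 2)" if i: "i \<in> I" for i t
  proof -
    have d: "distr M lborel (X i) = std_normal_distribution"
      using X[OF i] by (simp add: distributed_def)
    have "char (distr M borel (\<lambda>w. a i * X i w)) t = char (distr M lborel (X i)) (t * a i)"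
      unfolding char_def using i by (subst (1 2) integral_distr) (auto simp: mult_ac)
    also have "\<dots> = exp (- ((a i)\<^sup>2 * t\<^sup>2) / 2)"
      by (simp add: d char_std_normal_distribution power_mult_distrib mult_ac)
    finally show ?thesis .
  qed
  moreover have "char (distr M borel (\<lambda>w. \<Sum>i\<in>I. a i * X i w)) t
      = (\<Prod>i\<in>I. char (distr M borel (\<lambda>w. a i * X i w)) t)" for t
    by (intro char_distr_sum indep_vars_compose2[OF ind]) auto
  ultimately have "char (distr M borel (\<lambda>w. \<Sum>i\<in>I. a i * X i w)) t
      = exp (- ((\<Sum>i\<in>I. (a i)\<^sup>2) * t\<^sup>2) / 2)" for t
    by (simp add: exp_sum[OF I, symmetric] of_real_prod[symmetric] sum_distrib_right
        sum_negf sum_divide_distrib del: of_real_prod)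
  then show ?thesis
    by (subst gaussian_rv_iff_char) (auto intro!: sum_nonneg)
qed

lemma gaussian_rv_cong_AE:
  assumes "gaussian_rv M Y v" and [measurable]: "Z \<in> borel_measurable M" and "AE x in M. Y x = Z x"
  shows "gaussian_rv M Z v"
proof -
  have [measurable]: "Y \<in> borel_measurable M" using assms by (simp add: gaussian_rv_def)
  have "distr M borel Y = distr M borel Z" by (rule distr_cong_AE) (use assms in auto)
  with assms show ?thesis by (simp add: gaussian_rv_def)
qed

end

declare add_2_eq_Suc' [simp del] add_2_eq_Suc [simp del]

section \<open>The mixture function\<close>

locale mixture =
  fixes \<beta> :: "nat => real"
  assumes summable_beta: "summable (\<lambda>k. 2 ^ (k + 2) * (\<beta> (k + 2))\<^sup>2)"
begin

definition xi_coeff :: "nat => real" where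
  "xi_coeff n = (if n < 2 then 0 else (\<beta> n)\<^sup>2)"

definition dxi :: "real => real" where
  "dxi s = (\<Sum>n. diffs xi_coeff n * s ^ n)"

definition ddxi :: "real => real" where
  "ddxi s = (\<Sum>n. diffs (diffs xi_coeff) n * s ^ n)"

definition theta :: "real => real" where
  "theta s = s * dxi s - xi \<beta> s"

lemma xi_coeff_nonneg: "0 \<le> xi_coeff n"
  by (simp add: xi_coeff_def)

lemma summable_xi_shift:
  assumes "\<bar>s\<bar> \<le> 2" shows "summable (\<lambda>k. (\<beta> (k + 2))\<^sup>2 * s ^ (k + 2))"
proof (rule summable_comparison_test'[OF summable_beta])
  fix k
  have "\<bar>s\<bar> ^ (k + 2) \<le> 2 ^ (k + 2)" using assms by (intro power_mono) auto
  then have "\<bar>s\<bar> ^ (k + 2) * (\<beta> (k + 2))\<^sup>2 \<le> 2 ^ (k + 2) * (\<beta> (k + 2))\<^sup>2"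
    by (rule mult_right_mono) simp
  then show "norm ((\<beta> (k + 2))\<^sup>2 * s ^ (k + 2)) \<le> 2 ^ (k + 2) * (\<beta> (k + 2))\<^sup>2"
    by (simp add: abs_mult power_abs mult.commute)
qed

lemma summable_xi_coeff:
  assumes "\<bar>s\<bar> \<le> 2" shows "summable (\<lambda>n. xi_coeff n * s ^ n)"
  using summable_xi_shift[OF assms] summable_iff_shift[of "\<lambda>n. xi_coeff n * s ^ n" 2]
  by (simp add: xi_coeff_def)

lemma xi_powser:
  assumes "\<bar>s\<bar> \<le> 2" shows "xi \<beta> s = (\<Sum>n. xi_coeff n * s ^ n)"
  using suminf_split_initial_segment[OF summable_xi_coeff[OF assms], of 2]
  by (simp add: xi_coeff_def xi_def numeral_2_eq_2)

lemma xi_sums: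
  assumes "\<bar>s\<bar> \<le> 2" shows "(\<lambda>k. (\<beta> (k + 2))\<^sup>2 * s ^ (k + 2)) sums xi \<beta> s"
  unfolding xi_def by (rule summable_sums[OF summable_xi_shift[OF assms]])

lemma summable_dxi:
  assumes "\<bar>s\<bar> < 2" shows "summable (\<lambda>n. diffs xi_coeff n * s ^ n)"
  by (rule termdiff_converges[of _ 2]) (use assms in \<open>auto intro: summable_xi_coeff\<close>)

lemma summable_ddxi:
  assumes "\<bar>s\<bar> < 2" shows "summable (\<lambda>n. diffs (diffs xi_coeff) n * s ^ n)"
  by (rule termdiff_converges[of _ 2]) (use assms in \<open>auto intro: summable_dxi\<close>)

lemma has_derivative_xi:
  assumes "\<bar>s\<bar> < 2" shows "(xi \<beta> has_real_derivative dxi s) (at s)"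
proof -
  have "((\<lambda>s. \<Sum>n. xi_coeff n * s ^ n) has_real_derivative dxi s) (at s)"
    unfolding dxi_def by (rule termdiffs_strong[where K = 2]) (use assms summable_xi_coeff[of 2] in auto)
  then show ?thesis
    by (rule has_field_derivative_transform_within_open[where S = "{-2<..<2}"])
      (use assms in \<open>auto simp: xi_powser\<close>)
qed

lemma deriv_xi: "\<bar>s\<bar> < 2 ==> deriv (xi \<beta>) s = dxi s"
  by (rule DERIV_imp_deriv[OF has_derivative_xi])

lemma has_derivative_dxi:
  assumes "\<bar>s\<bar> < 3/2" shows "(dxi has_real_derivative ddxi s) (at s)"
  unfolding dxi_def[abs_def] ddxi_def
  by (rule termdiffs_strong[where K = "3/2"]) (use assms summable_dxi[of "3/2"] in auto)

lemma diffs_nonneg: "(\<And>n. 0 \<le> a n) ==> 0 \<le> diffs a n" for a :: "nat => real"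
  by (simp add: diffs_def)

lemma powser_abs_le_at_1:
  fixes a :: "nat => real"
  assumes a: "\<And>n. 0 \<le> a n" and sum: "summable a" and s: "\<bar>s\<bar> \<le> 1"
  shows "\<bar>\<Sum>n. a n * s ^ n\<bar> \<le> (\<Sum>n. a n * 1 ^ n)"
proof -
  have le: "\<bar>a n * s ^ n\<bar> \<le> a n" for n
    using a s by (simp add: abs_mult power_abs mult_left_le power_le_one)
  have "summable (\<lambda>n. \<bar>a n * s ^ n\<bar>)"
    by (rule summable_comparison_test'[OF sum]) (use le in auto)
  then have "\<bar>\<Sum>n. a n * s ^ n\<bar> \<le> (\<Sum>n. \<bar>a n * s ^ n\<bar>)" by (rule summable_rabs)
  also have "\<dots> \<le> (\<Sum>n. a n * 1 ^ n)"
    by (rule suminf_le) (use le sum \<open>summable (\<lambda>n. \<bar>a n * s ^ n\<bar>)\<close> in auto)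
  finally show ?thesis .
qed

lemma dxi_abs_le: "\<bar>s\<bar> \<le> 1 ==> \<bar>dxi s\<bar> \<le> dxi 1"
  unfolding dxi_def using summable_dxi[of 1]
  by (intro powser_abs_le_at_1 diffs_nonneg xi_coeff_nonneg) auto

lemma ddxi_abs_le: "\<bar>s\<bar> \<le> 1 ==> \<bar>ddxi s\<bar> \<le> ddxi 1"
  unfolding ddxi_def using summable_ddxi[of 1]
  by (intro powser_abs_le_at_1 diffs_nonneg xi_coeff_nonneg) auto

lemma dxi_nonneg: "0 \<le> s ==> s \<le> 1 ==> 0 \<le> dxi s"
  unfolding dxi_def using summable_dxi[of s]
  by (intro suminf_nonneg) (auto intro!: mult_nonneg_nonneg diffs_nonneg xi_coeff_nonneg)

lemma ddxi_nonneg: "0 \<le> s ==> s \<le> 1 ==> 0 \<le> ddxi s"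
  unfolding ddxi_def using summable_ddxi[of s]
  by (intro suminf_nonneg) (auto intro!: mult_nonneg_nonneg diffs_nonneg xi_coeff_nonneg)

lemma xi_lipschitz:
  assumes "\<bar>s\<bar> \<le> 1" "\<bar>t\<bar> \<le> 1" shows "\<bar>xi \<beta> s - xi \<beta> t\<bar> \<le> dxi 1 * \<bar>s - t\<bar>"
proof -
  have "norm (xi \<beta> s - xi \<beta> t) \<le> dxi 1 * norm (s - t)"
  proof (rule field_differentiable_bound[of "{-1..1}" "xi \<beta>" dxi "dxi 1" s t])
    show "(xi \<beta> has_field_derivative dxi z) (at z within {-1..1})" if "z \<in> {-1..1}" for z
      using that by (intro has_field_derivative_at_within[OF has_derivative_xi]) auto
    show "norm (dxi z) \<le> dxi 1" if "z \<in> {-1..1}" for z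
      using dxi_abs_le[of z] that by (simp add: abs_le_iff)
    show "s \<in> {-1..1}" "t \<in> {-1..1}" using assms by (simp_all add: abs_le_iff)
  qed simp
  then show ?thesis by simp
qed

lemma dxi_lipschitz:
  assumes "\<bar>s\<bar> \<le> 1" "\<bar>t\<bar> \<le> 1" shows "\<bar>dxi s - dxi t\<bar> \<le> ddxi 1 * \<bar>s - t\<bar>"
proof -
  have "norm (dxi s - dxi t) \<le> ddxi 1 * norm (s - t)"
  proof (rule field_differentiable_bound[of "{-1..1}" dxi ddxi "ddxi 1" s t])
    show "(dxi has_field_derivative ddxi z) (at z within {-1..1})" if "z \<in> {-1..1}" for z
      using that by (intro has_field_derivative_at_within[OF has_derivative_dxi]) auto
    show "norm (ddxi z) \<le> ddxi 1" if "z \<in> {-1..1}" for z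
      using ddxi_abs_le[of z] that by (simp add: abs_le_iff)
    show "s \<in> {-1..1}" "t \<in> {-1..1}" using assms by (simp_all add: abs_le_iff)
  qed simp
  then show ?thesis by simp
qed

lemma theta_lipschitz:
  assumes "\<bar>s\<bar> \<le> 1" "\<bar>t\<bar> \<le> 1"
  shows "\<bar>theta s - theta t\<bar> \<le> (ddxi 1 + 2 * dxi 1) * \<bar>s - t\<bar>"
proof -
  have "theta s - theta t = s * (dxi s - dxi t) + (s - t) * dxi t - (xi \<beta> s - xi \<beta> t)"
    by (simp add: theta_def algebra_simps)
  also have "\<bar>\<dots>\<bar> \<le> \<bar>s\<bar> * \<bar>dxi s - dxi t\<bar> + \<bar>s - t\<bar> * \<bar>dxi t\<bar> + \<bar>xi \<beta> s - xi \<beta> t\<bar>"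
    unfolding abs_mult[symmetric] by linarith
  also have "\<dots> \<le> 1 * (ddxi 1 * \<bar>s - t\<bar>) + \<bar>s - t\<bar> * dxi 1 + dxi 1 * \<bar>s - t\<bar>"
    using assms by (intro add_mono mult_mono dxi_lipschitz xi_lipschitz dxi_abs_le) auto
  finally show ?thesis by (simp add: algebra_simps)
qed

lemma xi_above_tangent:
  assumes "0 \<le> s" "s \<le> 1" "0 \<le> t" "t \<le> 1"
  shows "xi \<beta> s + dxi s * (t - s) \<le> xi \<beta> t"
proof -
  have "dxi s * (t - s) \<le> xi \<beta> t - xi \<beta> s"
    by (rule f''_imp_f'[where C = "{0..1}" and f'' = ddxi])
      (use assms in \<open>auto intro: has_derivative_xi has_derivative_dxi ddxi_nonneg\<close>)
  then show ?thesis by simp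
qed

lemma dxi_sums:
  assumes "\<bar>s\<bar> < 2"
  shows "(\<lambda>k. real (k + 2) * (\<beta> (k + 2))\<^sup>2 * s ^ (k + 1)) sums dxi s"
proof -
  have "(\<lambda>n. diffs xi_coeff n * s ^ n) sums dxi s"
    unfolding dxi_def by (rule summable_sums[OF summable_dxi[OF assms]])
  then have "(\<lambda>n. diffs xi_coeff (n + 1) * s ^ (n + 1)) sums (dxi s - (\<Sum>n<1. diffs xi_coeff n * s ^ n))"
    by (rule sums_split_initial_segment)
  then show ?thesis
    by (simp add: diffs_def xi_coeff_def numeral_2_eq_2 add.commute)
qed

lemma theta_sums:
  assumes "\<bar>s\<bar> < 2"
  shows "(\<lambda>k. real (k + 1) * (\<beta> (k + 2))\<^sup>2 * s ^ (k + 2)) sums theta s"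
proof -
  have "(\<lambda>k. s * (real (k + 2) * (\<beta> (k + 2))\<^sup>2 * s ^ (k + 1)) - (\<beta> (k + 2))\<^sup>2 * s ^ (k + 2)) sums theta s"
    unfolding theta_def
    using assms by (intro sums_diff sums_mult dxi_sums xi_sums) auto
  then show ?thesis by (simp add: algebra_simps power_add power2_eq_square)
qed

text \<open>The exponential weight leaves room for any polynomial factor, by the arithmetic-geometric
  mean inequality.\<close>

lemma summable_poly_abs_beta: "summable (\<lambda>k. real (k + 2) ^ 3 * \<bar>\<beta> (k + 2)\<bar>)"
proof -
  have "summable (\<lambda>n. real (n + 2) ^ 6 / 2 ^ (n + 2))"
  proof (rule summable_comparison_test_bigo)
    show "summable (\<lambda>n. norm ((3/4 :: real) ^ n))" by (simp add: summable_geometric)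
    have "(\<lambda>n. real (n + 2) ^ 6 * (1/2) ^ (n + 2)) \<in> O(\<lambda>n. (3/4 :: real) ^ n)" by real_asymp
    then show "(\<lambda>n. real (n + 2) ^ 6 / 2 ^ (n + 2)) \<in> O(\<lambda>n. (3/4 :: real) ^ n)"
      by (simp add: power_one_over)
  qed
  then have "summable (\<lambda>n. 2 ^ (n + 2) * (\<beta> (n + 2))\<^sup>2 + real (n + 2) ^ 6 / 2 ^ (n + 2))"
    by (intro summable_add summable_beta)
  then show ?thesis
  proof (rule summable_comparison_test')
    fix k
    define A where "A = sqrt (2 ^ (k + 2)) * \<bar>\<beta> (k + 2)\<bar>"
    define B where "B = real (k + 2) ^ 3 / sqrt (2 ^ (k + 2))"
    have A2: "A\<^sup>2 = 2 ^ (k + 2) * (\<beta> (k + 2))\<^sup>2"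
      by (simp add: A_def power_mult_distrib real_sqrt_pow2 del: power_Suc)
    have B2: "B\<^sup>2 = real (k + 2) ^ 6 / 2 ^ (k + 2)"
      by (simp add: B_def power_divide real_sqrt_pow2 power_mult[symmetric] del: power_Suc)
    have AB: "A * B = real (k + 2) ^ 3 * \<bar>\<beta> (k + 2)\<bar>"
      by (simp add: A_def B_def)
    have nn: "0 \<le> A * B" by (simp add: A_def B_def)
    have "A * B \<le> A\<^sup>2 + B\<^sup>2"
      using sum_squares_bound[of A B] nn by linarith
    then show "norm (real (k + 2) ^ 3 * \<bar>\<beta> (k + 2)\<bar>)
        \<le> 2 ^ (k + 2) * (\<beta> (k + 2))\<^sup>2 + real (k + 2) ^ 6 / 2 ^ (k + 2)"
      using nn unfolding A2 B2 AB by simp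
  qed
qed

lemma summable_mono_beta:
  assumes "\<And>k. \<bar>f k\<bar> \<le> C * (real (k + 2) ^ 3 * \<bar>\<beta> (k + 2)\<bar>)"
  shows "summable (f :: nat => real)"
  by (rule summable_comparison_test'[OF summable_mult[OF summable_poly_abs_beta, of C]])
    (use assms in auto)

end

section \<open>Gaussian series\<close>

lemma finite_multi_indices [simp]: "finite (multi_indices N p)"
  unfolding multi_indices_def
  by (rule finite_subset[OF _ finite_lists_length_eq[of "{1..N}" p]]) auto

lemma multi_indices_Suc:
  "multi_indices N (Suc p) = (\<lambda>(i, js). i # js) ` ({1..N} \<times> multi_indices N p)"
  by (auto simp: multi_indices_def image_iff length_Suc_conv)

lemma multi_indices_disjoint: "p \<noteq> p' ==> multi_indices N p \<inter> multi_indices N p' = {}"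
  by (auto simp: multi_indices_def)

lemma sum_multi_indices_prod:
  fixes a b :: "nat => real"
  shows "(\<Sum>js\<in>multi_indices N p. prod_list (map a js) * prod_list (map b js)) = (\<Sum>i=1..N. a i * b i) ^ p"
proof (induction p)
  case 0
  have "multi_indices N 0 = {[]}" by (auto simp: multi_indices_def)
  then show ?case by simp
next
  case (Suc p)
  have inj: "inj_on (\<lambda>(i, js). i # js) ({1..N} \<times> multi_indices N p)" by (auto simp: inj_on_def)
  have "(\<Sum>js\<in>multi_indices N (Suc p). prod_list (map a js) * prod_list (map b js))
      = (\<Sum>(i, js)\<in>{1..N} \<times> multi_indices N p.
          (a i * b i) * (prod_list (map a js) * prod_list (map b js)))"
    unfolding multi_indices_Suc by (subst sum.reindex[OF inj]) (auto intro!: sum.cong simp: mult_ac)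
  also have "\<dots> = (\<Sum>i=1..N. a i * b i) * (\<Sum>i=1..N. a i * b i) ^ p"
    by (simp only: sum.cartesian_product[symmetric] sum_distrib_left[symmetric] Suc.IH sum_distrib_right[symmetric])
  finally show ?case by simp
qed

text \<open>All random variables of the model, up to finitely many nonlinear operations, are series of
  the following form; the summability condition is on the \<open>L\<^sup>2\<close> norms of the
  homogeneous parts.\<close>

definition gseries :: "nat => (nat list => real) => (nat list => real) => real" where
  "gseries N b x = (\<Sum>k. \<Sum>js\<in>multi_indices N (k + 2). b js * x js)"

definition l2_summable :: "nat => (nat list => real) => bool" where
  "l2_summable N b \<longleftrightarrow> summable (\<lambda>k. L2_set b (multi_indices N (k + 2)))"

lemma L2_set_squared: "(L2_set b A)\<^sup>2 = (\<Sum>i\<in>A. (b i)\<^sup>2)"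
  by (simp add: L2_set_def sum_nonneg)

lemma l2_summable_add:
  assumes "l2_summable N a" "l2_summable N b" shows "l2_summable N (\<lambda>js. a js + b js)"
  unfolding l2_summable_def
proof (rule summable_comparison_test'[OF summable_add])
  show "summable (\<lambda>k. L2_set a (multi_indices N (k + 2)))" "summable (\<lambda>k. L2_set b (multi_indices N (k + 2)))"
    using assms by (auto simp: l2_summable_def)
  show "norm (L2_set (\<lambda>js. a js + b js) (multi_indices N (k + 2)))
      \<le> L2_set a (multi_indices N (k + 2)) + L2_set b (multi_indices N (k + 2))" for k
    by (simp add: L2_set_triangle_ineq)
qed

lemma l2_summable_scale:
  assumes "l2_summable N b" shows "l2_summable N (\<lambda>js. c * b js)"
proof -
  have "L2_set (\<lambda>js. c * b js) A = \<bar>c\<bar> * L2_set b A" for A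
    by (simp add: L2_set_def power_mult_distrib sum_distrib_left[symmetric] real_sqrt_mult)
  then show ?thesis using assms by (simp add: l2_summable_def summable_mult)
qed

lemma l2_summable_zero [simp]: "l2_summable N (\<lambda>js. 0)"
  by (simp add: l2_summable_def L2_set_def)

lemma l2_summable_sum:
  "finite T ==> (\<And>t. t \<in> T ==> l2_summable N (b t)) ==> l2_summable N (\<lambda>js. \<Sum>t\<in>T. c t * b t js)"
proof (induction T rule: finite_induct)
  case (insert t T)
  then have "l2_summable N (\<lambda>js. c t * b t js + (\<Sum>t\<in>T. c t * b t js))"
    by (intro l2_summable_add l2_summable_scale) auto
  with insert.hyps show ?case by simp
qed simp

lemma l2_summable_mono:
  assumes "l2_summable N b" and "\<And>js. \<bar>a js\<bar> \<le> \<bar>b js\<bar>"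
  shows "l2_summable N a"
  unfolding l2_summable_def
proof (rule summable_comparison_test')
  show "summable (\<lambda>k. L2_set b (multi_indices N (k + 2)))" using assms by (simp add: l2_summable_def)
  show "norm (L2_set a (multi_indices N (k + 2))) \<le> L2_set b (multi_indices N (k + 2))" for k
    using assms(2) by (simp add: L2_set_def sum_nonneg sum_mono abs_le_square_iff[symmetric])
qed

definition spin_coeff :: "(nat => real) => nat => (nat => real) => nat list => real" where
  "spin_coeff \<beta> N m js = \<beta> (length js) / real N powr ((real (length js) - 1) / 2) * prod_list (map m js)"

lemma pure_hamiltonian_eq:
  "pure_hamiltonian \<beta> x N p m = (\<Sum>js\<in>multi_indices N p. spin_coeff \<beta> N m js * x js)"
  unfolding pure_hamiltonian_def sum_distrib_left
  by (rule sum.cong) (auto simp: spin_coeff_def multi_indices_def)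

lemma mixed_hamiltonian_eq: "mixed_hamiltonian \<beta> x N m = gseries N (spin_coeff \<beta> N m) x"
  by (simp add: mixed_hamiltonian_def gseries_def pure_hamiltonian_eq)

lemma overlap_abs_le:
  assumes "\<And>i. i \<in> {1..N} ==> \<bar>a i\<bar> \<le> 1" "\<And>i. i \<in> {1..N} ==> \<bar>b i\<bar> \<le> 1"
  shows "\<bar>overlap N a b\<bar> \<le> 1"
proof (cases "N = 0")
  case False
  have "\<bar>\<Sum>i=1..N. a i * b i\<bar> \<le> (\<Sum>i=1..N. \<bar>a i * b i\<bar>)" by (rule sum_abs)
  also have "\<dots> \<le> (\<Sum>i=1..N. 1)"
    using assms by (intro sum_mono) (auto simp: abs_mult intro: mult_le_one)
  finally show ?thesis using False by (simp add: overlap_def)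
qed (simp add: overlap_def)

lemma normalization_squared:
  assumes N: "1 \<le> N" and p: "1 \<le> p"
  shows "(\<beta> p / real N powr ((real p - 1) / 2))\<^sup>2 = (\<beta> p)\<^sup>2 / real N ^ (p - 1)"
proof -
  have "(real N powr ((real p - 1) / 2))\<^sup>2 = real N powr (real (p - 1))"
    using N p by (simp add: power2_eq_square powr_add[symmetric] of_nat_diff)
  also have "\<dots> = real N ^ (p - 1)" using N by (simp add: powr_realpow)
  finally show ?thesis by (simp add: power_divide)
qed

lemma spin_coeff_inner:
  assumes N: "1 \<le> N" and p: "1 \<le> p"
  shows "(\<Sum>js\<in>multi_indices N p. spin_coeff \<beta> N a js * spin_coeff \<beta> N b js)
     = real N * ((\<beta> p)\<^sup>2 * overlap N a b ^ p)"
proof -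
  define c where "c = \<beta> p / real N powr ((real p - 1) / 2)"
  have c2: "c\<^sup>2 = (\<beta> p)\<^sup>2 / real N ^ (p - 1)" unfolding c_def by (rule normalization_squared[OF N p])
  have pw: "real N ^ p = real N * real N ^ (p - 1)" using p by (cases p) auto
  have "(\<Sum>js\<in>multi_indices N p. spin_coeff \<beta> N a js * spin_coeff \<beta> N b js)
     = (\<Sum>js\<in>multi_indices N p. c\<^sup>2 * (prod_list (map a js) * prod_list (map b js)))"
    by (rule sum.cong) (auto simp: spin_coeff_def c_def multi_indices_def power2_eq_square)
  also have "\<dots> = c\<^sup>2 * (real N * overlap N a b) ^ p"
    using N by (simp add: sum_distrib_left[symmetric] sum_multi_indices_prod overlap_def)
  also have "\<dots> = real N * ((\<beta> p)\<^sup>2 * overlap N a b ^ p)"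
    using N by (simp add: c2 power_mult_distrib pw)
  finally show ?thesis .
qed

context mixture
begin

lemma spin_coeff_inner_sums:
  assumes N: "1 \<le> N"
    and "\<And>i. i \<in> {1..N} ==> \<bar>a i\<bar> \<le> 1" "\<And>i. i \<in> {1..N} ==> \<bar>b i\<bar> \<le> 1"
  shows "(\<lambda>k. \<Sum>js\<in>multi_indices N (k + 2). spin_coeff \<beta> N a js * spin_coeff \<beta> N b js)
     sums (real N * xi \<beta> (overlap N a b))"
proof -
  have "\<bar>overlap N a b\<bar> \<le> 1" by (rule overlap_abs_le) (use assms in auto)
  then show ?thesis
    using N by (subst spin_coeff_inner) (auto intro!: sums_mult xi_sums)
qed

lemma l2_summable_spin_coeff:
  assumes N: "1 \<le> N" and a: "\<And>i. i \<in> {1..N} ==> \<bar>a i\<bar> \<le> 1"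
  shows "l2_summable N (spin_coeff \<beta> N a)"
  unfolding l2_summable_def
proof (rule summable_mono_beta[where C = "sqrt (real N)"])
  fix k
  have ov: "\<bar>overlap N a a\<bar> \<le> 1" by (rule overlap_abs_le) (use a in auto)
  have "(L2_set (spin_coeff \<beta> N a) (multi_indices N (k + 2)))\<^sup>2
      = real N * ((\<beta> (k + 2))\<^sup>2 * overlap N a a ^ (k + 2))"
    using spin_coeff_inner[OF N, of "k + 2" \<beta> a a]
    by (simp only: L2_set_squared) (simp add: power2_eq_square[symmetric])
  also have "\<dots> \<le> real N * ((\<beta> (k + 2))\<^sup>2 * 1)"
  proof (intro mult_left_mono)
    have "overlap N a a ^ (k + 2) \<le> \<bar>overlap N a a\<bar> ^ (k + 2)"
      by (simp only: power_abs[symmetric] abs_ge_self)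
    also have "\<dots> \<le> 1" using ov by (intro power_le_one) auto
    finally show "overlap N a a ^ (k + 2) \<le> 1" .
  qed auto
  also have "\<dots> = (sqrt (real N) * \<bar>\<beta> (k + 2)\<bar>)\<^sup>2" by (simp add: power_mult_distrib)
  finally have "L2_set (spin_coeff \<beta> N a) (multi_indices N (k + 2)) \<le> sqrt (real N) * \<bar>\<beta> (k + 2)\<bar>"
    by (rule power2_le_imp_le) simp
  also have "\<dots> \<le> sqrt (real N) * (real (k + 2) ^ 3 * \<bar>\<beta> (k + 2)\<bar>)"
  proof (intro mult_left_mono)
    have "1 * \<bar>\<beta> (k + 2)\<bar> \<le> real (k + 2) ^ 3 * \<bar>\<beta> (k + 2)\<bar>"
      by (intro mult_right_mono one_le_power) auto
    then show "\<bar>\<beta> (k + 2)\<bar> \<le> real (k + 2) ^ 3 * \<bar>\<beta> (k + 2)\<bar>" by simp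
  qed auto
  finally show "\<bar>L2_set (spin_coeff \<beta> N a) (multi_indices N (k + 2))\<bar>
     \<le> sqrt (real N) * (real (k + 2) ^ 3 * \<bar>\<beta> (k + 2)\<bar>)" by simp
qed

end

locale disorder = mixture \<beta> + prob_space M
  for \<beta> :: "nat => real" and M :: "'a measure" +
  fixes g :: "nat list => 'a => real"
  assumes indep_g: "indep_vars (\<lambda>_. borel) g {js. 2 \<le> length js \<and> set js \<subseteq> {1..}}"
    and normal_g: "\<And>js. 2 \<le> length js ==> set js \<subseteq> {1..} ==>
           distributed M lborel (g js) std_normal_density"
begin

abbreviation G :: "'a => nat list => real" where "G w \<equiv> (\<lambda>js. g js w)"

definition index :: "nat list set" where
  "index = {js. 2 \<le> length js \<and> set js \<subseteq> {1..}}"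

lemma multi_indices_index: "2 \<le> p ==> multi_indices N p \<subseteq> index"
  by (auto simp: multi_indices_def index_def)

lemma measurable_g: "js \<in> index ==> g js \<in> borel_measurable M"
  using normal_g[of js] by (auto simp: index_def dest: distributed_measurable)

lemma measurable_g_multi [measurable]: "js \<in> multi_indices N (k + 2) ==> g js \<in> borel_measurable M"
  using multi_indices_index[of "k + 2" N] by (auto intro: measurable_g)

lemma gaussian_finite_sum:
  assumes "finite I" "I \<subseteq> index"
  shows "gaussian_rv M (\<lambda>w. \<Sum>js\<in>I. b js * g js w) (\<Sum>js\<in>I. (b js)\<^sup>2)"
  using assms indep_g by (intro gaussian_rv_sum) (auto intro!: indep_vars_subset[OF indep_g] normal_g simp: index_def subset_iff)

lemma measurable_gseries [measurable]: "(\<lambda>w. gseries N b (G w)) \<in> borel_measurable M"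
  unfolding gseries_def by measurable

lemma gaussian_block:
  "gaussian_rv M (\<lambda>w. \<Sum>js\<in>multi_indices N (k + 2). b js * g js w)
     ((L2_set b (multi_indices N (k + 2)))\<^sup>2)"
  unfolding L2_set_squared by (intro gaussian_finite_sum multi_indices_index) auto

text \<open>Monotone convergence.\<close>

lemma AE_summable_of_integrals:
  fixes f :: "nat => 'a => real"
  assumes int: "\<And>k. integrable M (f k)" and nn: "\<And>k w. 0 \<le> f k w"
    and le: "\<And>k. (\<integral>w. f k w \<partial>M) \<le> c k" and c: "summable c"
  shows "AE w in M. summable (\<lambda>k. f k w)"
    and "integrable M (\<lambda>w. \<Sum>k. f k w)" (is ?two) and "(\<integral>w. (\<Sum>k. f k w) \<partial>M) \<le> suminf c" (is ?three)
proof -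
  have s: "summable (\<lambda>k. \<integral>w. f k w \<partial>M)"
    by (rule summable_comparison_test'[OF c]) (use le nn in \<open>simp add: integral_nonneg\<close>)
  have [measurable]: "f k \<in> borel_measurable M" for k using int by auto
  have "(\<integral>\<^sup>+w. (\<Sum>k. ennreal (f k w)) \<partial>M) = (\<Sum>k. ennreal (\<integral>w. f k w \<partial>M))"
    by (subst nn_integral_suminf) (auto simp: nn_integral_eq_integral int nn)
  also have "\<dots> = ennreal (\<Sum>k. \<integral>w. f k w \<partial>M)"
    by (rule suminf_ennreal2) (auto simp: s nn integral_nonneg)
  also have "\<dots> \<noteq> \<infinity>" by simp
  finally have "AE w in M. (\<Sum>k. ennreal (f k w)) \<noteq> \<infinity>"
    by (intro nn_integral_PInf_AE) auto
  then show AE: "AE w in M. summable (\<lambda>k. f k w)"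
    by eventually_elim (auto intro: summable_suminf_not_top nn)
  show ?two
    by (rule integrable_suminf) (use int AE s nn in auto)
  have "(\<integral>w. (\<Sum>k. f k w) \<partial>M) = (\<Sum>k. \<integral>w. f k w \<partial>M)"
    by (rule integral_suminf) (use int AE s nn in auto)
  also have "\<dots> \<le> suminf c" by (rule suminf_le[OF le s c])
  finally show ?three .
qed

text \<open>The blocks have mean absolute values bounded by their \<open>L\<^sup>2\<close> norms, so the series converges
  absolutely almost surely.\<close>

lemma gseries_AE_summable:
  assumes "l2_summable N b"
  shows "AE w in M. summable (\<lambda>k. \<Sum>js\<in>multi_indices N (k + 2). b js * g js w)"
proof -
  have "AE w in M. summable (\<lambda>k. \<bar>\<Sum>js\<in>multi_indices N (k + 2). b js * g js w\<bar>)"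
  proof (rule AE_summable_of_integrals(1))
    show "integrable M (\<lambda>w. \<bar>\<Sum>js\<in>multi_indices N (k + 2). b js * g js w\<bar>)" for k
      by (rule integrable_abs[OF gaussian_rv_abs(1)[OF gaussian_block]])
    show "(\<integral>w. \<bar>\<Sum>js\<in>multi_indices N (k + 2). b js * g js w\<bar> \<partial>M) \<le> L2_set b (multi_indices N (k + 2))" for k
      using gaussian_rv_abs(2)[OF gaussian_block[of b N k]] by (simp add: L2_set_nonneg)
    show "summable (\<lambda>k. L2_set b (multi_indices N (k + 2)))"
      using assms by (simp add: l2_summable_def)
  qed auto
  then show ?thesis by eventually_elim (rule summable_rabs_cancel)
qed

text \<open>The limit of centred Gaussian variables with converging variances is Gaussian.\<close>

lemma gaussian_gseries:
  assumes b: "l2_summable N b" and v: "(\<lambda>k. \<Sum>js\<in>multi_indices N (k + 2). (b js)\<^sup>2) sums v"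
  shows "gaussian_rv M (\<lambda>w. gseries N b (G w)) v"
proof (rule gaussian_rv_limit)
  define J where "J n = (\<Union>k<n. multi_indices N (k + 2))" for n
  have sumJ: "(\<Sum>js\<in>J n. f js) = (\<Sum>k<n. \<Sum>js\<in>multi_indices N (k + 2). f js)" for n and f :: "nat list => real"
    unfolding J_def by (rule sum.UNION_disjoint) (auto simp: multi_indices_disjoint)
  show "gaussian_rv M (\<lambda>w. \<Sum>js\<in>J n. b js * g js w) (\<Sum>js\<in>J n. (b js)\<^sup>2)" for n
  proof (rule gaussian_finite_sum)
    show "J n \<subseteq> index" by (auto simp: J_def multi_indices_def index_def)
  qed (simp add: J_def)
  show "(\<lambda>n. \<Sum>js\<in>J n. (b js)\<^sup>2) \<longlonglongrightarrow> v"
    using v by (simp add: sumJ sums_def)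
  show "AE w in M. (\<lambda>n. \<Sum>js\<in>J n. b js * g js w) \<longlonglongrightarrow> gseries N b (G w)"
    using gseries_AE_summable[OF b]
    by eventually_elim (simp add: sumJ gseries_def summable_LIMSEQ)
qed simp

lemma gseries_linear:
  assumes "finite T" "\<And>t. t \<in> T ==> l2_summable N (b t)"
  shows "AE w in M. gseries N (\<lambda>js. \<Sum>t\<in>T. c t * b t js) (G w) = (\<Sum>t\<in>T. c t * gseries N (b t) (G w))"
proof -
  have "AE w in M. \<forall>t\<in>T. summable (\<lambda>k. \<Sum>js\<in>multi_indices N (k + 2). b t js * g js w)"
    using assms by (intro AE_finite_allI gseries_AE_summable) auto
  then show ?thesis
  proof eventually_elim
    case (elim w)
    have "(\<lambda>k. \<Sum>t\<in>T. c t * (\<Sum>js\<in>multi_indices N (k + 2). b t js * g js w))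
        sums (\<Sum>t\<in>T. c t * gseries N (b t) (G w))"
      unfolding gseries_def using elim by (intro sums_sum sums_mult summable_sums) auto
    moreover have "(\<Sum>t\<in>T. c t * (\<Sum>js\<in>multi_indices N (k + 2). b t js * g js w))
        = (\<Sum>js\<in>multi_indices N (k + 2). (\<Sum>t\<in>T. c t * b t js) * g js w)" for k
      by (simp add: sum_distrib_left sum_distrib_right mult.assoc sum.swap[of _ T])
    ultimately show ?case by (simp add: gseries_def sums_iff)
  qed
qed

abbreviation X :: "nat => (nat => real) => 'a => real" where
  "X N a w \<equiv> mixed_hamiltonian \<beta> (G w) N a"

definition in_cube :: "nat => (nat => real) => bool" where
  "in_cube N a \<longleftrightarrow> (\<forall>i\<in>{1..N}. \<bar>a i\<bar> \<le> 1)"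

lemma in_cube_overlap: "in_cube N a ==> in_cube N b ==> \<bar>overlap N a b\<bar> \<le> 1"
  by (auto simp: in_cube_def intro: overlap_abs_le)

lemma measurable_X [measurable]: "X N a \<in> borel_measurable M"
  unfolding mixed_hamiltonian_eq by measurable

lemma gaussian_series_combination:
  assumes T: "finite T" and l2: "\<And>t. t \<in> T ==> l2_summable N (b t)"
    and cov: "\<And>t s. t \<in> T ==> s \<in> T ==> (\<lambda>k. \<Sum>js\<in>multi_indices N (k + 2). b t js * b s js) sums K t s"
  shows "gaussian_rv M (\<lambda>w. \<Sum>t\<in>T. c t * gseries N (b t) (G w)) (\<Sum>t\<in>T. \<Sum>s\<in>T. c t * c s * K t s)"
proof (rule gaussian_rv_cong_AE)
  let ?b = "\<lambda>js. \<Sum>t\<in>T. c t * b t js"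
  show "gaussian_rv M (\<lambda>w. gseries N ?b (G w)) (\<Sum>t\<in>T. \<Sum>s\<in>T. c t * c s * K t s)"
  proof (rule gaussian_gseries)
    show "l2_summable N ?b" by (rule l2_summable_sum[OF T l2])
    have "(\<Sum>js\<in>multi_indices N (k + 2). (?b js)\<^sup>2)
        = (\<Sum>t\<in>T. \<Sum>s\<in>T. c t * c s * (\<Sum>js\<in>multi_indices N (k + 2). b t js * b s js))" for k
    proof -
      have "(\<Sum>js\<in>multi_indices N (k + 2). (?b js)\<^sup>2)
          = (\<Sum>js\<in>multi_indices N (k + 2). \<Sum>t\<in>T. \<Sum>s\<in>T. (c t * b t js) * (c s * b s js))"
        by (simp only: power2_eq_square sum_product)
      also have "\<dots> = (\<Sum>t\<in>T. \<Sum>s\<in>T. \<Sum>js\<in>multi_indices N (k + 2). (c t * b t js) * (c s * b s js))"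
        by (subst sum.swap) (intro sum.cong refl sum.swap)
      finally show ?thesis by (simp add: sum_distrib_left mult_ac)
    qed
    then show "(\<lambda>k. \<Sum>js\<in>multi_indices N (k + 2). (?b js)\<^sup>2) sums (\<Sum>t\<in>T. \<Sum>s\<in>T. c t * c s * K t s)"
      using cov by (simp only:) (intro sums_sum sums_mult, auto)
  qed
  show "AE w in M. gseries N ?b (G w) = (\<Sum>t\<in>T. c t * gseries N (b t) (G w))"
    by (rule gseries_linear[OF T l2])
qed (intro borel_measurable_sum borel_measurable_times borel_measurable_const measurable_gseries)

lemma gaussian_field_combination:
  assumes N: "1 \<le> N" and T: "finite T" and a: "\<And>t. t \<in> T ==> in_cube N (a t)"
  shows "gaussian_rv M (\<lambda>w. \<Sum>t\<in>T. c t * X N (a t) w)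
    (real N * (\<Sum>t\<in>T. \<Sum>s\<in>T. c t * c s * xi \<beta> (overlap N (a t) (a s))))"
proof -
  have "gaussian_rv M (\<lambda>w. \<Sum>t\<in>T. c t * gseries N (spin_coeff \<beta> N (a t)) (G w))
    (\<Sum>t\<in>T. \<Sum>s\<in>T. c t * c s * (real N * xi \<beta> (overlap N (a t) (a s))))"
    using a by (intro gaussian_series_combination T l2_summable_spin_coeff spin_coeff_inner_sums N)
      (auto simp: in_cube_def)
  then show ?thesis by (simp add: mixed_hamiltonian_eq sum_distrib_left mult_ac)
qed

section \<open>Spin configurations and the supremum of the multilinear forms\<close>

lemma finite_spin_configs [simp]: "finite (spin_configs N)"
  by (auto simp: spin_configs_def intro!: finite_PiE)

lemma spin_configs_values: "\<sigma> \<in> spin_configs N ==> i \<in> {1..N} ==> \<sigma> i = 1 \<or> \<sigma> i = -1"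
  using PiE_mem[of \<sigma> "{1..N}" "\<lambda>_. {-1, 1}" i] unfolding spin_configs_def by blast

lemma spin_configs_in_cube: "\<sigma> \<in> spin_configs N ==> in_cube N \<sigma>"
  unfolding in_cube_def using spin_configs_values[of \<sigma> N] by force

lemma card_spin_configs: "card (spin_configs N) = 2 ^ N"
proof -
  have "card ({1..N} \<rightarrow>\<^sub>E {-1, 1 :: real}) = (\<Prod>i\<in>{1..N}. card {-1, 1 :: real})"
    by (rule card_PiE) simp
  then show ?thesis by (simp add: spin_configs_def numeral_2_eq_2)
qed

lemma spin_configs_nonempty [simp]: "spin_configs N \<noteq> {}"
  using card_spin_configs[of N] by auto

definition tuples :: "nat => nat => (nat => nat => real) set" where
  "tuples N n = {..<n} \<rightarrow>\<^sub>E spin_configs N"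

lemma finite_tuples [simp]: "finite (tuples N n)"
  by (auto simp: tuples_def intro!: finite_PiE)

lemma tuples_mem: "\<psi> \<in> tuples N n ==> l < n ==> \<psi> l \<in> spin_configs N"
  using PiE_mem[of \<psi> "{..<n}" "\<lambda>_. spin_configs N" l] unfolding tuples_def by simp

lemma card_tuples: "card (tuples N n) = 2 ^ (N * n)"
  by (simp add: tuples_def card_PiE card_spin_configs power_mult)

lemma tuples_nonempty [simp]: "tuples N n \<noteq> {}"
  using card_tuples[of N n] by auto

definition multilinear_coeff :: "nat => nat => (nat => nat => real) => nat list => real" where
  "multilinear_coeff N p \<phi> js = \<beta> p / real N powr ((real p - 1) / 2) * (\<Prod>k<p. \<phi> k (js ! k))"

definition multilinear :: "nat => nat => (nat => nat => real) => 'a => real" where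
  "multilinear N p \<phi> w = (\<Sum>js\<in>multi_indices N p. multilinear_coeff N p \<phi> js * g js w)"

text \<open>The supremum over different arguments in the slots of the \<open>p\<close>-linear form dominates the form at
  every convex combination of configurations, in particular at the magnetization.\<close>

definition form_sup :: "nat => nat => 'a => real" where
  "form_sup N p w = Max ((\<lambda>\<phi>. \<bar>multilinear N p \<phi> w\<bar>) ` tuples N p)"

lemma multilinear_le_form_sup: "\<phi> \<in> tuples N p ==> \<bar>multilinear N p \<phi> w\<bar> \<le> form_sup N p w"
  unfolding form_sup_def by (intro Max_ge) auto

lemma form_sup_nonneg: "0 \<le> form_sup N p w"
proof -
  obtain \<phi> where "\<phi> \<in> tuples N p" using tuples_nonempty by blast
  then show ?thesis using multilinear_le_form_sup[of \<phi> N p w] by linarith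
qed

lemma prod_list_map_nth: "js \<in> multi_indices N p ==> prod_list (map m js) = (\<Prod>k<p. m (js ! k))"
  for m :: "nat => real"
proof (induction p arbitrary: js)
  case 0 then show ?case by (auto simp: multi_indices_def)
next
  case (Suc p)
  then obtain i js' where "js = i # js'" "js' \<in> multi_indices N p" by (auto simp: multi_indices_Suc)
  with Suc.IH[of js'] show ?case by (simp add: prod.lessThan_Suc_shift del: prod.lessThan_Suc)
qed

lemma pure_hamiltonian_multilinear: "pure_hamiltonian \<beta> (G w) N p m = multilinear N p (\<lambda>_. m) w"
  unfolding pure_hamiltonian_def multilinear_def sum_distrib_left
  by (rule sum.cong) (auto simp: multilinear_coeff_def prod_list_map_nth)

lemma measurable_multilinear: "2 \<le> p ==> multilinear N p \<phi> \<in> borel_measurable M"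
  unfolding multilinear_def using multi_indices_index[of p N]
  by (intro borel_measurable_sum borel_measurable_times borel_measurable_const measurable_g) auto

lemma measurable_form_sup: "2 \<le> p ==> form_sup N p \<in> borel_measurable M"
  unfolding form_sup_def
  by (intro borel_measurable_Max finite_imageI finite_tuples) (auto intro!: borel_measurable_abs measurable_multilinear)

lemma gaussian_multilinear:
  assumes N: "1 \<le> N" and p: "2 \<le> p" and \<phi>: "\<phi> \<in> tuples N p"
  shows "gaussian_rv M (multilinear N p \<phi>) (real N * (\<beta> p)\<^sup>2)"
proof -
  have "(multilinear_coeff N p \<phi> js)\<^sup>2 = spin_coeff \<beta> N (\<lambda>_. 1) js * spin_coeff \<beta> N (\<lambda>_. 1) js"
    if js: "js \<in> multi_indices N p" for js
  proof -
    have "\<bar>\<phi> k (js ! k)\<bar> = 1" if "k < p" for k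
      using spin_configs_values[OF tuples_mem[OF \<phi> that], of "js ! k"] js that
      by (auto simp: multi_indices_def subset_iff)
    then have "\<bar>\<Prod>k<p. \<phi> k (js ! k)\<bar> = 1" by (simp add: abs_prod)
    then have "(\<Prod>k<p. \<phi> k (js ! k))\<^sup>2 = 1" by (metis power2_abs one_power2)
    moreover have "prod_list (map (\<lambda>_. 1) js) = (1 :: real)" by (induction js) auto
    ultimately show ?thesis using js
      by (simp add: multilinear_coeff_def spin_coeff_def power_mult_distrib multi_indices_def power2_eq_square)
  qed
  then have "(\<Sum>js\<in>multi_indices N p. (multilinear_coeff N p \<phi> js)\<^sup>2) = real N * (\<beta> p)\<^sup>2"
    using spin_coeff_inner[OF N, of p \<beta> "\<lambda>_. 1" "\<lambda>_. 1"] p N by (simp add: overlap_def)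
  then show ?thesis
    using gaussian_finite_sum[of "multi_indices N p" "multilinear_coeff N p \<phi>"] multi_indices_index[OF p]
    unfolding multilinear_def[abs_def] by simp
qed

text \<open>The union bound over the \<open>2\<^sup>N\<^sup>p\<close> choices of arguments costs only a factor
  exponential in \<open>N p\<close>, so the supremum is of order \<open>N p \<bar>\<beta>\<^sub>p\<bar>\<close>.\<close>

lemma form_sup_fourth_moment:
  assumes N: "1 \<le> N" and p: "2 \<le> p"
  shows "integrable M (\<lambda>w. form_sup N p w ^ 4)" (is ?one)
    and "(\<integral>w. form_sup N p w ^ 4 \<partial>M) \<le> 2304 * (real N * real p * \<bar>\<beta> p\<bar>) ^ 4" (is ?two)
proof -
  have [measurable]: "form_sup N p \<in> borel_measurable M" "\<And>\<phi>. multilinear N p \<phi> \<in> borel_measurable M"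
    using p measurable_form_sup measurable_multilinear by auto
  have "integrable M (\<lambda>w. form_sup N p w ^ 4) \<and>
    (\<integral>w. form_sup N p w ^ 4 \<partial>M) \<le> 2304 * (real N * real p * \<bar>\<beta> p\<bar>) ^ 4"
  proof (cases "\<beta> p = 0")
    case True
    then have "multilinear N p \<phi> w = 0" for \<phi> w by (simp add: multilinear_def multilinear_coeff_def)
    then have "form_sup N p w = 0" for w by (simp add: form_sup_def image_constant_conv)
    then show ?thesis by simp
  next
    case False
    define l where "l = 1 / \<bar>\<beta> p\<bar>"
    define l' where "l' = - l"
    have l: "0 < l" "l\<^sup>2 * (\<beta> p)\<^sup>2 = 1" using False by (auto simp: l_def power_divide)
    have l': "l'\<^sup>2 = l\<^sup>2" by (simp add: l'_def)
    \<comment> \<open>The sum of the exponential moments has expectation at most \<open>exp K\<close>, so \<open>K\<close> is the scale of \<open>l * form_sup\<close>.\<close>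
    define K where "K = 2 * real N * real p"
    have Np: "real N * 2 \<le> real N * real p" using p by (intro mult_left_mono) auto
    moreover have "1 \<le> real N" using N by simp
    ultimately have K: "1 \<le> K" and K2: "1 + real N / 2 \<le> real N * real p"
      unfolding K_def mult.assoc by linarith+
    define E where "E w = (\<Sum>\<phi>\<in>tuples N p. exp (l * multilinear N p \<phi> w) + exp (l' * multilinear N p \<phi> w))" for w
    have E_int: "integrable M E"
      unfolding E_def
      by (intro Bochner_Integration.integrable_sum Bochner_Integration.integrable_add
          gaussian_rv_exp(1)[OF gaussian_multilinear[OF N p]])
    have "(\<integral>w. E w \<partial>M) = (\<Sum>\<phi>\<in>tuples N p. exp (l\<^sup>2 * (real N * (\<beta> p)\<^sup>2) / 2) + exp (l'\<^sup>2 * (real N * (\<beta> p)\<^sup>2) / 2))"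
      unfolding E_def
      by (simp add: Bochner_Integration.integral_sum Bochner_Integration.integral_add
          gaussian_rv_exp[OF gaussian_multilinear[OF N p]])
    also have "\<dots> = 2 ^ (N * p) * (2 * exp (real N / 2))"
      unfolding l' using l(2) by (simp add: card_tuples mult.left_commute[of "l\<^sup>2"])
    also have "\<dots> \<le> exp 1 ^ (N * p) * (exp 1 * exp (real N / 2))"
      using exp_ge_add_one_self[of 1] by (intro mult_mono power_mono) auto
    also have "\<dots> = exp (real N * real p + (1 + real N / 2))"
      by (simp add: exp_of_nat_mult[symmetric] exp_add)
    also have "\<dots> \<le> exp K" using K2 by (simp add: K_def)
    finally have E_le: "(\<integral>w. E w \<partial>M) \<le> exp K" .
    have E_ge: "exp (l * form_sup N p w) \<le> E w" for w
    proof -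
      have "form_sup N p w \<in> (\<lambda>\<phi>. \<bar>multilinear N p \<phi> w\<bar>) ` tuples N p"
        unfolding form_sup_def by (rule Max_in) auto
      then obtain \<phi> where \<phi>: "\<phi> \<in> tuples N p" "form_sup N p w = \<bar>multilinear N p \<phi> w\<bar>" by auto
      have "exp (l * form_sup N p w) \<le> exp (l * multilinear N p \<phi> w) + exp (l' * multilinear N p \<phi> w)"
        unfolding \<phi>(2) l'_def by (cases "multilinear N p \<phi> w \<ge> 0") (auto simp: add_increasing add_increasing2)
      also have "\<dots> \<le> E w" unfolding E_def using \<phi>(1)
        by (intro member_le_sum[of _ _ "\<lambda>\<phi>. exp (l * multilinear N p \<phi> w) + exp (l' * multilinear N p \<phi> w)"])
          (auto intro: add_nonneg_nonneg)
      finally show ?thesis .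
    qed
    define W where "W w = l * form_sup N p w / K" for w
    have S_W: "form_sup N p w = (K / l) * W w" for w using l K by (simp add: W_def)
    have W0: "0 \<le> W w" for w using l K form_sup_nonneg by (simp add: W_def)
    \<comment> \<open>Fourth powers are bounded by exponentials, and \<open>exp (W - 1) \<le> 1 + exp (K (W - 1))\<close> because \<open>1 \<le> K\<close>.\<close>
    have W4: "W w ^ 4 \<le> 72 * (1 + E w * exp (- K))" for w
    proof -
      have "W w ^ 4 / fact 4 \<le> (\<Sum>n<5. W w ^ n / fact n)"
        using W0[of w] by (intro member_le_sum[of _ _ "\<lambda>n. W w ^ n / fact n"]) auto
      also have "\<dots> \<le> exp (W w)"
        using W0[of w] summable_exp_generic[of "W w"] unfolding exp_def
        by (auto intro!: sum_le_suminf simp: divide_inverse scaleR_conv_of_real mult.commute)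
      finally have "W w ^ 4 \<le> 24 * exp (W w)" by (simp add: fact_numeral)
      also have "exp (W w) = exp 1 * exp (W w - 1)" by (simp add: exp_diff)
      also have "exp (W w - 1) \<le> 1 + exp (K * (W w - 1))"
      proof (cases "W w \<le> 1")
        case True
        then have "exp (W w - 1) \<le> 1" by simp
        then show ?thesis using exp_gt_zero[of "K * (W w - 1)"] by linarith
      next
        case False
        then have "1 * (W w - 1) \<le> K * (W w - 1)" using K by (intro mult_right_mono) auto
        then have "exp (W w - 1) \<le> exp (K * (W w - 1))" by simp
        then show ?thesis by linarith
      qed
      also have "exp (K * (W w - 1)) = exp (l * form_sup N p w) * exp (- K)"
        using K by (simp add: W_def field_simps exp_add[symmetric])
      also have "24 * (exp 1 * (1 + exp (l * form_sup N p w) * exp (- K))) \<le> 24 * (3 * (1 + E w * exp (- K)))"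
        using exp_le E_ge[of w] by (intro mult_left_mono mult_mono add_mono mult_right_mono) (auto intro: add_nonneg_nonneg)
      finally show ?thesis by simp
    qed
    have i: "integrable M (\<lambda>w. W w ^ 4)"
      by (rule Bochner_Integration.integrable_bound[of _ "\<lambda>w. 72 * (1 + E w * exp (- K))"])
        (use E_int W4 W0 in \<open>auto simp: W_def[abs_def] intro: order_trans[OF _ abs_ge_self]\<close>)
    have "(\<integral>w. W w ^ 4 \<partial>M) \<le> (\<integral>w. 72 * (1 + E w * exp (- K)) \<partial>M)"
      using E_int by (intro integral_mono i W4) auto
    also have "\<dots> = 72 * (1 + (\<integral>w. E w \<partial>M) * exp (- K))" using E_int by (simp add: prob_space)
    also have "\<dots> \<le> 72 * (1 + exp K * exp (- K))" using E_le by simp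
    also have "\<dots> = 144" by (simp add: exp_add[symmetric])
    finally have W144: "(\<integral>w. W w ^ 4 \<partial>M) \<le> 144" .
    have Kl: "K / l = 2 * (real N * real p * \<bar>\<beta> p\<bar>)" by (simp add: K_def l_def)
    show ?thesis
    proof
      show ?one
        unfolding S_W power_mult_distrib using i by simp
      have "(\<integral>w. form_sup N p w ^ 4 \<partial>M) = (K / l) ^ 4 * (\<integral>w. W w ^ 4 \<partial>M)"
        unfolding S_W power_mult_distrib by simp
      also have "\<dots> \<le> (K / l) ^ 4 * 144" using W144 by (intro mult_left_mono) auto
      finally show ?two
        unfolding Kl by (simp add: power_mult_distrib)
    qed
  qed
  then show ?one
    and "(\<integral>w. form_sup N p w ^ 4 \<partial>M) \<le> 2304 * (real N * real p * \<bar>\<beta> p\<bar>) ^ 4" by auto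
qed

end

section \<open>Finite Gibbs averages\<close>

definition gibbs :: "'b set => ('b => real) => ('b => real) => real" where
  "gibbs S H f = (\<Sum>s\<in>S. exp (H s) * f s) / (\<Sum>s\<in>S. exp (H s))"

lemma gibbs_cong: "(\<And>s. s \<in> S ==> H s = H' s) ==> (\<And>s. s \<in> S ==> f s = f' s) ==> gibbs S H f = gibbs S H' f'"
  by (simp add: gibbs_def)

lemma gibbs_weights: "gibbs S H f = (\<Sum>s\<in>S. exp (H s) / (\<Sum>s\<in>S. exp (H s)) * f s)"
  by (simp add: gibbs_def sum_divide_distrib)

lemma gibbs_add: "gibbs S H (\<lambda>s. f s + k s) = gibbs S H f + gibbs S H k"
  by (simp add: gibbs_def distrib_left sum.distrib add_divide_distrib)

lemma gibbs_diff: "gibbs S H (\<lambda>s. f s - k s) = gibbs S H f - gibbs S H k"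
  by (simp add: gibbs_def right_diff_distrib sum_subtractf diff_divide_distrib)

lemma gibbs_minus: "gibbs S H (\<lambda>s. - f s) = - gibbs S H f"
  by (simp add: gibbs_def sum_negf)

lemma gibbs_mult: "gibbs S H (\<lambda>s. c * f s) = c * gibbs S H f"
  by (simp add: gibbs_def sum_distrib_left mult.left_commute)

lemma gibbs_mult_right: "gibbs S H (\<lambda>s. f s * c) = gibbs S H f * c"
  using gibbs_mult[of S H c f] by (simp add: mult.commute)

lemma gibbs_divide: "gibbs S H (\<lambda>s. f s / c) = gibbs S H f / c"
  using gibbs_mult_right[of S H f "1 / c"] by simp

lemma gibbs_sum: "gibbs S H (\<lambda>s. \<Sum>t\<in>T. f t s) = (\<Sum>t\<in>T. gibbs S H (f t))"
  by (simp add: gibbs_def sum_distrib_left sum.swap[of _ T] sum_divide_distrib)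

context
  fixes S :: "'b set"
  assumes S: "finite S" "S \<noteq> {}"
begin

lemma partition_pos: "0 < (\<Sum>s\<in>S. exp (H s :: real))"
  using S by (intro sum_pos) auto

lemma gibbs_const: "gibbs S H (\<lambda>_. c) = c"
  using partition_pos[of H] by (simp add: gibbs_def sum_distrib_right[symmetric])

lemma gibbs_mono: "(\<And>s. s \<in> S ==> f s \<le> k s) ==> gibbs S H f \<le> gibbs S H k"
  unfolding gibbs_def using partition_pos[of H]
  by (intro divide_right_mono sum_mono mult_left_mono) auto

lemma gibbs_nonneg: "(\<And>s. s \<in> S ==> 0 \<le> f s) ==> 0 \<le> gibbs S H f"
  using gibbs_mono[of "\<lambda>_. 0" f H] by (simp add: gibbs_const)

lemma gibbs_abs: "\<bar>gibbs S H f\<bar> \<le> gibbs S H (\<lambda>s. \<bar>f s\<bar>)"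
  using gibbs_mono[of f "\<lambda>s. \<bar>f s\<bar>" H] gibbs_mono[of "\<lambda>s. - f s" "\<lambda>s. \<bar>f s\<bar>" H]
  by (simp add: gibbs_minus abs_le_iff)

lemma gibbs_abs_le: "(\<And>s. s \<in> S ==> \<bar>f s\<bar> \<le> c) ==> \<bar>gibbs S H f\<bar> \<le> c"
  using gibbs_abs[of H f] gibbs_mono[of "\<lambda>s. \<bar>f s\<bar>" "\<lambda>_. c" H] by (simp add: gibbs_const)

text \<open>The tangent line to the exponential at the average.\<close>

lemma gibbs_exp_jensen: "exp (gibbs S H f) \<le> gibbs S H (\<lambda>s. exp (f s))"
proof -
  let ?a = "gibbs S H f"
  have "exp ?a * (1 - ?a + f s) \<le> exp (f s)" for s
  proof -
    have "exp ?a * (1 + (f s - ?a)) \<le> exp ?a * exp (f s - ?a)"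
      by (intro mult_left_mono exp_ge_add_one_self) auto
    then show ?thesis by (simp add: exp_diff add.commute add_diff_eq diff_add_eq)
  qed
  then have "gibbs S H (\<lambda>s. exp ?a * (1 - ?a + f s)) \<le> gibbs S H (\<lambda>s. exp (f s))"
    by (intro gibbs_mono)
  moreover have "gibbs S H (\<lambda>s. exp ?a * (1 - ?a + f s)) = exp ?a"
    by (simp only: gibbs_mult gibbs_add gibbs_const) simp
  ultimately show ?thesis by simp
qed

lemma gibbs_square_jensen: "(gibbs S H f)\<^sup>2 \<le> gibbs S H (\<lambda>s. (f s)\<^sup>2)"
proof -
  let ?a = "gibbs S H f"
  have "0 \<le> gibbs S H (\<lambda>s. (f s - ?a)\<^sup>2)" by (intro gibbs_nonneg) simp
  also have "(\<lambda>s. (f s - ?a)\<^sup>2) = (\<lambda>s. (f s)\<^sup>2 - 2 * ?a * f s + ?a\<^sup>2)"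
    by (simp add: power2_eq_square algebra_simps)
  also have "gibbs S H \<dots> = gibbs S H (\<lambda>s. (f s)\<^sup>2) - ?a\<^sup>2"
    by (simp only: gibbs_add gibbs_diff gibbs_mult gibbs_const) (simp add: power2_eq_square)
  finally show ?thesis by simp
qed

lemma ln_partition_diff:
  "ln (\<Sum>s\<in>S. exp (H s + u s)) - ln (\<Sum>s\<in>S. exp (H s)) = ln (gibbs S H (\<lambda>s. exp (u s)))"
  using partition_pos[of H] partition_pos[of "\<lambda>s. H s + u s"]
  by (simp add: gibbs_def exp_add ln_div)

lemma gibbs_exp_pos: "0 < gibbs S H (\<lambda>s. exp (u s))"
  using partition_pos[of H] partition_pos[of "\<lambda>s. H s + u s"] by (simp add: gibbs_def exp_add)

lemma gibbs_change:
  "gibbs S (\<lambda>s. H s + u s) f = gibbs S H (\<lambda>s. exp (u s) * f s) / gibbs S H (\<lambda>s. exp (u s))"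
  using partition_pos[of H] by (simp add: gibbs_def exp_add mult.assoc)

text \<open>Convexity of the log-partition function.\<close>

lemma ln_partition_tangent:
  "ln (\<Sum>s\<in>S. exp (H s)) + gibbs S H u \<le> ln (\<Sum>s\<in>S. exp (H s + u s))"
proof -
  have "gibbs S H u = ln (exp (gibbs S H u))" by simp
  also have "\<dots> \<le> ln (gibbs S H (\<lambda>s. exp (u s)))"
    using gibbs_exp_jensen[of H u] by (intro ln_mono) (auto intro: gibbs_exp_pos)
  finally show ?thesis using ln_partition_diff[of H u] by simp
qed

lemma ln_partition_abs:
  assumes "\<And>s. s \<in> S ==> \<bar>H s\<bar> \<le> c"
  shows "\<bar>ln (\<Sum>s\<in>S. exp (H s))\<bar> \<le> c + ln (card S)"
proof -
  have c: "0 < card S" using S by (simp add: card_gt_0_iff)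
  have "(\<Sum>s\<in>S. exp (H s)) \<le> (\<Sum>s\<in>S. exp c)" using assms by (intro sum_mono) (auto dest: abs_le_D1)
  then have "ln (\<Sum>s\<in>S. exp (H s)) \<le> ln (card S * exp c)"
    using partition_pos[of H] by (intro ln_mono) auto
  also have "\<dots> = c + ln (card S)" using c by (simp add: ln_mult)
  finally have 1: "ln (\<Sum>s\<in>S. exp (H s)) \<le> c + ln (card S)" .
  obtain s where s: "s \<in> S" using S by auto
  have "exp (- c) \<le> exp (H s)" using assms[OF s] by simp
  also have "\<dots> \<le> (\<Sum>s\<in>S. exp (H s))" using S s by (intro member_le_sum) auto
  finally have "ln (exp (- c)) \<le> ln (\<Sum>s\<in>S. exp (H s))" by (intro ln_mono) auto
  moreover have "0 \<le> ln (card S)" using c by simp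
  ultimately show ?thesis using 1 by simp
qed

end

lemma gibbs_replicas:
  fixes n :: nat
  assumes S: "finite S"
  shows "gibbs ({..<n} \<rightarrow>\<^sub>E S) (\<lambda>\<psi>. \<Sum>l<n. H (\<psi> l)) (\<lambda>\<psi>. \<Prod>l<n. f l (\<psi> l)) = (\<Prod>l<n. gibbs S H (f l))"
proof -
  have "(\<Prod>l<n. \<Sum>s\<in>S. exp (H s) * f l s) = (\<Sum>\<psi>\<in>{..<n} \<rightarrow>\<^sub>E S. \<Prod>l<n. exp (H (\<psi> l)) * f l (\<psi> l))"
    and "(\<Prod>l<n. \<Sum>s\<in>S. exp (H s)) = (\<Sum>\<psi>\<in>{..<n} \<rightarrow>\<^sub>E S. \<Prod>l<n. exp (H (\<psi> l)))"
    by (subst prod_sum_PiE; simp add: S)+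
  then show ?thesis by (simp add: gibbs_def prod_dividef exp_sum prod.distrib)
qed

lemma gibbs_replica_marginal:
  fixes l n :: nat
  assumes S: "finite S" "S \<noteq> {}" and l: "l < n"
  shows "gibbs ({..<n} \<rightarrow>\<^sub>E S) (\<lambda>\<psi>. \<Sum>l<n. H (\<psi> l)) (\<lambda>\<psi>. f (\<psi> l)) = gibbs S H f"
proof -
  have "(\<Prod>k<n. if k = l then f (\<psi> k) else 1) = f (\<psi> l)" for \<psi>
    using l by (subst prod.delta) auto
  moreover have "(\<Prod>k<n. gibbs S H (\<lambda>s. if k = l then f s else 1)) = (\<Prod>k<n. if k = l then gibbs S H f else 1)"
    by (rule prod.cong) (auto simp: gibbs_const[OF S])
  ultimately show ?thesis
    using gibbs_replicas[OF S(1), of n H "\<lambda>k s. if k = l then f s else 1"] l by simp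
qed

lemma gibbs_replica_pair:
  fixes l k n :: nat
  assumes S: "finite S" "S \<noteq> {}" and l: "l < n" "k < n" "l \<noteq> k"
  shows "gibbs ({..<n} \<rightarrow>\<^sub>E S) (\<lambda>\<psi>. \<Sum>l<n. H (\<psi> l)) (\<lambda>\<psi>. f (\<psi> l) (\<psi> k))
    = gibbs S H (\<lambda>s. gibbs S H (f s))"
proof -
  let ?A = "gibbs ({..<n} \<rightarrow>\<^sub>E S) (\<lambda>\<psi>. \<Sum>l<n. H (\<psi> l))"
  have ind: "?A (\<lambda>\<psi>. (if \<psi> l = s then 1 else 0) * (if \<psi> k = t then 1 else 0))
     = gibbs S H (\<lambda>u. if u = s then 1 else 0) * gibbs S H (\<lambda>u. if u = t then 1 else 0)" for s t
  proof -
    define F where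
      "F j u = (if j = l then if u = s then 1 else 0 else if j = k then if u = t then 1 else 0 else (1 :: real))" for j u
    have P: "(\<Prod>j<n. f j) = f l * f k" if "\<And>j. j \<noteq> l ==> j \<noteq> k ==> f j = 1" for f :: "nat => real"
    proof -
      have "(\<Prod>j<n. f j) = (\<Prod>j\<in>{l, k}. f j)"
        by (rule prod.mono_neutral_right) (use l that in auto)
      then show ?thesis using l by simp
    qed
    have "(\<Prod>j<n. F j (\<psi> j)) = (if \<psi> l = s then 1 else 0) * (if \<psi> k = t then 1 else 0)" for \<psi>
      by (subst P) (use l in \<open>auto simp: F_def\<close>)
    moreover have "(\<Prod>j<n. gibbs S H (F j)) = gibbs S H (F l) * gibbs S H (F k)"
    proof (rule P)
      fix j assume "j \<noteq> l" "j \<noteq> k"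
      then have "F j = (\<lambda>_. 1)" by (auto simp: F_def fun_eq_iff)
      then show "gibbs S H (F j) = 1" by (simp add: gibbs_const[OF S])
    qed
    moreover have "F l = (\<lambda>u. if u = s then 1 else 0)" "F k = (\<lambda>u. if u = t then 1 else 0)"
      using l by (auto simp: F_def fun_eq_iff)
    ultimately show ?thesis using gibbs_replicas[OF S(1), of n H F] by simp
  qed
  have dec: "f u v = (\<Sum>s\<in>S. \<Sum>t\<in>S. f s t * ((if u = s then 1 else 0) * (if v = t then 1 else 0)))"
    if "u \<in> S" "v \<in> S" for u v
    using that S by (simp add: if_distrib[of "\<lambda>x. _ * x"] sum.delta' cong: if_cong)
  have "?A (\<lambda>\<psi>. f (\<psi> l) (\<psi> k)) = ?A (\<lambda>\<psi>. \<Sum>s\<in>S. \<Sum>t\<in>S. f s t * ((if \<psi> l = s then 1 else 0) * (if \<psi> k = t then 1 else 0)))"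
  proof (rule gibbs_cong[OF refl])
    fix \<psi> assume "\<psi> \<in> {..<n} \<rightarrow>\<^sub>E S"
    then have "\<psi> l \<in> S" "\<psi> k \<in> S" using l by (auto dest: PiE_mem)
    then show "f (\<psi> l) (\<psi> k) = (\<Sum>s\<in>S. \<Sum>t\<in>S. f s t * ((if \<psi> l = s then 1 else 0) * (if \<psi> k = t then 1 else 0)))"
      by (rule dec)
  qed
  also have "\<dots> = (\<Sum>s\<in>S. \<Sum>t\<in>S. f s t * (gibbs S H (\<lambda>u. if u = s then 1 else 0) * gibbs S H (\<lambda>u. if u = t then 1 else 0)))"
    by (simp only: gibbs_sum gibbs_mult ind)
  also have "\<dots> = (\<Sum>s\<in>S. gibbs S H (\<lambda>u. if u = s then 1 else 0) * (\<Sum>t\<in>S. gibbs S H (\<lambda>u. if u = t then 1 else 0) * f s t))"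
    by (simp add: sum_distrib_left mult_ac)
  also have "\<dots> = gibbs S H (\<lambda>s. gibbs S H (f s))"
  proof -
    have wt: "gibbs S H (\<lambda>u. if u = s then 1 else 0) = exp (H s) / (\<Sum>s\<in>S. exp (H s))" if "s \<in> S" for s
      using that S by (simp add: gibbs_def if_distrib[of "\<lambda>x. _ * x"] sum.delta' cong: if_cong)
    have E: "gibbs S H F = (\<Sum>s\<in>S. gibbs S H (\<lambda>u. if u = s then 1 else 0) * F s)" for F
      by (simp add: gibbs_weights[of S H F] wt)
    have "gibbs S H (\<lambda>s. gibbs S H (f s)) = (\<Sum>s\<in>S. gibbs S H (\<lambda>u. if u = s then 1 else 0) * gibbs S H (f s))"
      by (rule E)
    also have "\<dots> = (\<Sum>s\<in>S. gibbs S H (\<lambda>u. if u = s then 1 else 0) * (\<Sum>t\<in>S. gibbs S H (\<lambda>u. if u = t then 1 else 0) * f s t))"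
      by (intro sum.cong refl arg_cong2[of _ _ _ _ times]) (rule E)
    finally show ?thesis by simp
  qed
  finally show ?thesis .
qed

lemma hamiltonian_gibbs:
  "gibbs_avg \<beta> h x N f = gibbs (spin_configs N) (hamiltonian \<beta> h x N) f"
  by (simp add: gibbs_avg_def gibbs_weight_def partition_function_def gibbs_weights)

lemma gibbs_avg2_gibbs:
  "gibbs_avg2 \<beta> h x N f =
     gibbs (spin_configs N) (hamiltonian \<beta> h x N) (\<lambda>\<sigma>. gibbs (spin_configs N) (hamiltonian \<beta> h x N) (f \<sigma>))"
  by (simp add: gibbs_avg2_def gibbs_weight_def partition_function_def gibbs_weights sum_distrib_left mult.assoc)

context disorder
begin

section \<open>Uniform bounds on the Hamiltonian\<close>

definition beta_sum :: real where
  "beta_sum = (\<Sum>k. real (k + 2) * \<bar>\<beta> (k + 2)\<bar>)"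

lemma summable_beta_sum: "summable (\<lambda>k. real (k + 2) * \<bar>\<beta> (k + 2)\<bar>)"
proof (rule summable_mono_beta[where C = 1])
  fix k
  have "real (k + 2) ^ 1 * \<bar>\<beta> (k + 2)\<bar> \<le> real (k + 2) ^ 3 * \<bar>\<beta> (k + 2)\<bar>"
    by (intro mult_right_mono power_increasing) auto
  then show "\<bar>real (k + 2) * \<bar>\<beta> (k + 2)\<bar>\<bar> \<le> 1 * (real (k + 2) ^ 3 * \<bar>\<beta> (k + 2)\<bar>)" by simp
qed

lemma beta_sum_nonneg: "0 \<le> beta_sum"
  unfolding beta_sum_def by (intro suminf_nonneg summable_beta_sum) auto

definition total_sup :: "nat => 'a => real" where
  "total_sup N w = (\<Sum>k. form_sup N (k + 2) w)"

text \<open>On this event of full probability the energy converges uniformly on the set of all averages of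
  configurations, so that the disorder-dependent magnetization causes no measure-zero problems.\<close>

definition tame :: "nat => 'a => bool" where
  "tame N w \<longleftrightarrow> summable (\<lambda>k. form_sup N (k + 2) w)"

lemma measurable_total_sup [measurable]: "total_sup N \<in> borel_measurable M"
  unfolding total_sup_def by (intro borel_measurable_suminf measurable_form_sup) auto

text \<open>The Cauchy-Schwarz inequality applied twice.\<close>

lemma sum_fourth_power_weighted:
  fixes f wt :: "nat => real"
  assumes wt: "\<And>k. 0 \<le> wt k" and f: "\<And>k. wt k = 0 ==> f k = 0"
  shows "(\<Sum>k<n. f k) ^ 4 \<le> (\<Sum>k<n. wt k) ^ 3 * (\<Sum>k<n. f k ^ 4 / wt k ^ 3)"
proof -
  have cs: "(\<Sum>k<n. e k)\<^sup>2 \<le> (\<Sum>k<n. wt k) * (\<Sum>k<n. (e k)\<^sup>2 / wt k)"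
    if e: "\<And>k. wt k = 0 ==> e k = 0" for e
  proof -
    have "(\<Sum>k<n. sqrt (wt k) * (e k / sqrt (wt k)))\<^sup>2 \<le> (\<Sum>k<n. (sqrt (wt k))\<^sup>2) * (\<Sum>k<n. (e k / sqrt (wt k))\<^sup>2)"
      by (rule Cauchy_Schwarz_ineq_sum)
    moreover have "sqrt (wt k) * (e k / sqrt (wt k)) = e k" for k using e[of k] by (cases "wt k = 0") auto
    ultimately show ?thesis using wt by (simp add: power_divide)
  qed
  have W: "0 \<le> (\<Sum>k<n. wt k)" using wt by (intro sum_nonneg)
  have "(\<Sum>k<n. f k) ^ 4 = ((\<Sum>k<n. f k)\<^sup>2)\<^sup>2" by simp
  also have "\<dots> \<le> ((\<Sum>k<n. wt k) * (\<Sum>k<n. (f k)\<^sup>2 / wt k))\<^sup>2"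
    by (intro power_mono cs f) auto
  also have "\<dots> = (\<Sum>k<n. wt k)\<^sup>2 * (\<Sum>k<n. (f k)\<^sup>2 / wt k)\<^sup>2" by (simp add: power_mult_distrib)
  also have "\<dots> \<le> (\<Sum>k<n. wt k)\<^sup>2 * ((\<Sum>k<n. wt k) * (\<Sum>k<n. ((f k)\<^sup>2 / wt k)\<^sup>2 / wt k))"
    by (intro mult_left_mono cs) (auto simp: f)
  also have "\<dots> = (\<Sum>k<n. wt k) ^ 3 * (\<Sum>k<n. f k ^ 4 / wt k ^ 3)"
    by (simp add: power_divide power2_eq_square power3_eq_cube power4_eq_xxxx mult_ac)
  finally show ?thesis .
qed

text \<open>The level \<open>p\<close> contributes order \<open>N wt\<^sub>p\<close> with \<open>wt\<^sub>p = p \<bar>\<beta>\<^sub>p\<bar>\<close>, a summable sequence; the fourth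
  moments are therefore added with these weights.\<close>

lemma total_sup_fourth_moment:
  assumes N: "1 \<le> N"
  shows "AE w in M. tame N w" and "integrable M (\<lambda>w. total_sup N w ^ 4)"
    and "(\<integral>w. total_sup N w ^ 4 \<partial>M) \<le> 2304 * (real N * beta_sum) ^ 4" (is ?three)
proof -
  define wt where "wt k = real (k + 2) * \<bar>\<beta> (k + 2)\<bar>" for k
  have wt: "0 \<le> wt k" for k by (simp add: wt_def)
  have w_sum: "summable wt" using summable_beta_sum by (simp add: wt_def[abs_def])
  have beta_sum_w: "beta_sum = suminf wt" by (simp add: beta_sum_def wt_def[abs_def])
  have f0: "form_sup N (k + 2) w = 0" if "wt k = 0" for k w
  proof -
    have "\<beta> (k + 2) = 0" using that by (auto simp: wt_def)
    then have "multilinear N (k + 2) \<phi> w = 0" for \<phi> by (simp add: multilinear_def multilinear_coeff_def)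
    then show ?thesis by (simp add: form_sup_def image_constant_conv)
  qed
  define u where "u k w = form_sup N (k + 2) w ^ 4 / wt k ^ 3" for k w
  have u0: "0 \<le> u k w" for k w using wt by (simp add: u_def)
  have [measurable]: "form_sup N (k + 2) \<in> borel_measurable M" for k by (rule measurable_form_sup) simp
  have u_int: "integrable M (u k)" for k
    unfolding u_def using form_sup_fourth_moment(1)[OF N, of "k + 2"] by simp
  have u_le: "(\<integral>w. u k w \<partial>M) \<le> 2304 * real N ^ 4 * wt k" for k
  proof -
    have "(\<integral>w. u k w \<partial>M) = (\<integral>w. form_sup N (k + 2) w ^ 4 \<partial>M) / wt k ^ 3"
      by (simp add: u_def)
    also have "\<dots> \<le> (2304 * (real N * wt k) ^ 4) / wt k ^ 3"
      using form_sup_fourth_moment(2)[OF N, of "k + 2"] wt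
      by (intro divide_right_mono) (auto simp: wt_def mult.assoc)
    also have "\<dots> = 2304 * real N ^ 4 * wt k"
      by (simp add: power_mult_distrib power4_eq_xxxx power3_eq_cube)
    finally show ?thesis .
  qed
  note U = AE_summable_of_integrals[of u, OF u_int u0 u_le summable_mult[OF w_sum]]
  have f_le: "form_sup N (k + 2) w \<le> wt k + u k w" for k w
  proof (cases "wt k = 0")
    case True then show ?thesis using f0[OF True] u0[of k w] by simp
  next
    case False
    then have wp: "0 < wt k" using wt[of k] by simp
    define t where "t = form_sup N (k + 2) w / wt k"
    have "t \<le> 1 + t ^ 4"
    proof (cases "t \<le> 1")
      case False
      then have "t ^ 1 \<le> t ^ 4" by (intro power_increasing) auto
      then show ?thesis by simp
    qed (simp add: add_increasing2)
    then have "wt k * t \<le> wt k * (1 + t ^ 4)" using wp by (intro mult_left_mono) auto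
    moreover have "wt k * t = form_sup N (k + 2) w" using wp by (simp add: t_def)
    moreover have "wt k * t ^ 4 = u k w" using wp
      by (simp add: t_def u_def power_divide power4_eq_xxxx power3_eq_cube)
    ultimately show ?thesis by (simp add: distrib_left)
  qed
  show tame: "AE w in M. tame N w"
    using U(1) unfolding tame_def
  proof eventually_elim
    case (elim w)
    show ?case
      by (rule summable_comparison_test'[OF summable_add[OF w_sum elim]])
        (use f_le in \<open>simp add: form_sup_nonneg\<close>)
  qed
  have le: "AE w in M. total_sup N w ^ 4 \<le> beta_sum ^ 3 * (\<Sum>k. u k w)"
    using U(1) tame
  proof eventually_elim
    case (elim w)
    have "(\<Sum>k<n. form_sup N (k + 2) w) ^ 4 \<le> beta_sum ^ 3 * (\<Sum>k. u k w)" for n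
    proof -
      have "(\<Sum>k<n. form_sup N (k + 2) w) ^ 4 \<le> (\<Sum>k<n. wt k) ^ 3 * (\<Sum>k<n. u k w)"
        unfolding u_def by (rule sum_fourth_power_weighted) (use wt f0 in auto)
      also have "\<dots> \<le> beta_sum ^ 3 * (\<Sum>k. u k w)"
        unfolding beta_sum_w using wt u0 elim(1) w_sum
        by (intro mult_mono power_mono sum_le_suminf)
          (auto intro!: sum_nonneg zero_le_power suminf_nonneg)
      finally show ?thesis .
    qed
    moreover have "(\<lambda>n. (\<Sum>k<n. form_sup N (k + 2) w) ^ 4) \<longlonglongrightarrow> total_sup N w ^ 4"
      unfolding total_sup_def using elim(2) by (intro tendsto_power summable_LIMSEQ) (simp add: tame_def)
    ultimately show ?case by (intro LIMSEQ_le_const2) auto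
  qed
  show int: "integrable M (\<lambda>w. total_sup N w ^ 4)"
  proof (rule Bochner_Integration.integrable_bound)
    show "integrable M (\<lambda>w. beta_sum ^ 3 * (\<Sum>k. u k w))" using U(2) by simp
    show "AE w in M. norm (total_sup N w ^ 4) \<le> norm (beta_sum ^ 3 * (\<Sum>k. u k w))"
      using le by eventually_elim simp
  qed simp
  have "(\<integral>w. total_sup N w ^ 4 \<partial>M) \<le> (\<integral>w. beta_sum ^ 3 * (\<Sum>k. u k w) \<partial>M)"
    by (rule integral_mono_AE) (use int U(2) le in auto)
  also have "\<dots> \<le> beta_sum ^ 3 * (\<Sum>k. 2304 * real N ^ 4 * wt k)"
    using U(3) beta_sum_nonneg by (simp add: mult_left_mono)
  also have "(\<Sum>k. 2304 * real N ^ 4 * wt k) = 2304 * real N ^ 4 * beta_sum"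
    unfolding beta_sum_w by (rule suminf_mult[OF w_sum])
  finally show ?three
    by (simp add: power_mult_distrib power4_eq_xxxx power3_eq_cube mult_ac)
qed

text \<open>A convex combination of spin configurations is the expectation of independent copies of a
  random configuration, one for each argument of the multilinear form.\<close>

lemma multilinear_expand:
  assumes m: "\<And>i. i \<in> {1..N} ==> m i = (\<Sum>\<sigma>\<in>spin_configs N. wt \<sigma> * \<sigma> i)"
  shows "multilinear N p (\<lambda>_. m) w = (\<Sum>\<phi>\<in>tuples N p. (\<Prod>k<p. wt (\<phi> k)) * multilinear N p \<phi> w)"
proof -
  have "(\<Prod>k<p. m (js ! k)) = (\<Sum>\<phi>\<in>tuples N p. (\<Prod>k<p. wt (\<phi> k)) * (\<Prod>k<p. \<phi> k (js ! k)))"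
    if "js \<in> multi_indices N p" for js
  proof -
    have "(\<Prod>k<p. m (js ! k)) = (\<Prod>k<p. \<Sum>\<sigma>\<in>spin_configs N. wt \<sigma> * \<sigma> (js ! k))"
      using that by (intro prod.cong refl m) (auto simp: multi_indices_def subset_iff)
    also have "\<dots> = (\<Sum>\<phi>\<in>tuples N p. (\<Prod>k<p. wt (\<phi> k)) * (\<Prod>k<p. \<phi> k (js ! k)))"
      unfolding tuples_def by (subst prod_sum_PiE) (auto simp: prod.distrib)
    finally show ?thesis .
  qed
  then have "multilinear N p (\<lambda>_. m) w = (\<Sum>js\<in>multi_indices N p. \<Sum>\<phi>\<in>tuples N p.
      (\<Prod>k<p. wt (\<phi> k)) * (multilinear_coeff N p \<phi> js * g js w))"
    by (simp add: multilinear_def multilinear_coeff_def sum_distrib_left sum_distrib_right mult_ac)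
  also have "\<dots> = (\<Sum>\<phi>\<in>tuples N p. (\<Prod>k<p. wt (\<phi> k)) * multilinear N p \<phi> w)"
    unfolding multilinear_def sum_distrib_left by (rule sum.swap)
  finally show ?thesis .
qed

text \<open>The points at which the energy is evaluated: configurations, barycentres of replicas and
  the magnetization are all of this form.\<close>

definition spin_average :: "nat => (nat => real) => bool" where
  "spin_average N m \<longleftrightarrow> (\<exists>wt. (\<forall>\<sigma>\<in>spin_configs N. 0 \<le> wt \<sigma>) \<and> (\<Sum>\<sigma>\<in>spin_configs N. wt \<sigma>) = 1 \<and>
     (\<forall>i\<in>{1..N}. m i = (\<Sum>\<sigma>\<in>spin_configs N. wt \<sigma> * \<sigma> i)))"

lemma pure_hamiltonian_le_form_sup:
  assumes "spin_average N m"
  shows "\<bar>pure_hamiltonian \<beta> (G w) N p m\<bar> \<le> form_sup N p w"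
proof -
  obtain wt where wt: "\<And>\<sigma>. \<sigma> \<in> spin_configs N ==> 0 \<le> wt \<sigma>" "(\<Sum>\<sigma>\<in>spin_configs N. wt \<sigma>) = 1"
    and m: "\<And>i. i \<in> {1..N} ==> m i = (\<Sum>\<sigma>\<in>spin_configs N. wt \<sigma> * \<sigma> i)"
    using assms unfolding spin_average_def by blast
  have w0: "0 \<le> (\<Prod>k<p. wt (\<phi> k))" if "\<phi> \<in> tuples N p" for \<phi>
    using that by (intro prod_nonneg) (auto intro: wt tuples_mem)
  have eq: "multilinear N p (\<lambda>_. m) w = (\<Sum>\<phi>\<in>tuples N p. (\<Prod>k<p. wt (\<phi> k)) * multilinear N p \<phi> w)"
    by (rule multilinear_expand) (rule m)
  have "\<bar>pure_hamiltonian \<beta> (G w) N p m\<bar> \<le> (\<Sum>\<phi>\<in>tuples N p. (\<Prod>k<p. wt (\<phi> k)) * form_sup N p w)"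
    unfolding pure_hamiltonian_multilinear eq
    by (rule order_trans[OF sum_abs]) (auto intro!: sum_mono mult_left_mono multilinear_le_form_sup w0 simp: abs_mult abs_of_nonneg[OF w0])
  also have "\<dots> = (\<Prod>k<p. \<Sum>\<sigma>\<in>spin_configs N. wt \<sigma>) * form_sup N p w"
    unfolding tuples_def sum_distrib_right[symmetric] by (subst prod_sum_PiE) auto
  finally show ?thesis by (simp add: wt)
qed

lemma spin_average_spin: "\<sigma> \<in> spin_configs N ==> spin_average N \<sigma>"
  unfolding spin_average_def
  by (rule exI[of _ "\<lambda>\<tau>. if \<tau> = \<sigma> then 1 else 0"]) (auto simp: if_distrib[of "\<lambda>x. x * _"] sum.delta cong: if_cong)

lemma spin_average_gibbs: "spin_average N (\<lambda>i. gibbs (spin_configs N) H (\<lambda>\<sigma>. \<sigma> i))"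
  unfolding spin_average_def
  using partition_pos[of "spin_configs N" H]
  by (intro exI[of _ "\<lambda>\<sigma>. exp (H \<sigma>) / (\<Sum>\<sigma>\<in>spin_configs N. exp (H \<sigma>))"])
    (auto simp: gibbs_weights sum_divide_distrib[symmetric])

lemma spin_average_in_cube:
  assumes "spin_average N m" shows "in_cube N m"
  unfolding in_cube_def
proof
  fix i assume i: "i \<in> {1..N}"
  obtain wt where wt: "\<And>\<sigma>. \<sigma> \<in> spin_configs N ==> 0 \<le> wt \<sigma>" "(\<Sum>\<sigma>\<in>spin_configs N. wt \<sigma>) = 1"
    and m: "m i = (\<Sum>\<sigma>\<in>spin_configs N. wt \<sigma> * \<sigma> i)"
    using assms i unfolding spin_average_def by blast
  have "\<bar>m i\<bar> \<le> (\<Sum>\<sigma>\<in>spin_configs N. \<bar>wt \<sigma> * \<sigma> i\<bar>)" unfolding m by (rule sum_abs)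
  also have "\<dots> \<le> (\<Sum>\<sigma>\<in>spin_configs N. wt \<sigma>)"
  proof (rule sum_mono)
    fix \<sigma> assume \<sigma>: "\<sigma> \<in> spin_configs N"
    have "\<bar>\<sigma> i\<bar> = 1" using spin_configs_values[OF \<sigma> i] by auto
    then show "\<bar>wt \<sigma> * \<sigma> i\<bar> \<le> wt \<sigma>" using wt(1)[OF \<sigma>] by (simp add: abs_mult)
  qed
  finally show "\<bar>m i\<bar> \<le> 1" by (simp add: wt)
qed

lemma tame_hamiltonian:
  assumes "tame N w" "spin_average N m"
  shows "summable (\<lambda>k. pure_hamiltonian \<beta> (G w) N (k + 2) m)" (is ?one) "\<bar>X N m w\<bar> \<le> total_sup N w" (is ?two)
proof -
  have a: "summable (\<lambda>k. \<bar>pure_hamiltonian \<beta> (G w) N (k + 2) m\<bar>)"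
    by (rule summable_comparison_test'[of "\<lambda>k. form_sup N (k + 2) w"])
      (use assms pure_hamiltonian_le_form_sup in \<open>auto simp: tame_def\<close>)
  then show ?one by (rule summable_rabs_cancel)
  have "\<bar>X N m w\<bar> \<le> (\<Sum>k. \<bar>pure_hamiltonian \<beta> (G w) N (k + 2) m\<bar>)"
    unfolding mixed_hamiltonian_def by (rule summable_rabs[OF a])
  also have "\<dots> \<le> total_sup N w"
    unfolding total_sup_def
    by (rule suminf_le[OF _ a]) (use assms pure_hamiltonian_le_form_sup in \<open>auto simp: tame_def\<close>)
  finally show ?two .
qed

end

lemma measurable_gibbs [measurable (raw)]:
  assumes "finite S" and "\<And>s. s \<in> S ==> (\<lambda>x. H x s) \<in> borel_measurable N"
    and "\<And>s. s \<in> S ==> (\<lambda>x. f x s) \<in> borel_measurable N"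
  shows "(\<lambda>x. gibbs S (H x) (f x)) \<in> borel_measurable N"
  unfolding gibbs_def using assms
  by (intro borel_measurable_divide borel_measurable_sum borel_measurable_times
      measurable_compose[OF _ borel_measurable_exp]) auto

lemma gibbs_has_derivative:
  assumes S: "finite S" "S \<noteq> {}"
  shows "((\<lambda>x. gibbs S (\<lambda>s. a s * x + b s) f) has_real_derivative
     (gibbs S (\<lambda>s. a s * x + b s) (\<lambda>s. f s * a s)
      - gibbs S (\<lambda>s. a s * x + b s) f * gibbs S (\<lambda>s. a s * x + b s) a)) (at x)"
proof -
  let ?Z = "\<lambda>x. \<Sum>s\<in>S. exp (a s * x + b s)"
  let ?F = "\<lambda>x. \<Sum>s\<in>S. exp (a s * x + b s) * f s"
  have Z: "0 < ?Z x" by (rule partition_pos[OF S])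
  have dZ: "(?Z has_real_derivative (\<Sum>s\<in>S. exp (a s * x + b s) * a s)) (at x)"
    by (auto intro!: derivative_eq_intros sum.cong)
  have dF: "(?F has_real_derivative (\<Sum>s\<in>S. exp (a s * x + b s) * (f s * a s))) (at x)"
    by (auto intro!: derivative_eq_intros sum.cong)
  have "((\<lambda>x. ?F x / ?Z x) has_real_derivative
      ((\<Sum>s\<in>S. exp (a s * x + b s) * (f s * a s)) * ?Z x - ?F x * (\<Sum>s\<in>S. exp (a s * x + b s) * a s))
        / (?Z x * ?Z x)) (at x)"
    by (rule DERIV_divide[OF dF dZ]) (use Z in auto)
  then show ?thesis
    unfolding gibbs_def using Z by (simp add: diff_divide_distrib)
qed

context disorder
begin

section \<open>Independence of disjoint parts of the disorder\<close>

definition masked :: "nat list set => (nat list => real) => nat list => real" where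
  "masked J x js = (if js \<in> J then x js else 0)"

text \<open>A series depends only on the coordinates where its coefficients do not vanish, which gives the
  measurability needed for independence.\<close>

lemma gseries_masked:
  assumes "\<And>js. js \<in> index ==> b js \<noteq> 0 ==> js \<in> J"
  shows "gseries N b x = gseries N b (masked J x)"
proof -
  have "b js * x js = b js * masked J x js" if "js \<in> multi_indices N (k + 2)" for js k
    using assms[of js] that multi_indices_index[of "k + 2" N] by (cases "b js = 0") (auto simp: masked_def)
  then show ?thesis unfolding gseries_def by (intro suminf_cong sum.cong) auto
qed

lemma measurable_gseries_masked:
  "(\<lambda>x. gseries N b (masked J x)) \<in> borel_measurable (PiM J (\<lambda>_. borel))"
proof -
  have "(\<lambda>x. masked J x js) \<in> borel_measurable (PiM J (\<lambda>_. borel))" for js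
    by (cases "js \<in> J") (auto simp: masked_def)
  then show ?thesis
    unfolding gseries_def
    by (intro borel_measurable_suminf borel_measurable_sum borel_measurable_times) auto
qed

definition series_vector :: "nat => 's set => ('s => nat list => real) => 'a => 's => real" where
  "series_vector N S b w = (\<lambda>s\<in>S. gseries N (b s) (G w))"

lemma measurable_series_vector [measurable]:
  "series_vector N S b \<in> measurable M (PiM S (\<lambda>_. borel))"
  unfolding series_vector_def by (rule measurable_restrict) measurable

lemma indep_series_vectors:
  fixes b1 b2 :: "'s => nat list => real"
  assumes J: "J1 \<inter> J2 = {}"
    and b1: "\<And>s js. s \<in> S1 ==> js \<in> index ==> b1 s js \<noteq> 0 ==> js \<in> J1"
    and b2: "\<And>s js. s \<in> S2 ==> js \<in> index ==> b2 s js \<noteq> 0 ==> js \<in> J2"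
  shows "indep_var (PiM S1 (\<lambda>_. borel)) (series_vector N S1 b1) (PiM S2 (\<lambda>_. borel)) (series_vector N S2 b2)"
proof -
  let ?J1 = "J1 \<inter> index" and ?J2 = "J2 \<inter> index"
  have ind: "indep_var (PiM ?J1 (\<lambda>_. borel)) (\<lambda>w. restrict (G w) ?J1) (PiM ?J2 (\<lambda>_. borel)) (\<lambda>w. restrict (G w) ?J2)"
    by (rule indep_var_restrict[OF indep_g]) (use J in \<open>auto simp: index_def\<close>)
  have meas: "(\<lambda>x. \<lambda>s\<in>S. gseries N (b s) (masked J x)) \<in> measurable (PiM J (\<lambda>_. borel)) (PiM S (\<lambda>_. borel))"
    for J S and b :: "'s => nat list => real"
    by (rule measurable_restrict) (rule measurable_gseries_masked)
  have comp: "(\<lambda>x. \<lambda>s\<in>S. gseries N (b s) (masked (J \<inter> index) x)) \<circ> (\<lambda>w. restrict (G w) (J \<inter> index)) = series_vector N S b"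
    if b: "\<And>s js. s \<in> S ==> js \<in> index ==> b s js \<noteq> 0 ==> js \<in> J" for S J and b :: "'s => nat list => real"
  proof
    fix w
    have m: "masked (J \<inter> index) (restrict (G w) (J \<inter> index)) = masked (J \<inter> index) (G w)"
      by (auto simp: masked_def)
    have "gseries N (b s) (G w) = gseries N (b s) (masked (J \<inter> index) (G w))" if "s \<in> S" for s
      by (rule gseries_masked) (use b that in auto)
    then show "((\<lambda>x. \<lambda>s\<in>S. gseries N (b s) (masked (J \<inter> index) x)) \<circ> (\<lambda>w. restrict (G w) (J \<inter> index))) w
        = series_vector N S b w"
      by (auto simp: series_vector_def m)
  qed
  show ?thesis
    using indep_var_compose[OF ind meas meas, of S1 b1 S2 b2] comp[of S1 b1 J1, OF b1] comp[of S2 b2 J2, OF b2]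
    by simp
qed

text \<open>A function of two independent vectors may be integrated with two independent
  realisations of the disorder, one for each vector.\<close>

lemma decouple:
  assumes ind: "indep_var A U B V" and F: "F \<in> borel_measurable (A \<Otimes>\<^sub>M B)"
    and int: "integrable M (\<lambda>w. F (U w, V w) :: real)"
  shows "integrable M (\<lambda>w. \<integral>w'. F (U w, V w') \<partial>M)" (is ?one)
    and "(\<integral>w. F (U w, V w) \<partial>M) = (\<integral>w. (\<integral>w'. F (U w, V w') \<partial>M) \<partial>M)" (is ?two)
proof -
  have U [measurable]: "U \<in> measurable M A" and V [measurable]: "V \<in> measurable M B"
    and prod: "distr M A U \<Otimes>\<^sub>M distr M B V = distr M (A \<Otimes>\<^sub>M B) (\<lambda>w. (U w, V w))"
    using ind by (auto simp: indep_var_distribution_eq)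
  interpret A: prob_space "distr M A U" by (rule prob_space_distr[OF U])
  interpret B: prob_space "distr M B V" by (rule prob_space_distr[OF V])
  interpret P: pair_prob_space "distr M A U" "distr M B V" by unfold_locales
  note F [measurable]
  have UV: "(\<lambda>w. (U w, V w)) \<in> measurable M (A \<Otimes>\<^sub>M B)" by measurable
  have F': "F \<in> borel_measurable (distr M A U \<Otimes>\<^sub>M distr M B V)" by measurable
  have Fx: "(\<lambda>y. F (x, y)) \<in> borel_measurable B" if "x \<in> space A" for x
    using that by measurable
  have I: "(\<lambda>x. \<integral>y. F (x, y) \<partial>distr M B V) \<in> borel_measurable A"
    using B.borel_measurable_lebesgue_integral[of "\<lambda>x y. F (x, y)" A] by simp
  have i: "integrable (distr M A U \<Otimes>\<^sub>M distr M B V) F"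
    unfolding prod by (subst integrable_distr_eq[OF UV F]) (rule int)
  have inner: "(\<integral>y. F (U w, y) \<partial>distr M B V) = (\<integral>w'. F (U w, V w') \<partial>M)" if "w \<in> space M" for w
    by (rule integral_distr[OF V Fx]) (rule measurable_space[OF U that])
  have "integrable (distr M A U) (\<lambda>x. \<integral>y. F (x, y) \<partial>distr M B V)"
    by (rule P.integrable_fst'[OF i])
  then have "integrable M (\<lambda>w. \<integral>y. F (U w, y) \<partial>distr M B V)"
    by (subst (asm) integrable_distr_eq[OF U I])
  then show ?one
    by (rule Bochner_Integration.integrable_cong[THEN iffD1, rotated 2]) (simp_all add: inner)
  have "(\<integral>w. F (U w, V w) \<partial>M) = integral\<^sup>L (distr M (A \<Otimes>\<^sub>M B) (\<lambda>w. (U w, V w))) F"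
    by (rule integral_distr[OF UV F, symmetric])
  also have "\<dots> = (\<integral>x. (\<integral>y. F (x, y) \<partial>distr M B V) \<partial>distr M A U)"
    unfolding prod[symmetric] by (rule P.integral_fst'[OF i, symmetric])
  also have "\<dots> = (\<integral>w. (\<integral>y. F (U w, y) \<partial>distr M B V) \<partial>M)"
    by (rule integral_distr[OF U I])
  also have "\<dots> = (\<integral>w. (\<integral>w'. F (U w, V w') \<partial>M) \<partial>M)"
    by (intro Bochner_Integration.integral_cong refl inner)
  finally show ?two .
qed

text \<open>For nonnegative functions a bound on the inner integral gives the integrability as well.\<close>

lemma decouple_bound:
  assumes ind: "indep_var A U B V" and F [measurable]: "F \<in> borel_measurable (A \<Otimes>\<^sub>M B)"
    and nn: "\<And>z. 0 \<le> F z"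
    and inner: "\<And>w. integrable M (\<lambda>w'. F (U w, V w'))"
    and le: "\<And>w. (\<integral>w'. F (U w, V w') \<partial>M) \<le> c w" and c: "integrable M c"
  shows "integrable M (\<lambda>w. F (U w, V w) :: real)" "(\<integral>w. F (U w, V w) \<partial>M) \<le> (\<integral>w. c w \<partial>M)" (is ?two)
proof -
  have U [measurable]: "U \<in> measurable M A" and V [measurable]: "V \<in> measurable M B"
    and prod: "distr M A U \<Otimes>\<^sub>M distr M B V = distr M (A \<Otimes>\<^sub>M B) (\<lambda>w. (U w, V w))"
    using ind by (auto simp: indep_var_distribution_eq)
  interpret B: prob_space "distr M B V" by (rule prob_space_distr[OF V])
  have UV: "(\<lambda>w. (U w, V w)) \<in> measurable M (A \<Otimes>\<^sub>M B)" by measurable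
  have F': "(\<lambda>z. ennreal (F z)) \<in> borel_measurable (A \<Otimes>\<^sub>M B)" by measurable
  have Fd: "(\<lambda>z. ennreal (F z)) \<in> borel_measurable (distr M A U \<Otimes>\<^sub>M distr M B V)" by measurable
  have I: "(\<lambda>x. \<integral>\<^sup>+y. F (x, y) \<partial>distr M B V) \<in> borel_measurable A"
    using B.borel_measurable_nn_integral[of "\<lambda>x y. ennreal (F (x, y))" A] by simp
  have c0: "0 \<le> c w" for w
  proof -
    have "0 \<le> (\<integral>w'. F (U w, V w') \<partial>M)" by (rule integral_nonneg_AE) (simp add: nn)
    then show ?thesis using le[of w] by linarith
  qed
  have "(\<integral>\<^sup>+w. F (U w, V w) \<partial>M) = (\<integral>\<^sup>+z. F z \<partial>(distr M A U \<Otimes>\<^sub>M distr M B V))"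
    unfolding prod by (rule nn_integral_distr[OF UV, symmetric]) (simp add: F')
  also have "\<dots> = (\<integral>\<^sup>+x. (\<integral>\<^sup>+y. F (x, y) \<partial>distr M B V) \<partial>distr M A U)"
    by (rule B.nn_integral_fst[OF Fd, symmetric])
  also have "\<dots> = (\<integral>\<^sup>+w. (\<integral>\<^sup>+y. F (U w, y) \<partial>distr M B V) \<partial>M)"
    by (rule nn_integral_distr[OF U]) (simp add: I)
  also have "\<dots> \<le> (\<integral>\<^sup>+w. ennreal (c w) \<partial>M)"
  proof (rule nn_integral_mono)
    fix w assume "w \<in> space M"
    then have "U w \<in> space A" by (rule measurable_space[OF U])
    then have FU: "(\<lambda>y. ennreal (F (U w, y))) \<in> borel_measurable B" by measurable
    have "(\<integral>\<^sup>+y. F (U w, y) \<partial>distr M B V) = (\<integral>\<^sup>+w'. F (U w, V w') \<partial>M)"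
      by (rule nn_integral_distr[OF V]) (simp add: FU)
    also have "\<dots> = ennreal (\<integral>w'. F (U w, V w') \<partial>M)"
      by (rule nn_integral_eq_integral[OF inner]) (simp add: nn)
    also have "\<dots> \<le> ennreal (c w)" by (rule ennreal_leI[OF le])
    finally show "(\<integral>\<^sup>+y. F (U w, y) \<partial>distr M B V) \<le> ennreal (c w)" .
  qed
  also have "\<dots> = ennreal (\<integral>w. c w \<partial>M)" by (rule nn_integral_eq_integral[OF c]) (simp add: c0)
  finally have *: "(\<integral>\<^sup>+w. F (U w, V w) \<partial>M) \<le> ennreal (\<integral>w. c w \<partial>M)" .
  show int: "integrable M (\<lambda>w. F (U w, V w))"
  proof (rule integrableI_nonneg)
    show "(\<lambda>w. F (U w, V w)) \<in> borel_measurable M" by (rule measurable_compose[OF UV F])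
    show "(\<integral>\<^sup>+w. F (U w, V w) \<partial>M) < \<infinity>" using * by (rule order_le_less_trans) simp
  qed (simp add: nn)
  have "ennreal (\<integral>w. F (U w, V w) \<partial>M) \<le> ennreal (\<integral>w. c w \<partial>M)"
    using * nn_integral_eq_integral[OF int] nn by simp
  moreover have "0 \<le> (\<integral>w. c w \<partial>M)" by (rule integral_nonneg_AE) (simp add: c0)
  ultimately show ?two
    by (simp add: ennreal_le_iff)
qed

section \<open>Gaussian integration by parts for the Gibbs measure\<close>

lemma gseries_single:
  assumes "js0 \<in> multi_indices N (k + 2)"
  shows "gseries N (\<lambda>js. if js = js0 then c else 0) x = c * x js0"
proof -
  have "(\<Sum>js\<in>multi_indices N (j + 2). (if js = js0 then c else 0) * x js) = (if j = k then c * x js0 else 0)" for j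
  proof (cases "j = k")
    case True
    then show ?thesis using assms by (simp add: if_distrib[of "\<lambda>y. y * _"] sum.delta' cong: if_cong)
  next
    case False
    then have "js0 \<notin> multi_indices N (j + 2)" using assms multi_indices_disjoint[of "j + 2" "k + 2" N] by auto
    then have "(\<Sum>js\<in>multi_indices N (j + 2). (if js = js0 then c else 0) * x js) = 0" by (intro sum.neutral) auto
    then show ?thesis using False by simp
  qed
  moreover have "(\<lambda>j. if j = k then c * x js0 else 0) sums (c * x js0)" by (rule sums_single)
  ultimately show ?thesis by (simp add: gseries_def sums_iff)
qed

lemma AE_split_coordinate:
  assumes js0: "js0 \<in> multi_indices N (k + 2)" and b: "l2_summable N b"
  shows "AE w in M. gseries N b (G w) = b js0 * g js0 w + gseries N (b(js0 := 0)) (G w)"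
proof -
  let ?T = "UNIV :: bool set"
  let ?c = "\<lambda>t js. if t then (if js = js0 then b js0 else 0) else (b(js0 := 0)) js"
  have l2: "l2_summable N (?c t)" for t
    by (rule l2_summable_mono[OF b]) (cases t, auto)
  have "AE w in M. gseries N (\<lambda>js. \<Sum>t\<in>?T. 1 * ?c t js) (G w) = (\<Sum>t\<in>?T. 1 * gseries N (?c t) (G w))"
    by (rule gseries_linear) (use l2 in auto)
  moreover have "(\<lambda>js. \<Sum>t\<in>?T. 1 * ?c t js) = b" by (auto simp: UNIV_bool)
  ultimately show ?thesis
    by (simp add: UNIV_bool gseries_single[OF js0] add.commute fun_upd_def)
qed

text \<open>One coordinate is independent of any finite number of series that do not contain it, so the
  one-dimensional formula applies with these series held fixed.\<close>

lemma gaussian_integration_by_parts: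
  fixes b :: "'s => nat list => real"
  assumes js0: "js0 \<in> multi_indices N (k + 2)"
    and b0: "\<And>s. s \<in> S ==> b s js0 = 0"
    and meas: "(\<lambda>(u, x). \<phi> x u) \<in> borel_measurable (PiM S (\<lambda>_. borel) \<Otimes>\<^sub>M borel)"
      "(\<lambda>(u, x). \<phi>' x u) \<in> borel_measurable (PiM S (\<lambda>_. borel) \<Otimes>\<^sub>M borel)"
    and der: "\<And>x u. ((\<lambda>x. \<phi> x u) has_real_derivative \<phi>' x u) (at x)"
    and cont: "\<And>x u. isCont (\<lambda>x. \<phi>' x u) x"
    and bound: "\<And>x u. \<bar>\<phi> x u\<bar> \<le> B" "\<And>x u. \<bar>\<phi>' x u\<bar> \<le> B"
  shows "(\<integral>w. g js0 w * \<phi> (g js0 w) (series_vector N S b w) \<partial>M) = (\<integral>w. \<phi>' (g js0 w) (series_vector N S b w) \<partial>M)"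
proof -
  let ?U = "series_vector N S b" and ?A = "PiM S (\<lambda>_. borel) :: ('s => real) measure"
  let ?V = "series_vector N {undefined :: 's} (\<lambda>_ js. if js = js0 then 1 else 0)"
    and ?B = "PiM {undefined} (\<lambda>_. borel) :: ('s => real) measure"
  have [measurable]: "g js0 \<in> borel_measurable M" using js0 by measurable
  have gauss: "gaussian_rv M (g js0) 1"
  proof -
    have "gaussian_rv M (\<lambda>w. \<Sum>js\<in>{js0}. 1 * g js w) (\<Sum>js\<in>{js0}. 1\<^sup>2)"
      by (rule gaussian_finite_sum) (use js0 multi_indices_index[of "k + 2" N] in auto)
    then show ?thesis by simp
  qed
  have ind: "indep_var ?A ?U ?B ?V"
    by (rule indep_series_vectors[of "- {js0}" "{js0}"]) (use b0 in \<open>auto split: if_splits\<close>)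
  have V: "?V w undefined = g js0 w" for w
    by (simp add: series_vector_def gseries_single[OF js0])
  have proj: "(\<lambda>z. (fst z, snd z undefined)) \<in> measurable (?A \<Otimes>\<^sub>M ?B) (?A \<Otimes>\<^sub>M borel)"
    by measurable
  have m2: "(\<lambda>z. \<phi>' (snd z undefined) (fst z)) \<in> borel_measurable (?A \<Otimes>\<^sub>M ?B)"
    using measurable_compose[OF proj meas(2)] by simp
  have m1: "(\<lambda>z. snd z undefined * \<phi> (snd z undefined) (fst z)) \<in> borel_measurable (?A \<Otimes>\<^sub>M ?B)"
    using measurable_compose[OF proj meas(1)] by (intro borel_measurable_times) (simp_all, measurable)
  have c1: "(\<lambda>w. \<phi> (g js0 w) (?U w)) \<in> borel_measurable M"
    using measurable_compose[OF _ meas(1), of "\<lambda>w. (?U w, g js0 w)" M] by simp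
  have c2: "(\<lambda>w. \<phi>' (g js0 w) (?U w)) \<in> borel_measurable M"
    using measurable_compose[OF _ meas(2), of "\<lambda>w. (?U w, g js0 w)" M] by simp
  have B: "0 \<le> B" using bound(1)[of 0 undefined] by linarith
  have i1: "integrable M (\<lambda>w. g js0 w * \<phi> (g js0 w) (?U w))"
  proof (rule Bochner_Integration.integrable_bound[of _ "\<lambda>w. B * g js0 w"])
    show "integrable M (\<lambda>w. B * g js0 w)" using gaussian_rv_abs(1)[OF gauss] by simp
    have "\<bar>g js0 w\<bar> * \<bar>\<phi> (g js0 w) (?U w)\<bar> \<le> \<bar>g js0 w\<bar> * B" for w
      by (intro mult_left_mono bound) auto
    then show "AE w in M. norm (g js0 w * \<phi> (g js0 w) (?U w)) \<le> norm (B * g js0 w)"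
      using B by (auto simp: abs_mult mult.commute)
  qed (use c1 in measurable)
  have i2: "integrable M (\<lambda>w. \<phi>' (g js0 w) (?U w))"
    by (rule integrable_const_bound[of _ B]) (use c2 bound in auto)
  have d1: "(\<integral>w. g js0 w * \<phi> (g js0 w) (?U w) \<partial>M)
      = (\<integral>w. (\<integral>w'. g js0 w' * \<phi> (g js0 w') (?U w) \<partial>M) \<partial>M)"
    using decouple(2)[OF ind m1] i1 by (simp add: V)
  have d2: "(\<integral>w. \<phi>' (g js0 w) (?U w) \<partial>M) = (\<integral>w. (\<integral>w'. \<phi>' (g js0 w') (?U w) \<partial>M) \<partial>M)"
    using decouple(2)[OF ind m2] i2 by (simp add: V)
  have "(\<integral>w'. g js0 w' * \<phi> (g js0 w') u \<partial>M) = (\<integral>w'. \<phi>' (g js0 w') u \<partial>M)" for u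
  proof -
    have [measurable]: "(\<lambda>x. \<phi> x u) \<in> borel_measurable borel"
      by (intro borel_measurable_continuous_onI continuous_at_imp_continuous_on ballI DERIV_isCont[OF der])
    have [measurable]: "(\<lambda>x. \<phi>' x u) \<in> borel_measurable borel"
      by (intro borel_measurable_continuous_onI continuous_at_imp_continuous_on) (auto simp: cont)
    have "(\<integral>w'. g js0 w' * \<phi> (g js0 w') u \<partial>M) = (\<integral>x. x * \<phi> x u \<partial>std_normal_distribution)"
      using gaussian_rv_expectation(2)[OF gauss, of "\<lambda>x. x * \<phi> x u"] by simp
    also have "\<dots> = (\<integral>x. \<phi>' x u \<partial>std_normal_distribution)"
      by (rule std_normal_integration_by_parts[OF der cont bound])
    also have "\<dots> = (\<integral>w'. \<phi>' (g js0 w') u \<partial>M)"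
      using gaussian_rv_expectation(2)[OF gauss, of "\<lambda>x. \<phi>' x u"] by simp
    finally show ?thesis .
  qed
  then show ?thesis unfolding d1 d2 by simp
qed

end

locale spin_glass = disorder \<beta> M g
  for \<beta> :: "nat => real" and M :: "'a measure" and g :: "nat list => 'a => real" +
  fixes h :: real
begin

abbreviation H :: "nat => 'a => (nat => real) => real" where
  "H N w \<equiv> hamiltonian \<beta> h (G w) N"

abbreviation avg :: "nat => 'a => ((nat => real) => real) => real" where
  "avg N w \<equiv> gibbs (spin_configs N) (H N w)"

abbreviation mag :: "nat => 'a => nat => real" where
  "mag N w \<equiv> magnetization \<beta> h (G w) N"

lemma mag_avg: "mag N w i = avg N w (\<lambda>\<sigma>. \<sigma> i)"
  by (simp add: magnetization_def hamiltonian_gibbs)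

lemmas avg_const = gibbs_const[OF finite_spin_configs spin_configs_nonempty]
  and avg_mono = gibbs_mono[OF finite_spin_configs spin_configs_nonempty]
  and avg_nonneg = gibbs_nonneg[OF finite_spin_configs spin_configs_nonempty]
  and avg_abs = gibbs_abs[OF finite_spin_configs spin_configs_nonempty]
  and avg_abs_le = gibbs_abs_le[OF finite_spin_configs spin_configs_nonempty]

lemma measurable_H [measurable]: "(\<lambda>w. H N w \<sigma>) \<in> borel_measurable M"
  unfolding hamiltonian_def by measurable

lemma measurable_avg [measurable (raw)]:
  assumes "\<And>\<sigma>. \<sigma> \<in> spin_configs N ==> (\<lambda>w. f w \<sigma>) \<in> borel_measurable M"
  shows "(\<lambda>w. avg N w (f w)) \<in> borel_measurable M"
  by (rule measurable_gibbs) (use assms in auto)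

lemma measurable_mag [measurable]: "(\<lambda>w. mag N w i) \<in> borel_measurable M"
  unfolding mag_avg by (rule measurable_avg) simp

lemma spin_average_mag: "spin_average N (mag N w)"
  using spin_average_gibbs[of N "H N w"] by (simp add: mag_avg[abs_def])

lemma mag_in_cube: "in_cube N (mag N w)"
  by (rule spin_average_in_cube[OF spin_average_mag])

lemma mag_abs_le: "i \<in> {1..N} ==> \<bar>mag N w i\<bar> \<le> 1"
  using mag_in_cube by (auto simp: in_cube_def)

lemma overlap_self: "\<sigma> \<in> spin_configs N ==> 1 \<le> N ==> overlap N \<sigma> \<sigma> = 1"
proof -
  assume "\<sigma> \<in> spin_configs N" "1 \<le> N"
  then have "\<sigma> i * \<sigma> i = 1" if "i \<in> {1..N}" for i using spin_configs_values[of \<sigma> N i] that by auto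
  then show ?thesis using \<open>1 \<le> N\<close> by (simp add: overlap_def)
qed

lemma spins_overlap: "\<sigma> \<in> spin_configs N ==> \<tau> \<in> spin_configs N ==> \<bar>overlap N \<sigma> \<tau>\<bar> \<le> 1"
  by (intro in_cube_overlap spin_configs_in_cube)

text \<open>The Hamiltonian as an affine function of one coordinate \<open>x\<close> of the disorder, given the rest \<open>u\<close>.\<close>

abbreviation single_out :: "nat => nat list => real => ((nat => real) => real) => (nat => real) => real" where
  "single_out N js x u \<equiv> (\<lambda>\<sigma>. spin_coeff \<beta> N \<sigma> js * x + (u \<sigma> + h * (\<Sum>i=1..N. \<sigma> i)))"

abbreviation rest :: "nat => nat list => 'a => (nat => real) => real" where
  "rest N js \<equiv> series_vector N (spin_configs N) (\<lambda>\<sigma>. (spin_coeff \<beta> N \<sigma>)(js := 0))"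

lemma AE_single_out:
  assumes N: "1 \<le> N" and js: "js \<in> multi_indices N (k + 2)"
  shows "AE w in M. \<forall>\<sigma>\<in>spin_configs N. H N w \<sigma> = single_out N js (g js w) (rest N js w) \<sigma>"
proof (rule AE_finite_allI)
  fix \<sigma> assume \<sigma>: "\<sigma> \<in> spin_configs N"
  have "l2_summable N (spin_coeff \<beta> N \<sigma>)"
    using spin_configs_in_cube[OF \<sigma>] by (intro l2_summable_spin_coeff N) (auto simp: in_cube_def)
  from AE_split_coordinate[OF js this]
  show "AE w in M. H N w \<sigma> = single_out N js (g js w) (rest N js w) \<sigma>"
    by eventually_elim (simp add: hamiltonian_def mixed_hamiltonian_eq series_vector_def \<sigma>)
qed simp

lemma measurable_gibbs_single_out:
  "(\<lambda>z. gibbs (spin_configs N) (single_out N js (snd z) (fst z)) f)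
     \<in> borel_measurable (PiM (spin_configs N) (\<lambda>_. borel) \<Otimes>\<^sub>M borel)"
proof (rule measurable_gibbs)
  fix \<sigma> assume [simp]: "\<sigma> \<in> spin_configs N"
  have "(\<lambda>z. fst z \<sigma>) \<in> borel_measurable (PiM (spin_configs N) (\<lambda>_. borel) \<Otimes>\<^sub>M (borel :: real measure))"
    using measurable_compose[OF measurable_fst measurable_component_singleton[of \<sigma> "spin_configs N" "\<lambda>_. borel"]]
    by simp
  then show "(\<lambda>z. single_out N js (snd z) (fst z) \<sigma>)
      \<in> borel_measurable (PiM (spin_configs N) (\<lambda>_. borel) \<Otimes>\<^sub>M borel)"
    by measurable
qed auto

lemma spin_coeff_abs_le:
  assumes "in_cube N a" "js \<in> multi_indices N p"
  shows "\<bar>spin_coeff \<beta> N a js\<bar> \<le> \<bar>\<beta> p / real N powr ((real p - 1) / 2)\<bar>"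
proof -
  have "\<bar>prod_list (map a js)\<bar> \<le> 1"
    using assms(2) unfolding prod_list_map_nth[OF assms(2)] abs_prod
    by (intro prod_le_1) (use assms(1) in \<open>auto simp: multi_indices_def in_cube_def subset_iff\<close>)
  then have "\<bar>\<beta> p / real N powr ((real p - 1) / 2)\<bar> * \<bar>prod_list (map a js)\<bar>
      \<le> \<bar>\<beta> p / real N powr ((real p - 1) / 2)\<bar> * 1"
    by (intro mult_left_mono) auto
  moreover have "length js = p" using assms(2) by (simp add: multi_indices_def)
  ultimately show ?thesis by (simp only: spin_coeff_def abs_mult mult_1_right)
qed

lemma gibbs_isCont:
  assumes "finite S" "S \<noteq> {}"
  shows "isCont (\<lambda>x. gibbs S (\<lambda>s. a s * x + b s) f) x"
  by (rule DERIV_isCont[OF gibbs_has_derivative[OF assms]])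

text \<open>Integration by parts for functions of the Hamiltonian restricted to the configurations: it
  suffices to know how they depend on a single coordinate.\<close>

lemma ibp_single_out:
  assumes N: "1 \<le> N" and js: "js \<in> multi_indices N (k + 2)"
    and meas: "(\<lambda>(u, x). \<phi> x u) \<in> borel_measurable (PiM (spin_configs N) (\<lambda>_. borel) \<Otimes>\<^sub>M borel)"
      "(\<lambda>(u, x). \<phi>' x u) \<in> borel_measurable (PiM (spin_configs N) (\<lambda>_. borel) \<Otimes>\<^sub>M borel)"
    and der: "\<And>x u. ((\<lambda>x. \<phi> x u) has_real_derivative \<phi>' x u) (at x)"
    and cont: "\<And>x u. isCont (\<lambda>x. \<phi>' x u) x"
    and bound: "\<And>x u. \<bar>\<phi> x u\<bar> \<le> B" "\<And>x u. \<bar>\<phi>' x u\<bar> \<le> B"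
    and [measurable]: "\<Phi> \<in> borel_measurable M" "\<Phi>' \<in> borel_measurable M"
    and eq: "\<And>w x u. (\<And>\<sigma>. \<sigma> \<in> spin_configs N ==> H N w \<sigma> = single_out N js x u \<sigma>) ==> \<Phi> w = \<phi> x u \<and> \<Phi>' w = \<phi>' x u"
  shows "(\<integral>w. g js w * \<Phi> w \<partial>M) = (\<integral>w. \<Phi>' w \<partial>M)"
proof -
  have [measurable]: "g js \<in> borel_measurable M" using js by (rule measurable_g_multi)
  have pair: "(\<lambda>w. (rest N js w, g js w)) \<in> measurable M (PiM (spin_configs N) (\<lambda>_. borel) \<Otimes>\<^sub>M borel)"
    by measurable
  have [measurable]: "(\<lambda>w. \<phi> (g js w) (rest N js w)) \<in> borel_measurable M"
    "(\<lambda>w. \<phi>' (g js w) (rest N js w)) \<in> borel_measurable M"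
    using measurable_compose[OF pair meas(1)] measurable_compose[OF pair meas(2)] by simp_all
  have ae: "AE w in M. \<Phi> w = \<phi> (g js w) (rest N js w) \<and> \<Phi>' w = \<phi>' (g js w) (rest N js w)"
    using AE_single_out[OF N js] by eventually_elim (rule eq, blast)
  have "(\<integral>w. g js w * \<Phi> w \<partial>M) = (\<integral>w. g js w * \<phi> (g js w) (rest N js w) \<partial>M)"
  proof (rule integral_cong_AE)
    show "AE w in M. g js w * \<Phi> w = g js w * \<phi> (g js w) (rest N js w)"
      using ae by eventually_elim simp
  qed measurable
  also have "\<dots> = (\<integral>w. \<phi>' (g js w) (rest N js w) \<partial>M)"
    by (rule gaussian_integration_by_parts[OF js _ meas der cont bound]) simp
  also have "\<dots> = (\<integral>w. \<Phi>' w \<partial>M)"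
  proof (rule integral_cong_AE)
    show "AE w in M. \<phi>' (g js w) (rest N js w) = \<Phi>' w" using ae by eventually_elim simp
  qed measurable
  finally show ?thesis .
qed

lemma ibp_energy_single:
  assumes N: "1 \<le> N" and js: "js \<in> multi_indices N (k + 2)"
  shows "(\<integral>w. g js w * avg N w (\<lambda>\<sigma>. spin_coeff \<beta> N \<sigma> js) \<partial>M)
    = (\<integral>w. avg N w (\<lambda>\<sigma>. spin_coeff \<beta> N \<sigma> js * spin_coeff \<beta> N \<sigma> js)
        - avg N w (\<lambda>\<sigma>. spin_coeff \<beta> N \<sigma> js) * avg N w (\<lambda>\<sigma>. spin_coeff \<beta> N \<sigma> js) \<partial>M)"
proof -
  let ?S = "spin_configs N" and ?a = "\<lambda>\<sigma>. spin_coeff \<beta> N \<sigma> js"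
  define c where "c = \<bar>\<beta> (k + 2) / real N powr ((real (k + 2) - 1) / 2)\<bar>"
  have a: "\<bar>?a \<sigma>\<bar> \<le> c" if "\<sigma> \<in> ?S" for \<sigma>
    unfolding c_def by (rule spin_coeff_abs_le[OF spin_configs_in_cube[OF that] js])
  have c0: "0 \<le> c" by (simp add: c_def)
  define \<phi> where "\<phi> x u = gibbs ?S (single_out N js x u) ?a" for x u
  define \<phi>' where "\<phi>' x u = gibbs ?S (single_out N js x u) (\<lambda>\<sigma>. ?a \<sigma> * ?a \<sigma>)
      - gibbs ?S (single_out N js x u) ?a * gibbs ?S (single_out N js x u) ?a" for x u
  have b1: "\<bar>\<phi> x u\<bar> \<le> c" for x u
    unfolding \<phi>_def by (rule avg_abs_le[OF a])
  have b2: "\<bar>gibbs ?S (single_out N js x u) (\<lambda>\<sigma>. ?a \<sigma> * ?a \<sigma>)\<bar> \<le> c * c" for x u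
  proof (rule avg_abs_le)
    fix \<sigma> assume "\<sigma> \<in> ?S"
    then show "\<bar>?a \<sigma> * ?a \<sigma>\<bar> \<le> c * c" unfolding abs_mult by (intro mult_mono a) (use c0 in auto)
  qed
  have b3: "\<bar>\<phi>' x u\<bar> \<le> 2 * (c * c)" for x u
  proof -
    have "\<bar>\<phi> x u * \<phi> x u\<bar> \<le> c * c" unfolding abs_mult by (intro mult_mono b1) (use c0 in auto)
    then show ?thesis using b2[of x u] unfolding \<phi>'_def \<phi>_def by linarith
  qed
  have cc: "0 \<le> c * c" by simp
  show ?thesis
  proof (rule ibp_single_out[OF N js, where \<phi> = \<phi> and \<phi>' = \<phi>'])
    show "((\<lambda>x. \<phi> x u) has_real_derivative \<phi>' x u) (at x)" for x u
      unfolding \<phi>_def \<phi>'_def by (rule gibbs_has_derivative) auto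
    show "isCont (\<lambda>x. \<phi>' x u) x" for x u
      unfolding \<phi>'_def by (intro isCont_diff isCont_mult gibbs_isCont) auto
    show "(\<lambda>(u, x). \<phi> x u) \<in> borel_measurable (PiM ?S (\<lambda>_. borel) \<Otimes>\<^sub>M borel)"
      "(\<lambda>(u, x). \<phi>' x u) \<in> borel_measurable (PiM ?S (\<lambda>_. borel) \<Otimes>\<^sub>M borel)"
      unfolding \<phi>_def \<phi>'_def case_prod_unfold
      by (intro borel_measurable_diff borel_measurable_times measurable_gibbs_single_out)+
    show "\<bar>\<phi> x u\<bar> \<le> c + 2 * (c * c)" "\<bar>\<phi>' x u\<bar> \<le> c + 2 * (c * c)" for x u
      using b1[of x u] b3[of x u] c0 cc by linarith+
    show "avg N w ?a = \<phi> x u \<and> avg N w (\<lambda>\<sigma>. ?a \<sigma> * ?a \<sigma>) - avg N w ?a * avg N w ?a = \<phi>' x u"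
      if "\<And>\<sigma>. \<sigma> \<in> ?S ==> H N w \<sigma> = single_out N js x u \<sigma>" for w x u
      unfolding \<phi>_def \<phi>'_def using that by (simp cong: gibbs_cong)
  qed measurable
qed

lemma ibp_magnetization_single:
  assumes N: "1 \<le> N" and js: "js \<in> multi_indices N (k + 2)"
  shows "(\<integral>w. g js w * (\<Prod>l<k + 2. mag N w (js ! l)) \<partial>M)
    = (\<integral>w. (\<Sum>l<k + 2. (avg N w (\<lambda>\<sigma>. \<sigma> (js ! l) * spin_coeff \<beta> N \<sigma> js)
        - mag N w (js ! l) * avg N w (\<lambda>\<sigma>. spin_coeff \<beta> N \<sigma> js))
          * (\<Prod>j\<in>{..<k + 2} - {l}. mag N w (js ! j))) \<partial>M)"
proof -
  let ?S = "spin_configs N" and ?a = "\<lambda>\<sigma>. spin_coeff \<beta> N \<sigma> js" and ?A = "\<lambda>x u. gibbs (spin_configs N) (single_out N js x u)"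
  define c where "c = \<bar>\<beta> (k + 2) / real N powr ((real (k + 2) - 1) / 2)\<bar>"
  have a: "\<bar>?a \<sigma>\<bar> \<le> c" if "\<sigma> \<in> ?S" for \<sigma>
    unfolding c_def by (rule spin_coeff_abs_le[OF spin_configs_in_cube[OF that] js])
  have c0: "0 \<le> c" by (simp add: c_def)
  have s: "\<bar>\<sigma> (js ! l)\<bar> \<le> 1" if "\<sigma> \<in> ?S" "l < k + 2" for \<sigma> l
    using spin_configs_in_cube[OF that(1)] js that(2) by (auto simp: in_cube_def multi_indices_def subset_iff)
  have m: "\<bar>?A x u (\<lambda>\<sigma>. \<sigma> (js ! l))\<bar> \<le> 1" if "l < k + 2" for l x u
    by (rule avg_abs_le) (use s that in auto)
  have aa: "\<bar>?A x u ?a\<bar> \<le> c" for x u by (rule avg_abs_le[OF a])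
  have sa: "\<bar>?A x u (\<lambda>\<sigma>. \<sigma> (js ! l) * ?a \<sigma>)\<bar> \<le> c" if l: "l < k + 2" for x u l
  proof (rule avg_abs_le)
    fix \<sigma> assume "\<sigma> \<in> ?S"
    then have "\<bar>\<sigma> (js ! l)\<bar> * \<bar>?a \<sigma>\<bar> \<le> 1 * c" using s l a c0 by (intro mult_mono) auto
    then show "\<bar>\<sigma> (js ! l) * ?a \<sigma>\<bar> \<le> c" by (simp add: abs_mult)
  qed
  define D where "D x u l = ?A x u (\<lambda>\<sigma>. \<sigma> (js ! l) * ?a \<sigma>) - ?A x u (\<lambda>\<sigma>. \<sigma> (js ! l)) * ?A x u ?a" for x u l
  have D: "\<bar>D x u l\<bar> \<le> 2 * c" if l: "l < k + 2" for x u l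
  proof -
    have "\<bar>?A x u (\<lambda>\<sigma>. \<sigma> (js ! l))\<bar> * \<bar>?A x u ?a\<bar> \<le> 1 * c" by (intro mult_mono m l aa) auto
    then show ?thesis using sa[OF l, of x u] unfolding D_def abs_mult[symmetric] by linarith
  qed
  define \<phi> where "\<phi> x u = (\<Prod>l<k + 2. ?A x u (\<lambda>\<sigma>. \<sigma> (js ! l)))" for x u
  define \<phi>' where "\<phi>' x u = (\<Sum>l<k + 2. D x u l * (\<Prod>j\<in>{..<k + 2} - {l}. ?A x u (\<lambda>\<sigma>. \<sigma> (js ! j))))" for x u
  have pr: "\<bar>\<Prod>j\<in>J. ?A x u (\<lambda>\<sigma>. \<sigma> (js ! j))\<bar> \<le> 1" if "J \<subseteq> {..<k + 2}" for J x u
    unfolding abs_prod by (intro prod_le_1) (use m that in auto)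
  have b1: "\<bar>\<phi> x u\<bar> \<le> 1" for x u unfolding \<phi>_def by (rule pr) auto
  have b2: "\<bar>\<phi>' x u\<bar> \<le> real (k + 2) * (2 * c)" for x u
  proof -
    have "\<bar>\<phi>' x u\<bar> \<le> (\<Sum>l<k + 2. \<bar>D x u l * (\<Prod>j\<in>{..<k + 2} - {l}. ?A x u (\<lambda>\<sigma>. \<sigma> (js ! j)))\<bar>)"
      unfolding \<phi>'_def by (rule sum_abs)
    also have "\<dots> \<le> (\<Sum>l<k + 2. 2 * c * 1)"
      unfolding abs_mult using c0 by (intro sum_mono mult_mono D pr) auto
    finally show ?thesis by simp
  qed
  have kc: "0 \<le> real (k + 2) * (2 * c)" using c0 by simp
  show ?thesis
  proof (rule ibp_single_out[OF N js, where \<phi> = \<phi> and \<phi>' = \<phi>'])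
    show "((\<lambda>x. \<phi> x u) has_real_derivative \<phi>' x u) (at x)" for x u
      unfolding \<phi>_def \<phi>'_def D_def by (rule has_field_derivative_prod) (rule gibbs_has_derivative, auto)
    show "isCont (\<lambda>x. \<phi>' x u) x" for x u
      unfolding \<phi>'_def D_def
      by (intro continuous_sum continuous_prod isCont_diff isCont_mult gibbs_isCont) auto
    show "(\<lambda>(u, x). \<phi> x u) \<in> borel_measurable (PiM ?S (\<lambda>_. borel) \<Otimes>\<^sub>M borel)"
      "(\<lambda>(u, x). \<phi>' x u) \<in> borel_measurable (PiM ?S (\<lambda>_. borel) \<Otimes>\<^sub>M borel)"
      unfolding \<phi>_def \<phi>'_def D_def case_prod_unfold
      by (intro borel_measurable_diff borel_measurable_times borel_measurable_sum borel_measurable_prod measurable_gibbs_single_out)+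
    show "\<bar>\<phi> x u\<bar> \<le> 1 + real (k + 2) * (2 * c)" "\<bar>\<phi>' x u\<bar> \<le> 1 + real (k + 2) * (2 * c)" for x u
      using b1[of x u] b2[of x u] kc by linarith+
    show "(\<Prod>l<k + 2. mag N w (js ! l)) = \<phi> x u \<and>
      (\<Sum>l<k + 2. (avg N w (\<lambda>\<sigma>. \<sigma> (js ! l) * spin_coeff \<beta> N \<sigma> js)
        - mag N w (js ! l) * avg N w (\<lambda>\<sigma>. spin_coeff \<beta> N \<sigma> js))
          * (\<Prod>j\<in>{..<k + 2} - {l}. mag N w (js ! j))) = \<phi>' x u"
      if "\<And>\<sigma>. \<sigma> \<in> ?S ==> H N w \<sigma> = single_out N js x u \<sigma>" for w x u
    proof -
      have "avg N w f = ?A x u f" for f by (rule gibbs_cong) (use that in auto)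
      then show ?thesis by (simp add: \<phi>_def \<phi>'_def D_def mag_avg)
    qed
  qed measurable
qed

lemma sum_multi_indices_factorize:
  fixes A :: "nat => nat => real"
  shows "(\<Sum>js\<in>multi_indices N p. \<Prod>l<p. A l (js ! l)) = (\<Prod>l<p. \<Sum>i=1..N. A l i)"
proof (induction p arbitrary: A)
  case 0
  have "multi_indices N 0 = {[]}" by (auto simp: multi_indices_def)
  then show ?case by simp
next
  case (Suc p)
  have inj: "inj_on (\<lambda>(i, js). i # js) ({1..N} \<times> multi_indices N p)" by (auto simp: inj_on_def)
  have "(\<Sum>js\<in>multi_indices N (Suc p). \<Prod>l<Suc p. A l (js ! l))
      = (\<Sum>(i, js)\<in>{1..N} \<times> multi_indices N p. A 0 i * (\<Prod>l<p. A (Suc l) (js ! l)))"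
    unfolding multi_indices_Suc
    by (subst sum.reindex[OF inj]) (auto intro!: sum.cong simp: prod.lessThan_Suc_shift simp del: prod.lessThan_Suc)
  also have "\<dots> = (\<Sum>i=1..N. A 0 i) * (\<Prod>l<p. \<Sum>i=1..N. A (Suc l) i)"
    by (simp only: sum.cartesian_product[symmetric] sum_distrib_left[symmetric]
        Suc.IH[of "\<lambda>l. A (Suc l)"] sum_distrib_right[symmetric])
  finally show ?case by (simp add: prod.lessThan_Suc_shift del: prod.lessThan_Suc)
qed

lemma spin_coeff_prod:
  "js \<in> multi_indices N p ==>
   spin_coeff \<beta> N m js = \<beta> p / real N powr ((real p - 1) / 2) * (\<Prod>l<p. m (js ! l))"
  using prod_list_map_nth[of js N p m] by (simp add: spin_coeff_def multi_indices_def)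

lemma spin_sites_square: "\<sigma> \<in> spin_configs N ==> i \<in> {1..N} ==> \<sigma> i * \<sigma> i = 1"
  using spin_configs_values[of \<sigma> N i] by auto

text \<open>Differentiating the product of magnetizations in one slot replaces one of the \<open>p\<close> factors
  \<open>overlap N \<sigma> m\<close> by the self-overlap \<open>1\<close> of the configuration.\<close>

lemma spin_coeff_one_slot:
  assumes N: "1 \<le> N" and \<sigma>: "\<sigma> \<in> spin_configs N" and l: "l < k + 2"
  shows "(\<Sum>js\<in>multi_indices N (k + 2). spin_coeff \<beta> N \<sigma> js *
      (\<beta> (k + 2) / real N powr ((real (k + 2) - 1) / 2) * (\<sigma> (js ! l) * (\<Prod>j\<in>{..<k + 2} - {l}. m (js ! j)))))
    = real N * ((\<beta> (k + 2))\<^sup>2 * overlap N \<sigma> m ^ (k + 1))"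
proof -
  define c where "c = \<beta> (k + 2) / real N powr ((real (k + 2) - 1) / 2)"
  have c2: "c\<^sup>2 = (\<beta> (k + 2))\<^sup>2 / real N ^ (k + 1)"
    unfolding c_def using normalization_squared[OF N, of "k + 2"] by simp
  define A where "A j i = (if j = l then 1 else \<sigma> i * m i)" for j i
  have t: "spin_coeff \<beta> N \<sigma> js * (c * (\<sigma> (js ! l) * (\<Prod>j\<in>{..<k + 2} - {l}. m (js ! j))))
      = c\<^sup>2 * (\<Prod>j<k + 2. A j (js ! j))" if js: "js \<in> multi_indices N (k + 2)" for js
  proof -
    have sq: "\<sigma> (js ! l) * \<sigma> (js ! l) = 1"
      using spin_sites_square[OF \<sigma>, of "js ! l"] js l by (auto simp: multi_indices_def subset_iff)
    have "(\<Prod>j<k + 2. f j) = f l * (\<Prod>j\<in>{..<k + 2} - {l}. f j)" for f :: "nat => real"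
      using l by (subst prod.remove[of _ l]) auto
    note split = this
    have "(\<Prod>j\<in>{..<k + 2} - {l}. \<sigma> (js ! j)) * (\<Prod>j\<in>{..<k + 2} - {l}. m (js ! j)) = (\<Prod>j\<in>{..<k + 2} - {l}. A j (js ! j))"
      unfolding prod.distrib[symmetric] by (rule prod.cong) (auto simp: A_def)
    then show ?thesis
      unfolding spin_coeff_prod[OF js] c_def[symmetric] split[of "\<lambda>j. \<sigma> (js ! j)"] split[of "\<lambda>j. A j (js ! j)"]
      using sq by (simp add: A_def power2_eq_square mult_ac)
  qed
  have "(\<Sum>js\<in>multi_indices N (k + 2). spin_coeff \<beta> N \<sigma> js *
      (c * (\<sigma> (js ! l) * (\<Prod>j\<in>{..<k + 2} - {l}. m (js ! j))))) = c\<^sup>2 * (\<Prod>j<k + 2. \<Sum>i=1..N. A j i)"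
    by (simp add: t sum_distrib_left[symmetric] sum_multi_indices_factorize)
  also have "(\<Prod>j<k + 2. \<Sum>i=1..N. A j i) = real N * (\<Prod>j\<in>{..<k + 2} - {l}. real N * overlap N \<sigma> m)"
    using l N by (subst prod.remove[of _ l]) (auto simp: A_def overlap_def intro!: prod.cong)
  also have "\<dots> = real N * (real N * overlap N \<sigma> m) ^ (k + 1)" using l by (simp add: card_Diff_singleton)
  also have "c\<^sup>2 * \<dots> = real N * ((\<beta> (k + 2))\<^sup>2 * overlap N \<sigma> m ^ (k + 1))"
    using N by (simp add: c2 power_mult_distrib)
  finally show ?thesis unfolding c_def .
qed

lemma pure_hamiltonian_abs_le: "\<sigma> \<in> spin_configs N ==> \<bar>pure_hamiltonian \<beta> (G w) N p \<sigma>\<bar> \<le> form_sup N p w"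
  by (rule pure_hamiltonian_le_form_sup[OF spin_average_spin])

lemma measurable_pure_hamiltonian:
  "(\<And>i. (\<lambda>w. m w i) \<in> borel_measurable M) ==> 2 \<le> p ==>
    (\<lambda>w. pure_hamiltonian \<beta> (G w) N p (m w)) \<in> borel_measurable M"
  unfolding pure_hamiltonian_multilinear multilinear_def multilinear_coeff_def
  using multi_indices_index[of p N]
  by (intro borel_measurable_sum borel_measurable_times borel_measurable_const borel_measurable_prod measurable_g) auto

lemma form_sup_mean:
  assumes N: "1 \<le> N" and p: "2 \<le> p"
  shows "integrable M (form_sup N p)" (is ?one) "(\<integral>w. form_sup N p w \<partial>M) \<le> 2305 * (real N * real p * \<bar>\<beta> p\<bar>)"
proof -
  have [measurable]: "form_sup N p \<in> borel_measurable M" by (rule measurable_form_sup[OF p])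
  define a where "a = real N * real p * \<bar>\<beta> p\<bar>"
  note f4 = form_sup_fourth_moment[OF N p, folded a_def]
  have "integrable M (form_sup N p) \<and> (\<integral>w. form_sup N p w \<partial>M) \<le> 2305 * a"
  proof (cases "a = 0")
    case True
    then have "\<beta> p = 0" using N p by (simp add: a_def)
    then have "multilinear N p \<phi> w = 0" for \<phi> w by (simp add: multilinear_def multilinear_coeff_def)
    then have "form_sup N p = (\<lambda>_. 0)" by (simp add: form_sup_def image_constant_conv fun_eq_iff)
    then show ?thesis by (simp add: True)
  next
    case False
    then have a: "0 < a" by (simp add: a_def zero_less_mult_iff)
    have le: "form_sup N p w \<le> a + form_sup N p w ^ 4 / a ^ 3" for w
    proof (cases "form_sup N p w \<le> a")
      case True then show ?thesis using a by (simp add: add_increasing2)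
    next
      case False
      then have "a ^ 3 * form_sup N p w \<le> form_sup N p w ^ 3 * form_sup N p w"
        using a form_sup_nonneg by (intro mult_right_mono power_mono) auto
      then have "form_sup N p w \<le> form_sup N p w ^ 4 / a ^ 3"
        using a by (simp add: field_simps power4_eq_xxxx power3_eq_cube)
      then show ?thesis using a by simp
    qed
    have i: "integrable M (\<lambda>w. a + form_sup N p w ^ 4 / a ^ 3)" using f4(1) by simp
    have i2: "integrable M (form_sup N p)"
      by (rule Bochner_Integration.integrable_bound[OF i]) (use le form_sup_nonneg in \<open>auto intro: order_trans[OF _ abs_ge_self]\<close>)
    have "(\<integral>w. form_sup N p w \<partial>M) \<le> (\<integral>w. a + form_sup N p w ^ 4 / a ^ 3 \<partial>M)"
      by (rule integral_mono[OF i2 i le])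
    also have "\<dots> = a + (\<integral>w. form_sup N p w ^ 4 \<partial>M) / a ^ 3" using f4(1) by (simp add: prob_space)
    also have "\<dots> \<le> a + 2304 * a ^ 4 / a ^ 3" using f4(2) a by (simp add: divide_right_mono)
    also have "\<dots> = 2305 * a" using a by (simp add: power4_eq_xxxx power3_eq_cube)
    finally show ?thesis using i2 by simp
  qed
  then show ?one "(\<integral>w. form_sup N p w \<partial>M) \<le> 2305 * (real N * real p * \<bar>\<beta> p\<bar>)"
    by (auto simp: a_def)
qed

text \<open>Integration by parts over every coordinate of level \<open>p\<close>; the two terms of the covariance
  are the self-overlap \<open>1\<close> and the overlap of two replicas.\<close>

lemma energy_level_mean:
  assumes N: "1 \<le> N"
  shows "(\<integral>w. avg N w (pure_hamiltonian \<beta> (G w) N (k + 2)) \<partial>M)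
    = real N * (\<beta> (k + 2))\<^sup>2 * (1 - (\<integral>w. avg N w (\<lambda>\<sigma>. avg N w (\<lambda>\<tau>. overlap N \<sigma> \<tau> ^ (k + 2))) \<partial>M))"
proof -
  let ?I = "multi_indices N (k + 2)" and ?s = "\<lambda>js \<sigma>. spin_coeff \<beta> N \<sigma> js"
  define c where "c = \<bar>\<beta> (k + 2) / real N powr ((real (k + 2) - 1) / 2)\<bar>"
  have s: "\<bar>?s js \<sigma>\<bar> \<le> c" if "js \<in> ?I" "\<sigma> \<in> spin_configs N" for js \<sigma>
    unfolding c_def by (rule spin_coeff_abs_le[OF spin_configs_in_cube[OF that(2)] that(1)])
  have c0: "0 \<le> c" by (simp add: c_def)
  have as: "\<bar>avg N w (?s js)\<bar> \<le> c" if "js \<in> ?I" for js w by (rule avg_abs_le) (rule s[OF that])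
  have i1: "integrable M (\<lambda>w. g js w * avg N w (?s js))" if js: "js \<in> ?I" for js
  proof (rule Bochner_Integration.integrable_bound[of _ "\<lambda>w. c * g js w"])
    have "gaussian_rv M (\<lambda>w. \<Sum>js\<in>{js}. 1 * g js w) (\<Sum>js\<in>{js}. 1\<^sup>2)"
      by (rule gaussian_finite_sum) (use js multi_indices_index[of "k + 2" N] in auto)
    then show "integrable M (\<lambda>w. c * g js w)" using gaussian_rv_abs(1)[of "g js" 1] by simp
    have "\<bar>g js w\<bar> * \<bar>avg N w (?s js)\<bar> \<le> \<bar>g js w\<bar> * c" for w by (intro mult_left_mono as js) auto
    then show "AE w in M. norm (g js w * avg N w (?s js)) \<le> norm (c * g js w)"
      using c0 by (auto simp: abs_mult mult.commute)
  qed (use js in measurable)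
  have i2: "integrable M (\<lambda>w. avg N w (\<lambda>\<sigma>. ?s js \<sigma> * ?s js \<sigma>) - avg N w (?s js) * avg N w (?s js))"
    if js: "js \<in> ?I" for js
  proof (rule integrable_const_bound[of _ "c * c + c * c"])
    have "\<bar>avg N w (\<lambda>\<sigma>. ?s js \<sigma> * ?s js \<sigma>)\<bar> \<le> c * c" for w
      by (rule avg_abs_le) (unfold abs_mult, intro mult_mono s js, use c0 in auto)
    moreover have "\<bar>avg N w (?s js) * avg N w (?s js)\<bar> \<le> c * c" for w
      unfolding abs_mult by (intro mult_mono as js) (use c0 in auto)
    ultimately show "AE w in M. norm (avg N w (\<lambda>\<sigma>. ?s js \<sigma> * ?s js \<sigma>) - avg N w (?s js) * avg N w (?s js)) \<le> c * c + c * c"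
      by (intro AE_I2) (simp only: real_norm_def, meson abs_triangle_ineq4 add_mono order_trans)
  qed measurable
  have ov: "\<bar>overlap N \<sigma> \<tau> ^ (k + 2)\<bar> \<le> 1" if "\<sigma> \<in> spin_configs N" "\<tau> \<in> spin_configs N" for \<sigma> \<tau>
    using spins_overlap[OF that] by (simp add: power_abs power_le_one)
  have i3: "integrable M (\<lambda>w. avg N w (\<lambda>\<sigma>. avg N w (\<lambda>\<tau>. overlap N \<sigma> \<tau> ^ (k + 2))))"
  proof (rule integrable_const_bound[of _ 1])
    show "AE w in M. norm (avg N w (\<lambda>\<sigma>. avg N w (\<lambda>\<tau>. overlap N \<sigma> \<tau> ^ (k + 2)))) \<le> 1"
      unfolding real_norm_def by (intro AE_I2 avg_abs_le ov)
  qed measurable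
  have "(\<integral>w. avg N w (pure_hamiltonian \<beta> (G w) N (k + 2)) \<partial>M)
      = (\<integral>w. (\<Sum>js\<in>?I. g js w * avg N w (?s js)) \<partial>M)"
    unfolding pure_hamiltonian_eq[abs_def] gibbs_sum gibbs_mult_right by (simp add: mult.commute)
  also have "\<dots> = (\<Sum>js\<in>?I. \<integral>w. g js w * avg N w (?s js) \<partial>M)"
    by (rule Bochner_Integration.integral_sum[OF i1])
  also have "\<dots> = (\<Sum>js\<in>?I. \<integral>w. avg N w (\<lambda>\<sigma>. ?s js \<sigma> * ?s js \<sigma>) - avg N w (?s js) * avg N w (?s js) \<partial>M)"
    by (intro sum.cong refl ibp_energy_single N)
  also have "\<dots> = (\<integral>w. (\<Sum>js\<in>?I. avg N w (\<lambda>\<sigma>. ?s js \<sigma> * ?s js \<sigma>) - avg N w (?s js) * avg N w (?s js)) \<partial>M)"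
    by (rule Bochner_Integration.integral_sum[OF i2, symmetric])
  also have "\<dots> = (\<integral>w. real N * (\<beta> (k + 2))\<^sup>2 * (1 - avg N w (\<lambda>\<sigma>. avg N w (\<lambda>\<tau>. overlap N \<sigma> \<tau> ^ (k + 2)))) \<partial>M)"
  proof (rule Bochner_Integration.integral_cong[OF refl])
    fix w
    have "(\<Sum>js\<in>?I. avg N w (\<lambda>\<sigma>. ?s js \<sigma> * ?s js \<sigma>)) = avg N w (\<lambda>\<sigma>. real N * ((\<beta> (k + 2))\<^sup>2 * 1))"
      unfolding gibbs_sum[symmetric]
      by (rule gibbs_cong[OF refl], subst spin_coeff_inner[OF N]) (simp_all add: overlap_self[OF _ N])
    moreover have "(\<Sum>js\<in>?I. avg N w (?s js) * avg N w (?s js))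
        = avg N w (\<lambda>\<sigma>. avg N w (\<lambda>\<tau>. real N * ((\<beta> (k + 2))\<^sup>2 * overlap N \<sigma> \<tau> ^ (k + 2))))"
    proof -
      have "(\<Sum>js\<in>?I. avg N w (?s js) * avg N w (?s js)) = avg N w (\<lambda>\<sigma>. avg N w (\<lambda>\<tau>. \<Sum>js\<in>?I. ?s js \<sigma> * ?s js \<tau>))"
        by (simp only: gibbs_sum gibbs_mult gibbs_mult_right)
      moreover have "1 \<le> k + 2" by linarith
      ultimately show ?thesis by (simp only: spin_coeff_inner[OF N])
    qed
    ultimately show "(\<Sum>js\<in>?I. avg N w (\<lambda>\<sigma>. ?s js \<sigma> * ?s js \<sigma>) - avg N w (?s js) * avg N w (?s js))
       = real N * (\<beta> (k + 2))\<^sup>2 * (1 - avg N w (\<lambda>\<sigma>. avg N w (\<lambda>\<tau>. overlap N \<sigma> \<tau> ^ (k + 2))))"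
      by (simp only: sum_subtractf gibbs_mult avg_const) (simp add: algebra_simps)
  qed
  also have "\<dots> = real N * (\<beta> (k + 2))\<^sup>2 * (1 - (\<integral>w. avg N w (\<lambda>\<sigma>. avg N w (\<lambda>\<tau>. overlap N \<sigma> \<tau> ^ (k + 2))) \<partial>M))"
    using i3 by (simp add: prob_space)
  finally show ?thesis .
qed

text \<open>Each factor \<open>m\<^sub>i\<close> of the monomial depends on the disorder; its derivative is the covariance of
  \<open>\<sigma>\<^sub>i\<close> with the monomial of \<open>\<sigma>\<close>, which produces the factor \<open>1 - R\<close>.\<close>

lemma magnetization_level_mean:
  assumes N: "1 \<le> N"
  shows "(\<integral>w. pure_hamiltonian \<beta> (G w) N (k + 2) (mag N w) \<partial>M)
    = (\<integral>w. real N * avg N w (\<lambda>\<sigma>. real (k + 2) * (\<beta> (k + 2))\<^sup>2 *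
        (overlap N \<sigma> (mag N w) ^ (k + 1) - overlap N \<sigma> (mag N w) ^ (k + 2))) \<partial>M)"
proof -
  let ?I = "multi_indices N (k + 2)" and ?s = "\<lambda>js \<sigma>. spin_coeff \<beta> N \<sigma> js"
  define b where "b = \<beta> (k + 2) / real N powr ((real (k + 2) - 1) / 2)"
  define c where "c = \<bar>b\<bar>"
  have s: "\<bar>?s js \<sigma>\<bar> \<le> c" if "js \<in> ?I" "\<sigma> \<in> spin_configs N" for js \<sigma>
    unfolding c_def b_def by (rule spin_coeff_abs_le[OF spin_configs_in_cube[OF that(2)] that(1)])
  have c0: "0 \<le> c" by (simp add: c_def)
  have site: "js ! l \<in> {1..N}" if "js \<in> ?I" "l < k + 2" for js l
    using that by (auto simp: multi_indices_def subset_iff)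
  have pr: "\<bar>\<Prod>j\<in>J. mag N w (js ! j)\<bar> \<le> 1" if "js \<in> ?I" "J \<subseteq> {..<k + 2}" for js J w
    unfolding abs_prod by (intro prod_le_1) (use mag_abs_le site that in auto)
  define D where "D js w l = (avg N w (\<lambda>\<sigma>. \<sigma> (js ! l) * ?s js \<sigma>) - mag N w (js ! l) * avg N w (?s js))
      * (\<Prod>j\<in>{..<k + 2} - {l}. mag N w (js ! j))" for js w l
  have i1: "integrable M (\<lambda>w. g js w * (\<Prod>l<k + 2. mag N w (js ! l)))" if js: "js \<in> ?I" for js
  proof (rule Bochner_Integration.integrable_bound[of _ "g js"])
    have "gaussian_rv M (\<lambda>w. \<Sum>js\<in>{js}. 1 * g js w) (\<Sum>js\<in>{js}. 1\<^sup>2)"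
      by (rule gaussian_finite_sum) (use js multi_indices_index[of "k + 2" N] in auto)
    then show "integrable M (g js)" using gaussian_rv_abs(1)[of "g js" 1] by simp
    have "\<bar>g js w\<bar> * \<bar>\<Prod>l<k + 2. mag N w (js ! l)\<bar> \<le> \<bar>g js w\<bar> * 1" for w by (intro mult_left_mono pr js) auto
    then show "AE w in M. norm (g js w * (\<Prod>l<k + 2. mag N w (js ! l))) \<le> norm (g js w)"
      by (auto simp: abs_mult)
  qed (use js in measurable)
  have i2: "integrable M (\<lambda>w. \<Sum>l<k + 2. D js w l)" if js: "js \<in> ?I" for js
  proof (rule Bochner_Integration.integrable_sum, rule integrable_const_bound[of _ "2 * c"])
    fix l assume "l \<in> {..<k + 2}" then have l: "l < k + 2" by simp
    show "AE w in M. norm (D js w l) \<le> 2 * c"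
    proof (rule AE_I2)
      fix w
      have 1: "\<bar>avg N w (\<lambda>\<sigma>. \<sigma> (js ! l) * ?s js \<sigma>)\<bar> \<le> c"
      proof (rule avg_abs_le)
        fix \<sigma> assume \<sigma>: "\<sigma> \<in> spin_configs N"
        have "\<bar>\<sigma> (js ! l)\<bar> * \<bar>?s js \<sigma>\<bar> \<le> 1 * c"
          using spin_configs_in_cube[OF \<sigma>] site[OF js l] s[OF js \<sigma>] c0
          by (intro mult_mono) (auto simp: in_cube_def)
        then show "\<bar>\<sigma> (js ! l) * ?s js \<sigma>\<bar> \<le> c" by (simp add: abs_mult)
      qed
      have "\<bar>mag N w (js ! l)\<bar> * \<bar>avg N w (?s js)\<bar> \<le> 1 * c"
        by (intro mult_mono mag_abs_le site js l avg_abs_le s) auto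
      then have 2: "\<bar>avg N w (\<lambda>\<sigma>. \<sigma> (js ! l) * ?s js \<sigma>) - mag N w (js ! l) * avg N w (?s js)\<bar> \<le> 2 * c"
        using 1 unfolding abs_mult[symmetric] by linarith
      have "\<bar>avg N w (\<lambda>\<sigma>. \<sigma> (js ! l) * ?s js \<sigma>) - mag N w (js ! l) * avg N w (?s js)\<bar>
          * \<bar>\<Prod>j\<in>{..<k + 2} - {l}. mag N w (js ! j)\<bar> \<le> (2 * c) * 1"
        using 2 c0 by (intro mult_mono pr js) auto
      then show "norm (D js w l) \<le> 2 * c" by (simp add: D_def abs_mult)
    qed
    show "(\<lambda>w. D js w l) \<in> borel_measurable M" unfolding D_def by measurable
  qed
  have "(\<integral>w. pure_hamiltonian \<beta> (G w) N (k + 2) (mag N w) \<partial>M)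
      = (\<integral>w. (\<Sum>js\<in>?I. b * (g js w * (\<Prod>l<k + 2. mag N w (js ! l)))) \<partial>M)"
    unfolding pure_hamiltonian_eq
    by (intro Bochner_Integration.integral_cong sum.cong refl) (simp add: spin_coeff_prod b_def)
  also have "\<dots> = (\<Sum>js\<in>?I. b * (\<integral>w. g js w * (\<Prod>l<k + 2. mag N w (js ! l)) \<partial>M))"
    using i1 by (subst Bochner_Integration.integral_sum) auto
  also have "\<dots> = (\<Sum>js\<in>?I. b * (\<integral>w. (\<Sum>l<k + 2. D js w l) \<partial>M))"
    unfolding D_def by (intro sum.cong refl arg_cong2[of _ _ _ _ times] ibp_magnetization_single N)
  also have "\<dots> = (\<integral>w. (\<Sum>js\<in>?I. b * (\<Sum>l<k + 2. D js w l)) \<partial>M)"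
    using i2 by (subst Bochner_Integration.integral_sum) auto
  also have "\<dots> = (\<integral>w. real N * avg N w (\<lambda>\<sigma>. real (k + 2) * (\<beta> (k + 2))\<^sup>2 *
        (overlap N \<sigma> (mag N w) ^ (k + 1) - overlap N \<sigma> (mag N w) ^ (k + 2))) \<partial>M)"
  proof (rule Bochner_Integration.integral_cong[OF refl])
    fix w
    let ?m = "mag N w"
    have one: "(\<Sum>js\<in>?I. b * D js w l)
        = avg N w (\<lambda>\<sigma>. real N * ((\<beta> (k + 2))\<^sup>2 * overlap N \<sigma> ?m ^ (k + 1))
            - real N * ((\<beta> (k + 2))\<^sup>2 * overlap N \<sigma> ?m ^ (k + 2)))" if l: "l < k + 2" for l
    proof -
      have D: "b * D js w l = avg N w (\<lambda>\<sigma>. ?s js \<sigma> * (b * (\<sigma> (js ! l) * (\<Prod>j\<in>{..<k + 2} - {l}. ?m (js ! j))))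
          - ?s js \<sigma> * spin_coeff \<beta> N ?m js)" if js: "js \<in> ?I" for js
      proof -
        have "(\<Prod>j<k + 2. ?m (js ! j)) = ?m (js ! l) * (\<Prod>j\<in>{..<k + 2} - {l}. ?m (js ! j))"
          using l by (subst prod.remove[of _ l]) auto
        then have "spin_coeff \<beta> N ?m js = b * (?m (js ! l) * (\<Prod>j\<in>{..<k + 2} - {l}. ?m (js ! j)))"
          unfolding spin_coeff_prod[OF js] b_def by simp
        moreover have "avg N w (\<lambda>\<sigma>. ?s js \<sigma> * (b * (\<sigma> (js ! l) * P))) = avg N w (\<lambda>\<sigma>. \<sigma> (js ! l) * ?s js \<sigma>) * (b * P)" for P
          unfolding gibbs_mult_right[symmetric] by (rule gibbs_cong) (auto simp: mult_ac)
        ultimately show ?thesis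
          by (simp only: gibbs_diff gibbs_mult_right D_def) (simp only: left_diff_distrib right_diff_distrib mult_ac)
      qed
      have "(\<Sum>js\<in>?I. b * D js w l) = avg N w (\<lambda>\<sigma>. \<Sum>js\<in>?I. ?s js \<sigma> * (b * (\<sigma> (js ! l) * (\<Prod>j\<in>{..<k + 2} - {l}. ?m (js ! j))))
          - ?s js \<sigma> * spin_coeff \<beta> N ?m js)"
        by (simp only: gibbs_sum D cong: sum.cong)
      also have "\<dots> = avg N w (\<lambda>\<sigma>. real N * ((\<beta> (k + 2))\<^sup>2 * overlap N \<sigma> ?m ^ (k + 1))
            - real N * ((\<beta> (k + 2))\<^sup>2 * overlap N \<sigma> ?m ^ (k + 2)))"
        using spin_coeff_one_slot[OF N _ l, folded b_def]
        by (intro gibbs_cong refl) (simp add: sum_subtractf spin_coeff_inner[OF N])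
      finally show ?thesis .
    qed
    have "(\<Sum>js\<in>?I. b * (\<Sum>l<k + 2. D js w l)) = (\<Sum>l<k + 2. \<Sum>js\<in>?I. b * D js w l)"
      unfolding sum_distrib_left by (rule sum.swap)
    also have "\<dots> = real (k + 2) * avg N w (\<lambda>\<sigma>. real N * ((\<beta> (k + 2))\<^sup>2 * overlap N \<sigma> ?m ^ (k + 1))
            - real N * ((\<beta> (k + 2))\<^sup>2 * overlap N \<sigma> ?m ^ (k + 2)))"
      by (simp add: one)
    also have "\<dots> = real N * avg N w (\<lambda>\<sigma>. real (k + 2) * (\<beta> (k + 2))\<^sup>2 *
        (overlap N \<sigma> ?m ^ (k + 1) - overlap N \<sigma> ?m ^ (k + 2)))"
      unfolding gibbs_mult[symmetric] by (rule gibbs_cong) (auto simp: algebra_simps)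
    finally show "(\<Sum>js\<in>?I. b * (\<Sum>l<k + 2. D js w l)) = real N * avg N w (\<lambda>\<sigma>. real (k + 2) * (\<beta> (k + 2))\<^sup>2 *
        (overlap N \<sigma> ?m ^ (k + 1) - overlap N \<sigma> ?m ^ (k + 2)))" .
  qed
  finally show ?thesis .
qed

text \<open>The suprema of the forms have summable expectations and serve as dominating functions.\<close>

lemma integral_level_series:
  assumes N: "1 \<le> N" and meas: "\<And>k. f k \<in> borel_measurable M"
    and le: "\<And>k w. \<bar>f k w\<bar> \<le> form_sup N (k + 2) w"
  shows "integrable M (\<lambda>w. \<Sum>k. f k w)" (is ?one) and "(\<lambda>k. \<integral>w. f k w \<partial>M) sums (\<integral>w. (\<Sum>k. f k w) \<partial>M)" (is ?two)
proof -
  note [measurable] = meas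
  have i: "integrable M (f k)" for k
    by (rule Bochner_Integration.integrable_bound[OF form_sup_mean(1)[OF N, of "k + 2"]])
      (use le in \<open>auto intro: order_trans[OF _ abs_ge_self]\<close>)
  have AE: "AE w in M. summable (\<lambda>k. norm (f k w))"
    using total_sup_fourth_moment(1)[OF N]
  proof eventually_elim
    case (elim w)
    show ?case by (rule summable_comparison_test'[of "\<lambda>k. form_sup N (k + 2) w"]) (use elim le in \<open>auto simp: tame_def\<close>)
  qed
  have s: "summable (\<lambda>k. \<integral>w. norm (f k w) \<partial>M)"
  proof (rule summable_comparison_test')
    show "summable (\<lambda>k. 2305 * real N * (real (k + 2) * \<bar>\<beta> (k + 2)\<bar>))"
      by (rule summable_mult[OF summable_beta_sum])
    show "norm (\<integral>w. norm (f k w) \<partial>M) \<le> 2305 * real N * (real (k + 2) * \<bar>\<beta> (k + 2)\<bar>)" for k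
    proof -
      have "(\<integral>w. \<bar>f k w\<bar> \<partial>M) \<le> (\<integral>w. form_sup N (k + 2) w \<partial>M)"
        using i form_sup_mean(1)[OF N, of "k + 2"] by (intro integral_mono le) auto
      also have "\<dots> \<le> 2305 * (real N * real (k + 2) * \<bar>\<beta> (k + 2)\<bar>)"
        by (rule form_sup_mean(2)[OF N]) simp
      finally have "(\<integral>w. \<bar>f k w\<bar> \<partial>M) \<le> 2305 * real N * (real (k + 2) * \<bar>\<beta> (k + 2)\<bar>)" by (simp only: mult.assoc)
      moreover have "0 \<le> (\<integral>w. \<bar>f k w\<bar> \<partial>M)" by simp
      ultimately show ?thesis by simp
    qed
  qed
  show ?one by (rule integrable_suminf[OF i AE s])
  show ?two by (rule sums_integral[OF i AE s])
qed

lemma magnetization_energy_mean: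
  assumes N: "1 \<le> N"
  shows "integrable M (\<lambda>w. X N (mag N w) w)" (is ?one)
    and "(\<integral>w. X N (mag N w) w \<partial>M)
      = real N * (\<integral>w. avg N w (\<lambda>\<sigma>. dxi (overlap N \<sigma> (mag N w)) * (1 - overlap N \<sigma> (mag N w))) \<partial>M)"
proof -
  let ?R = "\<lambda>w \<sigma>. overlap N \<sigma> (mag N w)"
  note X = integral_level_series[OF N, of "\<lambda>k w. pure_hamiltonian \<beta> (G w) N (k + 2) (mag N w)",
      OF measurable_pure_hamiltonian pure_hamiltonian_le_form_sup[OF spin_average_mag], folded mixed_hamiltonian_def]
  show ?one by (rule X(1)) auto
  have R: "\<bar>?R w \<sigma>\<bar> \<le> 1" if "\<sigma> \<in> spin_configs N" for w \<sigma>
    by (rule in_cube_overlap[OF spin_configs_in_cube[OF that] mag_in_cube])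
  have mR [measurable]: "(\<lambda>w. ?R w \<sigma>) \<in> borel_measurable M" for \<sigma> unfolding overlap_def by measurable
  define f where "f k w = avg N w (\<lambda>\<sigma>. real (k + 2) * (\<beta> (k + 2))\<^sup>2 * (?R w \<sigma> ^ (k + 1) - ?R w \<sigma> ^ (k + 2)))" for k w
  have [measurable]: "f k \<in> borel_measurable M" for k unfolding f_def by measurable
  have fb: "\<bar>f k w\<bar> \<le> 2 * (real (k + 2) * (\<beta> (k + 2))\<^sup>2)" for k w
    unfolding f_def
  proof (rule avg_abs_le)
    fix \<sigma> assume "\<sigma> \<in> spin_configs N"
    then have "\<bar>?R w \<sigma> ^ j\<bar> \<le> 1" for j using R[of \<sigma> w] by (simp add: power_abs power_le_one)
    from this[of "k + 1"] this[of "k + 2"] have "\<bar>?R w \<sigma> ^ (k + 1) - ?R w \<sigma> ^ (k + 2)\<bar> \<le> 2" by linarith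
    then have "(real (k + 2) * (\<beta> (k + 2))\<^sup>2) * \<bar>?R w \<sigma> ^ (k + 1) - ?R w \<sigma> ^ (k + 2)\<bar> \<le> (real (k + 2) * (\<beta> (k + 2))\<^sup>2) * 2"
      by (intro mult_left_mono) auto
    then show "\<bar>real (k + 2) * (\<beta> (k + 2))\<^sup>2 * (?R w \<sigma> ^ (k + 1) - ?R w \<sigma> ^ (k + 2))\<bar> \<le> 2 * (real (k + 2) * (\<beta> (k + 2))\<^sup>2)"
      by (simp add: abs_mult)
  qed
  have sb: "summable (\<lambda>k. 2 * (real (k + 2) * (\<beta> (k + 2))\<^sup>2))"
    using sums_summable[OF dxi_sums[of 1]] by (intro summable_mult) simp
  have f_sums: "(\<lambda>k. f k w) sums avg N w (\<lambda>\<sigma>. dxi (?R w \<sigma>) * (1 - ?R w \<sigma>))" for w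
  proof -
    have "(\<lambda>k. real (k + 2) * (\<beta> (k + 2))\<^sup>2 * (?R w \<sigma> ^ (k + 1) - ?R w \<sigma> ^ (k + 2))) sums (dxi (?R w \<sigma>) * (1 - ?R w \<sigma>))"
      if "\<sigma> \<in> spin_configs N" for \<sigma>
      using sums_mult2[OF dxi_sums[of "?R w \<sigma>"], of "1 - ?R w \<sigma>"] R[OF that, of w]
      by (simp add: algebra_simps power_add power2_eq_square)
    then show ?thesis
      unfolding f_def gibbs_def by (intro sums_divide sums_sum sums_mult) auto
  qed
  have "(\<lambda>k. \<integral>w. f k w \<partial>M) sums (\<integral>w. (\<Sum>k. f k w) \<partial>M)"
  proof (rule sums_integral)
    show "integrable M (f k)" for k by (rule integrable_const_bound) (use fb in auto)
    show "AE w in M. summable (\<lambda>k. norm (f k w))"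
      by (intro AE_I2 summable_comparison_test'[OF sb]) (use fb in auto)
    show "summable (\<lambda>k. \<integral>w. norm (f k w) \<partial>M)"
    proof (rule summable_comparison_test'[OF sb])
      fix k
      have "(\<integral>w. \<bar>f k w\<bar> \<partial>M) \<le> (\<integral>w. 2 * (real (k + 2) * (\<beta> (k + 2))\<^sup>2) \<partial>M)"
        by (rule integral_mono_AE') (use fb in auto)
      then show "norm (\<integral>w. norm (f k w) \<partial>M) \<le> 2 * (real (k + 2) * (\<beta> (k + 2))\<^sup>2)"
        by (simp add: prob_space)
    qed
  qed
  then have "(\<lambda>k. real N * (\<integral>w. f k w \<partial>M)) sums (real N * (\<integral>w. avg N w (\<lambda>\<sigma>. dxi (?R w \<sigma>) * (1 - ?R w \<sigma>)) \<partial>M))"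
    using f_sums by (intro sums_mult) (simp add: sums_iff)
  moreover have "(\<lambda>k. real N * (\<integral>w. f k w \<partial>M)) sums (\<integral>w. X N (mag N w) w \<partial>M)"
    using X(2) by (simp add: magnetization_level_mean[OF N] f_def)
  ultimately show "(\<integral>w. X N (mag N w) w \<partial>M)
      = real N * (\<integral>w. avg N w (\<lambda>\<sigma>. dxi (?R w \<sigma>) * (1 - ?R w \<sigma>)) \<partial>M)"
    by (simp add: sums_unique2)
qed

end

section \<open>The binary entropy\<close>

text \<open>Jensen's inequality for \<open>t log t\<close>, the value \<open>0\<close> included: if the average is \<open>0\<close> then
  the nonnegative function vanishes identically.\<close>

lemma gibbs_xlnx_jensen:
  assumes S: "finite S" "S \<noteq> {}" and f: "\<And>s. s \<in> S ==> 0 \<le> f s"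
  shows "gibbs S H f * ln (gibbs S H f) \<le> gibbs S H (\<lambda>s. f s * ln (f s))"
proof (cases "gibbs S H f = 0")
  case True
  have "(\<Sum>s\<in>S. exp (H s) * f s) = 0"
    using True partition_pos[OF S, of H] by (simp add: gibbs_def)
  then have "exp (H s) * f s = 0" if "s \<in> S" for s
    using S(1) f that by (subst (asm) sum_nonneg_eq_0_iff) auto
  then have "f s = 0" if "s \<in> S" for s using that by force
  then have "gibbs S H (\<lambda>s. f s * ln (f s)) = gibbs S H (\<lambda>_. 0)" by (intro gibbs_cong) auto
  then show ?thesis using True by (simp add: gibbs_const[OF S])
next
  case False
  let ?a = "gibbs S H f"
  have a: "0 < ?a" using False gibbs_nonneg[OF S, of f H] f by (simp add: less_le)
  have "?a * ln ?a + (1 + ln ?a) * (f s - ?a) \<le> f s * ln (f s)" if s: "s \<in> S" for s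
  proof (cases "f s = 0")
    case True then show ?thesis using a by (simp add: algebra_simps)
  next
    case False
    then have fs: "0 < f s" using f[OF s] by simp
    have "ln (?a / f s) \<le> ?a / f s - 1" using a fs by (intro ln_le_minus_one) simp
    then have "f s * (ln ?a - ln (f s)) \<le> f s * (?a / f s - 1)"
      using a fs by (intro mult_left_mono) (auto simp: ln_div)
    then show ?thesis using fs by (simp add: algebra_simps)
  qed
  then have "gibbs S H (\<lambda>s. ?a * ln ?a + (1 + ln ?a) * (f s - ?a)) \<le> gibbs S H (\<lambda>s. f s * ln (f s))"
    by (rule gibbs_mono[OF S])
  moreover have "gibbs S H (\<lambda>s. ?a * ln ?a + (1 + ln ?a) * (f s - ?a)) = ?a * ln ?a"
    by (simp only: gibbs_add gibbs_mult gibbs_diff gibbs_const[OF S]) simp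
  ultimately show ?thesis by simp
qed

lemma entropy_term_jensen:
  assumes S: "finite S" "S \<noteq> {}" and f: "\<And>s. s \<in> S ==> \<bar>f s\<bar> \<le> 1"
  shows "entropy_term (gibbs S H f) \<le> gibbs S H (\<lambda>s. entropy_term (f s))"
proof -
  have p: "gibbs S H (\<lambda>s. (1 + f s) / 2) = (1 + gibbs S H f) / 2"
    by (simp only: gibbs_divide gibbs_add gibbs_const[OF S])
  have m: "gibbs S H (\<lambda>s. (1 - f s) / 2) = (1 - gibbs S H f) / 2"
    by (simp only: gibbs_divide gibbs_diff gibbs_const[OF S])
  have "(1 + gibbs S H f) / 2 * ln ((1 + gibbs S H f) / 2) \<le> gibbs S H (\<lambda>s. (1 + f s) / 2 * ln ((1 + f s) / 2))"
    unfolding p[symmetric] by (rule gibbs_xlnx_jensen[OF S]) (use f in \<open>force simp: abs_le_iff\<close>)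
  moreover have "(1 - gibbs S H f) / 2 * ln ((1 - gibbs S H f) / 2) \<le> gibbs S H (\<lambda>s. (1 - f s) / 2 * ln ((1 - f s) / 2))"
    unfolding m[symmetric] by (rule gibbs_xlnx_jensen[OF S]) (use f in \<open>force simp: abs_le_iff\<close>)
  ultimately show ?thesis by (simp add: entropy_term_def gibbs_add)
qed

lemma entropy_term_bounds:
  assumes "\<bar>x\<bar> \<le> 1" shows "entropy_term x \<le> 0" (is ?one) "- 2 \<le> entropy_term x"
proof -
  have t: "t * ln t \<le> 0 \<and> - 1 \<le> t * ln t" if "0 \<le> t" "t \<le> 1" for t :: real
  proof (cases "t = 0")
    case False
    then have t: "0 < t" using that by simp
    have "ln (1 / t) \<le> 1 / t - 1" using t by (intro ln_le_minus_one) simp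
    then have "t * - ln t \<le> t * (1 / t - 1)" using t by (intro mult_left_mono) (auto simp: ln_div)
    then have "- 1 \<le> t * ln t" using t by (simp add: algebra_simps)
    moreover have "ln t \<le> 0" using t that by simp
    ultimately show ?thesis using t by (simp add: mult_nonneg_nonpos)
  qed simp
  have "0 \<le> (1 + x) / 2" "(1 + x) / 2 \<le> 1" "0 \<le> (1 - x) / 2" "(1 - x) / 2 \<le> 1"
    using assms by (auto simp: abs_le_iff)
  with t[of "(1 + x) / 2"] t[of "(1 - x) / 2"] show ?one "- 2 \<le> entropy_term x"
    unfolding entropy_term_def by linarith+
qed

section \<open>Replicas and their barycentre\<close>

text \<open>For a fixed tuple of configurations, the entropy of the barycentre is the log-likelihood of
  the tuple under the product measure with the same means.\<close>

definition barycentre :: "nat => (nat => nat => real) => nat => real" where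
  "barycentre n \<psi> i = (\<Sum>l<n. \<psi> l i) / real n"

text \<open>The identity behind the bound on the entropy weights: the likelihood of a sample under the
  coin whose bias is the empirical mean.\<close>

lemma entropy_likelihood:
  fixes s :: "nat => real"
  assumes n: "1 \<le> n" and s: "\<And>l. l < n ==> s l = 1 \<or> s l = -1"
  shows "exp (real n * entropy_term ((\<Sum>l<n. s l) / real n)) = (\<Prod>l<n. (1 + (\<Sum>l<n. s l) / real n * s l) / 2)"
proof -
  define a where "a = (\<Sum>l<n. s l) / real n"
  have na: "(\<Sum>l<n. s l) = real n * a" using n by (simp add: a_def)
  have pos: "0 < (1 + a * s l) / 2" if l: "l < n" for l
  proof -
    have "real n * (1 + a * s l) = (\<Sum>j<n. 1 + s j * s l)"
      using na by (simp add: sum.distrib sum_distrib_right[symmetric] distrib_left)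
    also have "\<dots> \<ge> 1 + s l * s l"
    proof (rule member_le_sum[of l _ "\<lambda>j. 1 + s j * s l"])
      show "0 \<le> 1 + s j * s l" if "j \<in> {..<n} - {l}" for j
        using s[of j] s[OF l] that by auto
    qed (use l in auto)
    also have "1 + s l * s l = 2" using s[OF l] by auto
    finally have "0 < real n * (1 + a * s l)" by linarith
    then show ?thesis using n by (simp add: zero_less_mult_iff)
  qed
  have term_eq: "ln ((1 + a * s l) / 2) = (1 + s l) / 2 * ln ((1 + a) / 2) + (1 - s l) / 2 * ln ((1 - a) / 2)"
    if "l < n" for l using s[OF that] by auto
  have "(\<Sum>l<n. ln ((1 + a * s l) / 2)) = (\<Sum>l<n. (1 + s l) / 2 * ln ((1 + a) / 2) + (1 - s l) / 2 * ln ((1 - a) / 2))"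
    using term_eq by (intro sum.cong) auto
  also have "\<dots> = (\<Sum>l<n. 1 + s l) / 2 * ln ((1 + a) / 2) + (\<Sum>l<n. 1 - s l) / 2 * ln ((1 - a) / 2)"
    by (simp only: sum.distrib sum_distrib_right[symmetric] sum_divide_distrib[symmetric])
  also have "\<dots> = real n * entropy_term a"
    by (simp add: sum.distrib sum_subtractf na entropy_term_def algebra_simps)
  finally have "exp (real n * entropy_term a) = (\<Prod>l<n. exp (ln ((1 + a * s l) / 2)))"
    by (simp add: exp_sum[symmetric])
  also have "\<dots> = (\<Prod>l<n. (1 + a * s l) / 2)" using pos by (intro prod.cong) auto
  finally show ?thesis by (simp only: a_def)
qed

context spin_glass
begin

lemma barycentre_values:
  assumes "\<psi> \<in> tuples N n" "i \<in> {1..N}"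
  shows "barycentre n \<psi> i \<in> (\<lambda>k. (2 * real k - real n) / real n) ` {..n}"
proof -
  have "\<exists>k\<le>j. (\<Sum>l<j. \<psi> l i) = 2 * real k - real j" if "j \<le> n" for j
    using that
  proof (induction j)
    case (Suc j)
    then obtain k where k: "k \<le> j" "(\<Sum>l<j. \<psi> l i) = 2 * real k - real j" by auto
    have "\<psi> j \<in> spin_configs N" using assms(1) Suc.prems by (intro tuples_mem) auto
    then have "\<psi> j i = 1 \<or> \<psi> j i = -1" using assms(2) by (rule spin_configs_values)
    then show ?case
    proof
      assume "\<psi> j i = 1" then show ?thesis using k by (intro exI[of _ "Suc k"]) auto
    next
      assume "\<psi> j i = -1" then show ?thesis using k by (intro exI[of _ k]) auto
    qed
  qed simp
  from this[of n] show ?thesis by (auto simp: barycentre_def)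
qed

lemma barycentre_spin_average:
  assumes \<psi>: "\<psi> \<in> tuples N n" and n: "1 \<le> n" shows "spin_average N (barycentre n \<psi>)"
  unfolding spin_average_def
proof (intro exI conjI ballI)
  let ?wt = "\<lambda>\<sigma>. real (card {l\<in>{..<n}. \<psi> l = \<sigma>}) / real n"
  have grp: "(\<Sum>\<sigma>\<in>spin_configs N. real (card {l\<in>{..<n}. \<psi> l = \<sigma>}) * f \<sigma>) = (\<Sum>l<n. f (\<psi> l))" for f
  proof -
    have "(\<Sum>l<n. f (\<psi> l)) = (\<Sum>\<sigma>\<in>spin_configs N. \<Sum>l\<in>{l\<in>{..<n}. \<psi> l = \<sigma>}. f (\<psi> l))"
      by (rule sum.group[symmetric]) (use tuples_mem[OF \<psi>] in auto)
    then show ?thesis by simp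
  qed
  show "0 \<le> ?wt \<sigma>" for \<sigma> by simp
  show "(\<Sum>\<sigma>\<in>spin_configs N. ?wt \<sigma>) = 1"
    using grp[of "\<lambda>_. 1"] n by (simp add: sum_divide_distrib[symmetric])
  show "barycentre n \<psi> i = (\<Sum>\<sigma>\<in>spin_configs N. ?wt \<sigma> * \<sigma> i)" for i
    using grp[of "\<lambda>\<sigma>. \<sigma> i"] by (simp add: barycentre_def sum_divide_distrib[symmetric])
qed

text \<open>The total weight \<open>\<Sum>\<^sub>\<psi> exp (n \<Sum>\<^sub>i I)\<close> is at most the number of possible barycentres, since
  for each barycentre the weights are the probabilities of disjoint events.\<close>

lemma sum_entropy_weights:
  assumes n: "1 \<le> n"
  shows "(\<Sum>\<psi>\<in>tuples N n. exp (real n * (\<Sum>i=1..N. entropy_term (barycentre n \<psi> i)))) \<le> real (n + 1) ^ N"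
proof -
  let ?V = "(\<lambda>k. (2 * real k - real n) / real n) ` {..n}"
  let ?B = "{1..N} \<rightarrow>\<^sub>E ?V"
  define P where "P m \<sigma> = (\<Prod>i\<in>{1..N}. (1 + m i * \<sigma> i) / 2)" for m \<sigma> :: "nat => real"
  have V: "\<bar>v\<bar> \<le> 1" if v: "v \<in> ?V" for v
  proof -
    obtain k where k: "k \<le> n" "v = (2 * real k - real n) / real n" using v by auto
    then have "\<bar>2 * real k - real n\<bar> \<le> real n" by (auto simp: abs_le_iff)
    then show ?thesis using k n by (simp add: divide_le_eq)
  qed
  have P0: "0 \<le> P m \<sigma>" if "m \<in> ?B" "\<sigma> \<in> spin_configs N" for m \<sigma>
    unfolding P_def
  proof (intro prod_nonneg ballI)
    fix i assume i: "i \<in> {1..N}"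
    have "\<bar>m i\<bar> \<le> 1" using that(1) i by (intro V) (auto dest: PiE_mem)
    moreover have "\<sigma> i = 1 \<or> \<sigma> i = -1" by (rule spin_configs_values[OF that(2) i])
    ultimately show "0 \<le> (1 + m i * \<sigma> i) / 2" by (auto simp: abs_le_iff)
  qed
  have P1: "(\<Sum>\<sigma>\<in>spin_configs N. P m \<sigma>) = 1" for m
    unfolding P_def spin_configs_def by (subst prod_sum_PiE[symmetric]) (auto simp: field_simps)
  have W: "exp (real n * (\<Sum>i=1..N. entropy_term (barycentre n \<psi> i))) = (\<Prod>l<n. P (restrict (barycentre n \<psi>) {1..N}) (\<psi> l))"
    if \<psi>: "\<psi> \<in> tuples N n" for \<psi>
  proof -
    have "exp (real n * (\<Sum>i=1..N. entropy_term (barycentre n \<psi> i)))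
        = (\<Prod>i\<in>{1..N}. exp (real n * entropy_term (barycentre n \<psi> i)))"
      by (simp add: sum_distrib_left exp_sum)
    also have "\<dots> = (\<Prod>i\<in>{1..N}. \<Prod>l<n. (1 + barycentre n \<psi> i * \<psi> l i) / 2)"
    proof (rule prod.cong[OF refl])
      fix i assume i: "i \<in> {1..N}"
      show "exp (real n * entropy_term (barycentre n \<psi> i)) = (\<Prod>l<n. (1 + barycentre n \<psi> i * \<psi> l i) / 2)"
        unfolding barycentre_def
        by (rule entropy_likelihood[OF n]) (rule spin_configs_values[OF tuples_mem[OF \<psi>] i])
    qed
    also have "\<dots> = (\<Prod>l<n. P (restrict (barycentre n \<psi>) {1..N}) (\<psi> l))"
      unfolding P_def by (subst prod.swap) (intro prod.cong, auto)
    finally show ?thesis .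
  qed
  have B: "restrict (barycentre n \<psi>) {1..N} \<in> ?B" if "\<psi> \<in> tuples N n" for \<psi>
    using barycentre_values[OF that] by auto
  have fin: "finite ?B" by (intro finite_PiE) auto
  have "(\<Sum>\<psi>\<in>tuples N n. exp (real n * (\<Sum>i=1..N. entropy_term (barycentre n \<psi> i))))
      \<le> (\<Sum>\<psi>\<in>tuples N n. \<Sum>m\<in>?B. \<Prod>l<n. P m (\<psi> l))"
  proof (rule sum_mono)
    fix \<psi> assume \<psi>: "\<psi> \<in> tuples N n"
    show "exp (real n * (\<Sum>i=1..N. entropy_term (barycentre n \<psi> i))) \<le> (\<Sum>m\<in>?B. \<Prod>l<n. P m (\<psi> l))"
      unfolding W[OF \<psi>]
      by (rule member_le_sum[of _ _ "\<lambda>m. \<Prod>l<n. P m (\<psi> l)"])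
        (use B[OF \<psi>] fin P0 tuples_mem[OF \<psi>] in \<open>auto intro!: prod_nonneg\<close>)
  qed
  also have "\<dots> = (\<Sum>m\<in>?B. \<Prod>l<n. \<Sum>\<sigma>\<in>spin_configs N. P m \<sigma>)"
    unfolding tuples_def by (subst sum.swap, intro sum.cong refl, subst prod_sum_PiE) auto
  also have "\<dots> = real (card ?B)" by (simp add: P1)
  also have "card ?B = card ?V ^ N" by (simp add: card_PiE)
  also have "card ?V \<le> n + 1" using card_image_le[of "{..n}" "\<lambda>k. (2 * real k - real n) / real n"] by simp
  then have "real (card ?V ^ N) \<le> real (n + 1) ^ N" by (simp add: power_mono del: of_nat_add)
  finally show ?thesis .
qed

abbreviation replica_avg :: "nat => nat => 'a => ((nat => nat => real) => real) => real" where
  "replica_avg n N w \<equiv> gibbs (tuples N n) (\<lambda>\<psi>. \<Sum>l<n. H N w (\<psi> l))"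

lemma replica_avg_barycentre:
  assumes n: "1 \<le> n" shows "replica_avg n N w (\<lambda>\<psi>. barycentre n \<psi> i) = mag N w i"
  unfolding barycentre_def gibbs_divide gibbs_sum tuples_def mag_avg
  using n by (simp add: gibbs_replica_marginal[where f = "\<lambda>\<sigma>. \<sigma> i"])

section \<open>The energy of the barycentre\<close>

text \<open>All but a fraction \<open>p\<^sup>2 / n\<close> of the maps from the \<open>p\<close> slots of the multilinear form to
  the \<open>n\<close> replicas are injective, and injective maps contribute exactly the energy of the
  magnetization.\<close>

lemma card_noninjective:
  "real (card {\<phi> \<in> {..<p} \<rightarrow>\<^sub>E {..<n}. \<not> inj_on \<phi> {..<p}}) \<le> real p ^ 2 * real n ^ (p - 1)"
proof -
  let ?E = "\<lambda>(a, b). {\<phi> \<in> {..<p} \<rightarrow>\<^sub>E {..<n}. a \<noteq> b \<and> \<phi> a = \<phi> b}"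
  have fin: "finite ({..<p} \<rightarrow>\<^sub>E {..<n})" by (intro finite_PiE) auto
  have E: "card (?E (a, b)) \<le> n ^ (p - 1)" if ab: "a < p" "b < p" for a b
  proof (cases "a = b")
    case False
    let ?r = "\<lambda>\<phi>. restrict \<phi> ({..<p} - {b})"
    have "inj_on ?r (?E (a, b))"
    proof (rule inj_onI)
      fix \<phi> \<phi>' assume *: "\<phi> \<in> ?E (a, b)" "\<phi>' \<in> ?E (a, b)" "?r \<phi> = ?r \<phi>'"
      have eq: "\<phi> k = \<phi>' k" if "k < p" "k \<noteq> b" for k
        using fun_cong[OF *(3), of k] that by simp
      have "\<phi> b = \<phi>' b" using eq[of a] ab False *(1,2) by auto
      then have "\<phi> k = \<phi>' k" if "k < p" for k using eq that by (cases "k = b") auto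
      moreover have "\<phi> k = \<phi>' k" if "\<not> k < p" for k using *(1,2) that by (auto simp: PiE_def extensional_def)
      ultimately show "\<phi> = \<phi>'" by blast
    qed
    moreover have "?r ` ?E (a, b) \<subseteq> ({..<p} - {b}) \<rightarrow>\<^sub>E {..<n}"
    proof
      fix \<phi>' assume "\<phi>' \<in> ?r ` ?E (a, b)"
      then obtain \<phi> where \<phi>: "\<phi> \<in> {..<p} \<rightarrow>\<^sub>E {..<n}" "\<phi>' = ?r \<phi>" by blast
      show "\<phi>' \<in> ({..<p} - {b}) \<rightarrow>\<^sub>E {..<n}"
        unfolding \<phi>(2) restrict_PiE_iff using PiE_mem[OF \<phi>(1)] by blast
    qed
    moreover have "finite (({..<p} - {b}) \<rightarrow>\<^sub>E {..<n})" by (intro finite_PiE) auto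
    ultimately have "card (?E (a, b)) \<le> card (({..<p} - {b}) \<rightarrow>\<^sub>E {..<n})" by (rule card_inj_on_le)
    also have "\<dots> = n ^ (p - 1)" using ab by (simp add: card_PiE)
    finally show ?thesis .
  qed simp
  have "{\<phi> \<in> {..<p} \<rightarrow>\<^sub>E {..<n}. \<not> inj_on \<phi> {..<p}} \<subseteq> (\<Union>ab\<in>{..<p} \<times> {..<p}. ?E ab)"
    by (auto simp: inj_on_def)
  then have "card {\<phi> \<in> {..<p} \<rightarrow>\<^sub>E {..<n}. \<not> inj_on \<phi> {..<p}} \<le> card (\<Union>ab\<in>{..<p} \<times> {..<p}. ?E ab)"
    by (rule card_mono[rotated]) (rule finite_UN_I, auto intro: finite_subset[OF _ fin])
  also have "\<dots> \<le> (\<Sum>ab\<in>{..<p} \<times> {..<p}. card (?E ab))" by (rule card_UN_le) simp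
  also have "\<dots> \<le> (\<Sum>ab\<in>{..<p} \<times> {..<p}. n ^ (p - 1))" by (rule sum_mono) (use E in auto)
  also have "\<dots> = p ^ 2 * n ^ (p - 1)" by (simp add: power2_eq_square)
  finally have "real (card {\<phi> \<in> {..<p} \<rightarrow>\<^sub>E {..<n}. \<not> inj_on \<phi> {..<p}}) \<le> real (p ^ 2 * n ^ (p - 1))"
    by (rule of_nat_mono)
  then show ?thesis by simp
qed

lemma barycentre_multilinear:
  assumes n: "1 \<le> n"
  shows "multilinear N p (\<lambda>_. barycentre n \<psi>) w
    = (\<Sum>\<phi>\<in>{..<p} \<rightarrow>\<^sub>E {..<n}. multilinear N p (\<lambda>k. \<psi> (\<phi> k)) w) / real n ^ p"
proof -
  have "(\<Prod>k<p. barycentre n \<psi> (js ! k)) = (\<Sum>\<phi>\<in>{..<p} \<rightarrow>\<^sub>E {..<n}. \<Prod>k<p. \<psi> (\<phi> k) (js ! k)) / real n ^ p" for js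
  proof -
    have "(\<Prod>k<p. barycentre n \<psi> (js ! k)) = (\<Prod>k<p. \<Sum>l<n. \<psi> l (js ! k)) / real n ^ p"
      by (simp add: barycentre_def prod_dividef)
    also have "(\<Prod>k<p. \<Sum>l<n. \<psi> l (js ! k)) = (\<Sum>\<phi>\<in>{..<p} \<rightarrow>\<^sub>E {..<n}. \<Prod>k<p. \<psi> (\<phi> k) (js ! k))"
      by (rule prod_sum_PiE) auto
    finally show ?thesis .
  qed
  then have "multilinear N p (\<lambda>_. barycentre n \<psi>) w = (\<Sum>js\<in>multi_indices N p. \<Sum>\<phi>\<in>{..<p} \<rightarrow>\<^sub>E {..<n}.
      multilinear_coeff N p (\<lambda>k. \<psi> (\<phi> k)) js * g js w) / real n ^ p"
    by (simp add: multilinear_def multilinear_coeff_def sum_distrib_left sum_distrib_right sum_divide_distrib mult_ac)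
  then show ?thesis unfolding multilinear_def by (subst sum.swap)
qed

lemma replica_avg_injective:
  assumes \<phi>: "\<phi> \<in> {..<p} \<rightarrow>\<^sub>E {..<n}" and inj: "inj_on \<phi> {..<p}"
  shows "replica_avg n N w (\<lambda>\<psi>. multilinear N p (\<lambda>k. \<psi> (\<phi> k)) w) = multilinear N p (\<lambda>_. mag N w) w"
proof -
  have im: "\<phi> ` {..<p} \<subseteq> {..<n}" using \<phi> by auto
  have key: "replica_avg n N w (\<lambda>\<psi>. \<Prod>k<p. \<psi> (\<phi> k) (js ! k)) = (\<Prod>k<p. mag N w (js ! k))" for js
  proof -
    let ?i = "the_inv_into {..<p} \<phi>"
    define f :: "nat => (nat => real) => real" where
      "f l \<sigma> = (if l \<in> \<phi> ` {..<p} then \<sigma> (js ! ?i l) else 1)" for l \<sigma>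
    have tr: "(\<Prod>l<n. F l) = (\<Prod>k<p. F (\<phi> k))" if "\<And>l. l \<notin> \<phi> ` {..<p} ==> F l = 1" for F :: "nat => real"
    proof -
      have "(\<Prod>l<n. F l) = (\<Prod>l\<in>\<phi> ` {..<p}. F l)" by (rule prod.mono_neutral_right) (use im that in auto)
      also have "\<dots> = (\<Prod>k<p. F (\<phi> k))" by (simp add: prod.reindex[OF inj])
      finally show ?thesis .
    qed
    have "(\<Prod>k<p. \<psi> (\<phi> k) (js ! k)) = (\<Prod>l<n. f l (\<psi> l))" for \<psi>
      by (subst tr) (auto simp: f_def the_inv_into_f_f[OF inj] intro!: prod.cong)
    moreover have "(\<Prod>l<n. avg N w (f l)) = (\<Prod>k<p. mag N w (js ! k))"
    proof (subst tr)
      show "avg N w (f l) = 1" if "l \<notin> \<phi> ` {..<p}" for l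
      proof -
        have "f l = (\<lambda>_. 1)" using that by (simp add: f_def fun_eq_iff)
        then show ?thesis by (simp add: avg_const)
      qed
      show "(\<Prod>k<p. avg N w (f (\<phi> k))) = (\<Prod>k<p. mag N w (js ! k))"
      proof (rule prod.cong[OF refl])
        fix k assume "k \<in> {..<p}"
        then have "f (\<phi> k) = (\<lambda>\<sigma>. \<sigma> (js ! k))" by (simp add: f_def fun_eq_iff the_inv_into_f_f[OF inj])
        then show "avg N w (f (\<phi> k)) = mag N w (js ! k)" by (simp add: mag_avg)
      qed
    qed
    ultimately show ?thesis
      using gibbs_replicas[of "spin_configs N" n "H N w" f] by (simp add: tuples_def)
  qed
  show ?thesis
    unfolding multilinear_def gibbs_sum
  proof (rule sum.cong[OF refl])
    fix js
    have "replica_avg n N w (\<lambda>\<psi>. multilinear_coeff N p (\<lambda>k. \<psi> (\<phi> k)) js * g js w)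
      = \<beta> p / real N powr ((real p - 1) / 2) * replica_avg n N w (\<lambda>\<psi>. \<Prod>k<p. \<psi> (\<phi> k) (js ! k)) * g js w"
      unfolding multilinear_coeff_def gibbs_mult_right gibbs_mult ..
    then show "replica_avg n N w (\<lambda>\<psi>. multilinear_coeff N p (\<lambda>k. \<psi> (\<phi> k)) js * g js w)
      = multilinear_coeff N p (\<lambda>_. mag N w) js * g js w"
      by (simp add: key multilinear_coeff_def)
  qed
qed

lemma multilinear_restrict:
  "multilinear N p (\<lambda>k\<in>{..<p}. \<psi> k) w = multilinear N p \<psi> w"
  by (simp add: multilinear_def multilinear_coeff_def)

text \<open>Averaging over replicas factorizes along an injective assignment of replicas to slots and gives
  the energy of the magnetization; the noninjective ones are bounded trivially by the supremum.\<close>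

lemma barycentre_level_energy:
  assumes n: "1 \<le> n" and p: "1 \<le> p"
  shows "\<bar>replica_avg n N w (\<lambda>\<psi>. pure_hamiltonian \<beta> (G w) N p (barycentre n \<psi>))
     - pure_hamiltonian \<beta> (G w) N p (mag N w)\<bar> \<le> 2 * real p ^ 2 / real n * form_sup N p w"
proof -
  let ?\<Phi> = "{..<p} \<rightarrow>\<^sub>E {..<n}" and ?B = "replica_avg n N w"
  let ?m = "multilinear N p (\<lambda>_. mag N w) w"
  let ?d = "\<lambda>\<phi>. ?B (\<lambda>\<psi>. multilinear N p (\<lambda>k. \<psi> (\<phi> k)) w) - ?m"
  have fin: "finite ?\<Phi>" by (intro finite_PiE) auto
  have card: "real (card ?\<Phi>) = real n ^ p" by (simp add: card_PiE)
  have np: "0 < real n ^ p" using n by simp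
  have m: "\<bar>?m\<bar> \<le> form_sup N p w"
    using pure_hamiltonian_le_form_sup[OF spin_average_mag] by (simp add: pure_hamiltonian_multilinear)
  have d: "\<bar>?d \<phi>\<bar> \<le> 2 * form_sup N p w" if \<phi>: "\<phi> \<in> ?\<Phi>" for \<phi>
  proof -
    have "\<bar>?B (\<lambda>\<psi>. multilinear N p (\<lambda>k. \<psi> (\<phi> k)) w)\<bar> \<le> form_sup N p w"
    proof (rule gibbs_abs_le[OF finite_tuples tuples_nonempty])
      fix \<psi> assume "\<psi> \<in> tuples N n"
      then have "(\<lambda>k\<in>{..<p}. \<psi> (\<phi> k)) \<in> tuples N p"
        using \<phi> by (auto simp: tuples_def[of N p] intro!: tuples_mem)
      from multilinear_le_form_sup[OF this, of w]
      show "\<bar>multilinear N p (\<lambda>k. \<psi> (\<phi> k)) w\<bar> \<le> form_sup N p w" by (simp add: multilinear_restrict)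
    qed
    then show ?thesis using m by linarith
  qed
  let ?N = "{\<phi>\<in>?\<Phi>. \<not> inj_on \<phi> {..<p}}"
  have "?B (\<lambda>\<psi>. multilinear N p (\<lambda>_. barycentre n \<psi>) w) = (\<Sum>\<phi>\<in>?\<Phi>. ?B (\<lambda>\<psi>. multilinear N p (\<lambda>k. \<psi> (\<phi> k)) w)) / real n ^ p"
    unfolding barycentre_multilinear[OF n] gibbs_divide gibbs_sum ..
  then have diff: "?B (\<lambda>\<psi>. multilinear N p (\<lambda>_. barycentre n \<psi>) w) - ?m = (\<Sum>\<phi>\<in>?\<Phi>. ?d \<phi>) / real n ^ p"
    using np card by (simp add: sum_subtractf diff_divide_distrib)
  have noninj: "(\<Sum>\<phi>\<in>?\<Phi>. ?d \<phi>) = (\<Sum>\<phi>\<in>?N. ?d \<phi>)"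
  proof (rule sum.mono_neutral_right[OF fin])
    show "\<forall>\<phi>\<in>?\<Phi> - ?N. ?d \<phi> = 0"
    proof
      fix \<phi> assume "\<phi> \<in> ?\<Phi> - ?N"
      then have "\<phi> \<in> ?\<Phi>" "inj_on \<phi> {..<p}" by blast+
      from replica_avg_injective[OF this] show "?d \<phi> = 0" by simp
    qed
  qed blast
  have "\<bar>\<Sum>\<phi>\<in>?N. ?d \<phi>\<bar> \<le> (\<Sum>\<phi>\<in>?N. 2 * form_sup N p w)"
    by (rule order_trans[OF sum_abs], rule sum_mono, rule d) blast
  also have "\<dots> = real (card ?N) * (2 * form_sup N p w)" by (rule sum_constant)
  also have "\<dots> \<le> (real p ^ 2 * real n ^ (p - 1)) * (2 * form_sup N p w)"
    using form_sup_nonneg[of N p w] by (intro mult_right_mono card_noninjective) simp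
  finally have "\<bar>\<Sum>\<phi>\<in>?N. ?d \<phi>\<bar> / real n ^ p \<le> (real p ^ 2 * real n ^ (p - 1)) * (2 * form_sup N p w) / real n ^ p"
    using np by (intro divide_right_mono) auto
  also have "\<dots> = 2 * real p ^ 2 / real n * form_sup N p w"
    using n p power_Suc[of "real n" "p - 1"] by (simp add: field_simps)
  finally have "\<bar>?B (\<lambda>\<psi>. multilinear N p (\<lambda>_. barycentre n \<psi>) w) - ?m\<bar> \<le> 2 * real p ^ 2 / real n * form_sup N p w"
    unfolding diff noninj using np by (simp add: abs_divide)
  then show ?thesis by (simp add: pure_hamiltonian_multilinear)
qed

end

lemma tap_correction_eq:
  assumes "mixture \<beta>" "0 \<le> u" "u \<le> 1"
  shows "tap_correction \<beta> u = (xi \<beta> 1 - xi \<beta> u - mixture.dxi \<beta> u * (1 - u)) / 2"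
  using mixture.deriv_xi[OF assms(1), of u] assms by (simp add: tap_correction_def)

context mixture
begin

lemma tap_correction_lipschitz:
  assumes "0 \<le> u" "u \<le> 1" "0 \<le> q" "q \<le> 1"
  shows "\<bar>tap_correction \<beta> u - tap_correction \<beta> q\<bar> \<le> (dxi 1 + ddxi 1) * \<bar>u - q\<bar>"
proof -
  have tri: "\<bar>- A / 2 - B / 2 + C / 2\<bar> \<le> \<bar>A\<bar> / 2 + \<bar>B\<bar> / 2 + \<bar>C\<bar> / 2" for A B C :: real
    by linarith
  have "tap_correction \<beta> u - tap_correction \<beta> q
      = - (xi \<beta> u - xi \<beta> q) / 2 - (dxi u - dxi q) * (1 - u) / 2 + dxi q * (u - q) / 2"
    using assms by (simp add: tap_correction_eq mixture_axioms field_simps)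
  also have "\<bar>\<dots>\<bar> \<le> \<bar>xi \<beta> u - xi \<beta> q\<bar> / 2 + \<bar>(dxi u - dxi q) * (1 - u)\<bar> / 2 + \<bar>dxi q * (u - q)\<bar> / 2"
    by (rule tri)
  also have "\<dots> \<le> dxi 1 * \<bar>u - q\<bar> / 2 + (ddxi 1 * \<bar>u - q\<bar>) * 1 / 2 + dxi 1 * \<bar>u - q\<bar> / 2"
    unfolding abs_mult using assms
    by (intro add_mono divide_right_mono mult_mono xi_lipschitz dxi_lipschitz dxi_abs_le)
      (auto simp: dxi_nonneg ddxi_nonneg)
  also have "\<dots> \<le> (dxi 1 + ddxi 1) * \<bar>u - q\<bar>"
    using mult_nonneg_nonneg[OF ddxi_nonneg[of 1] abs_ge_zero[of "u - q"]] by (simp add: field_simps)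
  finally show ?thesis .
qed

end

context spin_glass
begin

definition tap_gap :: "nat => 'a => real" where
  "tap_gap N w = tap_free_energy \<beta> h (G w) N (mag N w) - free_energy \<beta> h (G w) N"

definition overlap_dev :: "real => nat => 'a => real" where
  "overlap_dev q N w = avg N w (\<lambda>\<sigma>. avg N w (\<lambda>\<tau>. \<bar>overlap N \<sigma> \<tau> - q\<bar>))"

lemma measurable_overlap_dev [measurable]: "overlap_dev q N \<in> borel_measurable M"
  unfolding overlap_dev_def by measurable

lemma overlap_dev_nonneg: "0 \<le> overlap_dev q N w"
  unfolding overlap_dev_def by (intro avg_nonneg) auto

lemma overlap_mag: "avg N w (\<lambda>\<sigma>. avg N w (\<lambda>\<tau>. overlap N \<sigma> \<tau>)) = overlap N (mag N w) (mag N w)"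
  unfolding overlap_def gibbs_divide gibbs_sum gibbs_mult gibbs_mult_right mag_avg ..

lemma overlap_mag_dev: "\<bar>overlap N (mag N w) (mag N w) - q\<bar> \<le> overlap_dev q N w"
proof -
  have eq: "overlap N (mag N w) (mag N w) - q = avg N w (\<lambda>\<sigma>. avg N w (\<lambda>\<tau>. overlap N \<sigma> \<tau> - q))"
    by (simp only: overlap_mag[symmetric] gibbs_diff avg_const)
  have "\<bar>avg N w (\<lambda>\<sigma>. avg N w (\<lambda>\<tau>. overlap N \<sigma> \<tau> - q))\<bar>
      \<le> avg N w (\<lambda>\<sigma>. \<bar>avg N w (\<lambda>\<tau>. overlap N \<sigma> \<tau> - q)\<bar>)" by (rule avg_abs)
  also have "\<dots> \<le> overlap_dev q N w" unfolding overlap_dev_def by (rule avg_mono) (rule avg_abs)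
  finally show ?thesis unfolding eq .
qed

lemma self_overlap_unit: "0 \<le> overlap N (mag N w) (mag N w)" "overlap N (mag N w) (mag N w) \<le> 1"
  using abs_le_D1[OF in_cube_overlap[OF mag_in_cube mag_in_cube, of N w w]]
  by (auto simp: overlap_def intro!: divide_nonneg_nonneg sum_nonneg)

section \<open>The variance of the replicated field\<close>

definition replica_variance :: "nat => nat => (nat => nat => real) => real" where
  "replica_variance n N \<psi> = (\<Sum>l<n. \<Sum>k<n. xi \<beta> (overlap N (\<psi> l) (\<psi> k)))
     - 2 * real n * (\<Sum>l<n. xi \<beta> (overlap N (\<psi> l) (barycentre n \<psi>)))
     + (real n)\<^sup>2 * xi \<beta> (overlap N (barycentre n \<psi>) (barycentre n \<psi>))"

lemma overlap_commute: "overlap N a b = overlap N b a"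
  by (simp add: overlap_def mult.commute)

lemma replica_field_exp:
  assumes N: "1 \<le> N" and n: "1 \<le> n" and \<psi>: "\<psi> \<in> tuples N n"
  shows "integrable M (\<lambda>w. exp ((\<Sum>l<n. X N (\<psi> l) w) - real n * X N (barycentre n \<psi>) w))" (is ?one)
    and "(\<integral>w. exp ((\<Sum>l<n. X N (\<psi> l) w) - real n * X N (barycentre n \<psi>) w) \<partial>M)
      = exp (real N * replica_variance n N \<psi> / 2)"
proof -
  define a where "a t = (if t < n then \<psi> t else barycentre n \<psi>)" for t
  define c where "c t = (if t < n then 1 else - real n)" for t
  have cube: "in_cube N (a t)" for t
    using spin_configs_in_cube[OF tuples_mem[OF \<psi>]] spin_average_in_cube[OF barycentre_spin_average[OF \<psi> n]]
    by (auto simp: a_def)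
  have sum: "(\<Sum>t\<le>n. f t) = (\<Sum>t<n. f t) + f n" for f :: "nat => real"
    by (simp add: lessThan_Suc_atMost[symmetric])
  have v: "(\<Sum>t\<le>n. \<Sum>s\<le>n. c t * c s * xi \<beta> (overlap N (a t) (a s))) = replica_variance n N \<psi>"
    unfolding sum replica_variance_def
    by (simp add: a_def c_def sum.distrib sum_subtractf sum_negf sum_distrib_left[symmetric]
        overlap_commute[of N "barycentre n \<psi>" "\<psi> _"] power2_eq_square algebra_simps)
  have eq: "(\<Sum>t\<le>n. c t * X N (a t) w) = (\<Sum>l<n. X N (\<psi> l) w) - real n * X N (barycentre n \<psi>) w" for w
    unfolding sum by (simp add: a_def c_def)
  have "gaussian_rv M (\<lambda>w. (\<Sum>l<n. X N (\<psi> l) w) - real n * X N (barycentre n \<psi>) w) (real N * replica_variance n N \<psi>)"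
    using gaussian_field_combination[OF N, of "{..n}" a c] cube by (simp only: eq v) simp
  from gaussian_rv_exp[OF this, of 1]
  show ?one
    and "(\<integral>w. exp ((\<Sum>l<n. X N (\<psi> l) w) - real n * X N (barycentre n \<psi>) w) \<partial>M)
      = exp (real N * replica_variance n N \<psi> / 2)" by simp_all
qed

text \<open>If all overlaps of distinct replicas were equal to \<open>q\<close>, the variance would be \<open>n\<close> times
  \<open>\<xi>(1) - \<xi>(q)\<close> minus the increment of \<open>n\<^sup>2 \<xi>\<close> from \<open>q\<close> to \<open>q + (1 - q) / n\<close>, and convexity
  bounds that increment from below by \<open>n \<xi>'(q) (1 - q)\<close>: this is where the Onsager correction
  comes from.\<close>

lemma replica_variance_le:
  assumes N: "1 \<le> N" and n: "1 \<le> n" and \<psi>: "\<psi> \<in> tuples N n" and q: "0 \<le> q" "q \<le> 1"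
  shows "replica_variance n N \<psi> \<le> 2 * real n * tap_correction \<beta> q
    + 4 * dxi 1 * (\<Sum>l<n. \<Sum>k\<in>{..<n} - {l}. \<bar>overlap N (\<psi> l) (\<psi> k) - q\<bar>)"
proof -
  let ?R = "\<lambda>l k. overlap N (\<psi> l) (\<psi> k)" and ?b = "barycentre n \<psi>"
  define e where "e l = (\<Sum>k\<in>{..<n} - {l}. \<bar>?R l k - q\<bar>)" for l
  define E where "E = (\<Sum>l<n. e l)"
  \<comment> \<open>The overlap of a replica with the barycentre when all overlaps of distinct replicas equal \<open>q\<close>.\<close>
  define r where "r = q + (1 - q) / real n"
  have r: "0 \<le> r" "r \<le> 1"
  proof -
    have "(1 - q) / real n \<le> (1 - q) / 1" using n q by (intro divide_left_mono) auto
    then show "0 \<le> r" "r \<le> 1" using n q by (auto simp: r_def)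
  qed
  have nr: "real n * r = real (n - 1) * q + 1" using n by (simp add: r_def field_simps of_nat_diff)
  have d: "0 \<le> dxi 1" by (rule dxi_nonneg) auto
  have S: "\<psi> l \<in> spin_configs N" if "l < n" for l by (rule tuples_mem[OF \<psi> that])
  have cb: "in_cube N ?b" by (rule spin_average_in_cube[OF barycentre_spin_average[OF \<psi> n]])
  have R1: "\<bar>?R l k\<bar> \<le> 1" if "l < n" "k < n" for l k using spins_overlap[OF S[OF that(1)] S[OF that(2)]] .
  have Rb: "\<bar>overlap N (\<psi> l) ?b\<bar> \<le> 1" if "l < n" for l
    by (rule in_cube_overlap[OF spin_configs_in_cube[OF S[OF that]] cb])
  have split: "(\<Sum>k<n. f k) = f l + (\<Sum>k\<in>{..<n} - {l}. f k)" if "l < n" for f :: "nat => real" and l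
    using that by (subst sum.remove[of _ l]) auto
  have cardl: "card ({..<n} - {l}) = n - 1" if "l < n" for l using that by simp
  have lin: "overlap N a ?b = (\<Sum>k<n. overlap N a (\<psi> k)) / real n" for a
  proof -
    have "(\<Sum>i=1..N. a i * ?b i) = (\<Sum>k<n. \<Sum>i=1..N. a i * \<psi> k i) / real n"
      unfolding barycentre_def
      by (subst sum.swap) (simp add: sum_distrib_left sum_divide_distrib)
    then show ?thesis unfolding overlap_def sum_divide_distrib[symmetric]
      by (simp only: divide_divide_eq_left mult.commute)
  qed
  have 1: "(\<Sum>k<n. xi \<beta> (?R l k)) \<le> xi \<beta> 1 + real (n - 1) * xi \<beta> q + dxi 1 * e l" if l: "l < n" for l
  proof -
    have "(\<Sum>k\<in>{..<n} - {l}. xi \<beta> (?R l k)) \<le> (\<Sum>k\<in>{..<n} - {l}. xi \<beta> q + dxi 1 * \<bar>?R l k - q\<bar>)"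
    proof (rule sum_mono)
      fix k assume "k \<in> {..<n} - {l}"
      then have "\<bar>xi \<beta> (?R l k) - xi \<beta> q\<bar> \<le> dxi 1 * \<bar>?R l k - q\<bar>" using R1 l q by (intro xi_lipschitz) auto
      then show "xi \<beta> (?R l k) \<le> xi \<beta> q + dxi 1 * \<bar>?R l k - q\<bar>" by linarith
    qed
    then show ?thesis
      using l by (simp add: split[OF l, of "\<lambda>k. xi \<beta> (?R l k)"] overlap_self[OF S[OF l] N] sum.distrib
          e_def sum_distrib_left[symmetric])
  qed
  have dev: "\<bar>real n * (overlap N (\<psi> l) ?b - r)\<bar> \<le> e l" if l: "l < n" for l
  proof -
    have "real n * overlap N (\<psi> l) ?b = 1 + (\<Sum>k\<in>{..<n} - {l}. ?R l k)"
      using n by (simp add: lin split[OF l, of "?R l"] overlap_self[OF S[OF l] N])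
    then have "real n * (overlap N (\<psi> l) ?b - r) = (\<Sum>k\<in>{..<n} - {l}. ?R l k - q)"
      using l by (simp add: right_diff_distrib nr sum_subtractf)
    then show ?thesis unfolding e_def by (simp only: sum_abs)
  qed
  have 2: "real n * xi \<beta> r - dxi 1 * e l \<le> real n * xi \<beta> (overlap N (\<psi> l) ?b)" if l: "l < n" for l
  proof -
    have "\<bar>xi \<beta> (overlap N (\<psi> l) ?b) - xi \<beta> r\<bar> \<le> dxi 1 * \<bar>overlap N (\<psi> l) ?b - r\<bar>"
      using Rb[OF l] r by (intro xi_lipschitz) auto
    then have "real n * \<bar>xi \<beta> (overlap N (\<psi> l) ?b) - xi \<beta> r\<bar> \<le> real n * (dxi 1 * \<bar>overlap N (\<psi> l) ?b - r\<bar>)"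
      by (intro mult_left_mono) auto
    also have "\<dots> = dxi 1 * \<bar>real n * (overlap N (\<psi> l) ?b - r)\<bar>" by (simp add: abs_mult)
    also have "\<dots> \<le> dxi 1 * e l" by (intro mult_left_mono dev l d)
    finally have "\<bar>real n * xi \<beta> (overlap N (\<psi> l) ?b) - real n * xi \<beta> r\<bar> \<le> dxi 1 * e l"
      by (simp add: right_diff_distrib[symmetric] abs_mult)
    then show ?thesis by linarith
  qed
  have 3: "(real n)\<^sup>2 * xi \<beta> (overlap N ?b ?b) \<le> (real n)\<^sup>2 * xi \<beta> r + dxi 1 * E"
  proof -
    have nb: "real n * overlap N ?b ?b = (\<Sum>l<n. overlap N (\<psi> l) ?b)"
    proof -
      have "real n * overlap N ?b ?b = (\<Sum>l<n. overlap N ?b (\<psi> l))"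
        using n by (subst lin) simp
      then show ?thesis by (simp only: overlap_commute[of N ?b "\<psi> _"])
    qed
    have "(\<Sum>l<n. real n * (overlap N (\<psi> l) ?b - r)) = real n * ((\<Sum>l<n. overlap N (\<psi> l) ?b) - real n * r)"
      by (simp add: sum_distrib_left[symmetric] sum_subtractf)
    then have eq: "(real n)\<^sup>2 * (overlap N ?b ?b - r) = (\<Sum>l<n. real n * (overlap N (\<psi> l) ?b - r))"
      unfolding nb[symmetric] by (simp add: power2_eq_square algebra_simps)
    have "\<bar>\<Sum>l<n. real n * (overlap N (\<psi> l) ?b - r)\<bar> \<le> (\<Sum>l<n. \<bar>real n * (overlap N (\<psi> l) ?b - r)\<bar>)"
      by (rule sum_abs)
    also have "\<dots> \<le> E" unfolding E_def by (intro sum_mono dev) auto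
    finally have E: "\<bar>(real n)\<^sup>2 * (overlap N ?b ?b - r)\<bar> \<le> E" unfolding eq .
    have "\<bar>xi \<beta> (overlap N ?b ?b) - xi \<beta> r\<bar> \<le> dxi 1 * \<bar>overlap N ?b ?b - r\<bar>"
      using in_cube_overlap[OF cb cb] r by (intro xi_lipschitz) auto
    then have "(real n)\<^sup>2 * \<bar>xi \<beta> (overlap N ?b ?b) - xi \<beta> r\<bar> \<le> (real n)\<^sup>2 * (dxi 1 * \<bar>overlap N ?b ?b - r\<bar>)"
      by (intro mult_left_mono) auto
    also have "\<dots> = dxi 1 * \<bar>(real n)\<^sup>2 * (overlap N ?b ?b - r)\<bar>" by (simp add: abs_mult)
    also have "\<dots> \<le> dxi 1 * E" by (intro mult_left_mono E d)
    finally have "\<bar>(real n)\<^sup>2 * xi \<beta> (overlap N ?b ?b) - (real n)\<^sup>2 * xi \<beta> r\<bar> \<le> dxi 1 * E"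
      by (simp add: right_diff_distrib[symmetric] abs_mult)
    then show ?thesis by linarith
  qed
  have s1: "(\<Sum>l<n. \<Sum>k<n. xi \<beta> (?R l k)) \<le> real n * (xi \<beta> 1 + real (n - 1) * xi \<beta> q) + dxi 1 * E"
  proof -
    have "(\<Sum>l<n. \<Sum>k<n. xi \<beta> (?R l k)) \<le> (\<Sum>l<n. (xi \<beta> 1 + real (n - 1) * xi \<beta> q) + dxi 1 * e l)"
      by (intro sum_mono 1) auto
    then show ?thesis using n by (simp add: sum.distrib E_def sum_distrib_left[symmetric] of_nat_diff)
  qed
  have s2: "real n * (real n * xi \<beta> r) - dxi 1 * E \<le> real n * (\<Sum>l<n. xi \<beta> (overlap N (\<psi> l) ?b))"
  proof -
    have "(\<Sum>l<n. real n * xi \<beta> r - dxi 1 * e l) \<le> (\<Sum>l<n. real n * xi \<beta> (overlap N (\<psi> l) ?b))"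
      by (intro sum_mono 2) auto
    then show ?thesis by (simp add: sum_subtractf E_def sum_distrib_left[symmetric])
  qed
  have conv: "xi \<beta> q + dxi q * ((1 - q) / real n) \<le> xi \<beta> r"
    using xi_above_tangent[of q r] q r by (simp add: r_def)
  then have "(real n)\<^sup>2 * (xi \<beta> q + dxi q * ((1 - q) / real n)) \<le> (real n)\<^sup>2 * xi \<beta> r"
    by (intro mult_left_mono) auto
  moreover have "(real n)\<^sup>2 * (xi \<beta> q + dxi q * ((1 - q) / real n)) = (real n)\<^sup>2 * xi \<beta> q + real n * (dxi q * (1 - q))"
    using n by (simp add: power2_eq_square field_simps)
  moreover have "replica_variance n N \<psi> \<le> real n * (xi \<beta> 1 + real (n - 1) * xi \<beta> q) + 4 * (dxi 1 * E)
      - (real n)\<^sup>2 * xi \<beta> r"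
    using s1 s2 3 unfolding replica_variance_def by (simp add: power2_eq_square)
  moreover have "real n * (xi \<beta> 1 + real (n - 1) * xi \<beta> q) = real n * xi \<beta> 1 + (real n)\<^sup>2 * xi \<beta> q - real n * xi \<beta> q"
    using n by (simp add: of_nat_diff algebra_simps power2_eq_square)
  moreover have "2 * real n * tap_correction \<beta> q = real n * xi \<beta> 1 - real n * xi \<beta> q - real n * (dxi q * (1 - q))"
    using q by (simp add: tap_correction_eq[OF mixture_axioms] field_simps)
  ultimately have "replica_variance n N \<psi> \<le> 2 * real n * tap_correction \<beta> q + 4 * (dxi 1 * E)" by linarith
  then show ?thesis unfolding E_def e_def by simp
qed

lemma replica_avg_overlap_dev:
  "replica_avg n N w (\<lambda>\<psi>. \<Sum>l<n. \<Sum>k\<in>{..<n} - {l}. \<bar>overlap N (\<psi> l) (\<psi> k) - q\<bar>) \<le> (real n)\<^sup>2 * overlap_dev q N w"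
proof -
  have "replica_avg n N w (\<lambda>\<psi>. \<bar>overlap N (\<psi> l) (\<psi> k) - q\<bar>) = overlap_dev q N w"
    if "l < n" "k < n" "l \<noteq> k" for l k
    unfolding tuples_def overlap_dev_def
    using gibbs_replica_pair[OF finite_spin_configs spin_configs_nonempty that, of N "H N w" "\<lambda>\<sigma> \<tau>. \<bar>overlap N \<sigma> \<tau> - q\<bar>"] .
  then have "replica_avg n N w (\<lambda>\<psi>. \<Sum>l<n. \<Sum>k\<in>{..<n} - {l}. \<bar>overlap N (\<psi> l) (\<psi> k) - q\<bar>)
      = (\<Sum>l<n. \<Sum>k\<in>{..<n} - {l}. overlap_dev q N w)"
    unfolding gibbs_sum by (intro sum.cong refl) auto
  also have "\<dots> \<le> (\<Sum>l<n. \<Sum>k<n. overlap_dev q N w)"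
    using overlap_dev_nonneg by (intro sum_mono sum_mono2) auto
  finally show ?thesis by (simp add: power2_eq_square mult.assoc)
qed

section \<open>The free energy is at most the TAP free energy\<close>

text \<open>The first term replaces the energy of the replicas by that of their barycentre, the second
  compensates the variance of the difference, and the third makes the sum over the tuples finite on the
  exponential scale.\<close>

definition replica_exponent :: "nat => nat => 'a => (nat => nat => real) => real" where
  "replica_exponent n N w \<psi> = - real n * H N w (barycentre n \<psi>) - real N * replica_variance n N \<psi> / 2
     + real n * (\<Sum>i=1..N. entropy_term (barycentre n \<psi> i))"

definition replica_weight :: "nat => nat => 'a => real" where
  "replica_weight n N w = (\<Sum>\<psi>\<in>tuples N n. exp ((\<Sum>l<n. H N w (\<psi> l)) + replica_exponent n N w \<psi>))"

definition replica_log :: "nat => nat => 'a => real" where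
  "replica_log n N w = real n * ln (partition_function \<beta> h (G w) N) + replica_avg n N w (replica_exponent n N w)"

lemma hamiltonian_barycentre:
  assumes n: "1 \<le> n"
  shows "(\<Sum>l<n. H N w (\<psi> l)) - real n * H N w (barycentre n \<psi>)
    = (\<Sum>l<n. X N (\<psi> l) w) - real n * X N (barycentre n \<psi>) w"
proof -
  have "real n * (\<Sum>i=1..N. barycentre n \<psi> i) = (\<Sum>i=1..N. \<Sum>l<n. \<psi> l i)"
    using n by (simp add: barycentre_def sum_divide_distrib[symmetric])
  also have "\<dots> = (\<Sum>l<n. \<Sum>i=1..N. \<psi> l i)" by (rule sum.swap)
  finally show ?thesis
    by (simp add: hamiltonian_def sum.distrib sum_distrib_left[symmetric] algebra_simps)
qed

text \<open>The variance terms cancel exactly in the expectation, and only the entropy weights remain.\<close>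

lemma replica_weight_mean:
  assumes N: "1 \<le> N" and n: "1 \<le> n"
  shows "integrable M (replica_weight n N)" (is ?one) "(\<integral>w. replica_weight n N w \<partial>M) \<le> real (n + 1) ^ N" (is ?two)
proof -
  let ?Y = "\<lambda>\<psi> w. (\<Sum>l<n. X N (\<psi> l) w) - real n * X N (barycentre n \<psi>) w"
  let ?S = "\<lambda>\<psi>. \<Sum>i=1..N. entropy_term (barycentre n \<psi> i)"
  have eq: "replica_weight n N w = (\<Sum>\<psi>\<in>tuples N n. exp (?Y \<psi> w) * (exp (- (real N * replica_variance n N \<psi> / 2)) * exp (real n * ?S \<psi>)))" for w
    unfolding replica_weight_def replica_exponent_def exp_add[symmetric]
    using hamiltonian_barycentre[OF n] by (intro sum.cong refl arg_cong[of _ _ exp]) (simp add: algebra_simps)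
  show ?one
    unfolding eq[abs_def]
    by (intro Bochner_Integration.integrable_sum integrable_mult_left replica_field_exp(1)[OF N n])
  have "(\<integral>w. replica_weight n N w \<partial>M)
      = (\<Sum>\<psi>\<in>tuples N n. \<integral>w. exp (?Y \<psi> w) * (exp (- (real N * replica_variance n N \<psi> / 2)) * exp (real n * ?S \<psi>)) \<partial>M)"
    unfolding eq by (rule Bochner_Integration.integral_sum) (intro integrable_mult_left replica_field_exp(1)[OF N n])
  also have "\<dots> = (\<Sum>\<psi>\<in>tuples N n. exp (real n * ?S \<psi>))"
  proof (rule sum.cong[OF refl])
    fix \<psi> assume "\<psi> \<in> tuples N n"
    then show "(\<integral>w. exp (?Y \<psi> w) * (exp (- (real N * replica_variance n N \<psi> / 2)) * exp (real n * ?S \<psi>)) \<partial>M) = exp (real n * ?S \<psi>)"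
      by (simp add: replica_field_exp(2)[OF N n] exp_minus)
  qed
  also have "\<dots> \<le> real (n + 1) ^ N" by (rule sum_entropy_weights[OF n])
  finally show ?two .
qed

text \<open>Jensen's inequality for the replicated Gibbs measure, with the partition function factored out.\<close>

lemma replica_weight_ge: "exp (replica_log n N w) \<le> replica_weight n N w"
proof -
  let ?Hn = "\<lambda>\<psi>. \<Sum>l<n. H N w (\<psi> l)"
  let ?Z = "partition_function \<beta> h (G w) N"
  have Z: "0 < ?Z" unfolding partition_function_def by (rule partition_pos) auto
  have "?Z ^ n = (\<Prod>l<n. \<Sum>\<sigma>\<in>spin_configs N. exp (H N w \<sigma>))" by (simp add: partition_function_def)
  also have "\<dots> = (\<Sum>\<psi>\<in>tuples N n. exp (?Hn \<psi>))"
    unfolding tuples_def by (subst prod_sum_PiE) (auto simp: exp_sum)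
  finally have Zn: "(\<Sum>\<psi>\<in>tuples N n. exp (?Hn \<psi>)) = ?Z ^ n" by simp
  have "exp (replica_log n N w) = ?Z ^ n * exp (replica_avg n N w (replica_exponent n N w))"
    using Z by (simp add: replica_log_def exp_add exp_of_nat_mult)
  also have "\<dots> \<le> ?Z ^ n * replica_avg n N w (\<lambda>\<psi>. exp (replica_exponent n N w \<psi>))"
    using Z by (intro mult_left_mono gibbs_exp_jensen) auto
  also have "\<dots> = replica_weight n N w"
    using Z by (simp add: gibbs_def Zn replica_weight_def exp_add)
  finally show ?thesis .
qed

definition weighted_sup :: "nat => 'a => real" where
  "weighted_sup N w = (\<Sum>k. real (k + 2) ^ 2 * form_sup N (k + 2) w)"

definition beta_cube_sum :: real where
  "beta_cube_sum = (\<Sum>k. real (k + 2) ^ 3 * \<bar>\<beta> (k + 2)\<bar>)"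

lemma weighted_sup_mean:
  assumes N: "1 \<le> N"
  shows "AE w in M. summable (\<lambda>k. real (k + 2) ^ 2 * form_sup N (k + 2) w)"
    and "integrable M (weighted_sup N)" (is ?two)
    and "(\<integral>w. weighted_sup N w \<partial>M) \<le> 2305 * real N * beta_cube_sum" (is ?three)
proof -
  let ?f = "\<lambda>k w. real (k + 2) ^ 2 * form_sup N (k + 2) w"
  let ?c = "\<lambda>k. 2305 * real N * (real (k + 2) ^ 3 * \<bar>\<beta> (k + 2)\<bar>)"
  have le: "(\<integral>w. ?f k w \<partial>M) \<le> ?c k" for k
  proof -
    have "real (k + 2) ^ 2 * (\<integral>w. form_sup N (k + 2) w \<partial>M) \<le> real (k + 2) ^ 2 * (2305 * (real N * real (k + 2) * \<bar>\<beta> (k + 2)\<bar>))"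
      by (intro mult_left_mono form_sup_mean N) auto
    moreover have "a ^ 2 * (2305 * (b * a * c)) = 2305 * b * (a ^ 3 * c)" for a b c :: real
      by (simp add: power2_eq_square power3_eq_cube)
    ultimately show ?thesis by (simp only: integral_mult_right_zero)
  qed
  note * = AE_summable_of_integrals[of ?f ?c, OF _ _ le summable_mult[OF summable_poly_abs_beta]]
  show "AE w in M. summable (\<lambda>k. ?f k w)"
    by (rule *(1)) (auto simp: form_sup_nonneg intro!: form_sup_mean N)
  show ?two
    unfolding weighted_sup_def by (rule *(2)) (auto simp: form_sup_nonneg intro!: form_sup_mean N)
  have "(\<integral>w. weighted_sup N w \<partial>M) \<le> suminf ?c"
    unfolding weighted_sup_def by (rule *(3)) (auto simp: form_sup_nonneg intro!: form_sup_mean N)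
  also have "suminf ?c = 2305 * real N * beta_cube_sum"
    unfolding beta_cube_sum_def by (rule suminf_mult[OF summable_poly_abs_beta])
  finally show ?three .
qed

text \<open>The factor \<open>p\<^sup>2\<close> comes from the number of pairs of slots that may carry the same replica.\<close>

lemma barycentre_energy:
  assumes n: "1 \<le> n" and tame: "tame N w"
    and wt: "summable (\<lambda>k. real (k + 2) ^ 2 * form_sup N (k + 2) w)"
  shows "replica_avg n N w (\<lambda>\<psi>. X N (barycentre n \<psi>) w) - X N (mag N w) w \<le> 2 / real n * weighted_sup N w"
proof -
  let ?d = "\<lambda>k. replica_avg n N w (\<lambda>\<psi>. pure_hamiltonian \<beta> (G w) N (k + 2) (barycentre n \<psi>))
      - pure_hamiltonian \<beta> (G w) N (k + 2) (mag N w)"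
  have s: "(\<lambda>k. pure_hamiltonian \<beta> (G w) N (k + 2) m) sums X N m w" if "spin_average N m" for m
    unfolding mixed_hamiltonian_def by (rule summable_sums[OF tame_hamiltonian(1)[OF tame that]])
  have "?d sums (replica_avg n N w (\<lambda>\<psi>. X N (barycentre n \<psi>) w) - X N (mag N w) w)"
    unfolding gibbs_def
    by (intro sums_diff sums_divide sums_sum sums_mult s spin_average_mag barycentre_spin_average n)
  moreover have "(\<lambda>k. 2 / real n * (real (k + 2) ^ 2 * form_sup N (k + 2) w)) sums (2 / real n * weighted_sup N w)"
    unfolding weighted_sup_def by (intro sums_mult summable_sums[OF wt])
  moreover have "?d k \<le> 2 / real n * (real (k + 2) ^ 2 * form_sup N (k + 2) w)" for k
    using abs_le_D1[OF barycentre_level_energy[OF n, of "k + 2" N w]] by simp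
  ultimately show ?thesis by (rule sums_le[rotated])
qed

lemma tap_gap_lower_pathwise:
  assumes N: "1 \<le> N" and n: "1 \<le> n" and q: "0 \<le> q" "q \<le> 1" and tame: "tame N w"
    and wt: "summable (\<lambda>k. real (k + 2) ^ 2 * form_sup N (k + 2) w)"
  shows "- tap_gap N w \<le> replica_log n N w / (real n * real N) + 2 * weighted_sup N w / (real n * real N)
    + (2 * dxi 1 * real n + (dxi 1 + ddxi 1)) * overlap_dev q N w"
proof -
  let ?B = "replica_avg n N w" and ?Z = "partition_function \<beta> h (G w) N" and ?m = "mag N w"
  let ?r = "overlap_dev q N w" and ?u = "overlap N (mag N w) (mag N w)"
  let ?V = "?B (replica_variance n N)"
  let ?E = "?B (\<lambda>\<psi>. \<Sum>i=1..N. entropy_term (barycentre n \<psi> i))" and ?I = "\<Sum>i=1..N. entropy_term (?m i)"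
  let ?X = "?B (\<lambda>\<psi>. X N (barycentre n \<psi>) w)" and ?h = "h * (\<Sum>i=1..N. ?m i)"
  note tup = finite_tuples[of N n] tuples_nonempty[of N n]
  have nN: "0 < real n * real N" using n N by simp
  have HB: "?B (\<lambda>\<psi>. H N w (barycentre n \<psi>)) = ?X + ?h"
  proof -
    have "?B (\<lambda>\<psi>. H N w (barycentre n \<psi>)) = ?B (\<lambda>\<psi>. X N (barycentre n \<psi>) w + h * (\<Sum>i=1..N. barycentre n \<psi> i))"
      by (rule gibbs_cong) (simp_all add: hamiltonian_def)
    then show ?thesis by (simp only: gibbs_add gibbs_mult gibbs_sum replica_avg_barycentre[OF n])
  qed
  have L: "replica_log n N w = real n * ln ?Z - real n * (?X + ?h) - real N * ?V / 2 + real n * ?E"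
    unfolding replica_log_def replica_exponent_def HB[symmetric]
    by (simp only: gibbs_add gibbs_diff gibbs_mult gibbs_divide)
  have T: "- tap_gap N w * (real n * real N)
      = real n * ln ?Z - real n * (X N ?m w + ?h) + real n * ?I - real n * real N * tap_correction \<beta> ?u"
    using N n by (simp add: tap_gap_def tap_free_energy_def free_energy_def hamiltonian_def overlap_def
        power2_eq_square field_simps)
  have V: "?V \<le> 2 * real n * tap_correction \<beta> q + 4 * dxi 1 * ((real n)\<^sup>2 * ?r)"
  proof -
    have "?V \<le> ?B (\<lambda>\<psi>. 2 * real n * tap_correction \<beta> q
        + 4 * dxi 1 * (\<Sum>l<n. \<Sum>k\<in>{..<n} - {l}. \<bar>overlap N (\<psi> l) (\<psi> k) - q\<bar>))"
      by (rule gibbs_mono[OF tup]) (rule replica_variance_le[OF N n _ q])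
    also have "\<dots> = 2 * real n * tap_correction \<beta> q
        + 4 * dxi 1 * ?B (\<lambda>\<psi>. \<Sum>l<n. \<Sum>k\<in>{..<n} - {l}. \<bar>overlap N (\<psi> l) (\<psi> k) - q\<bar>)"
      by (simp only: gibbs_add gibbs_mult gibbs_const[OF tup])
    also have "\<dots> \<le> 2 * real n * tap_correction \<beta> q + 4 * dxi 1 * ((real n)\<^sup>2 * ?r)"
      using dxi_nonneg[of 1] by (intro add_left_mono mult_left_mono replica_avg_overlap_dev) auto
    finally show ?thesis .
  qed
  have I: "?I \<le> ?E"
    unfolding gibbs_sum
  proof (rule sum_mono)
    fix i assume i: "i \<in> {1..N}"
    have "entropy_term (?B (\<lambda>\<psi>. barycentre n \<psi> i)) \<le> ?B (\<lambda>\<psi>. entropy_term (barycentre n \<psi> i))"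
    proof (rule entropy_term_jensen[OF tup])
      fix \<psi> assume "\<psi> \<in> tuples N n"
      from spin_average_in_cube[OF barycentre_spin_average[OF this n]]
      show "\<bar>barycentre n \<psi> i\<bar> \<le> 1" using i by (simp add: in_cube_def)
    qed
    then show "entropy_term (?m i) \<le> ?B (\<lambda>\<psi>. entropy_term (barycentre n \<psi> i))"
      by (simp add: replica_avg_barycentre[OF n])
  qed
  have XB: "real n * (?X - X N ?m w) \<le> 2 * weighted_sup N w"
  proof -
    have "real n * (?X - X N ?m w) \<le> real n * (2 / real n * weighted_sup N w)"
      by (intro mult_left_mono barycentre_energy n tame wt) auto
    then show ?thesis using n by simp
  qed
  have C: "tap_correction \<beta> q \<le> tap_correction \<beta> ?u + (dxi 1 + ddxi 1) * ?r"
  proof -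
    have "\<bar>tap_correction \<beta> ?u - tap_correction \<beta> q\<bar> \<le> (dxi 1 + ddxi 1) * \<bar>?u - q\<bar>"
      using q self_overlap_unit by (intro tap_correction_lipschitz) auto
    also have "\<dots> \<le> (dxi 1 + ddxi 1) * ?r"
      using dxi_nonneg[of 1] ddxi_nonneg[of 1] by (intro mult_left_mono overlap_mag_dev) auto
    finally show ?thesis by linarith
  qed
  have "real N * ?V / 2 \<le> real N * (2 * real n * tap_correction \<beta> q + 4 * dxi 1 * ((real n)\<^sup>2 * ?r)) / 2"
    using V by (intro divide_right_mono mult_left_mono) auto
  also have "\<dots> = real n * real N * tap_correction \<beta> q + real n * real N * (2 * dxi 1 * real n * ?r)"
    by (simp add: power2_eq_square algebra_simps)
  also have "\<dots> \<le> real n * real N * (tap_correction \<beta> ?u + (dxi 1 + ddxi 1) * ?r) + real n * real N * (2 * dxi 1 * real n * ?r)"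
    using C by (intro add_right_mono mult_left_mono) auto
  finally have V2: "real N * ?V / 2 \<le> real n * real N * tap_correction \<beta> ?u
      + ((2 * dxi 1 * real n + (dxi 1 + ddxi 1)) * ?r) * (real n * real N)"
    by (simp add: algebra_simps)
  have "real n * ?I \<le> real n * ?E" using I by (intro mult_left_mono) auto
  then have "- tap_gap N w * (real n * real N) \<le> replica_log n N w + 2 * weighted_sup N w
      + ((2 * dxi 1 * real n + (dxi 1 + ddxi 1)) * ?r) * (real n * real N)"
    unfolding T L using V2 XB by (simp add: right_diff_distrib distrib_left)
  then have "- tap_gap N w \<le> (replica_log n N w + 2 * weighted_sup N w
      + ((2 * dxi 1 * real n + (dxi 1 + ddxi 1)) * ?r) * (real n * real N)) / (real n * real N)"
    using nN by (subst pos_le_divide_eq)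
  also have "\<dots> = replica_log n N w / (real n * real N) + 2 * weighted_sup N w / (real n * real N)
    + (2 * dxi 1 * real n + (dxi 1 + ddxi 1)) * ?r"
    using nonzero_mult_div_cancel_right[OF less_imp_neq[OF nN, symmetric]] by (simp only: add_divide_distrib)
  finally show ?thesis .
qed

lemma overlap_abs_dev_le: "\<bar>q\<bar> \<le> 1 ==> overlap_dev q N w \<le> 2"
  unfolding overlap_dev_def
  by (rule order_trans[OF abs_ge_self], rule avg_abs_le, rule avg_abs_le) (use spins_overlap in fastforce)

text \<open>The bound \<open>x \<le> s + exp (x - s)\<close> with \<open>s = N ln (n + 1)\<close> turns the first moment bound on
  \<open>exp (replica_log)\<close> into one on the positive part of \<open>replica_log\<close>.\<close>

lemma tap_gap_lower_mean:
  assumes N: "1 \<le> N" and n: "1 \<le> n" and q: "0 \<le> q" "q \<le> 1"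
    and int: "integrable M (tap_gap N)"
  shows "(\<integral>w. max 0 (- tap_gap N w) \<partial>M) \<le> ln (real (n + 1)) / real n + (1 + 4610 * beta_cube_sum) / real n
    + (2 * dxi 1 * real n + (dxi 1 + ddxi 1)) * (\<integral>w. overlap_dev q N w \<partial>M)"
proof -
  \<comment> \<open>The logarithm of the bound on the expected replica weight.\<close>
  define s where "s = real N * ln (real (n + 1))"
  define K where "K = 2 * dxi 1 * real n + (dxi 1 + ddxi 1)"
  have K: "0 \<le> K" using dxi_nonneg[of 1] ddxi_nonneg[of 1] by (simp add: K_def)
  have nN: "0 < real n * real N" using n N by simp
  have s0: "0 \<le> s" by (simp add: s_def)
  have exps: "exp (- s) * real (n + 1) ^ N = 1"
  proof -
    have "exp s = real (n + 1) ^ N" unfolding s_def by (subst exp_of_nat_mult) simp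
    then show ?thesis by (simp add: exp_minus)
  qed
  define F where "F w = (s + replica_weight n N w * exp (- s) + 2 * weighted_sup N w) / (real n * real N) + K * overlap_dev q N w" for w
  have r: "integrable M (overlap_dev q N)"
    by (rule integrable_const_bound[of _ 2]) (use overlap_abs_dev_le[of q N] overlap_dev_nonneg q in \<open>auto simp: abs_le_iff\<close>)
  have F: "integrable M F"
    unfolding F_def using replica_weight_mean(1)[OF N n] weighted_sup_mean(2)[OF N] r
    by (intro Bochner_Integration.integrable_add integrable_divide integrable_mult_right integrable_mult_left integrable_const) auto
  have "AE w in M. max 0 (- tap_gap N w) \<le> F w"
    using total_sup_fourth_moment(1)[OF N] weighted_sup_mean(1)[OF N]
  proof eventually_elim
    case (elim w)
    have w0: "0 \<le> weighted_sup N w"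
      unfolding weighted_sup_def by (intro suminf_nonneg elim(2)) (auto simp: form_sup_nonneg)
    have rw: "exp (replica_log n N w) \<le> replica_weight n N w" by (rule replica_weight_ge)
    have "replica_log n N w - s \<le> exp (replica_log n N w - s)"
      using exp_ge_add_one_self[of "replica_log n N w - s"] by linarith
    also have "\<dots> = exp (replica_log n N w) * exp (- s)" by (simp add: exp_diff exp_minus field_simps)
    also have "\<dots> \<le> replica_weight n N w * exp (- s)" using rw by (intro mult_right_mono) auto
    finally have "replica_log n N w \<le> s + replica_weight n N w * exp (- s)" by linarith
    then have "replica_log n N w / (real n * real N) + 2 * weighted_sup N w / (real n * real N) + K * overlap_dev q N w \<le> F w"
      unfolding F_def add_divide_distrib[symmetric] using nN by (intro add_mono divide_right_mono) auto
    then have "- tap_gap N w \<le> F w"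
      using tap_gap_lower_pathwise[OF N n q elim(1) elim(2)] unfolding K_def by linarith
    moreover have "0 \<le> F w"
    proof -
      have "0 \<le> replica_weight n N w" using rw exp_gt_zero[of "replica_log n N w"] by linarith
      then show ?thesis unfolding F_def using s0 w0 K overlap_dev_nonneg[of q N w] nN
        by (intro add_nonneg_nonneg divide_nonneg_pos mult_nonneg_nonneg) auto
    qed
    ultimately show ?case by simp
  qed
  then have "(\<integral>w. max 0 (- tap_gap N w) \<partial>M) \<le> (\<integral>w. F w \<partial>M)"
    using int F by (intro integral_mono_AE) auto
  also have "\<dots> = (s + (\<integral>w. replica_weight n N w \<partial>M) * exp (- s) + 2 * (\<integral>w. weighted_sup N w \<partial>M)) / (real n * real N)
      + K * (\<integral>w. overlap_dev q N w \<partial>M)"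
    unfolding F_def using replica_weight_mean(1)[OF N n] weighted_sup_mean(2)[OF N] r by (simp add: prob_space)
  also have "\<dots> \<le> (s + real (n + 1) ^ N * exp (- s) + 2 * (2305 * real N * beta_cube_sum)) / (real n * real N)
      + K * (\<integral>w. overlap_dev q N w \<partial>M)"
    using replica_weight_mean(2)[OF N n] weighted_sup_mean(3)[OF N] nN
    by (intro add_right_mono add_mono divide_right_mono mult_right_mono mult_left_mono order_refl) auto
  also have "(s + real (n + 1) ^ N * exp (- s) + 2 * (2305 * real N * beta_cube_sum)) / (real n * real N)
      = ln (real (n + 1)) / real n + (1 / real N + 4610 * beta_cube_sum) / real n"
    using exps N n by (simp add: s_def mult.commute[of "real (n + 1) ^ N"] field_simps)
  also have "\<dots> \<le> ln (real (n + 1)) / real n + (1 + 4610 * beta_cube_sum) / real n"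
    using N n by (intro add_mono divide_right_mono order_refl) auto
  finally show ?thesis unfolding K_def by simp
qed

end

section \<open>The hyperbolic tangent and the log-cosh function\<close>

definition log_cosh :: "real => real" where
  "log_cosh y = ln (exp y + exp (- y))"

lemma log_sum_exp_lipschitz:
  "\<bar>ln (exp a + exp b) - ln (exp a' + exp b')\<bar> \<le> \<bar>a - a'\<bar> + \<bar>b - b'\<bar>" for a b a' b' :: real
proof -
  have le: "ln (exp a + exp b) \<le> (\<bar>a - a'\<bar> + \<bar>b - b'\<bar>) + ln (exp a' + exp b')" for a b a' b' :: real
  proof -
    let ?D = "\<bar>a - a'\<bar> + \<bar>b - b'\<bar>"
    have "exp a \<le> exp (?D + a')" "exp b \<le> exp (?D + b')" by auto
    then have "exp a + exp b \<le> exp ?D * (exp a' + exp b')" by (simp add: exp_add distrib_left)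
    then have "ln (exp a + exp b) \<le> ln (exp ?D * (exp a' + exp b'))"
      by (intro ln_mono) (auto intro: add_pos_pos)
    also have "\<dots> = ?D + ln (exp a' + exp b')"
      using add_pos_pos[OF exp_gt_zero[of a'] exp_gt_zero[of b']] by (simp add: ln_mult)
    finally show ?thesis .
  qed
  from le[of a b a' b'] le[of a' b' a b] show ?thesis by (simp add: abs_le_iff abs_minus_commute)
qed

lemma log_cosh_lipschitz: "\<bar>log_cosh x - log_cosh y\<bar> \<le> 2 * \<bar>x - y\<bar>"
  using log_sum_exp_lipschitz[of x "- x" y "- y"] by (simp add: log_cosh_def abs_minus_commute)

lemma tanh_abs_le: "\<bar>tanh y\<bar> \<le> 1" for y :: real
  using tanh_real_bounds[of y] by (auto simp: abs_le_iff)

lemma tanh_square_le: "0 \<le> 1 - (tanh y)\<^sup>2" "1 - (tanh y)\<^sup>2 \<le> 1" for y :: real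
  using abs_le_square_iff[of "tanh y" 1] tanh_abs_le[of y] by auto

lemma has_derivative_tanh: "(tanh has_real_derivative 1 - (tanh y)\<^sup>2) (at y)" for y :: real
  by (auto intro!: derivative_eq_intros)

lemma real_lipschitz_of_derivative:
  fixes f f' :: "real => real"
  assumes "\<And>x. (f has_real_derivative f' x) (at x)" "\<And>x. \<bar>f' x\<bar> \<le> K"
  shows "\<bar>f x - f y\<bar> \<le> K * \<bar>x - y\<bar>"
proof -
  have "norm (f x - f y) \<le> K * norm (x - y)"
    by (rule field_differentiable_bound[of UNIV f f' K x y]) (use assms in auto)
  then show ?thesis by simp
qed

lemma tanh_lipschitz: "\<bar>tanh x - tanh y\<bar> \<le> 1 * \<bar>x - y\<bar>" for x y :: real
  by (rule real_lipschitz_of_derivative[OF has_derivative_tanh]) (use tanh_square_le in auto)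

lemma tanh_square_lipschitz: "\<bar>(tanh x)\<^sup>2 - (tanh y)\<^sup>2\<bar> \<le> 2 * \<bar>x - y\<bar>" for x y :: real
proof -
  have "(tanh x)\<^sup>2 - (tanh y)\<^sup>2 = (tanh x + tanh y) * (tanh x - tanh y)"
    by (simp add: power2_eq_square algebra_simps)
  moreover have "\<bar>tanh x + tanh y\<bar> \<le> 2" using tanh_abs_le[of x] tanh_abs_le[of y] by linarith
  ultimately show ?thesis
    using tanh_lipschitz[of x y] mult_mono[of "\<bar>tanh x + tanh y\<bar>" 2 "\<bar>tanh x - tanh y\<bar>" "\<bar>x - y\<bar>"]
    by (simp add: abs_mult)
qed

lemma has_derivative_log_cosh: "(log_cosh has_real_derivative tanh y) (at y)"
proof -
  have pos: "0 < exp y + exp (- y)" by (intro add_pos_pos) auto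
  have "(log_cosh has_real_derivative (exp y - exp (- y)) / (exp y + exp (- y))) (at y)"
    unfolding log_cosh_def[abs_def] using pos by (auto intro!: derivative_eq_intros)
  then show ?thesis by (simp add: tanh_altdef)
qed

text \<open>With \<open>m = tanh y\<close>, the contribution of one site to the TAP free energy without the Gaussian energy.\<close>

definition site_functional :: "real => real => real" where
  "site_functional h y = log_cosh y - (y - h) * tanh y"

text \<open>The Legendre duality between the binary entropy and \<open>log cosh\<close>.\<close>

lemma entropy_term_tanh: "- entropy_term (tanh y) + h * tanh y = site_functional h y"
proof -
  let ?Z = "exp y + exp (- y)"
  have Z: "0 < ?Z" by (intro add_pos_pos) auto
  define P Q where "P = exp y / ?Z" and "Q = exp (- y) / ?Z"
  have t: "tanh y = P - Q" by (simp add: tanh_altdef P_def Q_def diff_divide_distrib)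
  have one: "P + Q = 1" using Z by (simp add: P_def Q_def add_divide_distrib[symmetric])
  have p: "(1 + tanh y) / 2 = P" "(1 - tanh y) / 2 = Q" 
  proof -
    have "Q = 1 - P" using one by linarith
    then show "(1 + tanh y) / 2 = P" "(1 - tanh y) / 2 = Q" by (simp_all add: t)
  qed
  have l: "ln P = y - log_cosh y" "ln Q = - y - log_cosh y"
    using Z by (simp_all add: P_def Q_def ln_div log_cosh_def)
  have "entropy_term (tanh y) = (P - Q) * y - (P + Q) * log_cosh y"
    unfolding entropy_term_def p l by (simp add: algebra_simps)
  then have "entropy_term (tanh y) = tanh y * y - log_cosh y" unfolding one t by simp
  then show ?thesis by (simp add: site_functional_def algebra_simps)
qed

lemma site_functional_lipschitz: "\<bar>site_functional h x - site_functional h y\<bar> \<le> (\<bar>h\<bar> + 2) * \<bar>x - y\<bar>"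
proof (rule real_lipschitz_of_derivative)
  show "(site_functional h has_real_derivative (h - y) * (1 - (tanh y)\<^sup>2)) (at y)" for y
    unfolding site_functional_def[abs_def]
    by (rule derivative_eq_intros has_derivative_log_cosh has_derivative_tanh refl)+ (simp add: algebra_simps)
  show "\<bar>(h - y) * (1 - (tanh y)\<^sup>2)\<bar> \<le> \<bar>h\<bar> + 2" for y
  proof -
    let ?Z = "exp y + exp (- y)"
    have Z: "0 < ?Z" by (intro add_pos_pos) auto
    have "exp y * exp (- y) = 1" by (simp add: exp_minus)
    then have "?Z\<^sup>2 - (exp y - exp (- y))\<^sup>2 = 4" by (simp add: power2_eq_square algebra_simps)
    moreover have "(tanh y)\<^sup>2 = (exp y - exp (- y))\<^sup>2 / ?Z\<^sup>2"
      by (simp only: tanh_altdef power_divide)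
    moreover have "1 - C / ?Z\<^sup>2 = (?Z\<^sup>2 - C) / ?Z\<^sup>2" for C using Z by (simp add: diff_divide_distrib)
    ultimately have "1 - (tanh y)\<^sup>2 = 4 / ?Z\<^sup>2" by simp
    also have "\<dots> \<le> 4 / (1 + 2 * \<bar>y\<bar>)"
    proof (rule divide_left_mono)
      have "1 + 2 * \<bar>y\<bar> \<le> exp (2 * \<bar>y\<bar>)" by (rule exp_ge_add_one_self)
      also have "\<dots> = (exp \<bar>y\<bar>)\<^sup>2" by (simp add: exp_double)
      also have "\<dots> \<le> ?Z\<^sup>2" by (intro power_mono) (auto simp: abs_if)
      finally show "1 + 2 * \<bar>y\<bar> \<le> ?Z\<^sup>2" .
      show "0 < ?Z\<^sup>2 * (1 + 2 * \<bar>y\<bar>)" using Z by (intro mult_pos_pos) auto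
    qed simp
    finally have b: "1 - (tanh y)\<^sup>2 \<le> 4 / (1 + 2 * \<bar>y\<bar>)" .
    have "\<bar>y\<bar> * (1 - (tanh y)\<^sup>2) \<le> \<bar>y\<bar> * (4 / (1 + 2 * \<bar>y\<bar>))" using b by (intro mult_left_mono) auto
    also have "\<dots> \<le> 2" by (simp add: divide_le_eq)
    finally have y: "\<bar>y\<bar> * (1 - (tanh y)\<^sup>2) \<le> 2" .
    have "\<bar>h\<bar> * (1 - (tanh y)\<^sup>2) \<le> \<bar>h\<bar> * 1" by (intro mult_left_mono tanh_square_le) auto
    moreover have "\<bar>h - y\<bar> * (1 - (tanh y)\<^sup>2) \<le> (\<bar>h\<bar> + \<bar>y\<bar>) * (1 - (tanh y)\<^sup>2)"
      by (intro mult_right_mono tanh_square_le) auto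
    ultimately show ?thesis using y tanh_square_le[of y] by (simp add: abs_mult distrib_right)
  qed
qed

lemma tanh_half_log_ratio:
  fixes A B :: real
  assumes "0 < A" "0 < B" shows "tanh ((ln A - ln B) / 2) = (A - B) / (A + B)"
proof -
  let ?y = "(ln A - ln B) / 2"
  have "- 2 * ?y = ln B - ln A" by (simp add: field_simps)
  then have e: "exp (- 2 * ?y) = B / A" using assms by (simp only: exp_diff exp_ln)
  have "1 - B / A = (A - B) / A" "1 + B / A = (A + B) / A"
    using assms by (simp_all add: diff_divide_distrib add_divide_distrib)
  then show ?thesis unfolding tanh_real_altdef e using assms by simp
qed

lemma lipschitz_measurable:
  fixes F :: "real => real"
  assumes "\<And>x y. \<bar>F x - F y\<bar> \<le> K * \<bar>x - y\<bar>"
  shows "F \<in> borel_measurable borel"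
proof -
  have K: "0 \<le> K" using assms[of 1 0] by simp
  have "K-lipschitz_on UNIV F" by (rule lipschitz_onI) (use assms K in \<open>auto simp: dist_real_def\<close>)
  then show ?thesis by (intro borel_measurable_continuous_onI lipschitz_on_continuous_on)
qed

lemma std_normal_lipschitz:
  fixes F :: "real => real"
  assumes F: "\<And>x y. \<bar>F x - F y\<bar> \<le> K * \<bar>x - y\<bar>"
  shows "integrable std_normal_distribution (\<lambda>x. F (a + s * x))" (is ?one)
    and "\<bar>(\<integral>x. F (a + s * x) \<partial>std_normal_distribution) - (\<integral>x. F (a + t * x) \<partial>std_normal_distribution)\<bar> \<le> K * \<bar>s - t\<bar>" (is ?two)
proof -
  interpret N: prob_space std_normal_distribution by (rule prob_space_std_normal)
  have K: "0 \<le> K" using F[of 1 0] by simp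
  have [measurable]: "F \<in> borel_measurable borel" by (rule lipschitz_measurable[OF F])
  have i: "integrable std_normal_distribution (\<lambda>x. F (a + s * x))" for s
  proof (rule Bochner_Integration.integrable_bound[of _ "\<lambda>x. \<bar>F a\<bar> + K * \<bar>s\<bar> * \<bar>x\<bar>"])
    show "integrable std_normal_distribution (\<lambda>x. \<bar>F a\<bar> + K * \<bar>s\<bar> * \<bar>x\<bar>)"
      using integrable_abs[OF std_normal_moments(1)] by (intro Bochner_Integration.integrable_add N.integrable_const integrable_mult_right)
    have "\<bar>F (a + s * x)\<bar> \<le> \<bar>\<bar>F a\<bar> + K * \<bar>s\<bar> * \<bar>x\<bar>\<bar>" for x
      using F[of "a + s * x" a] K by (simp add: abs_mult mult.assoc)
    then show "AE x in std_normal_distribution. norm (F (a + s * x)) \<le> norm (\<bar>F a\<bar> + K * \<bar>s\<bar> * \<bar>x\<bar>)"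
      by simp
  qed simp
  then show ?one .
  have m: "(\<integral>x. \<bar>x\<bar> \<partial>std_normal_distribution) \<le> 1"
    using N.integral_abs_le_sqrt(2)[of "\<lambda>x. x", OF _ std_normal_moments(3)]
    unfolding std_normal_moments(4) by simp
  have "\<bar>(\<integral>x. F (a + s * x) \<partial>std_normal_distribution) - (\<integral>x. F (a + t * x) \<partial>std_normal_distribution)\<bar>
      = \<bar>\<integral>x. F (a + s * x) - F (a + t * x) \<partial>std_normal_distribution\<bar>" using i by simp
  also have "\<dots> \<le> (\<integral>x. \<bar>F (a + s * x) - F (a + t * x)\<bar> \<partial>std_normal_distribution)"
    using i by (intro integral_abs_bound)
  also have "\<dots> \<le> (\<integral>x. (K * \<bar>s - t\<bar>) * \<bar>x\<bar> \<partial>std_normal_distribution)"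
  proof (rule integral_mono)
    show "integrable std_normal_distribution (\<lambda>x. \<bar>F (a + s * x) - F (a + t * x)\<bar>)" using i by simp
    show "integrable std_normal_distribution (\<lambda>x. K * \<bar>s - t\<bar> * \<bar>x\<bar>)"
      using integrable_abs[OF std_normal_moments(1)] by (rule integrable_mult_right)
    show "\<bar>F (a + s * x) - F (a + t * x)\<bar> \<le> K * \<bar>s - t\<bar> * \<bar>x\<bar>" for x
    proof -
      have "a + s * x - (a + t * x) = (s - t) * x" by (simp add: algebra_simps)
      then show ?thesis using F[of "a + s * x" "a + t * x"] by (simp add: abs_mult mult.assoc)
    qed
  qed
  also have "\<dots> = (K * \<bar>s - t\<bar>) * (\<integral>x. \<bar>x\<bar> \<partial>std_normal_distribution)" by simp
  also have "\<dots> \<le> (K * \<bar>s - t\<bar>) * 1" using K by (intro mult_left_mono m) auto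
  finally show ?two
    by simp
qed

text \<open>The same Gaussian integration by parts that produces the term \<open>\<xi>'(q) (1 - q)\<close> in the energy
  produces it, with the opposite sign, in the entropy.\<close>

lemma site_functional_gaussian:
  "(\<integral>x. site_functional h (h + s * x) \<partial>std_normal_distribution)
    = (\<integral>x. log_cosh (h + s * x) \<partial>std_normal_distribution)
      - s\<^sup>2 * (1 - (\<integral>x. (tanh (h + s * x))\<^sup>2 \<partial>std_normal_distribution))"
proof -
  interpret N: prob_space std_normal_distribution by (rule prob_space_std_normal)
  have il: "integrable std_normal_distribution (\<lambda>x. log_cosh (h + s * x))"
    by (rule std_normal_lipschitz(1)[OF log_cosh_lipschitz])
  have it: "integrable std_normal_distribution (\<lambda>x. (tanh (h + s * x))\<^sup>2)"
    by (rule std_normal_lipschitz(1)[OF tanh_square_lipschitz])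
  have ix: "integrable std_normal_distribution (\<lambda>x. s * (x * tanh (h + s * x)))"
  proof -
    have "integrable std_normal_distribution (\<lambda>x. log_cosh (h + s * x) - site_functional h (h + s * x))"
      by (intro Bochner_Integration.integrable_diff il std_normal_lipschitz(1)[OF site_functional_lipschitz])
    then show ?thesis by (simp add: site_functional_def mult.assoc)
  qed
  have "(\<integral>x. x * tanh (h + s * x) \<partial>std_normal_distribution) = (\<integral>x. s * (1 - (tanh (h + s * x))\<^sup>2) \<partial>std_normal_distribution)"
  proof (rule std_normal_integration_by_parts[where B = "1 + \<bar>s\<bar>"])
    show "((\<lambda>x. tanh (h + s * x)) has_real_derivative s * (1 - (tanh (h + s * x))\<^sup>2)) (at x)" for x
      by (auto intro!: derivative_eq_intros)
    show "isCont (\<lambda>x. s * (1 - (tanh (h + s * x))\<^sup>2)) x" for x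
      by (intro continuous_intros) (auto simp: cosh_real_nonzero)
    show "\<bar>tanh (h + s * x)\<bar> \<le> 1 + \<bar>s\<bar>" for x using tanh_abs_le[of "h + s * x"] by linarith
    have "\<bar>s\<bar> * (1 - (tanh (h + s * x))\<^sup>2) \<le> \<bar>s\<bar> * 1" for x by (intro mult_left_mono tanh_square_le) auto
    then show "\<bar>s * (1 - (tanh (h + s * x))\<^sup>2)\<bar> \<le> 1 + \<bar>s\<bar>" for x
      using tanh_square_le(1)[of "h + s * x"] by (simp add: abs_mult add_increasing)
  qed
  also have "\<dots> = s * (1 - (\<integral>x. (tanh (h + s * x))\<^sup>2 \<partial>std_normal_distribution))"
    using it N.prob_space by simp
  finally have e: "(\<integral>x. x * tanh (h + s * x) \<partial>std_normal_distribution) = s * (1 - (\<integral>x. (tanh (h + s * x))\<^sup>2 \<partial>std_normal_distribution))" .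
  have "(\<integral>x. site_functional h (h + s * x) \<partial>std_normal_distribution)
      = (\<integral>x. log_cosh (h + s * x) - s * (x * tanh (h + s * x)) \<partial>std_normal_distribution)"
    by (simp add: site_functional_def mult.assoc)
  also have "\<dots> = (\<integral>x. log_cosh (h + s * x) \<partial>std_normal_distribution) - s * (\<integral>x. x * tanh (h + s * x) \<partial>std_normal_distribution)"
    using il ix by simp
  finally show ?thesis unfolding e by (simp add: power2_eq_square)
qed

lemma exp_lipschitz:
  fixes a b K :: real
  assumes "a \<le> K" "b \<le> K" shows "\<bar>exp a - exp b\<bar> \<le> exp K * \<bar>a - b\<bar>"
proof -
  have le: "exp a - exp b \<le> exp K * \<bar>a - b\<bar>" if "a \<le> K" for a b :: real
  proof (cases "b \<le> a")
    case True
    have "1 - exp (b - a) \<le> a - b" using exp_ge_add_one_self[of "b - a"] by linarith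
    then have "exp a * (1 - exp (b - a)) \<le> exp a * (a - b)" by (rule mult_left_mono) simp
    also have "\<dots> \<le> exp K * (a - b)" using True that by (intro mult_right_mono) auto
    finally show ?thesis using True by (simp add: right_diff_distrib exp_diff)
  next
    case False
    then have "exp a - exp b \<le> 0" by simp
    then show ?thesis by (rule order_trans) auto
  qed
  from le[OF assms(1), of b] le[OF assms(2), of a] show ?thesis by (simp add: abs_le_iff abs_minus_commute)
qed

lemma abs_half_sum:
  fixes a b c d h :: real
  shows "\<bar>(a + b + c + d) / 2 - 2 * h\<bar> \<le> (\<bar>a - 2 * h\<bar> + \<bar>b\<bar> + \<bar>c\<bar> + \<bar>d - 2 * h\<bar>) / 2"
proof -
  have eq: "(a + b + c + d) / 2 - 2 * h = ((a - 2 * h) + b + c + (d - 2 * h)) / 2" by (simp add: field_simps)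
  have "\<bar>(a - 2 * h) + b + c + (d - 2 * h)\<bar> \<le> \<bar>a - 2 * h\<bar> + \<bar>b\<bar> + \<bar>c\<bar> + \<bar>d - 2 * h\<bar>"
    by (rule order_trans[OF abs_triangle_ineq add_right_mono])
      (rule order_trans[OF abs_triangle_ineq add_right_mono[OF abs_triangle_ineq]])
  then show ?thesis unfolding eq by simp
qed

context mixture
begin

text \<open>A first order expansion whose error is second order in the increment and in the distance of
  the base point to \<open>q\<close>.\<close>

lemma xi_increment:
  assumes r: "\<bar>r\<bar> \<le> 1" "\<bar>r + t\<bar> \<le> 1" and q: "\<bar>q\<bar> \<le> 1"
  shows "\<bar>xi \<beta> (r + t) - xi \<beta> r - t * dxi q\<bar> \<le> ddxi 1 * (\<bar>r - q\<bar> + \<bar>t\<bar>) * \<bar>t\<bar>"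
proof -
  let ?f = "\<lambda>s. xi \<beta> s - s * dxi q" and ?S = "closed_segment r (r + t)"
  have seg: "\<bar>s\<bar> \<le> 1 \<and> \<bar>s - r\<bar> \<le> \<bar>t\<bar>" if "s \<in> ?S" for s
    using that r by (auto simp: closed_segment_eq_real_ivl split: if_splits)
  have "norm (?f (r + t) - ?f r) \<le> ddxi 1 * (\<bar>r - q\<bar> + \<bar>t\<bar>) * norm (r + t - r)"
  proof (rule field_differentiable_bound[of ?S ?f "\<lambda>s. dxi s - dxi q"])
    fix s assume s: "s \<in> ?S"
    have "(?f has_real_derivative dxi s - dxi q) (at s)"
      using seg[OF s] by (auto intro!: derivative_eq_intros has_derivative_xi)
    then show "(?f has_field_derivative dxi s - dxi q) (at s within ?S)" by (rule has_field_derivative_at_within)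
    have "\<bar>dxi s - dxi q\<bar> \<le> ddxi 1 * \<bar>s - q\<bar>" using seg[OF s] q by (intro dxi_lipschitz) auto
    also have "\<dots> \<le> ddxi 1 * (\<bar>r - q\<bar> + \<bar>t\<bar>)" using seg[OF s] ddxi_nonneg[of 1] by (intro mult_left_mono) auto
    finally show "norm (dxi s - dxi q) \<le> ddxi 1 * (\<bar>r - q\<bar> + \<bar>t\<bar>)" by simp
  qed auto
  then show ?thesis by (simp add: algebra_simps)
qed

end

lemma gibbs_integral:
  fixes F :: "'b => 'c => real"
  assumes "\<And>s. s \<in> S ==> integrable N (F s)"
  shows "integrable N (\<lambda>x. gibbs S W (\<lambda>s. F s x))" (is ?one)
    and "(\<integral>x. gibbs S W (\<lambda>s. F s x) \<partial>N) = gibbs S W (\<lambda>s. \<integral>x. F s x \<partial>N)" (is ?two)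
proof -
  have i: "\<And>s. s \<in> S ==> integrable N (\<lambda>x. exp (W s) * F s x)" using assms by simp
  show ?one
    unfolding gibbs_def by (intro integrable_divide Bochner_Integration.integrable_sum i)
  show ?two
    unfolding gibbs_def using i by (simp add: Bochner_Integration.integral_sum)
qed

lemma gibbs_product: "gibbs S W f * gibbs S W k = gibbs S W (\<lambda>s. gibbs S W (\<lambda>t. f s * k t))"
  by (simp only: gibbs_mult gibbs_mult_right)

section \<open>The cavity field at one site\<close>

context spin_glass
begin

definition cav_coeff :: "nat => nat => (nat => real) => nat list => real" where
  "cav_coeff N i \<sigma> js = spin_coeff \<beta> N \<sigma> js - spin_coeff \<beta> N (\<sigma>(i := 0)) js"

text \<open>The part of the energy that contains the spin \<open>i\<close>.\<close>

definition cav :: "nat => nat => (nat => real) => 'a => real" where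
  "cav N i \<sigma> w = gseries N (cav_coeff N i \<sigma>) (G w)"

definition cav_cov :: "nat => nat => (nat => real) => (nat => real) => real" where
  "cav_cov N i \<sigma> \<tau> = real N * (xi \<beta> (overlap N \<sigma> \<tau>) - xi \<beta> (overlap N (\<sigma>(i := 0)) (\<tau>(i := 0))))"

text \<open>The covariance of the cavity field depends on the overlaps before and after adding the site,
  which differ by at most \<open>1 / N\<close>.\<close>

definition cav_dev :: "real => nat => nat => (nat => real) => (nat => real) => real" where
  "cav_dev q N i \<sigma> \<tau> = \<bar>overlap N (\<sigma>(i := 0)) (\<tau>(i := 0)) - q\<bar> + 1 / real N"

lemma set_spin_configs: "\<sigma> \<in> spin_configs N ==> i \<in> {1..N} ==> e \<in> {-1, 1} ==> \<sigma>(i := e) \<in> spin_configs N"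
  unfolding spin_configs_def by (auto simp: PiE_iff extensional_def)

lemma flat_in_cube: "\<sigma> \<in> spin_configs N ==> in_cube N (\<sigma>(i := 0))"
  using spin_configs_in_cube[of \<sigma> N] by (auto simp: in_cube_def)

lemma overlap_flat_left: "overlap N (\<sigma>(i := 0)) \<tau> = overlap N (\<sigma>(i := 0)) (\<tau>(i := 0))"
  unfolding overlap_def by (intro arg_cong2[of _ _ _ _ "(/)"] sum.cong) auto

lemma overlap_flat_right: "overlap N \<sigma> (\<tau>(i := 0)) = overlap N (\<sigma>(i := 0)) (\<tau>(i := 0))"
  unfolding overlap_def by (intro arg_cong2[of _ _ _ _ "(/)"] sum.cong) auto

lemma overlap_set_spin:
  assumes "i \<in> {1..N}"
  shows "overlap N (\<sigma>(i := e)) (\<tau>(i := d)) = overlap N (\<sigma>(i := 0)) (\<tau>(i := 0)) + e * d / real N"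
proof -
  have "(\<Sum>j=1..N. (\<sigma>(i := e)) j * (\<tau>(i := d)) j) = e * d + (\<Sum>j\<in>{1..N} - {i}. \<sigma> j * \<tau> j)"
    using assms by (subst sum.remove[of _ i]) (auto intro!: sum.cong)
  moreover have "(\<Sum>j=1..N. (\<sigma>(i := 0)) j * (\<tau>(i := 0)) j) = (\<Sum>j\<in>{1..N} - {i}. \<sigma> j * \<tau> j)"
    using assms by (subst sum.remove[of _ i]) (auto intro!: sum.cong)
  ultimately show ?thesis by (simp add: overlap_def add_divide_distrib)
qed

lemma cav_coeff_l2:
  assumes N: "1 \<le> N" and \<sigma>: "\<sigma> \<in> spin_configs N" shows "l2_summable N (cav_coeff N i \<sigma>)"
proof -
  have "l2_summable N (\<lambda>js. spin_coeff \<beta> N \<sigma> js + (- 1) * spin_coeff \<beta> N (\<sigma>(i := 0)) js)"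
    using spin_configs_in_cube[OF \<sigma>] flat_in_cube[OF \<sigma>, of i]
    by (intro l2_summable_add l2_summable_scale l2_summable_spin_coeff N) (auto simp: in_cube_def)
  then show ?thesis by (simp add: cav_coeff_def[abs_def])
qed

lemma cav_coeff_inner:
  assumes N: "1 \<le> N" and \<sigma>: "\<sigma> \<in> spin_configs N" and \<tau>: "\<tau> \<in> spin_configs N"
  shows "(\<lambda>k. \<Sum>js\<in>multi_indices N (k + 2). cav_coeff N i \<sigma> js * cav_coeff N i \<tau> js) sums cav_cov N i \<sigma> \<tau>"
proof -
  let ?I = "\<lambda>a b k. \<Sum>js\<in>multi_indices N (k + 2). spin_coeff \<beta> N a js * spin_coeff \<beta> N b js"
  have s: "?I a b sums (real N * xi \<beta> (overlap N a b))" if "in_cube N a" "in_cube N b" for a b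
    using that by (intro spin_coeff_inner_sums N) (auto simp: in_cube_def)
  note c = spin_configs_in_cube[OF \<sigma>] flat_in_cube[OF \<sigma>, of i] spin_configs_in_cube[OF \<tau>] flat_in_cube[OF \<tau>, of i]
  have "(\<lambda>k. ?I \<sigma> \<tau> k - ?I \<sigma> (\<tau>(i := 0)) k - ?I (\<sigma>(i := 0)) \<tau> k + ?I (\<sigma>(i := 0)) (\<tau>(i := 0)) k) sums
      (real N * xi \<beta> (overlap N \<sigma> \<tau>) - real N * xi \<beta> (overlap N \<sigma> (\<tau>(i := 0)))
       - real N * xi \<beta> (overlap N (\<sigma>(i := 0)) \<tau>) + real N * xi \<beta> (overlap N (\<sigma>(i := 0)) (\<tau>(i := 0))))"
    by (intro sums_add sums_diff s c)
  moreover have "(\<Sum>js\<in>multi_indices N (k + 2). cav_coeff N i \<sigma> js * cav_coeff N i \<tau> js)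
      = ?I \<sigma> \<tau> k - ?I \<sigma> (\<tau>(i := 0)) k - ?I (\<sigma>(i := 0)) \<tau> k + ?I (\<sigma>(i := 0)) (\<tau>(i := 0)) k" for k
    unfolding sum_subtractf[symmetric] sum.distrib[symmetric]
    by (intro sum.cong) (simp_all add: cav_coeff_def algebra_simps)
  moreover have "real N * xi \<beta> (overlap N \<sigma> \<tau>) - real N * xi \<beta> (overlap N \<sigma> (\<tau>(i := 0)))
       - real N * xi \<beta> (overlap N (\<sigma>(i := 0)) \<tau>) + real N * xi \<beta> (overlap N (\<sigma>(i := 0)) (\<tau>(i := 0))) = cav_cov N i \<sigma> \<tau>"
    unfolding overlap_flat_left[of N \<sigma> i \<tau>] overlap_flat_right[of N \<sigma> \<tau> i] cav_cov_def by (simp add: right_diff_distrib)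
  ultimately show ?thesis by simp
qed

lemma gaussian_cav:
  assumes "1 \<le> N" "finite T" "\<And>t. t \<in> T ==> s t \<in> spin_configs N"
  shows "gaussian_rv M (\<lambda>w. \<Sum>t\<in>T. c t * cav N i (s t) w) (\<Sum>t\<in>T. \<Sum>t'\<in>T. c t * c t' * cav_cov N i (s t) (s t'))"
  unfolding cav_def using assms by (intro gaussian_series_combination cav_coeff_l2 cav_coeff_inner) auto

lemma measurable_cav [measurable]: "cav N i \<sigma> \<in> borel_measurable M"
  unfolding cav_def by measurable

text \<open>The covariance is \<open>N\<close> times an increment of \<open>\<xi>\<close> over a step of length \<open>1 / N\<close>.\<close>

lemma cav_cov_approx:
  assumes N: "1 \<le> N" and i: "i \<in> {1..N}" and \<sigma>: "\<sigma> \<in> spin_configs N" and \<tau>: "\<tau> \<in> spin_configs N"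
    and e: "e \<in> {-1, 1}" and d: "d \<in> {-1, 1}" and q: "\<bar>q\<bar> \<le> 1"
  shows "\<bar>cav_cov N i (\<sigma>(i := e)) (\<tau>(i := d)) - e * d * dxi q\<bar> \<le> ddxi 1 * cav_dev q N i \<sigma> \<tau>"
proof -
  let ?r = "overlap N (\<sigma>(i := 0)) (\<tau>(i := 0))" and ?t = "e * d / real N"
  have ed: "\<bar>e * d\<bar> = 1" using e d by auto
  have t: "\<bar>?t\<bar> = 1 / real N" by (simp add: abs_divide ed)
  have r: "\<bar>?r\<bar> \<le> 1" by (intro in_cube_overlap flat_in_cube \<sigma> \<tau>)
  have rt: "\<bar>?r + ?t\<bar> \<le> 1"
    using spins_overlap[OF set_spin_configs[OF \<sigma> i e] set_spin_configs[OF \<tau> i d]] by (simp add: overlap_set_spin[OF i, of \<sigma> e \<tau> d])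
  have "\<bar>xi \<beta> (?r + ?t) - xi \<beta> ?r - ?t * dxi q\<bar> \<le> ddxi 1 * (\<bar>?r - q\<bar> + \<bar>?t\<bar>) * \<bar>?t\<bar>"
    by (rule xi_increment[OF r rt q])
  then have "real N * \<bar>xi \<beta> (?r + ?t) - xi \<beta> ?r - ?t * dxi q\<bar> \<le> real N * (ddxi 1 * (\<bar>?r - q\<bar> + \<bar>?t\<bar>) * \<bar>?t\<bar>)"
    by (intro mult_left_mono) auto
  moreover have "real N * (ddxi 1 * (\<bar>?r - q\<bar> + \<bar>?t\<bar>) * \<bar>?t\<bar>) = ddxi 1 * cav_dev q N i \<sigma> \<tau>"
    using N by (simp only: t cav_dev_def) simp
  moreover have "cav_cov N i (\<sigma>(i := e)) (\<tau>(i := d)) - e * d * dxi q = real N * (xi \<beta> (?r + ?t) - xi \<beta> ?r - ?t * dxi q)"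
    using N by (simp add: cav_cov_def overlap_set_spin[OF i, of \<sigma> e \<tau> d] right_diff_distrib)
  ultimately show ?thesis by (simp add: abs_mult)
qed

lemma cav_cov_diag:
  assumes N: "1 \<le> N" and i: "i \<in> {1..N}" and \<sigma>: "\<sigma> \<in> spin_configs N" and e: "e \<in> {-1, 1}"
  shows "\<bar>cav_cov N i (\<sigma>(i := e)) (\<sigma>(i := e)) - dxi 1\<bar> \<le> 2 * ddxi 1 / real N"
proof -
  have ee: "e * e = 1" using e by auto
  have "overlap N (\<sigma>(i := e)) (\<sigma>(i := e)) = 1" by (rule overlap_self[OF set_spin_configs[OF \<sigma> i e] N])
  then have "overlap N (\<sigma>(i := 0)) (\<sigma>(i := 0)) = 1 - 1 / real N"
    using overlap_set_spin[OF i, of \<sigma> e \<sigma> e] ee by simp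
  then have "cav_dev 1 N i \<sigma> \<sigma> = 2 / real N" by (simp add: cav_dev_def)
  then show ?thesis using cav_cov_approx[OF N i \<sigma> \<sigma> e e, of 1] ee by (simp add: mult.commute)
qed

lemma cav_cov_abs_le:
  assumes N: "1 \<le> N" and i: "i \<in> {1..N}" and \<sigma>: "\<sigma> \<in> spin_configs N" and \<tau>: "\<tau> \<in> spin_configs N"
  shows "\<bar>cav_cov N i \<sigma> \<tau>\<bar> \<le> dxi 1"
proof -
  have e: "\<sigma> i \<in> {-1, 1}" "\<tau> i \<in> {-1, 1}" using spin_configs_values[OF \<sigma> i] spin_configs_values[OF \<tau> i] by auto
  have ov: "overlap N \<sigma> \<tau> = overlap N (\<sigma>(i := 0)) (\<tau>(i := 0)) + \<sigma> i * \<tau> i / real N"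
    using overlap_set_spin[OF i, of \<sigma> "\<sigma> i" \<tau> "\<tau> i"] by simp
  have "\<bar>xi \<beta> (overlap N \<sigma> \<tau>) - xi \<beta> (overlap N (\<sigma>(i := 0)) (\<tau>(i := 0)))\<bar>
      \<le> dxi 1 * \<bar>overlap N \<sigma> \<tau> - overlap N (\<sigma>(i := 0)) (\<tau>(i := 0))\<bar>"
    by (intro xi_lipschitz spins_overlap \<sigma> \<tau> in_cube_overlap flat_in_cube)
  also have "\<dots> = dxi 1 / real N" using e by (auto simp: ov)
  finally have "real N * \<bar>xi \<beta> (overlap N \<sigma> \<tau>) - xi \<beta> (overlap N (\<sigma>(i := 0)) (\<tau>(i := 0)))\<bar> \<le> real N * (dxi 1 / real N)"
    by (intro mult_left_mono) auto
  then show ?thesis using N by (simp add: cav_cov_def abs_mult)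
qed

lemma cav_dev_ge: "1 / real N \<le> cav_dev q N i \<sigma> \<tau>"
  by (simp_all add: cav_dev_def)

section \<open>Averages of the cavity field for given weights\<close>

text \<open>Here the weights \<open>exp (W \<sigma>)\<close> are deterministic; later they come from the part of the
  Hamiltonian that does not contain the spin.\<close>

definition cav_mean :: "nat => nat => real => ((nat => real) => real) => ((nat => real) => real) => real" where
  "cav_mean N i e W y = gibbs (spin_configs N) W (\<lambda>\<sigma>. y (\<sigma>(i := e)))"

definition cav_exp :: "nat => nat => real => ((nat => real) => real) => ((nat => real) => real) => real" where
  "cav_exp N i e W y = gibbs (spin_configs N) W (\<lambda>\<sigma>. exp (y (\<sigma>(i := e)) - cav_mean N i e W y))"

definition mean_dev :: "real => nat => nat => ((nat => real) => real) => real" where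
  "mean_dev q N i W = gibbs (spin_configs N) W (\<lambda>\<sigma>. gibbs (spin_configs N) W (cav_dev q N i \<sigma>))"

definition half_variance :: "real => real" where
  "half_variance q = (dxi 1 - dxi q) / 2"

lemma half_variance_nonneg: "\<bar>q\<bar> \<le> 1 ==> 0 \<le> half_variance q"
  using dxi_abs_le[of q] by (simp add: half_variance_def)

lemma mean_dev_ge: "1 / real N \<le> mean_dev q N i W"
proof -
  have "gibbs (spin_configs N) W (\<lambda>\<sigma>. gibbs (spin_configs N) W (\<lambda>\<tau>. 1 / real N)) \<le> mean_dev q N i W"
    unfolding mean_dev_def by (rule avg_mono, rule avg_mono, rule cav_dev_ge)
  then show ?thesis by (simp only: avg_const)
qed

lemma mean_dev_nonneg: "0 \<le> mean_dev q N i W"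
  by (rule order_trans[OF _ mean_dev_ge]) simp

context
  fixes N i :: nat and e q :: real and W :: "(nat => real) => real"
  assumes N: "1 \<le> N" and i: "i \<in> {1..N}" and e: "e \<in> {-1, 1}" and q: "\<bar>q\<bar> \<le> 1"
begin

private abbreviation "S \<equiv> spin_configs N"
private abbreviation "E \<equiv> gibbs S W"
private abbreviation "K \<sigma> \<tau> \<equiv> cav_cov N i (\<sigma>(i := e)) (\<tau>(i := e))"
private abbreviation "D \<sigma> w \<equiv> cav N i (\<sigma>(i := e)) w - cav_mean N i e W (\<lambda>\<sigma>. cav N i \<sigma> w)"
private abbreviation "wt \<sigma> \<equiv> exp (W \<sigma>) / (\<Sum>\<sigma>\<in>S. exp (W \<sigma>))"

private definition C :: "(nat => real) => (nat => real) => real" where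
  "C \<sigma> \<tau> = K \<sigma> \<tau> - E (K \<sigma>) - E (\<lambda>\<rho>. K \<rho> \<tau>) + E (\<lambda>\<rho>. E (K \<rho>))"

private lemma E_w: "E f = (\<Sum>\<sigma>\<in>S. wt \<sigma> * f \<sigma>)" by (rule gibbs_weights)

private lemma centred_sum:
  assumes "\<sigma> \<in> S" shows "(\<Sum>\<rho>\<in>S. ((if \<rho> = \<sigma> then 1 else 0) - wt \<rho>) * f \<rho>) = f \<sigma> - E f"
  using assms by (simp add: E_w left_diff_distrib sum_subtractf if_distrib[of "\<lambda>x. x * _"] sum.delta cong: if_cong)

private lemma centred_cov:
  assumes "\<sigma> \<in> S" "\<tau> \<in> S"
  shows "(\<Sum>\<rho>\<in>S. \<Sum>\<pi>\<in>S. ((if \<rho> = \<sigma> then 1 else 0) - wt \<rho>) * ((if \<pi> = \<tau> then 1 else 0) - wt \<pi>) * K \<rho> \<pi>) = C \<sigma> \<tau>"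
proof -
  have "(\<Sum>\<rho>\<in>S. \<Sum>\<pi>\<in>S. ((if \<rho> = \<sigma> then 1 else 0) - wt \<rho>) * ((if \<pi> = \<tau> then 1 else 0) - wt \<pi>) * K \<rho> \<pi>)
      = (\<Sum>\<rho>\<in>S. ((if \<rho> = \<sigma> then 1 else 0) - wt \<rho>) * (K \<rho> \<tau> - E (K \<rho>)))"
    by (simp only: mult.assoc sum_distrib_left[symmetric] centred_sum[OF assms(2)])
  also have "\<dots> = C \<sigma> \<tau>"
    by (simp only: centred_sum[OF assms(1)] gibbs_diff C_def)
  finally show ?thesis .
qed

private lemma D_sum: "\<sigma> \<in> S ==> D \<sigma> w = (\<Sum>\<rho>\<in>S. ((if \<rho> = \<sigma> then 1 else 0) - wt \<rho>) * cav N i (\<rho>(i := e)) w)"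
  by (simp only: centred_sum cav_mean_def)

private lemma gaussian_comb:
  "gaussian_rv M (\<lambda>w. \<Sum>\<rho>\<in>S. c \<rho> * cav N i (\<rho>(i := e)) w) (\<Sum>\<rho>\<in>S. \<Sum>\<pi>\<in>S. c \<rho> * c \<pi> * K \<rho> \<pi>)"
  by (rule gaussian_cav[OF N finite_spin_configs]) (rule set_spin_configs[OF _ i e])

private lemma gaussian_D:
  assumes "\<sigma> \<in> S" shows "gaussian_rv M (D \<sigma>) (C \<sigma> \<sigma>)"
  using gaussian_comb[of "\<lambda>\<rho>. (if \<rho> = \<sigma> then 1 else 0) - wt \<rho>"]
  by (simp only: D_sum[OF assms] centred_cov[OF assms assms])

private lemma gaussian_DD:
  assumes "\<sigma> \<in> S" "\<tau> \<in> S" shows "gaussian_rv M (\<lambda>w. D \<sigma> w + D \<tau> w) (C \<sigma> \<sigma> + C \<sigma> \<tau> + C \<tau> \<sigma> + C \<tau> \<tau>)"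
proof -
  let ?c = "\<lambda>\<sigma> \<rho>. (if \<rho> = \<sigma> then 1 else 0) - wt \<rho>"
  have "(\<Sum>\<rho>\<in>S. \<Sum>\<pi>\<in>S. (?c \<sigma> \<rho> + ?c \<tau> \<rho>) * (?c \<sigma> \<pi> + ?c \<tau> \<pi>) * K \<rho> \<pi>)
      = (\<Sum>\<rho>\<in>S. \<Sum>\<pi>\<in>S. ?c \<sigma> \<rho> * ?c \<sigma> \<pi> * K \<rho> \<pi>) + (\<Sum>\<rho>\<in>S. \<Sum>\<pi>\<in>S. ?c \<sigma> \<rho> * ?c \<tau> \<pi> * K \<rho> \<pi>)
        + (\<Sum>\<rho>\<in>S. \<Sum>\<pi>\<in>S. ?c \<tau> \<rho> * ?c \<sigma> \<pi> * K \<rho> \<pi>) + (\<Sum>\<rho>\<in>S. \<Sum>\<pi>\<in>S. ?c \<tau> \<rho> * ?c \<tau> \<pi> * K \<rho> \<pi>)"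
    by (simp only: distrib_left distrib_right sum.distrib)
  also have "\<dots> = C \<sigma> \<sigma> + C \<sigma> \<tau> + C \<tau> \<sigma> + C \<tau> \<tau>" by (simp only: centred_cov assms)
  finally have v: "(\<Sum>\<rho>\<in>S. \<Sum>\<pi>\<in>S. (?c \<sigma> \<rho> + ?c \<tau> \<rho>) * (?c \<sigma> \<pi> + ?c \<tau> \<pi>) * K \<rho> \<pi>) = C \<sigma> \<sigma> + C \<sigma> \<tau> + C \<tau> \<sigma> + C \<tau> \<tau>" .
  have s: "D \<sigma> w + D \<tau> w = (\<Sum>\<rho>\<in>S. (?c \<sigma> \<rho> + ?c \<tau> \<rho>) * cav N i (\<rho>(i := e)) w)" for w
    by (simp only: D_sum assms distrib_right sum.distrib)
  show ?thesis
    using gaussian_comb[of "\<lambda>\<rho>. ?c \<sigma> \<rho> + ?c \<tau> \<rho>"] by (simp only: s v)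
qed

private lemma K_bounds:
  assumes "\<sigma> \<in> S" "\<tau> \<in> S"
  shows "\<bar>K \<sigma> \<tau>\<bar> \<le> dxi 1" (is ?one) "\<bar>K \<sigma> \<tau> - dxi q\<bar> \<le> ddxi 1 * cav_dev q N i \<sigma> \<tau>" (is ?two)
proof -
  show ?one by (intro cav_cov_abs_le N i set_spin_configs assms e)
  have "e * e = 1" using e by auto
  then show ?two
    using cav_cov_approx[OF N i assms e e q] by simp
qed

private lemma E_dev:
  assumes "\<And>\<sigma>. \<sigma> \<in> S ==> \<bar>f \<sigma> - a\<bar> \<le> k \<sigma>" shows "\<bar>E f - a\<bar> \<le> E k"
proof -
  have "\<bar>E (\<lambda>\<sigma>. f \<sigma> - a)\<bar> \<le> E (\<lambda>\<sigma>. \<bar>f \<sigma> - a\<bar>)" by (rule avg_abs)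
  also have "\<dots> \<le> E k" by (rule avg_mono) (rule assms)
  finally show ?thesis by (simp only: gibbs_diff avg_const)
qed

private abbreviation "\<eta> \<equiv> cav_dev q N i"
private abbreviation "m \<equiv> mean_dev q N i W"
private abbreviation "L \<equiv> ddxi 1"

private lemma cav_dev_sym: "\<eta> \<sigma> \<tau> = \<eta> \<tau> \<sigma>"
  unfolding cav_dev_def by (subst overlap_commute) (rule refl)

private lemma E_K:
  assumes "\<sigma> \<in> S"
  shows "\<bar>E (K \<sigma>) - dxi q\<bar> \<le> L * E (\<eta> \<sigma>)" (is ?one) "\<bar>E (\<lambda>\<rho>. K \<rho> \<sigma>) - dxi q\<bar> \<le> L * E (\<eta> \<sigma>)" (is ?two)
proof -
  show ?one
    unfolding gibbs_mult[symmetric] by (rule E_dev) (rule K_bounds(2)[OF assms])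
  show ?two
    unfolding gibbs_mult[symmetric] by (rule E_dev) (subst cav_dev_sym, rule K_bounds(2)[OF _ assms])
qed

private lemma EE_K: "\<bar>E (\<lambda>\<rho>. E (K \<rho>)) - dxi q\<bar> \<le> L * m"
  unfolding mean_dev_def gibbs_mult[symmetric] by (rule E_dev) (simp only: gibbs_mult E_K(1))

private lemma C_approx:
  assumes "\<sigma> \<in> S" "\<tau> \<in> S"
  shows "\<bar>C \<sigma> \<tau>\<bar> \<le> L * (\<eta> \<sigma> \<tau> + E (\<eta> \<sigma>) + E (\<eta> \<tau>) + m)" (is ?one)
    and "\<bar>C \<sigma> \<sigma> - 2 * half_variance q\<bar> \<le> L * (2 / real N + 2 * E (\<eta> \<sigma>) + m)" (is ?two)
    and "\<bar>C \<sigma> \<tau>\<bar> \<le> 4 * dxi 1" (is ?three)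
proof -
  show ?one
    using K_bounds(2)[OF assms] E_K(1)[OF assms(1)] E_K(2)[OF assms(2)] EE_K
    unfolding C_def distrib_left by linarith
  show ?two
  proof -
    have hv: "2 * half_variance q = dxi 1 - dxi q" by (simp add: half_variance_def)
    have r: "L * (2 / real N + 2 * x + y) = 2 * L / real N + 2 * (L * x) + L * y" for x y
      by (simp add: distrib_left mult.commute)
    show ?thesis
      using cav_cov_diag[OF N i assms(1) e] E_K[OF assms(1)] EE_K unfolding C_def hv r by linarith
  qed
  have "\<bar>E (K \<sigma>)\<bar> \<le> dxi 1" by (rule avg_abs_le) (rule K_bounds(1)[OF assms(1)])
  moreover have "\<bar>E (\<lambda>\<rho>. K \<rho> \<tau>)\<bar> \<le> dxi 1" by (rule avg_abs_le) (rule K_bounds(1)[OF _ assms(2)])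
  moreover have "\<bar>E (\<lambda>\<rho>. E (K \<rho>))\<bar> \<le> dxi 1" by (rule avg_abs_le, rule avg_abs_le) (rule K_bounds(1))
  ultimately show ?three using K_bounds(1)[OF assms] unfolding C_def by linarith
qed

private lemma E_C_diag: "E (\<lambda>\<sigma>. \<bar>C \<sigma> \<sigma> - 2 * half_variance q\<bar>) \<le> 5 * L * m"
proof -
  have "E (\<lambda>\<sigma>. \<bar>C \<sigma> \<sigma> - 2 * half_variance q\<bar>) \<le> E (\<lambda>\<sigma>. L * (2 / real N + 2 * E (\<eta> \<sigma>) + m))"
    by (rule avg_mono) (rule C_approx(2))
  also have "\<dots> = L * (2 / real N + 2 * m + m)"
    by (simp only: gibbs_mult gibbs_add avg_const mean_dev_def)
  also have "\<dots> \<le> L * (5 * m)"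
    using mean_dev_ge[of N q i W] ddxi_nonneg[of 1] by (intro mult_left_mono) auto
  finally show ?thesis by simp
qed

private lemma EE_C: "E (\<lambda>\<sigma>. E (\<lambda>\<tau>. \<bar>C \<sigma> \<tau>\<bar>)) \<le> 4 * L * m"
proof -
  have "E (\<lambda>\<sigma>. E (\<lambda>\<tau>. \<bar>C \<sigma> \<tau>\<bar>)) \<le> E (\<lambda>\<sigma>. E (\<lambda>\<tau>. L * (\<eta> \<sigma> \<tau> + E (\<eta> \<sigma>) + E (\<eta> \<tau>) + m)))"
    by (rule avg_mono, rule avg_mono) (rule C_approx(1))
  also have "\<dots> = L * (m + m + m + m)"
    by (simp only: gibbs_mult gibbs_add avg_const mean_dev_def)
  finally show ?thesis by simp
qed

private abbreviation "B w \<equiv> cav_exp N i e W (\<lambda>\<sigma>. cav N i \<sigma> w)"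

private definition lip :: real where "lip = exp (8 * dxi 1)"

private lemma d1: "0 \<le> dxi 1" by (rule dxi_nonneg) auto

private lemma mean_B:
  shows "integrable M B" (is ?one) and "\<bar>(\<integral>w. B w \<partial>M) - exp (half_variance q)\<bar> \<le> 3 * lip * L * m" (is ?two)
proof -
  have i1: "integrable M (\<lambda>w. exp (D \<sigma> w))" and v1: "(\<integral>w. exp (D \<sigma> w) \<partial>M) = exp (C \<sigma> \<sigma> / 2)" if "\<sigma> \<in> S" for \<sigma>
    using gaussian_rv_exp[OF gaussian_D[OF that], of 1] by simp_all
  show ?one unfolding cav_exp_def by (rule gibbs_integral(1)) (rule i1)
  have "(\<integral>w. B w \<partial>M) = E (\<lambda>\<sigma>. \<integral>w. exp (D \<sigma> w) \<partial>M)"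
    unfolding cav_exp_def by (rule gibbs_integral(2)) (rule i1)
  also have "\<dots> = E (\<lambda>\<sigma>. exp (C \<sigma> \<sigma> / 2))" by (rule gibbs_cong[OF refl]) (rule v1)
  finally have "\<bar>(\<integral>w. B w \<partial>M) - exp (half_variance q)\<bar> = \<bar>E (\<lambda>\<sigma>. exp (C \<sigma> \<sigma> / 2)) - exp (half_variance q)\<bar>" by simp
  also have "\<dots> \<le> E (\<lambda>\<sigma>. (lip / 2) * \<bar>C \<sigma> \<sigma> - 2 * half_variance q\<bar>)"
  proof (rule E_dev)
    fix \<sigma> assume \<sigma>: "\<sigma> \<in> S"
    have "half_variance q \<le> 8 * dxi 1" using dxi_abs_le[OF q] d1 by (simp add: half_variance_def abs_le_iff)
    moreover have "C \<sigma> \<sigma> / 2 \<le> 8 * dxi 1" using C_approx(3)[OF \<sigma> \<sigma>] d1 by linarith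
    ultimately have "\<bar>exp (C \<sigma> \<sigma> / 2) - exp (half_variance q)\<bar> \<le> lip * \<bar>C \<sigma> \<sigma> / 2 - half_variance q\<bar>"
      unfolding lip_def by (intro exp_lipschitz)
    also have "\<dots> = (lip / 2) * \<bar>C \<sigma> \<sigma> - 2 * half_variance q\<bar>" by (simp add: abs_if)
    finally show "\<bar>exp (C \<sigma> \<sigma> / 2) - exp (half_variance q)\<bar> \<le> (lip / 2) * \<bar>C \<sigma> \<sigma> - 2 * half_variance q\<bar>" .
  qed
  also have "\<dots> \<le> (lip / 2) * (5 * L * m)"
    unfolding gibbs_mult by (intro mult_left_mono E_C_diag) (simp add: lip_def)
  also have "\<dots> \<le> 3 * lip * L * m"
  proof -
    have "0 \<le> lip * (L * m)"
      by (intro mult_nonneg_nonneg mean_dev_nonneg ddxi_nonneg) (auto simp: lip_def)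
    moreover have "(lip / 2) * (5 * L * m) = 5/2 * (lip * (L * m))" "3 * lip * L * m = 3 * (lip * (L * m))" by simp_all
    ultimately show ?thesis by linarith
  qed
  finally show ?two .
qed

private lemma mean_B_square:
  shows "integrable M (\<lambda>w. (B w)\<^sup>2)" (is ?one) and "\<bar>(\<integral>w. (B w)\<^sup>2 \<partial>M) - exp (2 * half_variance q)\<bar> \<le> 9 * lip * L * m" (is ?two)
proof -
  have i2: "integrable M (\<lambda>w. exp (D \<sigma> w + D \<tau> w))"
    and v2: "(\<integral>w. exp (D \<sigma> w + D \<tau> w) \<partial>M) = exp ((C \<sigma> \<sigma> + C \<sigma> \<tau> + C \<tau> \<sigma> + C \<tau> \<tau>) / 2)"
    if "\<sigma> \<in> S" "\<tau> \<in> S" for \<sigma> \<tau>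
    using gaussian_rv_exp[OF gaussian_DD[OF that], of 1] by simp_all
  have sq: "(B w)\<^sup>2 = E (\<lambda>\<sigma>. E (\<lambda>\<tau>. exp (D \<sigma> w + D \<tau> w)))" for w
    unfolding power2_eq_square cav_exp_def gibbs_product exp_add ..
  have inner: "integrable M (\<lambda>w. E (\<lambda>\<tau>. exp (D \<sigma> w + D \<tau> w)))"
    "(\<integral>w. E (\<lambda>\<tau>. exp (D \<sigma> w + D \<tau> w)) \<partial>M) = E (\<lambda>\<tau>. exp ((C \<sigma> \<sigma> + C \<sigma> \<tau> + C \<tau> \<sigma> + C \<tau> \<tau>) / 2))"
    if \<sigma>: "\<sigma> \<in> S" for \<sigma>
  proof -
    show "integrable M (\<lambda>w. E (\<lambda>\<tau>. exp (D \<sigma> w + D \<tau> w)))" by (rule gibbs_integral(1)) (rule i2[OF \<sigma>])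
    have "(\<integral>w. E (\<lambda>\<tau>. exp (D \<sigma> w + D \<tau> w)) \<partial>M) = E (\<lambda>\<tau>. \<integral>w. exp (D \<sigma> w + D \<tau> w) \<partial>M)"
      by (rule gibbs_integral(2)) (rule i2[OF \<sigma>])
    also have "\<dots> = E (\<lambda>\<tau>. exp ((C \<sigma> \<sigma> + C \<sigma> \<tau> + C \<tau> \<sigma> + C \<tau> \<tau>) / 2))"
      by (rule gibbs_cong[OF refl]) (rule v2[OF \<sigma>])
    finally show "(\<integral>w. E (\<lambda>\<tau>. exp (D \<sigma> w + D \<tau> w)) \<partial>M) = E (\<lambda>\<tau>. exp ((C \<sigma> \<sigma> + C \<sigma> \<tau> + C \<tau> \<sigma> + C \<tau> \<tau>) / 2))" .
  qed
  show ?one unfolding sq by (rule gibbs_integral(1)) (rule inner(1))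
  have "(\<integral>w. (B w)\<^sup>2 \<partial>M) = E (\<lambda>\<sigma>. \<integral>w. E (\<lambda>\<tau>. exp (D \<sigma> w + D \<tau> w)) \<partial>M)"
    unfolding sq by (rule gibbs_integral(2)) (rule inner(1))
  also have "\<dots> = E (\<lambda>\<sigma>. E (\<lambda>\<tau>. exp ((C \<sigma> \<sigma> + C \<sigma> \<tau> + C \<tau> \<sigma> + C \<tau> \<tau>) / 2)))"
    by (rule gibbs_cong[OF refl]) (rule inner(2))
  finally have "\<bar>(\<integral>w. (B w)\<^sup>2 \<partial>M) - exp (2 * half_variance q)\<bar>
      = \<bar>E (\<lambda>\<sigma>. E (\<lambda>\<tau>. exp ((C \<sigma> \<sigma> + C \<sigma> \<tau> + C \<tau> \<sigma> + C \<tau> \<tau>) / 2))) - exp (2 * half_variance q)\<bar>" by simp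
  also have "\<dots> \<le> E (\<lambda>\<sigma>. E (\<lambda>\<tau>. (lip / 2) * (\<bar>C \<sigma> \<sigma> - 2 * half_variance q\<bar> + \<bar>C \<sigma> \<tau>\<bar> + \<bar>C \<tau> \<sigma>\<bar> + \<bar>C \<tau> \<tau> - 2 * half_variance q\<bar>)))"
  proof (rule E_dev, rule E_dev)
    fix \<sigma> \<tau> assume s: "\<sigma> \<in> S" "\<tau> \<in> S"
    let ?V = "(C \<sigma> \<sigma> + C \<sigma> \<tau> + C \<tau> \<sigma> + C \<tau> \<tau>) / 2"
    have "2 * half_variance q \<le> 8 * dxi 1" using dxi_abs_le[OF q] d1 by (simp add: half_variance_def abs_le_iff)
    moreover have "?V \<le> 8 * dxi 1"
      using abs_le_D1[OF C_approx(3)[OF s(1) s(1)]] abs_le_D1[OF C_approx(3)[OF s]]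
        abs_le_D1[OF C_approx(3)[OF s(2) s(1)]] abs_le_D1[OF C_approx(3)[OF s(2) s(2)]] by simp
    ultimately have "\<bar>exp ?V - exp (2 * half_variance q)\<bar> \<le> lip * \<bar>?V - 2 * half_variance q\<bar>"
      unfolding lip_def by (intro exp_lipschitz)
    also have "\<bar>?V - 2 * half_variance q\<bar> \<le> (\<bar>C \<sigma> \<sigma> - 2 * half_variance q\<bar> + \<bar>C \<sigma> \<tau>\<bar> + \<bar>C \<tau> \<sigma>\<bar> + \<bar>C \<tau> \<tau> - 2 * half_variance q\<bar>) / 2"
      by (rule abs_half_sum)
    then have "lip * \<bar>?V - 2 * half_variance q\<bar> \<le> lip * ((\<bar>C \<sigma> \<sigma> - 2 * half_variance q\<bar> + \<bar>C \<sigma> \<tau>\<bar> + \<bar>C \<tau> \<sigma>\<bar> + \<bar>C \<tau> \<tau> - 2 * half_variance q\<bar>) / 2)"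
      by (rule mult_left_mono) (simp add: lip_def)
    finally show "\<bar>exp ?V - exp (2 * half_variance q)\<bar> \<le> (lip / 2) * (\<bar>C \<sigma> \<sigma> - 2 * half_variance q\<bar> + \<bar>C \<sigma> \<tau>\<bar> + \<bar>C \<tau> \<sigma>\<bar> + \<bar>C \<tau> \<tau> - 2 * half_variance q\<bar>)"
      by simp
  qed
  also have "\<dots> = (lip / 2) * (E (\<lambda>\<sigma>. \<bar>C \<sigma> \<sigma> - 2 * half_variance q\<bar>) + E (\<lambda>\<sigma>. E (\<lambda>\<tau>. \<bar>C \<sigma> \<tau>\<bar>))
      + E (\<lambda>\<sigma>. E (\<lambda>\<tau>. \<bar>C \<tau> \<sigma>\<bar>)) + E (\<lambda>\<sigma>. \<bar>C \<sigma> \<sigma> - 2 * half_variance q\<bar>))"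
    by (simp only: gibbs_mult gibbs_add avg_const)
  also have "E (\<lambda>\<sigma>. E (\<lambda>\<tau>. \<bar>C \<tau> \<sigma>\<bar>)) = E (\<lambda>\<tau>. E (\<lambda>\<sigma>. \<bar>C \<tau> \<sigma>\<bar>))"
    unfolding E_w by (simp only: sum_distrib_left) (subst sum.swap, simp only: mult.left_commute)
  also have "(lip / 2) * (E (\<lambda>\<sigma>. \<bar>C \<sigma> \<sigma> - 2 * half_variance q\<bar>) + E (\<lambda>\<sigma>. E (\<lambda>\<tau>. \<bar>C \<sigma> \<tau>\<bar>))
      + E (\<lambda>\<sigma>. E (\<lambda>\<tau>. \<bar>C \<sigma> \<tau>\<bar>)) + E (\<lambda>\<sigma>. \<bar>C \<sigma> \<sigma> - 2 * half_variance q\<bar>)) \<le> (lip / 2) * (5 * L * m + 4 * L * m + 4 * L * m + 5 * L * m)"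
    by (intro mult_left_mono add_mono E_C_diag EE_C) (simp add: lip_def)
  finally show ?two by simp
qed

text \<open>The second moment involves two replicas of the rest of the system; for most pairs their
  cavity fields, centred by the common mean, are nearly uncorrelated
  when the overlap is close to \<open>q\<close>.\<close>

lemma cav_exp_variance:
  shows "integrable M (\<lambda>w. (cav_exp N i e W (\<lambda>\<sigma>. cav N i \<sigma> w) - exp (half_variance q))\<^sup>2)"
    and "(\<integral>w. (cav_exp N i e W (\<lambda>\<sigma>. cav N i \<sigma> w) - exp (half_variance q))\<^sup>2 \<partial>M)
      \<le> (9 + 6 * exp (half_variance q)) * exp (8 * dxi 1) * ddxi 1 * mean_dev q N i W"
proof -
  let ?c = "exp (half_variance q)"
  have sq: "(B w - ?c)\<^sup>2 = (B w)\<^sup>2 - 2 * ?c * B w + ?c\<^sup>2" for w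
    by (simp add: power2_eq_square algebra_simps)
  have c2: "?c\<^sup>2 = exp (2 * half_variance q)" by (simp add: exp_double)
  show "integrable M (\<lambda>w. (B w - ?c)\<^sup>2)"
    unfolding sq using mean_B(1) mean_B_square(1) by simp
  have "(\<integral>w. (B w - ?c)\<^sup>2 \<partial>M) = (\<integral>w. (B w)\<^sup>2 \<partial>M) - 2 * ?c * (\<integral>w. B w \<partial>M) + ?c\<^sup>2"
    unfolding sq using mean_B(1) mean_B_square(1) by (simp add: prob_space)
  also have "\<dots> = ((\<integral>w. (B w)\<^sup>2 \<partial>M) - exp (2 * half_variance q)) - 2 * ?c * ((\<integral>w. B w \<partial>M) - ?c)"
    unfolding c2[symmetric] by (simp add: power2_eq_square algebra_simps)
  also have "\<dots> \<le> 9 * lip * L * m + 2 * ?c * (3 * lip * L * m)"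
  proof -
    have "2 * ?c * (- ((\<integral>w. B w \<partial>M) - ?c)) \<le> 2 * ?c * (3 * lip * L * m)"
      using abs_le_D2[OF mean_B(2)] by (rule mult_left_mono) simp
    then show ?thesis using abs_le_D1[OF mean_B_square(2)] by (simp only: mult_minus_right)
  qed
  also have "\<dots> = (9 + 6 * ?c) * exp (8 * dxi 1) * ddxi 1 * m" by (simp add: lip_def algebra_simps)
  finally show "(\<integral>w. (B w - ?c)\<^sup>2 \<partial>M) \<le> (9 + 6 * ?c) * exp (8 * dxi 1) * ddxi 1 * m" .
qed

lemma gaussian_cav_mean:
  "\<exists>v. gaussian_rv M (\<lambda>w. cav_mean N i e W (\<lambda>\<sigma>. cav N i \<sigma> w)) v \<and> \<bar>v - dxi q\<bar> \<le> ddxi 1 * mean_dev q N i W"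
proof (intro exI conjI)
  have "gaussian_rv M (\<lambda>w. \<Sum>\<sigma>\<in>S. wt \<sigma> * cav N i (\<sigma>(i := e)) w) (\<Sum>\<sigma>\<in>S. \<Sum>\<tau>\<in>S. wt \<sigma> * wt \<tau> * K \<sigma> \<tau>)"
    by (rule gaussian_comb)
  moreover have "(\<Sum>\<sigma>\<in>S. \<Sum>\<tau>\<in>S. wt \<sigma> * wt \<tau> * K \<sigma> \<tau>) = E (\<lambda>\<sigma>. E (K \<sigma>))"
    unfolding E_w by (simp only: sum_distrib_left mult.assoc)
  ultimately show "gaussian_rv M (\<lambda>w. cav_mean N i e W (\<lambda>\<sigma>. cav N i \<sigma> w)) (E (\<lambda>\<sigma>. E (K \<sigma>)))"
    by (simp only: cav_mean_def E_w)
  show "\<bar>E (\<lambda>\<sigma>. E (K \<sigma>)) - dxi q\<bar> \<le> ddxi 1 * mean_dev q N i W" by (rule EE_K)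
qed

end

end

lemma ln_lipschitz_above_one: "1 \<le> x ==> 1 \<le> y ==> \<bar>ln x - ln y\<bar> \<le> \<bar>x - y\<bar>" for x y :: real
proof -
  assume x: "1 \<le> x" and y: "1 \<le> y"
  have le: "ln x - ln y \<le> \<bar>x - y\<bar>" if "1 \<le> x" "1 \<le> y" for x y :: real
  proof (cases "y \<le> x")
    case True
    have "ln x - ln y = ln (x / y)" using that by (simp add: ln_div)
    also have "\<dots> \<le> x / y - 1" using that by (intro ln_le_minus_one) auto
    also have "\<dots> = (x - y) / y" using that by (simp add: diff_divide_distrib)
    also have "\<dots> \<le> (x - y) / 1" using that True by (intro divide_left_mono) auto
    finally show ?thesis by simp
  next
    case False
    then have "ln x \<le> ln y" using that by simp
    then show ?thesis by linarith
  qed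
  from le[OF x y] le[OF y x] show ?thesis by (simp add: abs_le_iff abs_minus_commute)
qed

context spin_glass
begin

text \<open>How far the averages of the cavity field are from their limits: the exponential averages are
  close to the constant \<open>exp ((\<xi>'(1) - \<xi>'(q)) / 2)\<close>, and the means for the two spin values are opposite.\<close>

definition cav_defect :: "real => nat => nat => ((nat => real) => real) => ((nat => real) => real) => real" where
  "cav_defect q N i W y = \<bar>cav_exp N i 1 W y - exp (half_variance q)\<bar> + \<bar>cav_exp N i (-1) W y - exp (half_variance q)\<bar>
     + \<bar>cav_mean N i 1 W y + cav_mean N i (-1) W y\<bar>"

definition defect_const :: "real => real" where
  "defect_const q = 2 * sqrt ((9 + 6 * exp (half_variance q)) * exp (8 * dxi 1) * ddxi 1) + 2 * sqrt (ddxi 1)"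

lemma defect_const_nonneg: "0 \<le> defect_const q"
  using ddxi_nonneg[of 1] by (simp add: defect_const_def)

text \<open>Reversing the spin reverses the cavity field up to the interactions that are even in the spin; the
  variance of what remains is controlled by the deviation of the overlap.\<close>

lemma cav_mean_antisymmetric:
  assumes N: "1 \<le> N" and i: "i \<in> {1..N}" and q: "\<bar>q\<bar> \<le> 1"
  shows "\<exists>v. gaussian_rv M (\<lambda>w. cav_mean N i 1 W (\<lambda>\<sigma>. cav N i \<sigma> w) + cav_mean N i (-1) W (\<lambda>\<sigma>. cav N i \<sigma> w)) v
    \<and> v \<le> 4 * ddxi 1 * mean_dev q N i W"
proof (intro exI conjI)
  let ?S = "spin_configs N" and ?E = "gibbs (spin_configs N) W"
  let ?wt = "\<lambda>\<sigma>. exp (W \<sigma>) / (\<Sum>\<sigma>\<in>?S. exp (W \<sigma>))"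
  let ?T = "?S \<times> {-1, 1 :: real}" and ?s = "\<lambda>t. (fst t)(i := snd t) :: nat => real" and ?c = "\<lambda>t. ?wt (fst t)"
  let ?K = "\<lambda>\<sigma> \<tau>. cav_cov N i (\<sigma>(i := -1)) (\<tau>(i := -1)) + cav_cov N i (\<sigma>(i := -1)) (\<tau>(i := 1))
      + cav_cov N i (\<sigma>(i := 1)) (\<tau>(i := -1)) + cav_cov N i (\<sigma>(i := 1)) (\<tau>(i := 1))"
  have sT: "(\<Sum>t\<in>?T. f t) = (\<Sum>\<sigma>\<in>?S. f (\<sigma>, -1) + f (\<sigma>, 1))" for f :: "(nat => real) \<times> real => real"
    by (simp add: sum.cartesian_product[symmetric, of "\<lambda>\<sigma> e. f (\<sigma>, e)", simplified case_prod_eta])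
  have sp: "?s t \<in> ?S" if "t \<in> ?T" for t
    using that set_spin_configs[OF _ i] by (auto simp del: fun_upd_apply)
  have "gaussian_rv M (\<lambda>w. \<Sum>t\<in>?T. ?c t * cav N i (?s t) w) (\<Sum>t\<in>?T. \<Sum>t'\<in>?T. ?c t * ?c t' * cav_cov N i (?s t) (?s t'))"
    by (rule gaussian_cav[OF N]) (use sp in auto)
  moreover have "(\<Sum>t\<in>?T. ?c t * cav N i (?s t) w) = cav_mean N i 1 W (\<lambda>\<sigma>. cav N i \<sigma> w) + cav_mean N i (-1) W (\<lambda>\<sigma>. cav N i \<sigma> w)" for w
    unfolding sT cav_mean_def gibbs_weights by (simp add: sum.distrib add.commute)
  moreover have "(\<Sum>t\<in>?T. \<Sum>t'\<in>?T. ?c t * ?c t' * cav_cov N i (?s t) (?s t')) = ?E (\<lambda>\<sigma>. ?E (?K \<sigma>))"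
  proof -
    have "?E (\<lambda>\<sigma>. ?E (?K \<sigma>)) = (\<Sum>\<sigma>\<in>?S. \<Sum>\<tau>\<in>?S. ?wt \<sigma> * (?wt \<tau> * ?K \<sigma> \<tau>))"
      unfolding gibbs_weights by (simp only: sum_distrib_left)
    moreover have "(\<Sum>t\<in>?T. \<Sum>t'\<in>?T. ?c t * ?c t' * cav_cov N i (?s t) (?s t')) = (\<Sum>\<sigma>\<in>?S. \<Sum>\<tau>\<in>?S. ?wt \<sigma> * (?wt \<tau> * ?K \<sigma> \<tau>))"
      unfolding sT sum.distrib[symmetric] by (intro sum.cong refl) (simp add: algebra_simps)
    ultimately show ?thesis by simp
  qed
  ultimately show "gaussian_rv M (\<lambda>w. cav_mean N i 1 W (\<lambda>\<sigma>. cav N i \<sigma> w) + cav_mean N i (-1) W (\<lambda>\<sigma>. cav N i \<sigma> w)) (?E (\<lambda>\<sigma>. ?E (?K \<sigma>)))"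
    by simp
  have "?E (\<lambda>\<sigma>. ?E (?K \<sigma>)) \<le> ?E (\<lambda>\<sigma>. ?E (\<lambda>\<tau>. 4 * ddxi 1 * cav_dev q N i \<sigma> \<tau>))"
  proof (rule avg_mono, rule avg_mono)
    fix \<sigma> \<tau> assume s: "\<sigma> \<in> ?S" "\<tau> \<in> ?S"
    note a = cav_cov_approx[OF N i s _ _ q]
    show "?K \<sigma> \<tau> \<le> 4 * ddxi 1 * cav_dev q N i \<sigma> \<tau>"
      using abs_le_D1[OF a[of 1 1]] abs_le_D1[OF a[of 1 "-1"]] abs_le_D1[OF a[of "-1" 1]] abs_le_D1[OF a[of "-1" "-1"]]
      by simp
  qed
  also have "\<dots> = 4 * ddxi 1 * mean_dev q N i W" by (simp only: gibbs_mult mean_dev_def)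
  finally show "?E (\<lambda>\<sigma>. ?E (?K \<sigma>)) \<le> 4 * ddxi 1 * mean_dev q N i W" .
qed

lemma measurable_cav_mean_fixed [measurable]: "(\<lambda>w. cav_mean N i e W (\<lambda>\<sigma>. cav N i \<sigma> w)) \<in> borel_measurable M"
  unfolding cav_mean_def by (rule measurable_gibbs) auto

lemma measurable_cav_exp_fixed [measurable]: "(\<lambda>w. cav_exp N i e W (\<lambda>\<sigma>. cav N i \<sigma> w)) \<in> borel_measurable M"
  unfolding cav_exp_def by (rule measurable_gibbs) auto

lemma cav_defect_fixed:
  assumes N: "1 \<le> N" and i: "i \<in> {1..N}" and q: "\<bar>q\<bar> \<le> 1"
  shows "integrable M (\<lambda>w. cav_defect q N i W (\<lambda>\<sigma>. cav N i \<sigma> w))"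
    and "(\<integral>w. cav_defect q N i W (\<lambda>\<sigma>. cav N i \<sigma> w) \<partial>M) \<le> defect_const q * sqrt (mean_dev q N i W)"
proof -
  let ?y = "\<lambda>w \<sigma>. cav N i \<sigma> w" and ?c = "exp (half_variance q)" and ?m = "mean_dev q N i W"
  let ?A = "(9 + 6 * exp (half_variance q)) * exp (8 * dxi 1) * ddxi 1"
  have B: "integrable M (\<lambda>w. cav_exp N i e W (?y w) - ?c)"
    "(\<integral>w. \<bar>cav_exp N i e W (?y w) - ?c\<bar> \<partial>M) \<le> sqrt ?A * sqrt ?m" if e: "e \<in> {-1, 1}" for e
  proof -
    note sq = integral_abs_le_sqrt[OF _ cav_exp_variance(1)[OF N i e q, of W]]
    show "integrable M (\<lambda>w. cav_exp N i e W (?y w) - ?c)" by (rule sq(1)) measurable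
    have "(\<integral>w. \<bar>cav_exp N i e W (?y w) - ?c\<bar> \<partial>M) \<le> sqrt (\<integral>w. (cav_exp N i e W (?y w) - ?c)\<^sup>2 \<partial>M)"
      by (rule sq(2)) measurable
    also have "\<dots> \<le> sqrt (?A * ?m)" by (rule real_sqrt_le_mono) (rule cav_exp_variance(2)[OF N i e q])
    finally show "(\<integral>w. \<bar>cav_exp N i e W (?y w) - ?c\<bar> \<partial>M) \<le> sqrt ?A * sqrt ?m"
      by (simp only: real_sqrt_mult)
  qed
  obtain v where v: "gaussian_rv M (\<lambda>w. cav_mean N i 1 W (?y w) + cav_mean N i (-1) W (?y w)) v" "v \<le> 4 * ddxi 1 * ?m"
    using cav_mean_antisymmetric[OF N i q, of W] by blast
  have z: "(\<integral>w. \<bar>cav_mean N i 1 W (?y w) + cav_mean N i (-1) W (?y w)\<bar> \<partial>M) \<le> 2 * sqrt (ddxi 1) * sqrt ?m"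
  proof -
    have "(\<integral>w. \<bar>cav_mean N i 1 W (?y w) + cav_mean N i (-1) W (?y w)\<bar> \<partial>M) \<le> sqrt v"
      by (rule gaussian_rv_abs(2)[OF v(1)])
    also have "\<dots> \<le> sqrt (4 * ddxi 1 * ?m)" using v(2) by (rule real_sqrt_le_mono)
    finally show ?thesis by (simp add: real_sqrt_mult)
  qed
  note i1 = integrable_abs[OF B(1)[of 1]] integrable_abs[OF B(1)[of "-1"]] integrable_abs[OF gaussian_rv_abs(1)[OF v(1)]]
  show "integrable M (\<lambda>w. cav_defect q N i W (?y w))"
    unfolding cav_defect_def by (intro Bochner_Integration.integrable_add i1) auto
  have "(\<integral>w. cav_defect q N i W (?y w) \<partial>M) = (\<integral>w. \<bar>cav_exp N i 1 W (?y w) - ?c\<bar> \<partial>M)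
      + (\<integral>w. \<bar>cav_exp N i (-1) W (?y w) - ?c\<bar> \<partial>M)
      + (\<integral>w. \<bar>cav_mean N i 1 W (?y w) + cav_mean N i (-1) W (?y w)\<bar> \<partial>M)"
    unfolding cav_defect_def
    by (subst Bochner_Integration.integral_add, (intro Bochner_Integration.integrable_add i1; simp), (intro i1),
        subst Bochner_Integration.integral_add, (intro i1; simp), (intro i1; simp), rule refl)
  also have "\<dots> \<le> sqrt ?A * sqrt ?m + sqrt ?A * sqrt ?m + 2 * sqrt (ddxi 1) * sqrt ?m"
    by (intro add_mono B(2) z) auto
  also have "\<dots> = defect_const q * sqrt ?m" by (simp only: defect_const_def) (simp only: distrib_right mult_2)
  finally show "(\<integral>w. cav_defect q N i W (?y w) \<partial>M) \<le> defect_const q * sqrt ?m" .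
qed

section \<open>Decoupling the cavity field from the rest of the system\<close>

definition other_field :: "nat => nat => (nat => real) => real" where
  "other_field N i \<sigma> = h * (\<Sum>j\<in>{1..N} - {i}. \<sigma> j)"

definition H0 :: "nat => nat => 'a => (nat => real) => real" where
  "H0 N i w \<sigma> = X N (\<sigma>(i := 0)) w + other_field N i \<sigma>"

abbreviation flat_vector :: "nat => nat => 'a => (nat => real) => real" where
  "flat_vector N i \<equiv> series_vector N (spin_configs N) (\<lambda>\<sigma>. spin_coeff \<beta> N (\<sigma>(i := 0)))"

abbreviation cav_vector :: "nat => nat => 'a => (nat => real) => real" where
  "cav_vector N i \<equiv> series_vector N (spin_configs N) (cav_coeff N i)"

abbreviation field_space :: "nat => ((nat => real) => real) measure" where
  "field_space N \<equiv> PiM (spin_configs N) (\<lambda>_. borel)"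

abbreviation weight :: "nat => nat => ((nat => real) => real) => (nat => real) => real" where
  "weight N i u \<equiv> (\<lambda>\<sigma>. u \<sigma> + other_field N i \<sigma>)"

text \<open>The two vectors use disjoint sets of couplings: those whose indices avoid the site \<open>i\<close>, and those
  whose indices contain it.\<close>

lemma indep_cavity: "indep_var (field_space N) (flat_vector N i) (field_space N) (cav_vector N i)"
proof (rule indep_series_vectors[of "{js. i \<notin> set js}" "{js. i \<in> set js}"])
  show "js \<in> {js. i \<notin> set js}" if "spin_coeff \<beta> N (\<sigma>(i := 0)) js \<noteq> 0" for \<sigma> js
  proof (rule ccontr)
    assume "js \<notin> {js. i \<notin> set js}"
    then have "0 \<in> set (map (\<sigma>(i := 0)) js)" by force
    then have "prod_list (map (\<sigma>(i := 0)) js) = 0" by (simp only: prod_list_zero_iff)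
    then show False using that by (simp add: spin_coeff_def)
  qed
  show "js \<in> {js. i \<in> set js}" if "cav_coeff N i \<sigma> js \<noteq> 0" for \<sigma> js
  proof (rule ccontr)
    assume "js \<notin> {js. i \<in> set js}"
    then have m: "map (\<sigma>(i := 0)) js = map \<sigma> js" by auto
    have "cav_coeff N i \<sigma> js = 0" unfolding cav_coeff_def spin_coeff_def m by simp
    then show False using that by simp
  qed
qed auto

lemma weight_flat: "\<sigma> \<in> spin_configs N ==> weight N i (flat_vector N i w) \<sigma> = H0 N i w \<sigma>"
  by (simp add: series_vector_def H0_def mixed_hamiltonian_eq)

lemma cav_vector_apply: "\<sigma> \<in> spin_configs N ==> cav_vector N i w \<sigma> = cav N i \<sigma> w"
  by (simp add: series_vector_def cav_def)

lemma cav_mean_cong: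
  assumes "i \<in> {1..N}" "e \<in> {-1, 1}"
    and "\<And>\<sigma>. \<sigma> \<in> spin_configs N ==> W \<sigma> = W' \<sigma>" "\<And>\<sigma>. \<sigma> \<in> spin_configs N ==> y \<sigma> = y' \<sigma>"
  shows "cav_mean N i e W y = cav_mean N i e W' y'"
  unfolding cav_mean_def using assms set_spin_configs[OF _ assms(1,2)] by (intro gibbs_cong) auto

lemma cav_exp_cong:
  assumes "i \<in> {1..N}" "e \<in> {-1, 1}"
    and "\<And>\<sigma>. \<sigma> \<in> spin_configs N ==> W \<sigma> = W' \<sigma>" "\<And>\<sigma>. \<sigma> \<in> spin_configs N ==> y \<sigma> = y' \<sigma>"
  shows "cav_exp N i e W y = cav_exp N i e W' y'"
  unfolding cav_exp_def
proof (rule gibbs_cong)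
  fix \<sigma> assume "\<sigma> \<in> spin_configs N"
  then have "y (\<sigma>(i := e)) = y' (\<sigma>(i := e))" by (intro assms(4) set_spin_configs assms(1,2))
  then show "exp (y (\<sigma>(i := e)) - cav_mean N i e W y) = exp (y' (\<sigma>(i := e)) - cav_mean N i e W' y')"
    using cav_mean_cong[OF assms] by simp
qed (rule assms(3))

lemma cav_defect_cong:
  assumes "i \<in> {1..N}"
    and "\<And>\<sigma>. \<sigma> \<in> spin_configs N ==> W \<sigma> = W' \<sigma>" "\<And>\<sigma>. \<sigma> \<in> spin_configs N ==> y \<sigma> = y' \<sigma>"
  shows "cav_defect q N i W y = cav_defect q N i W' y'"
proof -
  have "cav_exp N i 1 W y = cav_exp N i 1 W' y'" "cav_exp N i (-1) W y = cav_exp N i (-1) W' y'"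
    "cav_mean N i 1 W y = cav_mean N i 1 W' y'" "cav_mean N i (-1) W y = cav_mean N i (-1) W' y'"
    using assms by (auto intro!: cav_exp_cong cav_mean_cong)
  then show ?thesis by (simp add: cav_defect_def)
qed

lemma measurable_pair_component:
  assumes "\<sigma> \<in> spin_configs N"
  shows "(\<lambda>z. fst z \<sigma>) \<in> borel_measurable (field_space N \<Otimes>\<^sub>M field_space N)"
    and "(\<lambda>z. snd z \<sigma>) \<in> borel_measurable (field_space N \<Otimes>\<^sub>M field_space N)"
  by (rule measurable_compose[OF measurable_fst measurable_component_singleton[OF assms, of "\<lambda>_. borel"]])
    (rule measurable_compose[OF measurable_snd measurable_component_singleton[OF assms, of "\<lambda>_. borel"]])

lemma measurable_cav_mean_pair:
  assumes "i \<in> {1..N}" "e \<in> {-1, 1}"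
  shows "(\<lambda>z. cav_mean N i e (weight N i (fst z)) (snd z)) \<in> borel_measurable (field_space N \<Otimes>\<^sub>M field_space N)"
  unfolding cav_mean_def
  by (intro measurable_gibbs finite_spin_configs borel_measurable_add borel_measurable_const
      measurable_pair_component set_spin_configs assms)

lemma measurable_cav_exp_pair:
  assumes "i \<in> {1..N}" "e \<in> {-1, 1}"
  shows "(\<lambda>z. cav_exp N i e (weight N i (fst z)) (snd z)) \<in> borel_measurable (field_space N \<Otimes>\<^sub>M field_space N)"
  unfolding cav_exp_def
  by (intro measurable_gibbs finite_spin_configs borel_measurable_add borel_measurable_const
      measurable_compose[OF _ borel_measurable_exp] borel_measurable_diff measurable_cav_mean_pair
      measurable_pair_component set_spin_configs assms)

lemma measurable_H0 [measurable]: "(\<lambda>w. H0 N i w \<sigma>) \<in> borel_measurable M"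
  unfolding H0_def by measurable

abbreviation site_dev :: "real => nat => nat => 'a => real" where
  "site_dev q N i w \<equiv> mean_dev q N i (H0 N i w)"

lemma measurable_site_dev [measurable]: "site_dev q N i \<in> borel_measurable M"
  unfolding mean_dev_def by (intro measurable_gibbs finite_spin_configs measurable_H0 borel_measurable_const)

lemma site_dev_le:
  assumes "1 \<le> N" "\<bar>q\<bar> \<le> 1" shows "site_dev q N i w \<le> 3"
proof -
  have "cav_dev q N i \<sigma> \<tau> \<le> 3" if "\<sigma> \<in> spin_configs N" "\<tau> \<in> spin_configs N" for \<sigma> \<tau>
  proof -
    have "\<bar>overlap N (\<sigma>(i := 0)) (\<tau>(i := 0))\<bar> \<le> 1" by (intro in_cube_overlap flat_in_cube that)
    moreover have "1 / real N \<le> 1" using assms by simp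
    ultimately show ?thesis using assms unfolding cav_dev_def by linarith
  qed
  then have "site_dev q N i w \<le> gibbs (spin_configs N) (H0 N i w) (\<lambda>\<sigma>. gibbs (spin_configs N) (H0 N i w) (\<lambda>\<tau>. 3))"
    unfolding mean_dev_def by (intro avg_mono)
  then show ?thesis by (simp only: avg_const)
qed

definition root_dev :: "real => nat => nat => real" where
  "root_dev q N i = (\<integral>w. sqrt (site_dev q N i w) \<partial>M)"

lemma integrable_root_dev:
  assumes "1 \<le> N" "\<bar>q\<bar> \<le> 1" shows "integrable M (\<lambda>w. sqrt (site_dev q N i w))"
  by (rule integrable_const_bound[of _ "sqrt 3"]) (use site_dev_le[OF assms] mean_dev_nonneg in auto)

abbreviation site_defect :: "real => nat => nat => 'a => real" where
  "site_defect q N i w \<equiv> cav_defect q N i (H0 N i w) (\<lambda>\<sigma>. cav N i \<sigma> w)"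

abbreviation site_field :: "nat => nat => 'a => real" where
  "site_field N i w \<equiv> cav_mean N i 1 (H0 N i w) (\<lambda>\<sigma>. cav N i \<sigma> w)"

text \<open>The bound for deterministic weights holds conditionally on the couplings that avoid the site.\<close>

lemma site_defect_mean:
  assumes N: "1 \<le> N" and i: "i \<in> {1..N}" and q: "\<bar>q\<bar> \<le> 1"
  shows "integrable M (site_defect q N i)" (is ?one)
    and "(\<integral>w. site_defect q N i w \<partial>M) \<le> defect_const q * root_dev q N i" (is ?two)
proof -
  let ?F = "\<lambda>z. cav_defect q N i (weight N i (fst z)) (snd z)"
  have e: "(1::real) \<in> {-1, 1}" "(-1::real) \<in> {-1, 1}" by auto
  have F: "?F \<in> borel_measurable (field_space N \<Otimes>\<^sub>M field_space N)"
    unfolding cav_defect_def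
    by (intro borel_measurable_add borel_measurable_abs borel_measurable_diff borel_measurable_const
        measurable_cav_exp_pair measurable_cav_mean_pair i e)
  have eq: "?F (flat_vector N i w, cav_vector N i w') = cav_defect q N i (H0 N i w) (\<lambda>\<sigma>. cav N i \<sigma> w')" for w w'
    by (simp only: fst_conv snd_conv) (rule cav_defect_cong[OF i], (erule weight_flat, erule cav_vector_apply)+)
  note d = decouple_bound[OF indep_cavity[of N i] F, where c = "\<lambda>w. defect_const q * sqrt (site_dev q N i w)"]
  have c: "integrable M (\<lambda>w. defect_const q * sqrt (site_dev q N i w))"
    by (rule integrable_mult_right[OF integrable_root_dev[OF N q]])
  have nn: "0 \<le> ?F z" for z by (simp add: cav_defect_def)
  show ?one
    using d(1)[OF nn, unfolded eq, OF cav_defect_fixed[OF N i q] c] .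
  have "(\<integral>w. site_defect q N i w \<partial>M) \<le> (\<integral>w. defect_const q * sqrt (site_dev q N i w) \<partial>M)"
    using d(2)[OF nn, unfolded eq, OF cav_defect_fixed[OF N i q] c] .
  then show ?two by (simp add: root_dev_def)
qed

lemma sqrt_diff_le: "0 \<le> a ==> 0 \<le> b ==> \<bar>sqrt a - sqrt b\<bar> \<le> sqrt \<bar>a - b\<bar>"
proof -
  assume a: "0 \<le> a" and b: "0 \<le> b"
  have le: "sqrt a \<le> sqrt b + sqrt \<bar>a - b\<bar>" if "0 \<le> a" "0 \<le> b" for a b :: real
  proof -
    have "sqrt a \<le> sqrt (b + \<bar>a - b\<bar>)" by simp
    also have "\<dots> \<le> sqrt b + sqrt \<bar>a - b\<bar>" using that by (intro sqrt_add_le_add_sqrt) auto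
    finally show ?thesis .
  qed
  from le[OF a b] le[OF b a] show ?thesis by (simp add: abs_le_iff abs_minus_commute)
qed

text \<open>Conditionally on the couplings that avoid the site, the mean cavity field is Gaussian with
  variance close to \<open>\<xi>'(q)\<close>.\<close>

lemma site_field_law:
  fixes F :: "real => real"
  assumes N: "1 \<le> N" and i: "i \<in> {1..N}" and q: "0 \<le> q" "q \<le> 1"
    and F: "\<And>x y. \<bar>F x - F y\<bar> \<le> K * \<bar>x - y\<bar>"
  shows "integrable M (\<lambda>w. F (h + site_field N i w))"
    and "\<bar>(\<integral>w. F (h + site_field N i w) \<partial>M) - (\<integral>x. F (h + sqrt (dxi q) * x) \<partial>std_normal_distribution)\<bar>
      \<le> K * sqrt (ddxi 1) * root_dev q N i" (is ?two)
proof -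
  have q1: "\<bar>q\<bar> \<le> 1" using q by simp
  have K: "0 \<le> K" using F[of 1 0] by simp
  have [measurable]: "F \<in> borel_measurable borel" by (rule lipschitz_measurable[OF F])
  have e: "(1::real) \<in> {-1, 1}" by simp
  have zm: "(\<lambda>z. cav_mean N i 1 (weight N i (fst z)) (snd z)) \<in> borel_measurable (field_space N \<Otimes>\<^sub>M field_space N)"
    by (rule measurable_cav_mean_pair[OF i e])
  have eq: "cav_mean N i 1 (weight N i (flat_vector N i w)) (cav_vector N i w') = cav_mean N i 1 (H0 N i w) (\<lambda>\<sigma>. cav N i \<sigma> w')" for w w'
    by (rule cav_mean_cong[OF i e], erule weight_flat, erule cav_vector_apply)
  define I where "I = (\<integral>x. F (h + sqrt (dxi q) * x) \<partial>std_normal_distribution)"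
  have inner: "\<bar>(\<integral>w'. F (h + cav_mean N i 1 (H0 N i w) (\<lambda>\<sigma>. cav N i \<sigma> w')) \<partial>M) - I\<bar> \<le> K * sqrt (ddxi 1) * sqrt (site_dev q N i w)" for w
  proof -
    obtain v where v: "gaussian_rv M (\<lambda>w'. cav_mean N i 1 (H0 N i w) (\<lambda>\<sigma>. cav N i \<sigma> w')) v" "\<bar>v - dxi q\<bar> \<le> ddxi 1 * site_dev q N i w"
      using gaussian_cav_mean[OF N i e q1, of "H0 N i w"] by blast
    have v0: "0 \<le> v" using v(1) by (simp add: gaussian_rv_def)
    have "(\<integral>w'. F (h + cav_mean N i 1 (H0 N i w) (\<lambda>\<sigma>. cav N i \<sigma> w')) \<partial>M) = (\<integral>x. F (h + sqrt v * x) \<partial>std_normal_distribution)"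
      by (rule gaussian_rv_expectation(2)[OF v(1), of "\<lambda>z. F (h + z)"]) measurable
    then have "\<bar>(\<integral>w'. F (h + cav_mean N i 1 (H0 N i w) (\<lambda>\<sigma>. cav N i \<sigma> w')) \<partial>M) - I\<bar> \<le> K * \<bar>sqrt v - sqrt (dxi q)\<bar>"
      unfolding I_def using std_normal_lipschitz(2)[OF F, of h "sqrt v" "sqrt (dxi q)"] by simp
    also have "\<dots> \<le> K * sqrt \<bar>v - dxi q\<bar>" using K v0 dxi_nonneg[OF q] by (intro mult_left_mono sqrt_diff_le)
    also have "\<dots> \<le> K * sqrt (ddxi 1 * site_dev q N i w)" using K v(2) by (intro mult_left_mono real_sqrt_le_mono)
    finally show ?thesis by (simp add: real_sqrt_mult mult.assoc)
  qed
  show int: "integrable M (\<lambda>w. F (h + site_field N i w))"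
  proof -
    let ?F = "\<lambda>z. \<bar>cav_mean N i 1 (weight N i (fst z)) (snd z)\<bar>"
    have "integrable M (\<lambda>w. ?F (flat_vector N i w, cav_vector N i w))"
    proof (rule decouple_bound(1)[OF indep_cavity[of N i], where c = "\<lambda>_. sqrt (dxi 1 + ddxi 1 * 3)"])
      show "?F \<in> borel_measurable (field_space N \<Otimes>\<^sub>M field_space N)" by (intro borel_measurable_abs zm)
      fix w
      obtain v where v: "gaussian_rv M (\<lambda>w'. cav_mean N i 1 (H0 N i w) (\<lambda>\<sigma>. cav N i \<sigma> w')) v" "\<bar>v - dxi q\<bar> \<le> ddxi 1 * site_dev q N i w"
        using gaussian_cav_mean[OF N i e q1, of "H0 N i w"] by blast
      have "ddxi 1 * site_dev q N i w \<le> ddxi 1 * 3" using site_dev_le[OF N q1] ddxi_nonneg[of 1] by (intro mult_left_mono) auto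
      then have vle: "v \<le> dxi 1 + ddxi 1 * 3" using v(2) dxi_abs_le[OF q1] by linarith
      show "integrable M (\<lambda>w'. ?F (flat_vector N i w, cav_vector N i w'))"
        by (simp only: fst_conv snd_conv eq) (rule integrable_abs[OF gaussian_rv_abs(1)[OF v(1)]])
      show "(\<integral>w'. ?F (flat_vector N i w, cav_vector N i w') \<partial>M) \<le> sqrt (dxi 1 + ddxi 1 * 3)"
        by (simp only: fst_conv snd_conv eq) (rule order_trans[OF gaussian_rv_abs(2)[OF v(1)] real_sqrt_le_mono[OF vle]])
    qed auto
    then have z: "integrable M (\<lambda>w. \<bar>site_field N i w\<bar>)" by (simp only: fst_conv snd_conv eq)
    have zmeas: "site_field N i \<in> borel_measurable M"
      unfolding cav_mean_def by (intro measurable_gibbs finite_spin_configs measurable_H0 measurable_cav)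
    show ?thesis
    proof (rule Bochner_Integration.integrable_bound[of _ "\<lambda>w. \<bar>F h\<bar> + K * \<bar>site_field N i w\<bar>"])
      show "integrable M (\<lambda>w. \<bar>F h\<bar> + K * \<bar>site_field N i w\<bar>)" using z by simp
      show "(\<lambda>w. F (h + site_field N i w)) \<in> borel_measurable M" using zmeas by measurable
      have "\<bar>F (h + site_field N i w)\<bar> \<le> \<bar>F h\<bar> + K * \<bar>site_field N i w\<bar>" for w
        using F[of "h + site_field N i w" h] by simp
      then show "AE w in M. norm (F (h + site_field N i w)) \<le> norm (\<bar>F h\<bar> + K * \<bar>site_field N i w\<bar>)"
        using K by (auto intro: order_trans[OF _ abs_ge_self])
    qed
  qed
  have Fm: "(\<lambda>z. F (h + cav_mean N i 1 (weight N i (fst z)) (snd z))) \<in> borel_measurable (field_space N \<Otimes>\<^sub>M field_space N)"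
    using zm by measurable
  note d = decouple[OF indep_cavity[of N i] Fm, unfolded fst_conv snd_conv eq, OF int]
  have "(\<integral>w. F (h + site_field N i w) \<partial>M) - I = (\<integral>w. (\<integral>w'. F (h + cav_mean N i 1 (H0 N i w) (\<lambda>\<sigma>. cav N i \<sigma> w')) \<partial>M) - I \<partial>M)"
    using d by (simp add: prob_space)
  then have "\<bar>(\<integral>w. F (h + site_field N i w) \<partial>M) - I\<bar>
      \<le> (\<integral>w. \<bar>(\<integral>w'. F (h + cav_mean N i 1 (H0 N i w) (\<lambda>\<sigma>. cav N i \<sigma> w')) \<partial>M) - I\<bar> \<partial>M)"
    by (simp only: integral_abs_bound)
  also have "\<dots> \<le> (\<integral>w. K * sqrt (ddxi 1) * sqrt (site_dev q N i w) \<partial>M)"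
    using d(1) by (intro integral_mono inner integrable_mult_right integrable_root_dev N q1 integrable_abs Bochner_Integration.integrable_diff integrable_const)
  finally show ?two
    by (simp add: root_dev_def I_def)
qed

end

lemma abs_diff_chain: "\<bar>x - y\<bar> \<le> a ==> \<bar>y - z\<bar> \<le> b ==> \<bar>x - z\<bar> \<le> a + b" for x y z a b :: real
  by linarith

section \<open>The effective field at one site\<close>

context spin_glass
begin

lemma AE_cavity_split:
  assumes N: "1 \<le> N" and i: "i \<in> {1..N}"
  shows "AE w in M. \<forall>\<sigma>\<in>spin_configs N. H N w \<sigma> = H0 N i w \<sigma> + (cav N i \<sigma> w + h * \<sigma> i)"
proof (rule AE_finite_allI[OF finite_spin_configs])
  fix \<sigma> assume s: "\<sigma> \<in> spin_configs N"
  let ?c = "\<lambda>t. if t then 1 else -1 :: real" and ?b = "\<lambda>t. if t then spin_coeff \<beta> N \<sigma> else spin_coeff \<beta> N (\<sigma>(i := 0))"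
  have "AE w in M. gseries N (\<lambda>js. \<Sum>t\<in>UNIV. ?c t * ?b t js) (G w) = (\<Sum>t\<in>UNIV. ?c t * gseries N (?b t) (G w))"
  proof (rule gseries_linear)
    show "l2_summable N (?b t)" for t
      using spin_configs_in_cube[OF s] flat_in_cube[OF s, of i] N
      by (cases t) (auto simp: in_cube_def intro!: l2_summable_spin_coeff)
  qed simp
  then show "AE w in M. H N w \<sigma> = H0 N i w \<sigma> + (cav N i \<sigma> w + h * \<sigma> i)"
  proof eventually_elim
    case (elim w)
    have "cav N i \<sigma> w = X N \<sigma> w - X N (\<sigma>(i := 0)) w"
      using elim by (simp add: cav_def mixed_hamiltonian_eq cav_coeff_def[abs_def] UNIV_bool)
    moreover have "(\<Sum>j=1..N. \<sigma> j) = \<sigma> i + (\<Sum>j\<in>{1..N} - {i}. \<sigma> j)" using i by (simp add: sum.remove)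
    ultimately show ?case by (simp add: hamiltonian_def H0_def other_field_def distrib_left)
  qed
qed

lemma H0_set_spin: "H0 N i w (\<sigma>(i := e)) = H0 N i w \<sigma>"
  by (simp add: H0_def other_field_def)

text \<open>If the weights do not depend on the spin at \<open>i\<close>, that spin is a fair coin, independent of the
  others.\<close>

lemma gibbs_flip:
  assumes i: "i \<in> {1..N}" and W: "\<And>\<sigma> e. W (\<sigma>(i := e)) = W \<sigma>"
  shows "gibbs (spin_configs N) W f = gibbs (spin_configs N) W (\<lambda>\<sigma>. (f (\<sigma>(i := 1)) + f (\<sigma>(i := -1))) / 2)"
proof -
  let ?S = "spin_configs N"
  have v: "\<sigma> i = 1 \<or> \<sigma> i = -1" if "\<sigma> \<in> ?S" for \<sigma> using spin_configs_values[OF that i] by auto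
  have sp: "\<sigma>(i := - \<sigma> i) \<in> ?S" if "\<sigma> \<in> ?S" for \<sigma> using v[OF that] by (intro set_spin_configs that i) auto
  have "(\<Sum>\<sigma>\<in>?S. exp (W \<sigma>) * f \<sigma>) = (\<Sum>\<sigma>\<in>?S. exp (W \<sigma>) * f (\<sigma>(i := - \<sigma> i)))"
    by (rule sum.reindex_bij_witness[of _ "\<lambda>\<sigma>. \<sigma>(i := - \<sigma> i)" "\<lambda>\<sigma>. \<sigma>(i := - \<sigma> i)"]) (auto simp: W intro: sp)
  then have a: "gibbs ?S W f = gibbs ?S W (\<lambda>\<sigma>. f (\<sigma>(i := - \<sigma> i)))" by (simp add: gibbs_def)
  have "gibbs ?S W (\<lambda>\<sigma>. (f (\<sigma>(i := 1)) + f (\<sigma>(i := -1))) / 2) = gibbs ?S W (\<lambda>\<sigma>. (f \<sigma> + f (\<sigma>(i := - \<sigma> i))) / 2)"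
  proof (rule gibbs_cong[OF refl])
    fix \<sigma> assume "\<sigma> \<in> ?S"
    then consider "\<sigma> i = 1" | "\<sigma> i = -1" using v by blast
    then show "(f (\<sigma>(i := 1)) + f (\<sigma>(i := -1))) / 2 = (f \<sigma> + f (\<sigma>(i := - \<sigma> i))) / 2"
    proof cases
      case 1
      then have "\<sigma>(i := 1) = \<sigma>" by auto
      then show ?thesis using 1 by simp
    next
      case 2
      then have "\<sigma>(i := -1) = \<sigma>" by auto
      then show ?thesis using 2 by simp
    qed
  qed
  also have "\<dots> = gibbs ?S W f" by (simp only: gibbs_divide gibbs_add a[symmetric]) simp
  finally show ?thesis ..
qed

abbreviation site_exp :: "nat => nat => real => 'a => real" where
  "site_exp N i e w \<equiv> cav_exp N i e (H0 N i w) (\<lambda>\<sigma>. cav N i \<sigma> w)"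

abbreviation site_mean :: "nat => nat => real => 'a => real" where
  "site_mean N i e w \<equiv> cav_mean N i e (H0 N i w) (\<lambda>\<sigma>. cav N i \<sigma> w)"

text \<open>The logarithm of the weight of the spin value \<open>e\<close> at site \<open>i\<close>, relative to the system
  without that spin.\<close>

definition site_log :: "nat => nat => real => 'a => real" where
  "site_log N i e w = e * h + site_mean N i e w + ln (site_exp N i e w)"

definition local_field :: "nat => nat => 'a => real" where
  "local_field N i w = (site_log N i 1 w - site_log N i (-1) w) / 2"

abbreviation reduced_partition :: "nat => nat => 'a => real" where
  "reduced_partition N i w \<equiv> \<Sum>\<sigma>\<in>spin_configs N. exp (H0 N i w \<sigma>)"

lemma site_exp_ge_1: "1 \<le> site_exp N i e w"
proof -
  let ?E = "gibbs (spin_configs N) (H0 N i w)"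
  have "exp (?E (\<lambda>\<sigma>. cav N i (\<sigma>(i := e)) w - site_mean N i e w)) \<le> site_exp N i e w"
    unfolding cav_exp_def by (rule gibbs_exp_jensen[OF finite_spin_configs spin_configs_nonempty])
  moreover have "?E (\<lambda>\<sigma>. cav N i (\<sigma>(i := e)) w - site_mean N i e w) = 0"
    by (simp only: gibbs_diff avg_const cav_mean_def)
  ultimately show ?thesis by simp
qed

lemma exp_site_log:
  "exp (site_log N i e w) = exp (e * h) * gibbs (spin_configs N) (H0 N i w) (\<lambda>\<sigma>. exp (cav N i (\<sigma>(i := e)) w))"
proof -
  have "gibbs (spin_configs N) (H0 N i w) (\<lambda>\<sigma>. exp (cav N i (\<sigma>(i := e)) w))
      = gibbs (spin_configs N) (H0 N i w) (\<lambda>\<sigma>. exp (site_mean N i e w) * exp (cav N i (\<sigma>(i := e)) w - site_mean N i e w))"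
    by (simp add: exp_add[symmetric])
  also have "\<dots> = exp (site_mean N i e w) * site_exp N i e w" by (simp only: gibbs_mult cav_exp_def)
  finally have a: "gibbs (spin_configs N) (H0 N i w) (\<lambda>\<sigma>. exp (cav N i (\<sigma>(i := e)) w)) = exp (site_mean N i e w) * site_exp N i e w" .
  have "0 < site_exp N i e w" using site_exp_ge_1[of N i e w] by linarith
  then show ?thesis unfolding a site_log_def by (simp add: exp_add mult.assoc)
qed

lemma measurable_site_mean [measurable]: "site_mean N i e \<in> borel_measurable M"
  unfolding cav_mean_def by (intro measurable_gibbs finite_spin_configs measurable_H0 measurable_cav)

lemma measurable_site_exp [measurable]: "site_exp N i e \<in> borel_measurable M"
  unfolding cav_exp_def
  by (intro measurable_gibbs finite_spin_configs measurable_H0 borel_measurable_exp measurable_compose[OF _ borel_measurable_exp]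
      borel_measurable_diff measurable_cav measurable_site_mean)

lemma measurable_site_log [measurable]: "site_log N i e \<in> borel_measurable M"
  unfolding site_log_def[abs_def] using measurable_site_mean measurable_site_exp by measurable

lemma measurable_local_field [measurable]: "local_field N i \<in> borel_measurable M"
  unfolding local_field_def[abs_def] by measurable

text \<open>Summing out one spin: given the others, it is a two-valued variable whose weights are the
  averages of the cavity field over the system without that spin.\<close>

lemma AE_local_field:
  assumes N: "1 \<le> N" and i: "i \<in> {1..N}"
  shows "AE w in M. mag N w i = tanh (local_field N i w) \<and>
    ln (partition_function \<beta> h (G w) N) - ln (reduced_partition N i w)
      = ln (exp (site_log N i 1 w) + exp (site_log N i (-1) w)) - ln 2"
  using AE_cavity_split[OF N i]
proof eventually_elim
  case (elim w)
  let ?S = "spin_configs N" and ?E = "gibbs (spin_configs N) (H0 N i w)"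
  let ?u = "\<lambda>\<sigma>. cav N i \<sigma> w + h * \<sigma> i" and ?A = "exp (site_log N i 1 w)" and ?B = "exp (site_log N i (-1) w)"
  note S = finite_spin_configs spin_configs_nonempty
  have flip: "?E f = ?E (\<lambda>\<sigma>. (f (\<sigma>(i := 1)) + f (\<sigma>(i := -1))) / 2)" for f
    by (rule gibbs_flip[OF i]) (rule H0_set_spin)
  have den: "?E (\<lambda>\<sigma>. exp (?u \<sigma>)) = (?A + ?B) / 2"
    unfolding exp_site_log gibbs_divide[symmetric] gibbs_mult[symmetric] gibbs_add[symmetric]
    by (subst flip) (rule gibbs_cong[OF refl], simp add: exp_add exp_diff exp_minus field_simps)
  have num: "?E (\<lambda>\<sigma>. exp (?u \<sigma>) * \<sigma> i) = (?A - ?B) / 2"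
    unfolding exp_site_log gibbs_divide[symmetric] gibbs_mult[symmetric] gibbs_diff[symmetric]
    by (subst flip) (rule gibbs_cong[OF refl], simp add: exp_add exp_diff exp_minus field_simps)
  have half: "(a / 2) / (b / 2) = a / b" for a b :: real by simp
  have "mag N w i = gibbs ?S (\<lambda>\<sigma>. H0 N i w \<sigma> + ?u \<sigma>) (\<lambda>\<sigma>. \<sigma> i)"
    unfolding mag_avg using elim by (intro gibbs_cong) auto
  also have "\<dots> = (?A - ?B) / (?A + ?B)"
    unfolding gibbs_change[OF S] num den by (rule half)
  also have "\<dots> = tanh (local_field N i w)"
    using tanh_half_log_ratio[of ?A ?B] by (simp add: local_field_def)
  finally have m: "mag N w i = tanh (local_field N i w)" .
  have "partition_function \<beta> h (G w) N = (\<Sum>\<sigma>\<in>?S. exp (H0 N i w \<sigma> + ?u \<sigma>))"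
    unfolding partition_function_def using elim by (intro sum.cong) auto
  then have "ln (partition_function \<beta> h (G w) N) - ln (reduced_partition N i w) = ln ((?A + ?B) / 2)"
    using ln_partition_diff[OF S, of "H0 N i w" ?u] by (simp add: den)
  also have "\<dots> = ln (?A + ?B) - ln 2"
    by (rule ln_divide_pos) (auto intro: add_pos_pos)
  finally show ?case using m by simp
qed

lemma ln_site_exp_defect:
  assumes "\<bar>q\<bar> \<le> 1"
  shows "\<bar>ln (site_exp N i e w) - half_variance q\<bar> \<le> \<bar>site_exp N i e w - exp (half_variance q)\<bar>"
  using ln_lipschitz_above_one[of "site_exp N i e w" "exp (half_variance q)"] site_exp_ge_1[of N i e w] half_variance_nonneg[OF assms]
  by simp

text \<open>The constant \<open>half_variance q\<close> is common to both spin values and cancels in the difference.\<close>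

lemma local_field_defect:
  assumes q: "\<bar>q\<bar> \<le> 1"
  shows "\<bar>local_field N i w - (h + site_field N i w)\<bar> \<le> site_defect q N i w"
proof -
  have eq: "local_field N i w - (h + site_field N i w) = ((ln (site_exp N i 1 w) - half_variance q)
      - (ln (site_exp N i (-1) w) - half_variance q) - (site_mean N i 1 w + site_mean N i (-1) w)) / 2"
    by (simp add: local_field_def site_log_def field_simps)
  have h: "\<bar>(a - b - c) / 2\<bar> \<le> A + B + \<bar>c\<bar>" if "\<bar>a\<bar> \<le> A" "\<bar>b\<bar> \<le> B" for a b c A B :: real
    using abs_le_D1[OF that(1)] abs_le_D2[OF that(1)] abs_le_D1[OF that(2)] abs_le_D2[OF that(2)]
      abs_ge_self[of c] abs_ge_minus_self[of c] by (intro abs_leI) (simp_all add: field_simps)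
  show ?thesis unfolding eq cav_defect_def by (intro h ln_site_exp_defect q)
qed

lemma site_partition_defect:
  assumes q: "\<bar>q\<bar> \<le> 1"
  shows "\<bar>ln (exp (site_log N i 1 w) + exp (site_log N i (-1) w)) - half_variance q - log_cosh (h + site_field N i w)\<bar>
    \<le> site_defect q N i w"
proof -
  let ?c = "half_variance q" and ?y = "h + site_field N i w"
  have pos: "0 < exp ?y + exp (- ?y)" by (intro add_pos_pos) auto
  have "ln (exp (?y + ?c) + exp (- ?y + ?c)) = ln (exp ?c * (exp ?y + exp (- ?y)))"
    by (simp add: exp_add exp_diff exp_minus field_simps)
  also have "\<dots> = ?c + log_cosh ?y"
    by (subst ln_mult_pos) (use pos in \<open>auto simp: log_cosh_def\<close>)
  finally have "\<bar>ln (exp (site_log N i 1 w) + exp (site_log N i (-1) w)) - ?c - log_cosh ?y\<bar>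
      = \<bar>ln (exp (site_log N i 1 w) + exp (site_log N i (-1) w)) - ln (exp (?y + ?c) + exp (- ?y + ?c))\<bar>" by simp
  also have "\<dots> \<le> \<bar>site_log N i 1 w - (?y + ?c)\<bar> + \<bar>site_log N i (-1) w - (- ?y + ?c)\<bar>" by (rule log_sum_exp_lipschitz)
  also have "\<dots> \<le> site_defect q N i w"
  proof -
    have e1: "site_log N i 1 w - (?y + ?c) = ln (site_exp N i 1 w) - ?c" by (simp add: site_log_def)
    have e2: "site_log N i (-1) w - (- ?y + ?c) = (ln (site_exp N i (-1) w) - ?c) + (site_mean N i 1 w + site_mean N i (-1) w)"
      by (simp add: site_log_def)
    have h: "\<bar>a\<bar> + \<bar>b + c\<bar> \<le> A + B + \<bar>c\<bar>" if "\<bar>a\<bar> \<le> A" "\<bar>b\<bar> \<le> B" for a b c A B :: real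
      using that by linarith
    show ?thesis unfolding e1 e2 cav_defect_def by (intro h ln_site_exp_defect q)
  qed
  finally show ?thesis .
qed

lemma integral_close:
  fixes f k d :: "'a => real"
  assumes k: "integrable M k" and d: "integrable M d" and [measurable]: "f \<in> borel_measurable M"
    and le: "AE w in M. \<bar>f w - k w\<bar> \<le> d w"
  shows "integrable M f" and "\<bar>(\<integral>w. f w \<partial>M) - (\<integral>w. k w \<partial>M)\<bar> \<le> (\<integral>w. d w \<partial>M)" (is ?two)
proof -
  have [measurable]: "k \<in> borel_measurable M" using k by auto
  have fk: "integrable M (\<lambda>w. f w - k w)"
    by (rule Bochner_Integration.integrable_bound[OF d]) (use le in auto)
  show f: "integrable M f" using Bochner_Integration.integrable_add[OF fk k] by simp
  have "\<bar>(\<integral>w. f w \<partial>M) - (\<integral>w. k w \<partial>M)\<bar> = \<bar>\<integral>w. f w - k w \<partial>M\<bar>" using f k by simp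
  also have "\<dots> \<le> (\<integral>w. \<bar>f w - k w\<bar> \<partial>M)" by (rule integral_abs_bound)
  also have "\<dots> \<le> (\<integral>w. d w \<partial>M)" by (rule integral_mono_AE[OF integrable_abs[OF fk] d le])
  finally show ?two .
qed

lemma local_field_law:
  fixes F :: "real => real"
  assumes N: "1 \<le> N" and i: "i \<in> {1..N}" and q: "0 \<le> q" "q \<le> 1"
    and F: "\<And>x y. \<bar>F x - F y\<bar> \<le> K * \<bar>x - y\<bar>"
  shows "integrable M (\<lambda>w. F (local_field N i w))" (is ?one)
    and "\<bar>(\<integral>w. F (local_field N i w) \<partial>M) - (\<integral>x. F (h + sqrt (dxi q) * x) \<partial>std_normal_distribution)\<bar>
      \<le> K * (defect_const q + sqrt (ddxi 1)) * root_dev q N i" (is ?two)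
proof -
  have q1: "\<bar>q\<bar> \<le> 1" using q by simp
  have K: "0 \<le> K" using F[of 1 0] by simp
  have [measurable]: "F \<in> borel_measurable borel" by (rule lipschitz_measurable[OF F])
  note law = site_field_law[OF N i q F] and def = site_defect_mean[OF N i q1]
  have le: "\<bar>F (local_field N i w) - F (h + site_field N i w)\<bar> \<le> K * site_defect q N i w" for w
    by (rule order_trans[OF F]) (intro mult_left_mono local_field_defect q1 K)
  note c = integral_close[OF law(1) integrable_mult_right[OF def(1)], of "\<lambda>w. F (local_field N i w)" K, OF _ AE_I2[OF le]]
  show ?one by (rule c(1)) measurable
  have "\<bar>(\<integral>w. F (local_field N i w) \<partial>M) - (\<integral>w. F (h + site_field N i w) \<partial>M)\<bar> \<le> (\<integral>w. K * site_defect q N i w \<partial>M)"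
    by (rule c(2)) measurable
  also have "\<dots> \<le> K * (defect_const q * root_dev q N i)" using def(2) K by (simp add: mult_left_mono)
  finally show ?two
    using abs_diff_chain[OF _ law(2)] by (simp add: distrib_left distrib_right mult.assoc)
qed

text \<open>The term \<open>ln 2\<close> is subtracted because the spin \<open>i\<close> is still summed over in the reduced partition
  function, whose Hamiltonian does not depend on it.\<close>

lemma spin_addition_mean:
  assumes N: "1 \<le> N" and i: "i \<in> {1..N}" and q: "0 \<le> q" "q \<le> 1"
  shows "integrable M (\<lambda>w. ln (partition_function \<beta> h (G w) N) - ln (reduced_partition N i w))"
    and "\<bar>(\<integral>w. ln (partition_function \<beta> h (G w) N) - ln (reduced_partition N i w) \<partial>M)
      - (half_variance q - ln 2 + (\<integral>x. log_cosh (h + sqrt (dxi q) * x) \<partial>std_normal_distribution))\<bar>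
      \<le> (defect_const q + 2 * sqrt (ddxi 1)) * root_dev q N i"
proof -
  have q1: "\<bar>q\<bar> \<le> 1" using q by simp
  let ?f = "\<lambda>w. ln (partition_function \<beta> h (G w) N) - ln (reduced_partition N i w)"
  let ?k = "\<lambda>w. log_cosh (h + site_field N i w) + (half_variance q - ln 2)"
  have m: "?f \<in> borel_measurable M" unfolding partition_function_def by measurable
  note law = site_field_law[OF N i q log_cosh_lipschitz] and def = site_defect_mean[OF N i q1]
  have k: "integrable M ?k" using law(1) by simp
  have le: "AE w in M. \<bar>?f w - ?k w\<bar> \<le> site_defect q N i w"
    using AE_local_field[OF N i]
  proof eventually_elim
    case (elim w)
    show ?case using site_partition_defect[OF q1, of N i w] elim by (simp add: algebra_simps)
  qed
  note c = integral_close[OF k def(1) m le]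
  show "integrable M ?f" by (rule c(1))
  define P where "P = (\<integral>x. log_cosh (h + sqrt (dxi q) * x) \<partial>std_normal_distribution)"
  have "(\<integral>w. ?k w \<partial>M) = (\<integral>w. log_cosh (h + site_field N i w) \<partial>M) + (half_variance q - ln 2)"
    using law(1) by (simp add: prob_space)
  then have "\<bar>(\<integral>w. ?k w \<partial>M) - (half_variance q - ln 2 + P)\<bar> \<le> 2 * sqrt (ddxi 1) * root_dev q N i"
    using law(2) by (simp add: P_def)
  note bound = order_trans[OF abs_diff_chain[OF c(2) this] add_right_mono[OF def(2)]]
  show "\<bar>(\<integral>w. ?f w \<partial>M)
      - (half_variance q - ln 2 + (\<integral>x. log_cosh (h + sqrt (dxi q) * x) \<partial>std_normal_distribution))\<bar>
      \<le> (defect_const q + 2 * sqrt (ddxi 1)) * root_dev q N i"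
    using bound by (simp only: P_def distrib_right)
qed

end

section \<open>Concentration of the overlap without one spin\<close>

text \<open>A change of measure: the density \<open>\<rho>\<close> of the weights \<open>W\<close> with respect to the weights \<open>W + u\<close>
  has second moment \<open>\<langle>exp u\<rangle> \<langle>exp (- u)\<rangle>\<close>, and \<open>\<rho> \<rho>' f \<le> f\<^sup>2 / 2 s + s (\<rho> \<rho>')\<^sup>2 / 2\<close>.\<close>

lemma gibbs_tilt_pair:
  fixes s :: real and u W :: "'b => real"
  assumes S: "finite S" "S \<noteq> {}" and s: "0 < s"
  shows "gibbs S W (\<lambda>\<sigma>. gibbs S W (f \<sigma>))
    \<le> gibbs S (\<lambda>\<sigma>. W \<sigma> + u \<sigma>) (\<lambda>\<sigma>. gibbs S (\<lambda>\<sigma>. W \<sigma> + u \<sigma>) (\<lambda>\<tau>. (f \<sigma> \<tau>)\<^sup>2)) / (2 * s)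
      + s / 4 * (gibbs S W (\<lambda>\<sigma>. exp (4 * u \<sigma>)) + gibbs S W (\<lambda>\<sigma>. exp (- 4 * u \<sigma>)))"
proof -
  let ?E = "gibbs S W" and ?A = "gibbs S (\<lambda>\<sigma>. W \<sigma> + u \<sigma>)"
  define \<rho> where "\<rho> \<sigma> = exp (- u \<sigma>) / ?A (\<lambda>\<sigma>. exp (- u \<sigma>))" for \<sigma>
  have dens: "?E k = ?A (\<lambda>\<sigma>. \<rho> \<sigma> * k \<sigma>)" for k
    using gibbs_change[OF S, where H = "\<lambda>\<sigma>. W \<sigma> + u \<sigma>" and u = "\<lambda>\<sigma>. - u \<sigma>" and f = k]
    by (simp add: \<rho>_def gibbs_divide)
  have "?A (\<lambda>\<sigma>. exp (- u \<sigma>)) = 1 / ?E (\<lambda>\<sigma>. exp (u \<sigma>))"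
    using gibbs_change[OF S, where H = W and u = u and f = "\<lambda>\<sigma>. exp (- u \<sigma>)"] gibbs_const[OF S, of W 1]
    by (simp add: exp_add[symmetric])
  then have "?E \<rho> = ?E (\<lambda>\<sigma>. exp (- u \<sigma>)) * ?E (\<lambda>\<sigma>. exp (u \<sigma>))"
    by (simp add: \<rho>_def[abs_def] gibbs_divide gibbs_mult_right)
  then have sq: "?A (\<lambda>\<sigma>. (\<rho> \<sigma>)\<^sup>2) = ?E (\<lambda>\<sigma>. exp (- u \<sigma>)) * ?E (\<lambda>\<sigma>. exp (u \<sigma>))"
    by (simp add: dens[of \<rho>] power2_eq_square)
  have four: "((?E (\<lambda>\<sigma>. exp (v \<sigma>)))\<^sup>2)\<^sup>2 \<le> ?E (\<lambda>\<sigma>. exp (4 * v \<sigma>))" for v :: "'b => real"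
  proof -
    have "((?E (\<lambda>\<sigma>. exp (v \<sigma>)))\<^sup>2)\<^sup>2 \<le> (?E (\<lambda>\<sigma>. (exp (v \<sigma>))\<^sup>2))\<^sup>2"
      by (rule power_mono[OF gibbs_square_jensen[OF S]]) simp
    also have "\<dots> \<le> ?E (\<lambda>\<sigma>. ((exp (v \<sigma>))\<^sup>2)\<^sup>2)" by (rule gibbs_square_jensen[OF S])
    also have "\<dots> = ?E (\<lambda>\<sigma>. exp (4 * v \<sigma>))" by (simp add: exp_double[symmetric] mult.assoc[symmetric])
    finally show ?thesis .
  qed
  have ag: "(x * y)\<^sup>2 \<le> ((x\<^sup>2)\<^sup>2 + (y\<^sup>2)\<^sup>2) / 2" for x y :: real
    using sum_squares_bound[of "x\<^sup>2" "y\<^sup>2"] by (simp add: power_mult_distrib)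
  have sq2: "(?A (\<lambda>\<sigma>. (\<rho> \<sigma>)\<^sup>2))\<^sup>2 \<le> (?E (\<lambda>\<sigma>. exp (4 * u \<sigma>)) + ?E (\<lambda>\<sigma>. exp (- 4 * u \<sigma>))) / 2"
    unfolding sq using ag[of "?E (\<lambda>\<sigma>. exp (- u \<sigma>))" "?E (\<lambda>\<sigma>. exp (u \<sigma>))"] four[of u] four[of "\<lambda>\<sigma>. - u \<sigma>"]
    by simp
  have young: "x * y \<le> y\<^sup>2 / (2 * s) + s / 2 * x\<^sup>2" for x y :: real
  proof -
    have "0 \<le> (y - s * x)\<^sup>2 / (2 * s)" using s by simp
    also have "(y - s * x)\<^sup>2 / (2 * s) = y\<^sup>2 / (2 * s) + s / 2 * x\<^sup>2 - x * y"
      using s by (simp add: power2_eq_square field_simps)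
    finally show ?thesis by simp
  qed
  have "?E (\<lambda>\<sigma>. ?E (f \<sigma>)) = ?A (\<lambda>\<sigma>. ?A (\<lambda>\<tau>. (\<rho> \<sigma> * \<rho> \<tau>) * f \<sigma> \<tau>))"
    by (simp only: dens gibbs_mult[symmetric] mult.assoc)
  also have "\<dots> \<le> ?A (\<lambda>\<sigma>. ?A (\<lambda>\<tau>. (f \<sigma> \<tau>)\<^sup>2 / (2 * s) + s / 2 * ((\<rho> \<sigma>)\<^sup>2 * (\<rho> \<tau>)\<^sup>2)))"
    by (intro gibbs_mono[OF S]) (metis young power_mult_distrib)
  also have "\<dots> = ?A (\<lambda>\<sigma>. ?A (\<lambda>\<tau>. (f \<sigma> \<tau>)\<^sup>2)) / (2 * s) + s / 2 * (?A (\<lambda>\<sigma>. (\<rho> \<sigma>)\<^sup>2))\<^sup>2"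
    by (simp only: gibbs_add gibbs_divide gibbs_mult gibbs_mult_right power2_eq_square[of "?A _"])
  also have "\<dots> \<le> ?A (\<lambda>\<sigma>. ?A (\<lambda>\<tau>. (f \<sigma> \<tau>)\<^sup>2)) / (2 * s)
      + s / 2 * ((?E (\<lambda>\<sigma>. exp (4 * u \<sigma>)) + ?E (\<lambda>\<sigma>. exp (- 4 * u \<sigma>))) / 2)"
    using s by (intro add_left_mono mult_left_mono sq2) auto
  finally show ?thesis by simp
qed

context spin_glass
begin

definition overlap_var :: "real => nat => real" where
  "overlap_var q N = (\<integral>w. avg N w (\<lambda>\<sigma>. avg N w (\<lambda>\<tau>. (overlap N \<sigma> \<tau> - q)\<^sup>2)) \<partial>M)"

lemma integrable_avg_bounded:
  assumes "\<And>\<sigma>. \<sigma> \<in> spin_configs N ==> (\<lambda>w. f w \<sigma>) \<in> borel_measurable M"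
    and "\<And>w \<sigma>. \<sigma> \<in> spin_configs N ==> \<bar>f w \<sigma>\<bar> \<le> (c :: real)"
  shows "integrable M (\<lambda>w. avg N w (f w))"
  by (rule integrable_const_bound[of _ c]) (use assms in \<open>auto intro!: avg_abs_le measurable_avg\<close>)

lemma integrable_pair_avg:
  assumes "\<And>\<sigma> \<tau>. \<sigma> \<in> spin_configs N ==> \<tau> \<in> spin_configs N ==> \<bar>f \<sigma> \<tau>\<bar> \<le> (c :: real)"
  shows "integrable M (\<lambda>w. avg N w (\<lambda>\<sigma>. avg N w (f \<sigma>)))"
  by (rule integrable_avg_bounded[of _ _ c]) (use assms in \<open>auto intro!: avg_abs_le measurable_avg\<close>)

lemma overlap_square_le:
  assumes "\<bar>q\<bar> \<le> 1" "\<sigma> \<in> spin_configs N" "\<tau> \<in> spin_configs N" shows "\<bar>(overlap N \<sigma> \<tau> - q)\<^sup>2\<bar> \<le> 4"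
proof -
  have "\<bar>overlap N \<sigma> \<tau> - q\<bar> \<le> 2" using spins_overlap[OF assms(2,3)] assms(1) by linarith
  then have "\<bar>overlap N \<sigma> \<tau> - q\<bar>\<^sup>2 \<le> 2\<^sup>2" by (rule power_mono) simp
  then show ?thesis by simp
qed

lemma overlap_var_nonneg: "0 \<le> overlap_var q N"
  unfolding overlap_var_def by (intro Bochner_Integration.integral_nonneg avg_nonneg) auto

lemma overlap_dev_mean:
  assumes q: "\<bar>q\<bar> \<le> 1"
  shows "integrable M (overlap_dev q N)" (is ?one) and "(\<integral>w. overlap_dev q N w \<partial>M) \<le> sqrt (overlap_var q N)" (is ?two)
proof -
  let ?V = "\<lambda>w. avg N w (\<lambda>\<sigma>. avg N w (\<lambda>\<tau>. (overlap N \<sigma> \<tau> - q)\<^sup>2))"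
  have V: "integrable M ?V" by (rule integrable_pair_avg) (rule overlap_square_le[OF q])
  have le: "(overlap_dev q N w)\<^sup>2 \<le> ?V w" for w
  proof -
    have "(overlap_dev q N w)\<^sup>2 \<le> avg N w (\<lambda>\<sigma>. (avg N w (\<lambda>\<tau>. \<bar>overlap N \<sigma> \<tau> - q\<bar>))\<^sup>2)"
      unfolding overlap_dev_def by (rule gibbs_square_jensen[OF finite_spin_configs spin_configs_nonempty])
    also have "\<dots> \<le> avg N w (\<lambda>\<sigma>. avg N w (\<lambda>\<tau>. \<bar>overlap N \<sigma> \<tau> - q\<bar>\<^sup>2))"
      by (rule avg_mono) (rule gibbs_square_jensen[OF finite_spin_configs spin_configs_nonempty])
    finally show ?thesis by simp
  qed
  have sq: "integrable M (\<lambda>w. (overlap_dev q N w)\<^sup>2)"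
    by (rule Bochner_Integration.integrable_bound[OF V]) (use le in \<open>auto intro: order_trans[OF _ abs_ge_self]\<close>)
  show ?one by (rule integral_abs_le_sqrt(1)[OF _ sq]) measurable
  have "(\<integral>w. overlap_dev q N w \<partial>M) \<le> (\<integral>w. \<bar>overlap_dev q N w\<bar> \<partial>M)"
    using overlap_dev_nonneg by simp
  also have "\<dots> \<le> sqrt (\<integral>w. (overlap_dev q N w)\<^sup>2 \<partial>M)"
    by (rule integral_abs_le_sqrt(2)[OF _ sq]) measurable
  also have "\<dots> \<le> sqrt (overlap_var q N)"
    unfolding overlap_var_def by (intro real_sqrt_le_mono integral_mono sq V le)
  finally show ?two .
qed

text \<open>For deterministic weights this is the exponential moment of a Gaussian variable of variance at
  most \<open>\<xi>'(1)\<close>; the weights are independent of the cavity field.\<close>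

lemma cav_exp_moment:
  assumes N: "1 \<le> N" and i: "i \<in> {1..N}" and c: "c \<in> {4, -4}"
  shows "integrable M (\<lambda>w. gibbs (spin_configs N) (H0 N i w) (\<lambda>\<sigma>. exp (c * cav N i \<sigma> w)))"
    and "(\<integral>w. gibbs (spin_configs N) (H0 N i w) (\<lambda>\<sigma>. exp (c * cav N i \<sigma> w)) \<partial>M) \<le> exp (8 * dxi 1)"
proof -
  let ?S = "spin_configs N"
  let ?F = "\<lambda>z. gibbs ?S (weight N i (fst z)) (\<lambda>\<sigma>. exp (c * snd z \<sigma>))"
  have F: "?F \<in> borel_measurable (field_space N \<Otimes>\<^sub>M field_space N)"
    by (intro measurable_gibbs finite_spin_configs borel_measurable_add borel_measurable_const
        measurable_compose[OF _ borel_measurable_exp] borel_measurable_times measurable_pair_component)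
  have eq: "?F (flat_vector N i w, cav_vector N i w') = gibbs ?S (H0 N i w) (\<lambda>\<sigma>. exp (c * cav N i \<sigma> w'))" for w w'
    by (rule gibbs_cong) (simp_all only: fst_conv snd_conv weight_flat cav_vector_apply)
  have g: "integrable M (\<lambda>w'. exp (c * cav N i \<sigma> w'))" "(\<integral>w'. exp (c * cav N i \<sigma> w') \<partial>M) \<le> exp (8 * dxi 1)" if s: "\<sigma> \<in> ?S" for \<sigma>
  proof -
    have v: "gaussian_rv M (cav N i \<sigma>) (cav_cov N i \<sigma> \<sigma>)"
      using gaussian_cav[OF N, of "{\<sigma>}" "\<lambda>t. t" "\<lambda>_. 1" i] s by simp
    show "integrable M (\<lambda>w'. exp (c * cav N i \<sigma> w'))" by (rule gaussian_rv_exp(1)[OF v])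
    have "c\<^sup>2 = 16" using c by auto
    then show "(\<integral>w'. exp (c * cav N i \<sigma> w') \<partial>M) \<le> exp (8 * dxi 1)"
      using cav_cov_abs_le[OF N i s s] by (simp add: gaussian_rv_exp(2)[OF v])
  qed
  have inner: "integrable M (\<lambda>w'. ?F (flat_vector N i w, cav_vector N i w'))" for w
    unfolding eq by (rule gibbs_integral(1)) (rule g(1))
  have le: "(\<integral>w'. ?F (flat_vector N i w, cav_vector N i w') \<partial>M) \<le> exp (8 * dxi 1)" for w
  proof -
    have "(\<integral>w'. ?F (flat_vector N i w, cav_vector N i w') \<partial>M)
        = gibbs ?S (H0 N i w) (\<lambda>\<sigma>. \<integral>w'. exp (c * cav N i \<sigma> w') \<partial>M)"
      unfolding eq by (rule gibbs_integral(2)) (rule g(1))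
    also have "\<dots> \<le> gibbs ?S (H0 N i w) (\<lambda>\<sigma>. exp (8 * dxi 1))" by (rule avg_mono) (rule g(2))
    finally show ?thesis by (simp only: avg_const)
  qed
  have nn: "0 \<le> ?F z" for z by (rule avg_nonneg) simp
  note d = decouple_bound[OF indep_cavity[of N i] F nn inner le integrable_const]
  show "integrable M (\<lambda>w. gibbs ?S (H0 N i w) (\<lambda>\<sigma>. exp (c * cav N i \<sigma> w)))" using d(1) unfolding eq .
  show "(\<integral>w. gibbs ?S (H0 N i w) (\<lambda>\<sigma>. exp (c * cav N i \<sigma> w)) \<partial>M) \<le> exp (8 * dxi 1)"
    using d(2) unfolding eq by (simp add: prob_space)
qed

lemma site_dev_pathwise:
  assumes N: "1 \<le> N" and i: "i \<in> {1..N}" and s: "0 < s"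
    and split: "\<forall>\<sigma>\<in>spin_configs N. H N w \<sigma> = H0 N i w \<sigma> + (cav N i \<sigma> w + h * \<sigma> i)"
  shows "site_dev q N i w \<le> avg N w (\<lambda>\<sigma>. avg N w (\<lambda>\<tau>. (overlap N \<sigma> \<tau> - q)\<^sup>2)) / (2 * s)
    + s / 4 * (exp (4 * \<bar>h\<bar>) * (gibbs (spin_configs N) (H0 N i w) (\<lambda>\<sigma>. exp (4 * cav N i \<sigma> w))
      + gibbs (spin_configs N) (H0 N i w) (\<lambda>\<sigma>. exp (-4 * cav N i \<sigma> w)))) + 2 / real N"
proof -
  let ?S = "spin_configs N" and ?E = "gibbs (spin_configs N) (H0 N i w)"
  let ?u = "\<lambda>\<sigma>. cav N i \<sigma> w + h * \<sigma> i"
  have H: "gibbs ?S (\<lambda>\<sigma>. H0 N i w \<sigma> + ?u \<sigma>) f = avg N w f" for f using split by (intro gibbs_cong) auto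
  have dev: "cav_dev q N i \<sigma> \<tau> \<le> \<bar>overlap N \<sigma> \<tau> - q\<bar> + 2 / real N" if "\<sigma> \<in> ?S" "\<tau> \<in> ?S" for \<sigma> \<tau>
  proof -
    have "\<bar>\<sigma> i * \<tau> i\<bar> = 1" using spin_configs_values[OF that(1) i] spin_configs_values[OF that(2) i] by auto
    then have a: "\<bar>\<sigma> i * \<tau> i / real N\<bar> = 1 / real N" by simp
    have b: "overlap N \<sigma> \<tau> = overlap N (\<sigma>(i := 0)) (\<tau>(i := 0)) + \<sigma> i * \<tau> i / real N"
      using overlap_set_spin[OF i, of \<sigma> "\<sigma> i" \<tau> "\<tau> i"] by simp
    show ?thesis unfolding cav_dev_def b using a by linarith
  qed
  have "site_dev q N i w \<le> ?E (\<lambda>\<sigma>. ?E (\<lambda>\<tau>. \<bar>overlap N \<sigma> \<tau> - q\<bar> + 2 / real N))"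
    unfolding mean_dev_def by (intro avg_mono dev)
  also have "\<dots> = ?E (\<lambda>\<sigma>. ?E (\<lambda>\<tau>. \<bar>overlap N \<sigma> \<tau> - q\<bar>)) + 2 / real N" by (simp only: gibbs_add avg_const)
  finally have 1: "site_dev q N i w \<le> ?E (\<lambda>\<sigma>. ?E (\<lambda>\<tau>. \<bar>overlap N \<sigma> \<tau> - q\<bar>)) + 2 / real N" .
  have wt: "?E (\<lambda>\<sigma>. exp (c * ?u \<sigma>)) \<le> exp (4 * \<bar>h\<bar>) * ?E (\<lambda>\<sigma>. exp (c * cav N i \<sigma> w))" if c: "c = 4 \<or> c = -4" for c
  proof -
    have "?E (\<lambda>\<sigma>. exp (c * ?u \<sigma>)) \<le> ?E (\<lambda>\<sigma>. exp (4 * \<bar>h\<bar>) * exp (c * cav N i \<sigma> w))"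
    proof (rule avg_mono)
      fix \<sigma> assume "\<sigma> \<in> ?S"
      then have "\<sigma> i = 1 \<or> \<sigma> i = -1" using spin_configs_values[OF _ i] by auto
      then have "c * (h * \<sigma> i) \<le> 4 * \<bar>h\<bar>" using c by auto
      then show "exp (c * ?u \<sigma>) \<le> exp (4 * \<bar>h\<bar>) * exp (c * cav N i \<sigma> w)"
        by (simp add: exp_add[symmetric] distrib_left)
    qed
    then show ?thesis by (simp only: gibbs_mult)
  qed
  have "?E (\<lambda>\<sigma>. ?E (\<lambda>\<tau>. \<bar>overlap N \<sigma> \<tau> - q\<bar>)) \<le> avg N w (\<lambda>\<sigma>. avg N w (\<lambda>\<tau>. \<bar>overlap N \<sigma> \<tau> - q\<bar>\<^sup>2)) / (2 * s)
      + s / 4 * (?E (\<lambda>\<sigma>. exp (4 * ?u \<sigma>)) + ?E (\<lambda>\<sigma>. exp (- 4 * ?u \<sigma>)))"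
    using gibbs_tilt_pair[OF finite_spin_configs[of N] spin_configs_nonempty[of N] s, where W = "H0 N i w" and u = ?u and f = "\<lambda>\<sigma> \<tau>. \<bar>overlap N \<sigma> \<tau> - q\<bar>"]
    unfolding H .
  also have "\<dots> \<le> avg N w (\<lambda>\<sigma>. avg N w (\<lambda>\<tau>. \<bar>overlap N \<sigma> \<tau> - q\<bar>\<^sup>2)) / (2 * s)
      + s / 4 * (exp (4 * \<bar>h\<bar>) * ?E (\<lambda>\<sigma>. exp (4 * cav N i \<sigma> w)) + exp (4 * \<bar>h\<bar>) * ?E (\<lambda>\<sigma>. exp (-4 * cav N i \<sigma> w)))"
    using s by (intro add_left_mono mult_left_mono add_mono wt) auto
  finally show ?thesis using 1 by (simp add: distrib_left)
qed

lemma site_dev_mean: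
  assumes N: "1 \<le> N" and i: "i \<in> {1..N}" and s: "0 < s" and q: "\<bar>q\<bar> \<le> 1"
  shows "integrable M (site_dev q N i)"
    and "(\<integral>w. site_dev q N i w \<partial>M) \<le> overlap_var q N / (2 * s) + s / 2 * exp (4 * \<bar>h\<bar> + 8 * dxi 1) + 2 / real N" (is ?two)
proof -
  show int: "integrable M (site_dev q N i)"
    by (rule integrable_const_bound[of _ 3]) (use site_dev_le[OF N q] mean_dev_nonneg in auto)
  let ?V = "\<lambda>w. avg N w (\<lambda>\<sigma>. avg N w (\<lambda>\<tau>. (overlap N \<sigma> \<tau> - q)\<^sup>2))"
  let ?e = "\<lambda>c w. gibbs (spin_configs N) (H0 N i w) (\<lambda>\<sigma>. exp (c * cav N i \<sigma> w))"
  let ?B = "\<lambda>w. ?V w / (2 * s) + s / 4 * (exp (4 * \<bar>h\<bar>) * (?e 4 w + ?e (-4) w)) + 2 / real N"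
  have V: "integrable M ?V" by (rule integrable_pair_avg) (rule overlap_square_le[OF q])
  have c: "(4::real) \<in> {4, -4}" "(-4::real) \<in> {4, -4}" by auto
  note e = cav_exp_moment[OF N i c(1)] cav_exp_moment[OF N i c(2)]
  have B: "integrable M ?B"
    using V e(1,3) by (intro Bochner_Integration.integrable_add integrable_mult_right integrable_divide integrable_const)
  have "(\<integral>w. site_dev q N i w \<partial>M) \<le> (\<integral>w. ?B w \<partial>M)"
  proof (rule integral_mono_AE[OF int B])
    show "AE w in M. site_dev q N i w \<le> ?B w"
      using AE_cavity_split[OF N i]
      by eventually_elim (rule site_dev_pathwise[OF N i s])
  qed
  also have "\<dots> = overlap_var q N / (2 * s) + s / 4 * (exp (4 * \<bar>h\<bar>) * ((\<integral>w. ?e 4 w \<partial>M) + (\<integral>w. ?e (-4) w \<partial>M))) + 2 / real N"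
    using V e(1,3) by (simp add: prob_space overlap_var_def)
  also have "\<dots> \<le> overlap_var q N / (2 * s) + s / 4 * (exp (4 * \<bar>h\<bar>) * (exp (8 * dxi 1) + exp (8 * dxi 1))) + 2 / real N"
    using s by (intro add_right_mono add_left_mono mult_left_mono add_mono e(2,4)) auto
  also have "\<dots> = overlap_var q N / (2 * s) + s / 2 * exp (4 * \<bar>h\<bar> + 8 * dxi 1) + 2 / real N"
    by (simp add: exp_add)
  finally show ?two .
qed

text \<open>The square root of the bound of \<open>site_dev_mean\<close> for the nearly optimal choice \<open>s = \<surd>v + 1 / N\<close>, where \<open>v\<close> is the
  variance of the overlap; the summand \<open>1 / N\<close> keeps \<open>s\<close> positive when \<open>v = 0\<close>.\<close>

definition dev_rate :: "real => nat => real" where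
  "dev_rate q N = sqrt (sqrt (overlap_var q N) / 2
     + (sqrt (overlap_var q N) + 1 / real N) / 2 * exp (4 * \<bar>h\<bar> + 8 * dxi 1) + 2 / real N)"

lemma root_dev_rate:
  assumes N: "1 \<le> N" and i: "i \<in> {1..N}" and q: "\<bar>q\<bar> \<le> 1"
  shows "root_dev q N i \<le> dev_rate q N"
proof -
  let ?v = "overlap_var q N"
  define s where "s = sqrt ?v + 1 / real N"
  have s: "0 < s" using N overlap_var_nonneg[of q N] by (simp add: s_def add_nonneg_pos)
  have "?v = sqrt ?v * sqrt ?v" using overlap_var_nonneg[of q N] by simp
  also have "\<dots> \<le> sqrt ?v * s" using overlap_var_nonneg[of q N] by (intro mult_left_mono) (auto simp: s_def)
  finally have "?v / (2 * s) \<le> sqrt ?v * s / (2 * s)" using s by (intro divide_right_mono) auto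
  then have v: "?v / (2 * s) \<le> sqrt ?v / 2" using s by simp
  have i2: "integrable M (\<lambda>w. (sqrt (site_dev q N i w))\<^sup>2)"
    using site_dev_mean(1)[OF N i s q] mean_dev_nonneg by simp
  have "root_dev q N i = (\<integral>w. \<bar>sqrt (site_dev q N i w)\<bar> \<partial>M)"
    using mean_dev_nonneg by (simp add: root_dev_def)
  also have "\<dots> \<le> sqrt (\<integral>w. (sqrt (site_dev q N i w))\<^sup>2 \<partial>M)"
    by (rule integral_abs_le_sqrt(2)[OF _ i2]) measurable
  also have "(\<integral>w. (sqrt (site_dev q N i w))\<^sup>2 \<partial>M) = (\<integral>w. site_dev q N i w \<partial>M)"
    using mean_dev_nonneg by simp
  also have "sqrt (\<integral>w. site_dev q N i w \<partial>M) \<le> dev_rate q N"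
    unfolding dev_rate_def using site_dev_mean(2)[OF N i s q] v unfolding s_def
    by (intro real_sqrt_le_mono) linarith
  finally show ?thesis .
qed

lemma dev_rate_nonneg: "0 \<le> dev_rate q N"
  unfolding dev_rate_def using overlap_var_nonneg[of q N] by simp

lemma dev_rate_tendsto:
  assumes "overlap_var q \<longlonglongrightarrow> 0" shows "dev_rate q \<longlonglongrightarrow> 0"
proof -
  have "(\<lambda>N. sqrt (sqrt (overlap_var q N) / 2
     + (sqrt (overlap_var q N) + 1 / real N) / 2 * exp (4 * \<bar>h\<bar> + 8 * dxi 1) + 2 / real N))
    \<longlonglongrightarrow> sqrt (sqrt 0 / 2 + (sqrt 0 + 0) / 2 * exp (4 * \<bar>h\<bar> + 8 * dxi 1) + 0)"
    by (intro tendsto_intros assms lim_const_over_n lim_1_over_n) auto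
  then show ?thesis by (simp add: dev_rate_def[abs_def])
qed

end

section \<open>The mean TAP free energy of the magnetization\<close>

context spin_glass
begin

definition gauss_log_cosh :: "real => real" where
  "gauss_log_cosh q = (\<integral>x. log_cosh (h + sqrt (dxi q) * x) \<partial>std_normal_distribution)"

definition gauss_tanh_square :: "real => real" where
  "gauss_tanh_square q = (\<integral>x. (tanh (h + sqrt (dxi q) * x))\<^sup>2 \<partial>std_normal_distribution)"

definition field_error :: "real => nat => real" where
  "field_error q N = (defect_const q + sqrt (ddxi 1)) * dev_rate q N"

lemma site_average_law:
  fixes F :: "real => real"
  assumes N: "1 \<le> N" and q: "0 \<le> q" "q \<le> 1" and F: "\<And>x y. \<bar>F x - F y\<bar> \<le> K * \<bar>x - y\<bar>"
  shows "integrable M (\<lambda>w. (\<Sum>i=1..N. F (local_field N i w)) / real N)"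
    and "\<bar>(\<integral>w. (\<Sum>i=1..N. F (local_field N i w)) / real N \<partial>M) - (\<integral>x. F (h + sqrt (dxi q) * x) \<partial>std_normal_distribution)\<bar>
      \<le> K * field_error q N"
proof -
  have q1: "\<bar>q\<bar> \<le> 1" using q by simp
  have K: "0 \<le> K" using F[of 1 0] by simp
  let ?I = "\<integral>x. F (h + sqrt (dxi q) * x) \<partial>std_normal_distribution"
  note law = local_field_law[OF N _ q F]
  show int: "integrable M (\<lambda>w. (\<Sum>i=1..N. F (local_field N i w)) / real N)"
    by (intro integrable_divide Bochner_Integration.integrable_sum law(1))
  have each: "\<bar>(\<integral>w. F (local_field N i w) \<partial>M) - ?I\<bar> \<le> K * field_error q N" if i: "i \<in> {1..N}" for i
  proof -
    have "0 \<le> K * (defect_const q + sqrt (ddxi 1))"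
      using K defect_const_nonneg[of q] ddxi_nonneg[of 1] by (intro mult_nonneg_nonneg add_nonneg_nonneg) auto
    then have "K * (defect_const q + sqrt (ddxi 1)) * root_dev q N i \<le> K * (defect_const q + sqrt (ddxi 1)) * dev_rate q N"
      by (intro mult_left_mono root_dev_rate N i q1)
    then show ?thesis using law(2)[OF i] unfolding field_error_def mult.assoc by (rule order_trans[rotated])
  qed
  have m: "(\<integral>w. (\<Sum>i=1..N. F (local_field N i w)) / real N \<partial>M) = (\<Sum>i=1..N. \<integral>w. F (local_field N i w) \<partial>M) / real N"
    using law(1) by (simp add: Bochner_Integration.integral_sum)
  have "(\<Sum>i=1..N. \<integral>w. F (local_field N i w) \<partial>M) / real N - ?I = (\<Sum>i=1..N. (\<integral>w. F (local_field N i w) \<partial>M) - ?I) / real N"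
    using N by (simp add: sum_subtractf diff_divide_distrib)
  moreover have "\<bar>(\<Sum>i=1..N. (\<integral>w. F (local_field N i w) \<partial>M) - ?I) / real N\<bar> \<le> (\<Sum>i=1..N. K * field_error q N) / real N"
    unfolding abs_divide abs_of_nat by (intro divide_right_mono order_trans[OF sum_abs] sum_mono each) auto
  moreover have "(\<Sum>i=1..N. K * field_error q N) / real N = K * field_error q N" using N by simp
  ultimately show "\<bar>(\<integral>w. (\<Sum>i=1..N. F (local_field N i w)) / real N \<partial>M) - ?I\<bar> \<le> K * field_error q N"
    unfolding m by (simp only:)
qed

lemma AE_local_field_all:
  assumes N: "1 \<le> N" shows "AE w in M. \<forall>i\<in>{1..N}. mag N w i = tanh (local_field N i w)"
proof (rule AE_finite_allI)
  show "AE w in M. mag N w i = tanh (local_field N i w)" if "i \<in> {1..N}" for i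
    using AE_local_field[OF N that] by eventually_elim simp
qed simp

lemma integral_AE_eq:
  fixes f k :: "'a => real"
  assumes "integrable M k" "f \<in> borel_measurable M" "AE w in M. f w = k w"
  shows "integrable M f" "(\<integral>w. f w \<partial>M) = (\<integral>w. k w \<partial>M)"
  using assms by (auto intro: integrable_cong_AE_imp integral_cong_AE)

lemma self_overlap_sum: "overlap N (mag N w) (mag N w) = (\<Sum>i=1..N. (mag N w i)\<^sup>2) / real N"
  by (simp add: overlap_def power2_eq_square)

text \<open>The self-overlap of the magnetization is the Gibbs average of the overlap of two replicas,
  and it is also the average over the sites of \<open>tanh\<^sup>2\<close> of the local fields.\<close>

lemma self_overlap_law:
  assumes N: "1 \<le> N" and q: "0 \<le> q" "q \<le> 1"
  shows "\<bar>q - gauss_tanh_square q\<bar> \<le> 2 * field_error q N + sqrt (overlap_var q N)"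
proof -
  have q1: "\<bar>q\<bar> \<le> 1" using q by simp
  let ?R = "\<lambda>w. overlap N (mag N w) (mag N w)"
  note law = site_average_law[OF N q tanh_square_lipschitz]
  have m: "?R \<in> borel_measurable M" unfolding self_overlap_sum by measurable
  have "AE w in M. ?R w = (\<Sum>i=1..N. (tanh (local_field N i w))\<^sup>2) / real N"
    using AE_local_field_all[OF N] by eventually_elim (simp add: self_overlap_sum)
  note R = integral_AE_eq[OF law(1) m this]
  have "\<bar>(\<integral>w. ?R w \<partial>M) - (\<integral>w. q \<partial>M)\<bar> \<le> (\<integral>w. overlap_dev q N w \<partial>M)"
    by (rule integral_close(2)[OF integrable_const overlap_dev_mean(1)[OF q1] m]) (simp add: overlap_mag_dev)
  then have a: "\<bar>q - (\<integral>w. ?R w \<partial>M)\<bar> \<le> sqrt (overlap_var q N)"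
    using overlap_dev_mean(2)[OF q1, of N] by (simp add: prob_space abs_minus_commute)
  have b: "\<bar>(\<integral>w. ?R w \<partial>M) - gauss_tanh_square q\<bar> \<le> 2 * field_error q N"
    using law(2) unfolding R(2) gauss_tanh_square_def .
  show ?thesis using abs_diff_chain[OF a b] by simp
qed

text \<open>The value at which the overlap concentrates solves the replica symmetric fixed point equation.\<close>

lemma fixed_point:
  assumes q: "0 \<le> q" "q \<le> 1" and lim: "overlap_var q \<longlonglongrightarrow> 0"
  shows "gauss_tanh_square q = q"
proof -
  have "(\<lambda>N. 2 * ((defect_const q + sqrt (ddxi 1)) * dev_rate q N) + sqrt (overlap_var q N))
      \<longlonglongrightarrow> 2 * ((defect_const q + sqrt (ddxi 1)) * 0) + sqrt 0"
    by (intro tendsto_intros dev_rate_tendsto lim)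
  then have "(\<lambda>N. 2 * field_error q N + sqrt (overlap_var q N)) \<longlonglongrightarrow> 0" by (simp add: field_error_def)
  moreover have "eventually (\<lambda>N. \<bar>q - gauss_tanh_square q\<bar> \<le> 2 * field_error q N + sqrt (overlap_var q N)) sequentially"
    using eventually_ge_at_top[of 1] by eventually_elim (rule self_overlap_law[OF _ q])
  ultimately have "\<bar>q - gauss_tanh_square q\<bar> \<le> 0"
    by (intro tendsto_lowerbound) auto
  then show ?thesis by simp
qed

lemma measurable_dxi [measurable]: "dxi \<in> borel_measurable borel"
  unfolding dxi_def[abs_def] by measurable

lemma overlap_spin_mag: "overlap N \<sigma> (mag N w) = avg N w (\<lambda>\<tau>. overlap N \<sigma> \<tau>)"
  unfolding overlap_def gibbs_divide gibbs_sum mag_avg gibbs_mult ..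

text \<open>The overlap of a configuration with the magnetization is an average of overlaps, hence it
  concentrates at \<open>q\<close> too.\<close>

lemma magnetization_energy_limit:
  assumes N: "1 \<le> N" and q: "0 \<le> q" "q \<le> 1"
  shows "\<bar>(\<integral>w. X N (mag N w) w / real N \<partial>M) - dxi q * (1 - q)\<bar> \<le> (2 * ddxi 1 + dxi 1) * sqrt (overlap_var q N)"
proof -
  have q1: "\<bar>q\<bar> \<le> 1" using q by simp
  let ?r = "\<lambda>w \<sigma>. overlap N \<sigma> (mag N w)" and ?K = "2 * ddxi 1 + dxi 1"
  have K: "0 \<le> ?K" using ddxi_nonneg[of 1] dxi_nonneg[of 1] by simp
  have lip: "\<bar>dxi r * (1 - r) - dxi q * (1 - q)\<bar> \<le> ?K * \<bar>r - q\<bar>" if r: "\<bar>r\<bar> \<le> 1" for r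
  proof -
    have "dxi r * (1 - r) - dxi q * (1 - q) = (dxi r - dxi q) * (1 - r) - dxi q * (r - q)" by (simp add: algebra_simps)
    also have "\<bar>\<dots>\<bar> \<le> \<bar>(dxi r - dxi q) * (1 - r)\<bar> + \<bar>dxi q * (r - q)\<bar>" by (rule abs_triangle_ineq4)
    also have "\<dots> \<le> (ddxi 1 * \<bar>r - q\<bar>) * 2 + dxi 1 * \<bar>r - q\<bar>"
      unfolding abs_mult using r q1 dxi_abs_le[OF q1] ddxi_nonneg[of 1] by (intro add_mono mult_mono dxi_lipschitz) auto
    finally show ?thesis by (simp add: algebra_simps)
  qed
  let ?f = "\<lambda>w. avg N w (\<lambda>\<sigma>. dxi (?r w \<sigma>) * (1 - ?r w \<sigma>))"
  have mr: "(\<lambda>w. ?r w \<sigma>) \<in> borel_measurable M" for \<sigma> unfolding overlap_def by measurable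
  have m: "?f \<in> borel_measurable M"
    by (intro measurable_avg borel_measurable_times borel_measurable_diff borel_measurable_const mr
        measurable_compose[OF mr measurable_dxi])
  have le: "\<bar>?f w - dxi q * (1 - q)\<bar> \<le> ?K * overlap_dev q N w" for w
  proof -
    have e: "?f w - dxi q * (1 - q) = avg N w (\<lambda>\<sigma>. dxi (?r w \<sigma>) * (1 - ?r w \<sigma>) - dxi q * (1 - q))"
      by (simp only: gibbs_diff avg_const)
    have "\<bar>?f w - dxi q * (1 - q)\<bar> \<le> avg N w (\<lambda>\<sigma>. \<bar>dxi (?r w \<sigma>) * (1 - ?r w \<sigma>) - dxi q * (1 - q)\<bar>)"
      unfolding e by (rule avg_abs)
    also have "\<dots> \<le> avg N w (\<lambda>\<sigma>. ?K * avg N w (\<lambda>\<tau>. \<bar>overlap N \<sigma> \<tau> - q\<bar>))"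
    proof (rule avg_mono)
      fix \<sigma> assume s: "\<sigma> \<in> spin_configs N"
      have "\<bar>?r w \<sigma>\<bar> \<le> 1" by (intro in_cube_overlap spin_configs_in_cube s mag_in_cube)
      then have "\<bar>dxi (?r w \<sigma>) * (1 - ?r w \<sigma>) - dxi q * (1 - q)\<bar> \<le> ?K * \<bar>?r w \<sigma> - q\<bar>" by (rule lip)
      also have "\<dots> = ?K * \<bar>avg N w (\<lambda>\<tau>. overlap N \<sigma> \<tau> - q)\<bar>"
        unfolding gibbs_diff avg_const overlap_spin_mag ..
      also have "\<dots> \<le> ?K * avg N w (\<lambda>\<tau>. \<bar>overlap N \<sigma> \<tau> - q\<bar>)"
        by (intro mult_left_mono avg_abs K)
      finally show "\<bar>dxi (?r w \<sigma>) * (1 - ?r w \<sigma>) - dxi q * (1 - q)\<bar> \<le> ?K * avg N w (\<lambda>\<tau>. \<bar>overlap N \<sigma> \<tau> - q\<bar>)" .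
    qed
    also have "\<dots> = ?K * overlap_dev q N w" by (simp only: gibbs_mult overlap_dev_def)
    finally show ?thesis .
  qed
  have "\<bar>(\<integral>w. ?f w \<partial>M) - (\<integral>w. dxi q * (1 - q) \<partial>M)\<bar> \<le> (\<integral>w. ?K * overlap_dev q N w \<partial>M)"
    by (rule integral_close(2)[OF integrable_const integrable_mult_right[OF overlap_dev_mean(1)[OF q1]] m AE_I2[OF le]])
  also have "\<dots> \<le> ?K * sqrt (overlap_var q N)" using overlap_dev_mean(2)[OF q1, of N] K by (simp add: mult_left_mono)
  finally have "\<bar>(\<integral>w. ?f w \<partial>M) - dxi q * (1 - q)\<bar> \<le> ?K * sqrt (overlap_var q N)" by (simp add: prob_space)
  moreover have "(\<integral>w. X N (mag N w) w / real N \<partial>M) = (\<integral>w. ?f w \<partial>M)"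
    using magnetization_energy_mean[OF N] N by simp
  ultimately show ?thesis by simp
qed

text \<open>Since the correction involves a derivative, measurability is obtained from its Lipschitz
  bound on the unit interval.\<close>

lemma measurable_tap_correction:
  assumes [measurable]: "f \<in> borel_measurable M" and f: "\<And>w. 0 \<le> f w \<and> f w \<le> 1"
  shows "(\<lambda>w. tap_correction \<beta> (f w)) \<in> borel_measurable M"
proof -
  let ?F = "\<lambda>x. tap_correction \<beta> (max 0 (min 1 x))"
  have "?F \<in> borel_measurable borel"
  proof (rule lipschitz_measurable)
    fix x y :: real
    have "\<bar>?F x - ?F y\<bar> \<le> (dxi 1 + ddxi 1) * \<bar>max 0 (min 1 x) - max 0 (min 1 y)\<bar>"
      by (rule tap_correction_lipschitz) auto
    also have "\<dots> \<le> (dxi 1 + ddxi 1) * \<bar>x - y\<bar>"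
      using ddxi_nonneg[of 1] dxi_nonneg[of 1] by (intro mult_left_mono) auto
    finally show "\<bar>?F x - ?F y\<bar> \<le> (dxi 1 + ddxi 1) * \<bar>x - y\<bar>" .
  qed
  then have "(\<lambda>w. ?F (f w)) \<in> borel_measurable M" by measurable
  moreover have "max 0 (min 1 (f w)) = f w" for w using f[of w] by auto
  ultimately show ?thesis by simp
qed

abbreviation tap_value :: "nat => 'a => real" where
  "tap_value N w \<equiv> tap_free_energy \<beta> h (G w) N (mag N w)"

lemma tap_value_split:
  "tap_value N w = X N (mag N w) w / real N + (\<Sum>i=1..N. - entropy_term (mag N w i) + h * mag N w i) / real N
    + tap_correction \<beta> (overlap N (mag N w) (mag N w))"
  unfolding tap_free_energy_def hamiltonian_def self_overlap_sum sum.distrib sum_negf sum_distrib_left[symmetric]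
  by (simp add: add_divide_distrib diff_divide_distrib)

lemma measurable_entropy_term [measurable]: "entropy_term \<in> borel_measurable borel"
  unfolding entropy_term_def[abs_def] by measurable

text \<open>The replica symmetric formula.\<close>

definition rs_value :: "real => real" where
  "rs_value q = gauss_log_cosh q + tap_correction \<beta> q"

definition tap_error :: "real => nat => real" where
  "tap_error q N = (\<bar>h\<bar> + 2) * field_error q N + (2 * dxi 1 + 3 * ddxi 1) * sqrt (overlap_var q N)"

text \<open>The energy of the magnetization, \<open>\<xi>'(q) (1 - q)\<close>, cancels the loss in the Gaussian
  average of the entropy.\<close>

lemma tap_value_mean:
  assumes N: "1 \<le> N" and q: "0 \<le> q" "q \<le> 1" and fp: "gauss_tanh_square q = q"
  shows "integrable M (tap_value N)" (is ?one) and "\<bar>(\<integral>w. tap_value N w \<partial>M) - rs_value q\<bar> \<le> tap_error q N" (is ?two)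
proof -
  have q1: "\<bar>q\<bar> \<le> 1" using q by simp
  let ?R = "\<lambda>w. overlap N (mag N w) (mag N w)"
  let ?e = "\<lambda>w. (\<Sum>i=1..N. - entropy_term (mag N w i) + h * mag N w i) / real N"
  let ?c = "\<lambda>w. tap_correction \<beta> (?R w)" and ?x = "\<lambda>w. X N (mag N w) w / real N"
  have x: "integrable M ?x" using magnetization_energy_mean(1)[OF N] by simp
  note law = site_average_law[OF N q site_functional_lipschitz[of h]]
  have me: "?e \<in> borel_measurable M" by measurable
  have "AE w in M. ?e w = (\<Sum>i=1..N. site_functional h (local_field N i w)) / real N"
    using AE_local_field_all[OF N] by eventually_elim (auto simp: entropy_term_tanh[symmetric] intro!: arg_cong2[of _ _ _ _ "(/)"] sum.cong)
  note e = integral_AE_eq[OF law(1) me this]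
  have "sqrt (dxi q) ^ 2 = dxi q" using dxi_nonneg[OF q] by simp
  then have g: "(\<integral>x. site_functional h (h + sqrt (dxi q) * x) \<partial>std_normal_distribution) = gauss_log_cosh q - dxi q * (1 - q)"
    unfolding site_functional_gaussian gauss_log_cosh_def[symmetric] gauss_tanh_square_def[symmetric] fp by simp
  have eb: "\<bar>(\<integral>w. ?e w \<partial>M) - (gauss_log_cosh q - dxi q * (1 - q))\<bar> \<le> (\<bar>h\<bar> + 2) * field_error q N"
    using law(2) unfolding e(2) g .
  have R: "?R \<in> borel_measurable M" unfolding self_overlap_sum by measurable
  have mc: "?c \<in> borel_measurable M" by (rule measurable_tap_correction[OF R]) (simp add: self_overlap_unit)
  have lec: "\<bar>?c w - tap_correction \<beta> q\<bar> \<le> (dxi 1 + ddxi 1) * overlap_dev q N w" for w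
  proof -
    have "\<bar>?c w - tap_correction \<beta> q\<bar> \<le> (dxi 1 + ddxi 1) * \<bar>?R w - q\<bar>"
      by (intro tap_correction_lipschitz self_overlap_unit q)
    also have "\<dots> \<le> (dxi 1 + ddxi 1) * overlap_dev q N w"
      using ddxi_nonneg[of 1] dxi_nonneg[of 1] by (intro mult_left_mono overlap_mag_dev) auto
    finally show ?thesis .
  qed
  note c = integral_close[OF integrable_const integrable_mult_right[OF overlap_dev_mean(1)[OF q1]] mc AE_I2[OF lec]]
  have "(dxi 1 + ddxi 1) * (\<integral>w. overlap_dev q N w \<partial>M) \<le> (dxi 1 + ddxi 1) * sqrt (overlap_var q N)"
    using ddxi_nonneg[of 1] dxi_nonneg[of 1] by (intro mult_left_mono overlap_dev_mean(2)[OF q1]) auto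
  then have cb: "\<bar>(\<integral>w. ?c w \<partial>M) - tap_correction \<beta> q\<bar> \<le> (dxi 1 + ddxi 1) * sqrt (overlap_var q N)"
    using c(2) by (simp add: prob_space)
  note ci = c(1)
  show ?one
    unfolding tap_value_split by (intro Bochner_Integration.integrable_add x e(1) ci)
  have s: "(\<integral>w. tap_value N w \<partial>M) = (\<integral>w. ?x w \<partial>M) + (\<integral>w. ?e w \<partial>M) + (\<integral>w. ?c w \<partial>M)"
    unfolding tap_value_split
    by (subst Bochner_Integration.integral_add[OF Bochner_Integration.integrable_add[OF x e(1)] ci],
        subst Bochner_Integration.integral_add[OF x e(1)]) (rule refl)
  have three: "\<bar>(x + y + z) - (p + r)\<bar> \<le> a + b + c"
    if "\<bar>x - wt\<bar> \<le> a" "\<bar>y - (p - wt)\<bar> \<le> b" "\<bar>z - r\<bar> \<le> c" for x y z p r wt a b c :: real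
    using that by linarith
  have "\<bar>(\<integral>w. tap_value N w \<partial>M) - rs_value q\<bar>
      \<le> (2 * ddxi 1 + dxi 1) * sqrt (overlap_var q N) + (\<bar>h\<bar> + 2) * field_error q N + (dxi 1 + ddxi 1) * sqrt (overlap_var q N)"
    unfolding s rs_value_def by (rule three[OF magnetization_energy_limit[OF N q] eb cb])
  then show ?two
    unfolding tap_error_def by (simp add: algebra_simps)
qed

lemma tap_error_tendsto:
  assumes "overlap_var q \<longlonglongrightarrow> 0" shows "tap_error q \<longlonglongrightarrow> 0" (is ?one) "field_error q \<longlonglongrightarrow> 0"
proof -
  have "(\<lambda>N. (defect_const q + sqrt (ddxi 1)) * dev_rate q N) \<longlonglongrightarrow> (defect_const q + sqrt (ddxi 1)) * 0"
    by (intro tendsto_intros dev_rate_tendsto assms)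
  then show f: "field_error q \<longlonglongrightarrow> 0" by (simp add: field_error_def[abs_def])
  have "(\<lambda>N. (\<bar>h\<bar> + 2) * field_error q N + (2 * dxi 1 + 3 * ddxi 1) * sqrt (overlap_var q N))
      \<longlonglongrightarrow> (\<bar>h\<bar> + 2) * 0 + (2 * dxi 1 + 3 * ddxi 1) * sqrt 0"
    by (intro tendsto_intros f assms)
  then show ?one by (simp add: tap_error_def[abs_def])
qed

end

section \<open>Adding one spin to the system\<close>

lemma spin_configs_Suc: "(\<Sum>\<sigma>\<in>spin_configs (Suc n). f \<sigma>) = (\<Sum>\<tau>\<in>spin_configs n. f (\<tau>(Suc n := 1)) + f (\<tau>(Suc n := -1)))"
  for f :: "(nat => real) => real"
proof -
  let ?T = "\<lambda>_::nat. {-1, 1 :: real}"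
  have "spin_configs (Suc n) = (\<lambda>(e, \<tau>). \<tau>(Suc n := e)) ` ({-1, 1} \<times> spin_configs n)"
    using PiE_insert_eq[of "Suc n" "{1..n}" ?T] by (simp add: spin_configs_def atLeastAtMostSuc_conv)
  moreover have "inj_on (\<lambda>(e, \<tau>). \<tau>(Suc n := e)) ({-1, 1} \<times> spin_configs n)"
    using inj_combinator[of "Suc n" "{1..n}" ?T] by (simp add: spin_configs_def)
  ultimately have "(\<Sum>\<sigma>\<in>spin_configs (Suc n). f \<sigma>) = (\<Sum>(e, \<tau>)\<in>{-1, 1} \<times> spin_configs n. f (\<tau>(Suc n := e)))"
    by (simp add: sum.reindex case_prod_unfold comp_def)
  also have "\<dots> = (\<Sum>\<tau>\<in>spin_configs n. f (\<tau>(Suc n := 1)) + f (\<tau>(Suc n := -1)))"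
    by (simp add: sum.cartesian_product[symmetric] sum.distrib)
  finally show ?thesis .
qed

text \<open>Passing from \<open>n\<close> to \<open>n + 1\<close> spins multiplies the couplings of order \<open>p\<close> by this factor.\<close>

definition shrink :: "nat => nat => real" where
  "shrink n p = (real n / real (Suc n)) powr ((real p - 1) / 2)"

lemma shrink_bounds:
  assumes n: "1 \<le> n" and p: "1 \<le> p"
  shows "0 \<le> 1 - shrink n p" (is ?one) "1 - shrink n p \<le> 1" (is ?two) "real n * (1 - shrink n p) \<le> (real p - 1) / 2"
proof -
  let ?a = "(real p - 1) / 2"
  have a: "0 \<le> ?a" using p by simp
  show ?two by (simp add: shrink_def)
  have "shrink n p = exp (?a * ln (real n / real (Suc n)))" using n by (simp add: shrink_def powr_def)
  moreover have "ln (real n / real (Suc n)) \<le> 0" using n by (simp add: ln_div)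
  ultimately show ?one using a by (simp add: mult_nonneg_nonpos)
  have "ln (real n / real (Suc n)) = - ln (1 + 1 / real n)"
    using n by (simp add: ln_div[symmetric] ln_inverse[symmetric] field_simps)
  moreover have "ln (1 + 1 / real n) \<le> 1 / real n" by (rule ln_add_one_self_le_self) simp
  ultimately have "?a * (- (1 / real n)) \<le> ?a * ln (real n / real (Suc n))" using a by (intro mult_left_mono) auto
  moreover have "1 + ?a * ln (real n / real (Suc n)) \<le> shrink n p"
    unfolding \<open>shrink n p = _\<close> by (rule exp_ge_add_one_self)
  moreover have "?a * (- (1 / real n)) = - (?a / real n)" by simp
  ultimately have "1 - shrink n p \<le> ?a / real n" by linarith
  then have "real n * (1 - shrink n p) \<le> real n * (?a / real n)" by (intro mult_left_mono) auto
  then show "real n * (1 - shrink n p) \<le> ?a" using n by simp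
qed

text \<open>Monomials that contain the site set to \<open>0\<close> vanish.\<close>

lemma pure_hamiltonian_shrink:
  assumes n: "1 \<le> n" and p: "1 \<le> p"
  shows "pure_hamiltonian \<beta> x (Suc n) p (\<tau>(Suc n := 0)) = shrink n p * pure_hamiltonian \<beta> x n p \<tau>"
proof -
  have "(\<Sum>js\<in>multi_indices (Suc n) p. x js * prod_list (map (\<tau>(Suc n := 0)) js))
      = (\<Sum>js\<in>multi_indices n p. x js * prod_list (map (\<tau>(Suc n := 0)) js))"
  proof (rule sum.mono_neutral_right)
    show "multi_indices n p \<subseteq> multi_indices (Suc n) p" by (auto simp: multi_indices_def)
    show "\<forall>js\<in>multi_indices (Suc n) p - multi_indices n p. x js * prod_list (map (\<tau>(Suc n := 0)) js) = 0"
    proof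
      fix js assume js: "js \<in> multi_indices (Suc n) p - multi_indices n p"
      have "Suc n \<in> set js"
      proof (rule ccontr)
        assume "Suc n \<notin> set js"
        then have "set js \<subseteq> {1..n}" using js by (force simp: multi_indices_def atLeastAtMostSuc_conv)
        then show False using js by (simp add: multi_indices_def)
      qed
      then have "0 \<in> set (map (\<tau>(Suc n := 0)) js)" by force
      then have "prod_list (map (\<tau>(Suc n := 0)) js) = 0" by (simp only: prod_list_zero_iff)
      then show "x js * prod_list (map (\<tau>(Suc n := 0)) js) = 0" by simp
    qed
  qed simp
  also have "\<dots> = (\<Sum>js\<in>multi_indices n p. x js * prod_list (map \<tau> js))"
  proof (rule sum.cong[OF refl])
    fix js assume "js \<in> multi_indices n p"
    then have "map (\<tau>(Suc n := 0)) js = map \<tau> js" by (force simp: multi_indices_def)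
    then show "x js * prod_list (map (\<tau>(Suc n := 0)) js) = x js * prod_list (map \<tau> js)" by (simp only:)
  qed
  finally have s: "(\<Sum>js\<in>multi_indices (Suc n) p. x js * prod_list (map (\<tau>(Suc n := 0)) js))
      = (\<Sum>js\<in>multi_indices n p. x js * prod_list (map \<tau> js))" .
  have "\<beta> p / real (Suc n) powr ((real p - 1) / 2) = shrink n p * (\<beta> p / real n powr ((real p - 1) / 2))"
    using n by (simp add: shrink_def powr_divide)
  then show ?thesis unfolding pure_hamiltonian_def s by simp
qed

context spin_glass
begin

text \<open>The energy lost when the normalization passes from \<open>n\<close> to \<open>n + 1\<close>.\<close>

definition norm_defect :: "nat => (nat => real) => 'a => real" where
  "norm_defect n \<tau> w = (\<Sum>k. (1 - shrink n (k + 2)) * pure_hamiltonian \<beta> (G w) n (k + 2) \<tau>)"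

lemma shrunk_level_le:
  assumes n: "1 \<le> n" and x: "\<bar>x\<bar> \<le> c"
  shows "\<bar>(1 - shrink n (k + 2)) * x\<bar> \<le> c"
proof -
  have "\<bar>(1 - shrink n (k + 2)) * x\<bar> \<le> 1 * c"
    unfolding abs_mult using shrink_bounds(1,2)[OF n, of "k + 2"] x by (intro mult_mono) auto
  then show ?thesis by simp
qed

lemma summable_norm_defect:
  assumes n: "1 \<le> n" and tame: "tame n w" and \<tau>: "\<tau> \<in> spin_configs n"
  shows "summable (\<lambda>k. (1 - shrink n (k + 2)) * pure_hamiltonian \<beta> (G w) n (k + 2) \<tau>)"
proof (rule summable_comparison_test')
  show "summable (\<lambda>k. form_sup n (k + 2) w)" using tame by (simp add: tame_def)
  show "norm ((1 - shrink n (k + 2)) * pure_hamiltonian \<beta> (G w) n (k + 2) \<tau>) \<le> form_sup n (k + 2) w" for k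
    using shrunk_level_le[OF n pure_hamiltonian_abs_le[OF \<tau>]] by simp
qed

lemma reduced_hamiltonian:
  assumes n: "1 \<le> n" and tame: "tame n w" and \<tau>: "\<tau> \<in> spin_configs n"
  shows "H0 (Suc n) (Suc n) w \<tau> = H n w \<tau> + - norm_defect n \<tau> w"
proof -
  let ?p = "\<lambda>k. pure_hamiltonian \<beta> (G w) n (k + 2) \<tau>"
  have "(\<lambda>k. ?p k - (1 - shrink n (k + 2)) * ?p k) sums (X n \<tau> w - norm_defect n \<tau> w)"
    unfolding mixed_hamiltonian_def norm_defect_def
    by (intro sums_diff summable_sums summable_norm_defect n tame \<tau> tame_hamiltonian(1) spin_average_spin)
  moreover have "?p k - (1 - shrink n (k + 2)) * ?p k = pure_hamiltonian \<beta> (G w) (Suc n) (k + 2) (\<tau>(Suc n := 0))" for k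
    by (subst pure_hamiltonian_shrink[OF n]) (simp_all add: left_diff_distrib)
  ultimately have "X (Suc n) (\<tau>(Suc n := 0)) w = X n \<tau> w - norm_defect n \<tau> w"
    by (simp add: mixed_hamiltonian_def[of _ _ "Suc n"] sums_iff)
  moreover have "{1..Suc n} - {Suc n} = {1..n}" by auto
  ultimately show ?thesis by (simp add: H0_def other_field_def hamiltonian_def)
qed

lemma reduced_partition_Suc:
  assumes n: "1 \<le> n" and tame: "tame n w"
  shows "ln (reduced_partition (Suc n) (Suc n) w) = ln 2 + ln (\<Sum>\<tau>\<in>spin_configs n. exp (H n w \<tau> + - norm_defect n \<tau> w))"
proof -
  have "reduced_partition (Suc n) (Suc n) w = (\<Sum>\<tau>\<in>spin_configs n. 2 * exp (H n w \<tau> + - norm_defect n \<tau> w))"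
    unfolding spin_configs_Suc H0_set_spin
    by (intro sum.cong refl) (simp only: reduced_hamiltonian[OF n tame] mult_2)
  also have "\<dots> = 2 * (\<Sum>\<tau>\<in>spin_configs n. exp (H n w \<tau> + - norm_defect n \<tau> w))" by (simp only: sum_distrib_left)
  finally show ?thesis
    using partition_pos[OF finite_spin_configs[of n] spin_configs_nonempty[of n], of "\<lambda>\<tau>. H n w \<tau> + - norm_defect n \<tau> w"]
    by (simp add: ln_mult_pos)
qed

definition mean_norm_defect :: "nat => 'a => real" where
  "mean_norm_defect n w = (\<Sum>k. (1 - shrink n (k + 2)) * avg n w (pure_hamiltonian \<beta> (G w) n (k + 2)))"

text \<open>The factor \<open>2\<close> counts the values of the spin that has been removed; the change of the energy is
  bounded to first order by convexity.\<close>

lemma reduced_partition_lower: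
  assumes n: "1 \<le> n" and tame: "tame n w"
  shows "ln 2 + ln (partition_function \<beta> h (G w) n) - mean_norm_defect n w \<le> ln (reduced_partition (Suc n) (Suc n) w)"
proof -
  let ?S = "spin_configs n"
  note S = finite_spin_configs[of n] spin_configs_nonempty[of n]
  have "(\<lambda>k. avg n w (\<lambda>\<tau>. (1 - shrink n (k + 2)) * pure_hamiltonian \<beta> (G w) n (k + 2) \<tau>)) sums avg n w (\<lambda>\<tau>. norm_defect n \<tau> w)"
    unfolding gibbs_weights[of ?S] norm_defect_def
    by (intro sums_sum sums_mult summable_sums summable_norm_defect n tame)
  then have m: "avg n w (\<lambda>\<tau>. norm_defect n \<tau> w) = mean_norm_defect n w"
    by (simp add: gibbs_mult mean_norm_defect_def sums_iff)
  show ?thesis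
    using ln_partition_tangent[OF S, of "H n w" "\<lambda>\<tau>. - norm_defect n \<tau> w"]
    unfolding reduced_partition_Suc[OF n tame] gibbs_minus m partition_function_def by simp
qed

lemma avg_level_abs_le:
  "\<bar>avg n w (pure_hamiltonian \<beta> (G w) n p)\<bar> \<le> form_sup n p w"
  by (rule avg_abs_le) (rule pure_hamiltonian_abs_le)

text \<open>Each level of the energy contributes at most \<open>\<beta>\<^sub>p\<^sup>2 (1 - R\<^sup>p) (p - 1) / 2\<close>; the sum is
  \<open>(\<theta>(1) - \<theta>(R)) / 2\<close>.\<close>

lemma mean_norm_defect_mean:
  assumes n: "1 \<le> n" and q: "\<bar>q\<bar> \<le> 1"
  shows "integrable M (mean_norm_defect n)" (is ?one)
    and "(\<integral>w. mean_norm_defect n w \<partial>M) \<le> (theta 1 - theta q + (ddxi 1 + 2 * dxi 1) * sqrt (overlap_var q n)) / 2"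
proof -
  let ?f = "\<lambda>k w. (1 - shrink n (k + 2)) * avg n w (pure_hamiltonian \<beta> (G w) n (k + 2))"
  let ?L = "ddxi 1 + 2 * dxi 1"
  have m: "(\<lambda>w. avg n w (pure_hamiltonian \<beta> (G w) n (k + 2))) \<in> borel_measurable M" for k
    by (intro measurable_avg measurable_pure_hamiltonian) auto
  have le: "\<bar>?f k w\<bar> \<le> form_sup n (k + 2) w" for k w
    by (rule shrunk_level_le[OF n avg_level_abs_le])
  note ser = integral_level_series[OF n, of ?f, OF borel_measurable_times[OF borel_measurable_const m] le]
  show ?one using ser(1) by (simp add: mean_norm_defect_def[abs_def])
  let ?P = "\<lambda>k w. avg n w (\<lambda>\<sigma>. avg n w (\<lambda>\<tau>. overlap n \<sigma> \<tau> ^ (k + 2)))"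
  have pw: "\<bar>overlap n \<sigma> \<tau> ^ k\<bar> \<le> 1" if "\<sigma> \<in> spin_configs n" "\<tau> \<in> spin_configs n" for \<sigma> \<tau> k
    using spins_overlap[OF that] by (simp add: power_abs power_le_one)
  have iP: "integrable M (?P k)" for k by (rule integrable_pair_avg) (rule pw)
  have Pb: "\<bar>?P k w\<bar> \<le> 1" for k w by (intro avg_abs_le pw)
  have level: "(\<integral>w. ?f k w \<partial>M) \<le> (\<integral>w. real (k + 1) / 2 * (\<beta> (k + 2))\<^sup>2 * (1 - ?P k w) \<partial>M)" for k
  proof -
    have I: "(\<integral>w. ?P k w \<partial>M) \<le> 1"
      using integral_mono[OF iP integrable_const[of 1], of k] abs_le_D1[OF Pb] by (simp add: prob_space)
    have "(\<integral>w. ?f k w \<partial>M) = (real n * (1 - shrink n (k + 2))) * ((\<beta> (k + 2))\<^sup>2 * (1 - (\<integral>w. ?P k w \<partial>M)))"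
      by (simp add: energy_level_mean[OF n])
    also have "\<dots> \<le> (real (k + 1) / 2) * ((\<beta> (k + 2))\<^sup>2 * (1 - (\<integral>w. ?P k w \<partial>M)))"
      using shrink_bounds(3)[OF n, of "k + 2"] I by (intro mult_right_mono mult_nonneg_nonneg) auto
    also have "\<dots> = (\<integral>w. real (k + 1) / 2 * (\<beta> (k + 2))\<^sup>2 * (1 - ?P k w) \<partial>M)"
      using iP by (simp add: prob_space)
    finally show ?thesis .
  qed
  have th: "(\<Sum>k<K. real (k + 1) / 2 * (\<beta> (k + 2))\<^sup>2 * (1 - r ^ (k + 2))) \<le> (theta 1 - theta r) / 2" if r: "\<bar>r\<bar> \<le> 1" for K r
  proof -
    have s: "(\<lambda>k. (real (k + 1) * (\<beta> (k + 2))\<^sup>2 * 1 ^ (k + 2) - real (k + 1) * (\<beta> (k + 2))\<^sup>2 * r ^ (k + 2)) / 2) sums ((theta 1 - theta r) / 2)"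
      using r by (intro sums_divide sums_diff theta_sums) auto
    have "r ^ k \<le> 1" for k using r by (metis abs_ge_self abs_le_D1 order_trans power_abs power_le_one abs_ge_zero)
    then have "(\<Sum>k<K. (real (k + 1) * (\<beta> (k + 2))\<^sup>2 * 1 ^ (k + 2) - real (k + 1) * (\<beta> (k + 2))\<^sup>2 * r ^ (k + 2)) / 2) \<le> (theta 1 - theta r) / 2"
      unfolding sums_unique[OF s] by (intro sum_le_suminf sums_summable[OF s]) (auto intro!: mult_left_le)
    then show ?thesis by (simp add: algebra_simps diff_divide_distrib)
  qed
  let ?B = "\<lambda>w. (theta 1 - theta q + ?L * overlap_dev q n w) / 2"
  have part: "(\<Sum>k<K. real (k + 1) / 2 * (\<beta> (k + 2))\<^sup>2 * (1 - ?P k w)) \<le> ?B w" for K w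
  proof -
    have "(\<Sum>k<K. real (k + 1) / 2 * (\<beta> (k + 2))\<^sup>2 * (1 - ?P k w))
        = avg n w (\<lambda>\<sigma>. avg n w (\<lambda>\<tau>. \<Sum>k<K. real (k + 1) / 2 * (\<beta> (k + 2))\<^sup>2 * (1 - overlap n \<sigma> \<tau> ^ (k + 2))))"
      by (simp only: gibbs_sum gibbs_mult gibbs_diff avg_const)
    also have "\<dots> \<le> avg n w (\<lambda>\<sigma>. avg n w (\<lambda>\<tau>. (theta 1 - theta q + ?L * \<bar>overlap n \<sigma> \<tau> - q\<bar>) / 2))"
    proof (intro avg_mono)
      fix \<sigma> \<tau> assume s: "\<sigma> \<in> spin_configs n" "\<tau> \<in> spin_configs n"
      have "\<bar>theta (overlap n \<sigma> \<tau>) - theta q\<bar> \<le> ?L * \<bar>overlap n \<sigma> \<tau> - q\<bar>"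
        by (intro theta_lipschitz spins_overlap s q)
      from abs_le_D2[OF this] have "theta 1 - theta (overlap n \<sigma> \<tau>) \<le> theta 1 - theta q + ?L * \<bar>overlap n \<sigma> \<tau> - q\<bar>" by simp
      then show "(\<Sum>k<K. real (k + 1) / 2 * (\<beta> (k + 2))\<^sup>2 * (1 - overlap n \<sigma> \<tau> ^ (k + 2))) \<le> (theta 1 - theta q + ?L * \<bar>overlap n \<sigma> \<tau> - q\<bar>) / 2"
        by (intro order_trans[OF th[OF spins_overlap[OF s]]] divide_right_mono) auto
    qed
    also have "\<dots> = ?B w"
      by (simp only: gibbs_divide gibbs_add gibbs_mult avg_const overlap_dev_def)
    finally show ?thesis .
  qed
  have iB: "integrable M ?B" using overlap_dev_mean(1)[OF q] by simp
  have "(\<Sum>k<K. \<integral>w. ?f k w \<partial>M) \<le> (\<integral>w. ?B w \<partial>M)" for K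
  proof -
    have i: "integrable M (\<lambda>w. real (k + 1) / 2 * (\<beta> (k + 2))\<^sup>2 * (1 - ?P k w))" for k using iP by simp
    have "(\<Sum>k<K. \<integral>w. ?f k w \<partial>M) \<le> (\<Sum>k<K. \<integral>w. real (k + 1) / 2 * (\<beta> (k + 2))\<^sup>2 * (1 - ?P k w) \<partial>M)"
      by (rule sum_mono) (rule level)
    also have "\<dots> = (\<integral>w. (\<Sum>k<K. real (k + 1) / 2 * (\<beta> (k + 2))\<^sup>2 * (1 - ?P k w)) \<partial>M)"
      by (rule Bochner_Integration.integral_sum[symmetric]) (rule i)
    also have "\<dots> \<le> (\<integral>w. ?B w \<partial>M)"
      by (rule integral_mono[OF Bochner_Integration.integrable_sum[OF i] iB part])
    finally show ?thesis .
  qed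
  then have "(\<integral>w. mean_norm_defect n w \<partial>M) \<le> (\<integral>w. ?B w \<partial>M)"
    using ser(2) unfolding mean_norm_defect_def sums_def by (intro LIMSEQ_le_const2) auto
  also have "\<dots> = (theta 1 - theta q + ?L * (\<integral>w. overlap_dev q n w \<partial>M)) / 2"
    using overlap_dev_mean(1)[OF q] by (simp add: prob_space)
  also have "\<dots> \<le> (theta 1 - theta q + ?L * sqrt (overlap_var q n)) / 2"
    using overlap_dev_mean(2)[OF q, of n] ddxi_nonneg[of 1] dxi_nonneg[of 1]
    by (intro divide_right_mono add_left_mono mult_left_mono) auto
  finally show "(\<integral>w. mean_norm_defect n w \<partial>M) \<le> (theta 1 - theta q + ?L * sqrt (overlap_var q n)) / 2" .
qed

lemma integrable_ln_partition:
  assumes N: "1 \<le> N" shows "integrable M (\<lambda>w. ln (partition_function \<beta> h (G w) N))" (is ?one)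
    and "AE w in M. \<bar>ln (partition_function \<beta> h (G w) N)\<bar> \<le> total_sup N w + (\<bar>h\<bar> + 1) * real N"
proof -
  have le: "\<bar>ln (partition_function \<beta> h (G w) N)\<bar> \<le> total_sup N w + (\<bar>h\<bar> + 1) * real N" if "tame N w" for w
  proof -
    have "\<bar>H N w \<sigma>\<bar> \<le> total_sup N w + \<bar>h\<bar> * real N" if s: "\<sigma> \<in> spin_configs N" for \<sigma>
    proof -
      have "\<bar>\<Sum>i=1..N. \<sigma> i\<bar> \<le> (\<Sum>i=1..N. 1)"
        using spin_configs_in_cube[OF s] by (intro order_trans[OF sum_abs] sum_mono) (auto simp: in_cube_def)
      then have "\<bar>h * (\<Sum>i=1..N. \<sigma> i)\<bar> \<le> \<bar>h\<bar> * real N" unfolding abs_mult by (intro mult_left_mono) auto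
      then show ?thesis
        using tame_hamiltonian(2)[OF \<open>tame N w\<close> spin_average_spin[OF s]] unfolding hamiltonian_def by linarith
    qed
    from ln_partition_abs[OF finite_spin_configs spin_configs_nonempty this]
    have "\<bar>ln (partition_function \<beta> h (G w) N)\<bar> \<le> total_sup N w + \<bar>h\<bar> * real N + ln (card (spin_configs N))"
      unfolding partition_function_def .
    moreover have "ln (real (card (spin_configs N))) \<le> 1 * real N"
      using ln_2_less_1 mult_right_mono[of "ln 2" 1 "real N"] by (simp add: card_spin_configs ln_realpow mult.commute)
    ultimately show ?thesis unfolding distrib_right by linarith
  qed
  have m: "(\<lambda>w. ln (partition_function \<beta> h (G w) N)) \<in> borel_measurable M" unfolding partition_function_def by measurable
  show ae: "AE w in M. \<bar>ln (partition_function \<beta> h (G w) N)\<bar> \<le> total_sup N w + (\<bar>h\<bar> + 1) * real N"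
    using total_sup_fourth_moment(1)[OF N] by eventually_elim (rule le)
  have four: "\<bar>x\<bar> \<le> 1 + x ^ 4" for x :: real
  proof -
    have "0 \<le> (\<bar>x\<bar> - 1)\<^sup>2" "0 \<le> (x\<^sup>2 - 1)\<^sup>2" "0 \<le> x ^ 4" by auto
    moreover have "(\<bar>x\<bar> - 1)\<^sup>2 = x\<^sup>2 - 2 * \<bar>x\<bar> + 1" "(x\<^sup>2 - 1)\<^sup>2 = x ^ 4 - 2 * x\<^sup>2 + 1"
      by (simp_all add: power2_eq_square algebra_simps numeral_eq_Suc)
    ultimately show ?thesis by linarith
  qed
  have "integrable M (\<lambda>w. total_sup N w)"
    by (rule Bochner_Integration.integrable_bound[of _ "\<lambda>w. 1 + total_sup N w ^ 4"])
       (use total_sup_fourth_moment(2)[OF N] four in \<open>auto intro: order_trans[OF _ abs_ge_self]\<close>)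
  then have i: "integrable M (\<lambda>w. total_sup N w + (\<bar>h\<bar> + 1) * real N)" by simp
  show ?one
    by (rule Bochner_Integration.integrable_bound[OF i m]) (use ae in \<open>auto elim!: eventually_mono intro: order_trans[OF _ abs_ge_self]\<close>)
qed

abbreviation mean_log_partition :: "nat => real" where
  "mean_log_partition N \<equiv> \<integral>w. ln (partition_function \<beta> h (G w) N) \<partial>M"

definition step_error :: "real => nat => real" where
  "step_error q n = (defect_const q + 2 * sqrt (ddxi 1)) * dev_rate q (Suc n) + (ddxi 1 + 2 * dxi 1) * sqrt (overlap_var q n) / 2"

text \<open>The constants combine to the correction term since
  \<open>\<xi>'(1) - \<xi>'(q) - (\<theta>(1) - \<theta>(q)) = \<xi>(1) - \<xi>(q) - \<xi>'(q) (1 - q)\<close>.\<close>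

lemma free_energy_increment:
  assumes n: "1 \<le> n" and q: "0 \<le> q" "q \<le> 1"
  shows "rs_value q - step_error q n \<le> mean_log_partition (Suc n) - mean_log_partition n"
proof -
  have q1: "\<bar>q\<bar> \<le> 1" using q by simp
  have N: "1 \<le> Suc n" and i: "Suc n \<in> {1..Suc n}" by auto
  let ?Z = "\<lambda>N w. ln (partition_function \<beta> h (G w) N)" and ?R = "\<lambda>w. ln (reduced_partition (Suc n) (Suc n) w)"
  note add = spin_addition_mean[OF N i q] and nd = mean_norm_defect_mean[OF n q1]
  note z = integrable_ln_partition(1)[OF n] integrable_ln_partition(1)[OF N]
  have iR: "integrable M ?R" using Bochner_Integration.integrable_diff[OF z(2) add(1)] by simp
  have "(\<integral>w. ln 2 + ?Z n w - mean_norm_defect n w \<partial>M) \<le> (\<integral>w. ?R w \<partial>M)"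
  proof (rule integral_mono_AE)
    show "AE w in M. ln 2 + ?Z n w - mean_norm_defect n w \<le> ?R w"
      using total_sup_fourth_moment(1)[OF n] by eventually_elim (rule reduced_partition_lower[OF n])
  qed (use z nd(1) iR in auto)
  then have a: "ln 2 + mean_log_partition n - (\<integral>w. mean_norm_defect n w \<partial>M) \<le> (\<integral>w. ?R w \<partial>M)"
    using z nd(1) by (simp add: prob_space)
  have b: "(\<integral>w. ?Z (Suc n) w - ?R w \<partial>M) = mean_log_partition (Suc n) - (\<integral>w. ?R w \<partial>M)"
    using z(2) iR by simp
  have "(defect_const q + 2 * sqrt (ddxi 1)) * root_dev q (Suc n) (Suc n) \<le> (defect_const q + 2 * sqrt (ddxi 1)) * dev_rate q (Suc n)"
    using defect_const_nonneg[of q] ddxi_nonneg[of 1] by (intro mult_left_mono root_dev_rate N i q1) auto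
  with add(2) have c: "half_variance q - ln 2 + gauss_log_cosh q - (defect_const q + 2 * sqrt (ddxi 1)) * dev_rate q (Suc n)
      \<le> mean_log_partition (Suc n) - (\<integral>w. ?R w \<partial>M)"
    unfolding b gauss_log_cosh_def[symmetric] abs_le_iff by simp
  have t: "tap_correction \<beta> q = (xi \<beta> 1 - xi \<beta> q - dxi q * (1 - q)) / 2"
    using q by (intro tap_correction_eq mixture_axioms)
  have "half_variance q - (theta 1 - theta q) / 2 = tap_correction \<beta> q"
    unfolding t half_variance_def theta_def by (simp add: field_simps)
  then show ?thesis
    using a c nd(2) unfolding rs_value_def step_error_def add_divide_distrib diff_divide_distrib by argo
qed

end

section \<open>Convergence in mean square\<close>

lemma tendsto_zero_of_bounds:
  fixes f :: "nat => real"
  assumes nn: "\<And>N. 0 \<le> f N"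
    and le: "\<And>e. 0 < e ==> \<exists>k. k \<longlonglongrightarrow> 0 \<and> eventually (\<lambda>N. f N \<le> e + k N) sequentially"
  shows "f \<longlonglongrightarrow> 0"
proof (rule tendstoI)
  fix r :: real assume r: "0 < r"
  then obtain k where k: "k \<longlonglongrightarrow> 0" "eventually (\<lambda>N. f N \<le> r / 2 + k N) sequentially"
    using le[of "r / 2"] by auto
  have "eventually (\<lambda>N. k N < r / 2) sequentially" using r by (intro order_tendstoD(2)[OF k(1)]) simp
  with k(2) show "eventually (\<lambda>N. dist (f N) 0 < r) sequentially"
  proof eventually_elim
    case (elim N)
    then have "f N < r" by linarith
    then show ?case using nn[of N] by simp
  qed
qed

lemma averages_tendsto_zero:
  fixes e :: "nat => real"
  assumes e: "e \<longlonglongrightarrow> 0" and nn: "\<And>n. 0 \<le> e n"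
  shows "(\<lambda>N. (\<Sum>n<N. e n) / real N) \<longlonglongrightarrow> 0"
proof (rule tendsto_zero_of_bounds)
  show "0 \<le> (\<Sum>n<N. e n) / real N" for N using nn by (simp add: sum_nonneg)
  fix r :: real assume r: "0 < r"
  then obtain m where m: "e n < r" if "m \<le> n" for n
    using order_tendstoD(2)[OF e r] unfolding eventually_sequentially by blast
  have le: "(\<Sum>n<N. e n) \<le> real N * r + (\<Sum>n<m. e n)" for N
  proof (induction N)
    case 0
    then show ?case using nn by (simp add: sum_nonneg)
  next
    case (Suc N)
    show ?case
    proof (cases "m \<le> N")
      case True
      then show ?thesis using Suc m[OF True] by (simp add: algebra_simps)
    next
      case False
      then have "(\<Sum>n<Suc N. e n) \<le> (\<Sum>n<m. e n)" using nn by (intro sum_mono2) auto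
      also have "\<dots> \<le> real (Suc N) * r + (\<Sum>n<m. e n)" using r by simp
      finally show ?thesis .
    qed
  qed
  show "\<exists>k. k \<longlonglongrightarrow> 0 \<and> eventually (\<lambda>N. (\<Sum>n<N. e n) / real N \<le> r + k N) sequentially"
  proof (intro exI conjI)
    show "(\<lambda>N. (\<Sum>n<m. e n) / real N) \<longlonglongrightarrow> 0" by (rule lim_const_over_n)
    show "eventually (\<lambda>N. (\<Sum>n<N. e n) / real N \<le> r + (\<Sum>n<m. e n) / real N) sequentially"
      using eventually_gt_at_top[of 0]
    proof eventually_elim
      case (elim N)
      have "(\<Sum>n<N. e n) / real N \<le> (real N * r + (\<Sum>n<m. e n)) / real N" by (rule divide_right_mono[OF le]) simp
      then show ?case using elim by (simp add: add_divide_distrib)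
    qed
  qed
qed

context spin_glass
begin

lemma step_error_nonneg: "0 \<le> step_error q n"
  unfolding step_error_def using defect_const_nonneg[of q] ddxi_nonneg[of 1] dxi_nonneg[of 1] dev_rate_nonneg overlap_var_nonneg[of q n]
  by (intro add_nonneg_nonneg mult_nonneg_nonneg divide_nonneg_nonneg) auto

lemma step_error_tendsto:
  assumes "overlap_var q \<longlonglongrightarrow> 0" shows "step_error q \<longlonglongrightarrow> 0"
proof -
  have "(\<lambda>n. dev_rate q (Suc n)) \<longlonglongrightarrow> 0" using dev_rate_tendsto[OF assms] by (rule LIMSEQ_Suc)
  then have "(\<lambda>n. (defect_const q + 2 * sqrt (ddxi 1)) * dev_rate q (Suc n) + (ddxi 1 + 2 * dxi 1) * sqrt (overlap_var q n) / 2)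
      \<longlonglongrightarrow> (defect_const q + 2 * sqrt (ddxi 1)) * 0 + (ddxi 1 + 2 * dxi 1) * sqrt 0 / 2"
    by (intro tendsto_intros assms) auto
  then show ?thesis by (simp add: step_error_def[abs_def])
qed

definition free_energy_error :: "real => nat => real" where
  "free_energy_error q N = (rs_value q - mean_log_partition 1) / real N + (\<Sum>n<N. step_error q n) / real N"

lemma mean_free_energy_lower:
  assumes N: "1 \<le> N" and q: "0 \<le> q" "q \<le> 1"
  shows "rs_value q - free_energy_error q N \<le> mean_log_partition N / real N"
proof -
  have "mean_log_partition 1 + real (N - 1) * rs_value q - (\<Sum>n<N. step_error q n) \<le> mean_log_partition N"
    using N
  proof (induction N rule: dec_induct)
    case base
    show ?case using step_error_nonneg[of q 0] by simp
  next
    case (step n)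
    have "real (Suc n - 1) * rs_value q = real (n - 1) * rs_value q + rs_value q"
      using step(1) by (simp add: of_nat_diff algebra_simps)
    then show ?case using free_energy_increment[OF step(1) q] step(3) unfolding sum.lessThan_Suc by linarith
  qed
  then have "(mean_log_partition 1 + real (N - 1) * rs_value q - (\<Sum>n<N. step_error q n)) / real N \<le> mean_log_partition N / real N"
    by (intro divide_right_mono) auto
  moreover have "(mean_log_partition 1 + real (N - 1) * rs_value q - (\<Sum>n<N. step_error q n)) / real N = rs_value q - free_energy_error q N"
    using N by (simp add: free_energy_error_def of_nat_diff field_simps)
  ultimately show ?thesis by simp
qed

lemma free_energy_error_tendsto:
  assumes "overlap_var q \<longlonglongrightarrow> 0" shows "free_energy_error q \<longlonglongrightarrow> 0"
  using tendsto_add[OF lim_const_over_n[of "rs_value q - mean_log_partition 1"]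
      averages_tendsto_zero[OF step_error_tendsto[OF assms] step_error_nonneg]]
  by (simp add: free_energy_error_def[abs_def])

lemma tap_gap_mean:
  assumes N: "1 \<le> N" and q: "0 \<le> q" "q \<le> 1" and fp: "gauss_tanh_square q = q"
  shows "integrable M (tap_gap N)" (is ?one) and "(\<integral>w. tap_gap N w \<partial>M) \<le> tap_error q N + free_energy_error q N" (is ?two)
proof -
  note t = tap_value_mean[OF N q fp] and z = integrable_ln_partition(1)[OF N]
  show ?one
    unfolding tap_gap_def[abs_def] free_energy_def using t(1) z by simp
  have "(\<integral>w. tap_gap N w \<partial>M) = (\<integral>w. tap_value N w \<partial>M) - mean_log_partition N / real N"
    unfolding tap_gap_def[abs_def] free_energy_def using t(1) z by simp
  then show ?two
    using abs_le_D1[OF t(2)] mean_free_energy_lower[OF N q] by linarith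
qed

text \<open>The mean of the gap is asymptotically nonpositive and its negative part vanishes, so it
  tends to zero in mean.\<close>

lemma tap_gap_mean_abs_tendsto:
  assumes q: "0 \<le> q" "q \<le> 1" and lim: "overlap_var q \<longlonglongrightarrow> 0"
  shows "(\<lambda>N. \<integral>w. \<bar>tap_gap N w\<bar> \<partial>M) \<longlonglongrightarrow> 0"
proof (rule tendsto_zero_of_bounds)
  have q1: "\<bar>q\<bar> \<le> 1" using q by simp
  note fp = fixed_point[OF q lim]
  show "0 \<le> (\<integral>w. \<bar>tap_gap N w\<bar> \<partial>M)" for N by simp
  fix e :: real assume e: "0 < e"
  let ?A = "\<lambda>n. ln (real (n + 1)) / real n + (1 + 4610 * beta_cube_sum) / real n"
  have "(\<lambda>n. ln (real (n + 1)) / real n) \<longlonglongrightarrow> 0" by real_asymp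
  from tendsto_add[OF this lim_const_over_n[of "1 + 4610 * beta_cube_sum"]] have "?A \<longlonglongrightarrow> 0" by simp
  then have "eventually (\<lambda>n. ?A n < e / 2 \<and> 1 \<le> n) sequentially"
    using e by (intro eventually_conj order_tendstoD(2)[of ?A 0] eventually_ge_at_top) auto
  then obtain n where n: "?A n < e / 2" "1 \<le> n" unfolding eventually_sequentially by blast
  let ?B = "2 * dxi 1 * real n + (dxi 1 + ddxi 1)"
  let ?k = "\<lambda>N. tap_error q N + free_energy_error q N + 2 * (?B * sqrt (overlap_var q N))"
  show "\<exists>k. k \<longlonglongrightarrow> 0 \<and> eventually (\<lambda>N. (\<integral>w. \<bar>tap_gap N w\<bar> \<partial>M) \<le> e + k N) sequentially"
  proof (intro exI conjI)
    have "?k \<longlonglongrightarrow> 0 + 0 + 2 * (?B * sqrt 0)"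
      by (intro tendsto_intros tap_error_tendsto(1) free_energy_error_tendsto lim)
    then show "?k \<longlonglongrightarrow> 0" by simp
    show "eventually (\<lambda>N. (\<integral>w. \<bar>tap_gap N w\<bar> \<partial>M) \<le> e + ?k N) sequentially"
      using eventually_ge_at_top[of 1]
    proof eventually_elim
      case (elim N)
      note t = tap_gap_mean[OF elim q fp]
      have "(\<integral>w. \<bar>tap_gap N w\<bar> \<partial>M) = (\<integral>w. tap_gap N w + 2 * max 0 (- tap_gap N w) \<partial>M)"
        by (rule Bochner_Integration.integral_cong) (auto simp: max_def)
      also have "\<dots> = (\<integral>w. tap_gap N w \<partial>M) + 2 * (\<integral>w. max 0 (- tap_gap N w) \<partial>M)"
        using t(1) by simp
      finally have "(\<integral>w. \<bar>tap_gap N w\<bar> \<partial>M) = (\<integral>w. tap_gap N w \<partial>M) + 2 * (\<integral>w. max 0 (- tap_gap N w) \<partial>M)" .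
      moreover have "?B * (\<integral>w. overlap_dev q N w \<partial>M) \<le> ?B * sqrt (overlap_var q N)"
        using ddxi_nonneg[of 1] dxi_nonneg[of 1] by (intro mult_left_mono overlap_dev_mean(2) q1) auto
      ultimately show ?case using t(2) tap_gap_lower_mean[OF elim n(2) q t(1)] n(1) by linarith
    qed
  qed
qed

definition gap_bound :: real where
  "gap_bound = 2 * \<bar>h\<bar> + 3 + dxi 1 + ddxi 1"

lemma tap_gap_abs_le:
  assumes N: "1 \<le> N"
  shows "AE w in M. \<bar>tap_gap N w\<bar> \<le> gap_bound + 2 * (total_sup N w / real N)"
  using integrable_ln_partition(2)[OF N] total_sup_fourth_moment(1)[OF N]
proof eventually_elim
  case (elim w)
  have N0: "0 < real N" using N by simp
  let ?s = "total_sup N w / real N"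
  have "\<bar>ln (partition_function \<beta> h (G w) N)\<bar> / real N \<le> (total_sup N w + (\<bar>h\<bar> + 1) * real N) / real N"
    using elim(1) by (intro divide_right_mono) auto
  also have "\<dots> = ?s + (\<bar>h\<bar> + 1)" using N0 by (simp add: add_divide_distrib)
  finally have f: "\<bar>free_energy \<beta> h (G w) N\<bar> \<le> ?s + (\<bar>h\<bar> + 1)" by (simp add: free_energy_def)
  have "\<bar>X N (mag N w) w\<bar> / real N \<le> ?s"
    using tame_hamiltonian(2)[OF elim(2) spin_average_mag] by (intro divide_right_mono) auto
  then have x: "\<bar>X N (mag N w) w / real N\<bar> \<le> ?s" by simp
  have "\<bar>\<Sum>i=1..N. - entropy_term (mag N w i) + h * mag N w i\<bar> \<le> (\<Sum>i=1..N. 2 + \<bar>h\<bar>)"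
  proof (intro order_trans[OF sum_abs] sum_mono)
    fix i assume "i \<in> {1..N}"
    then have m: "\<bar>mag N w i\<bar> \<le> 1" by (rule mag_abs_le)
    then have "\<bar>h * mag N w i\<bar> \<le> \<bar>h\<bar> * 1" unfolding abs_mult by (intro mult_left_mono) auto
    then show "\<bar>- entropy_term (mag N w i) + h * mag N w i\<bar> \<le> 2 + \<bar>h\<bar>"
      using entropy_term_bounds[OF m] by linarith
  qed
  then have "\<bar>\<Sum>i=1..N. - entropy_term (mag N w i) + h * mag N w i\<bar> / real N \<le> (\<Sum>i=1..N. 2 + \<bar>h\<bar>) / real N"
    by (intro divide_right_mono) auto
  then have e: "\<bar>(\<Sum>i=1..N. - entropy_term (mag N w i) + h * mag N w i) / real N\<bar> \<le> 2 + \<bar>h\<bar>" using N0 by simp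
  have "tap_correction \<beta> 1 = 0" by (subst tap_correction_eq[OF mixture_axioms]) auto
  moreover have "\<bar>tap_correction \<beta> (overlap N (mag N w) (mag N w)) - tap_correction \<beta> 1\<bar>
      \<le> (dxi 1 + ddxi 1) * \<bar>overlap N (mag N w) (mag N w) - 1\<bar>"
    by (intro tap_correction_lipschitz self_overlap_unit) auto
  moreover have "(dxi 1 + ddxi 1) * \<bar>overlap N (mag N w) (mag N w) - 1\<bar> \<le> (dxi 1 + ddxi 1) * 1"
    using self_overlap_unit[of N w] ddxi_nonneg[of 1] dxi_nonneg[of 1] by (intro mult_left_mono) auto
  ultimately have c: "\<bar>tap_correction \<beta> (overlap N (mag N w) (mag N w))\<bar> \<le> dxi 1 + ddxi 1" by simp
  have four: "\<bar>x + y + z - wt\<bar> \<le> a + b + c + d" if "\<bar>x\<bar> \<le> a" "\<bar>y\<bar> \<le> b" "\<bar>z\<bar> \<le> c" "\<bar>wt\<bar> \<le> d" for x y z wt a b c d :: real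
    using that by linarith
  show ?case
    unfolding tap_gap_def tap_value_split gap_bound_def using four[OF x e c f] by simp
qed

definition fourth_moment_bound :: real where
  "fourth_moment_bound = 8 * gap_bound ^ 4 + 128 * (2304 * beta_sum ^ 4)"

text \<open>Mean convergence is upgraded to mean square by \<open>t\<^sup>2 \<le> K \<bar>t\<bar> + t\<^sup>4 / K\<^sup>2\<close> and a fourth moment that
  is bounded uniformly in \<open>N\<close>.\<close>

lemma tap_gap_square_mean:
  assumes N: "1 \<le> N" and K: "0 < K" and int: "integrable M (tap_gap N)"
  shows "integrable M (\<lambda>w. (tap_gap N w)\<^sup>2)"
    and "(\<integral>w. (tap_gap N w)\<^sup>2 \<partial>M) \<le> K * (\<integral>w. \<bar>tap_gap N w\<bar> \<partial>M) + fourth_moment_bound / K\<^sup>2" (is ?two)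
proof -
  let ?U = "\<lambda>w. 8 * gap_bound ^ 4 + 128 * (total_sup N w ^ 4 / real N ^ 4)"
  let ?B = "\<lambda>w. K * \<bar>tap_gap N w\<bar> + ?U w / K\<^sup>2"
  have [measurable]: "tap_gap N \<in> borel_measurable M" using int by auto
  have conv: "(a + b) ^ 4 \<le> 8 * a ^ 4 + 8 * b ^ 4" for a b :: real
  proof -
    have s: "(x + y)\<^sup>2 \<le> 2 * x\<^sup>2 + 2 * y\<^sup>2" for x y :: real
      using sum_squares_bound[of x y] by (simp add: power2_sum)
    have f: "x ^ 4 = (x\<^sup>2)\<^sup>2" for x :: real by simp
    have "((a + b)\<^sup>2)\<^sup>2 \<le> (2 * a\<^sup>2 + 2 * b\<^sup>2)\<^sup>2" by (rule power_mono[OF s]) simp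
    also have "\<dots> \<le> 2 * (2 * a\<^sup>2)\<^sup>2 + 2 * (2 * b\<^sup>2)\<^sup>2" by (rule s)
    finally show ?thesis unfolding f by (simp add: power_mult_distrib)
  qed
  have sq: "t\<^sup>2 \<le> K * \<bar>t\<bar> + t ^ 4 / K\<^sup>2" for t
  proof (cases "\<bar>t\<bar> \<le> K")
    case True
    have "t\<^sup>2 = \<bar>t\<bar> * \<bar>t\<bar>" by (simp add: power2_eq_square)
    also have "\<dots> \<le> K * \<bar>t\<bar>" using True by (intro mult_right_mono) auto
    finally show ?thesis by (simp add: add_increasing2)
  next
    case False
    then have "K\<^sup>2 \<le> \<bar>t\<bar>\<^sup>2" using K by (intro power_mono) auto
    then have "K\<^sup>2 * t\<^sup>2 \<le> t\<^sup>2 * t\<^sup>2" by (intro mult_right_mono) auto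
    then have "t\<^sup>2 \<le> t ^ 4 / K\<^sup>2" using K by (simp add: field_simps power_add[symmetric])
    then show ?thesis using K by (simp add: add_increasing)
  qed
  have le: "AE w in M. (tap_gap N w)\<^sup>2 \<le> ?B w"
    using tap_gap_abs_le[OF N]
  proof eventually_elim
    case (elim w)
    have "tap_gap N w ^ 4 = \<bar>tap_gap N w\<bar> ^ 4" by simp
    also have "\<dots> \<le> (gap_bound + 2 * (total_sup N w / real N)) ^ 4" by (intro power_mono elim) simp
    also have "\<dots> \<le> 8 * gap_bound ^ 4 + 8 * (2 * (total_sup N w / real N)) ^ 4" by (rule conv)
    also have "\<dots> = ?U w" by (simp add: power_mult_distrib power_divide)
    finally have "tap_gap N w ^ 4 / K\<^sup>2 \<le> ?U w / K\<^sup>2" by (rule divide_right_mono) simp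
    then show ?case using sq[of "tap_gap N w"] by linarith
  qed
  note four = total_sup_fourth_moment(2,3)[OF N]
  have B: "integrable M ?B" using int four(1) by simp
  show i: "integrable M (\<lambda>w. (tap_gap N w)\<^sup>2)"
    by (rule Bochner_Integration.integrable_bound[OF B]) (use le in \<open>auto elim!: eventually_mono intro: order_trans[OF _ abs_ge_self]\<close>)
  have "(\<integral>w. total_sup N w ^ 4 \<partial>M) / real N ^ 4 \<le> (2304 * (real N * beta_sum) ^ 4) / real N ^ 4"
    by (rule divide_right_mono[OF four(2)]) simp
  also have "\<dots> = 2304 * beta_sum ^ 4" using N by (simp add: power_mult_distrib)
  finally have U: "8 * gap_bound ^ 4 + 128 * ((\<integral>w. total_sup N w ^ 4 \<partial>M) / real N ^ 4) \<le> fourth_moment_bound"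
    by (simp add: fourth_moment_bound_def)
  have "(\<integral>w. (tap_gap N w)\<^sup>2 \<partial>M) \<le> (\<integral>w. ?B w \<partial>M)" by (rule integral_mono_AE[OF i B le])
  also have "\<dots> = K * (\<integral>w. \<bar>tap_gap N w\<bar> \<partial>M) + (8 * gap_bound ^ 4 + 128 * ((\<integral>w. total_sup N w ^ 4 \<partial>M) / real N ^ 4)) / K\<^sup>2"
    using int four(1) by (simp add: prob_space)
  also have "\<dots> \<le> K * (\<integral>w. \<bar>tap_gap N w\<bar> \<partial>M) + fourth_moment_bound / K\<^sup>2"
    using U by (intro add_left_mono divide_right_mono) auto
  finally show ?two .
qed

lemma integrable_tap_gap_square:
  assumes q: "0 \<le> q" "q \<le> 1" and lim: "overlap_var q \<longlonglongrightarrow> 0"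
  shows "integrable M (\<lambda>w. (tap_gap N w)\<^sup>2)"
proof (cases "N = 0")
  case True
  then have "tap_gap N w = tap_correction \<beta> 0" for w
    by (simp add: tap_gap_def tap_free_energy_def free_energy_def)
  then show ?thesis by simp
next
  case False
  then have "1 \<le> N" by simp
  then show ?thesis by (intro tap_gap_square_mean(1)[of N 1] tap_gap_mean(1)[OF _ q fixed_point[OF q lim]]) auto
qed

lemma tap_gap_square_tendsto:
  assumes q: "0 \<le> q" "q \<le> 1" and lim: "overlap_var q \<longlonglongrightarrow> 0"
  shows "(\<lambda>N. \<integral>w. (tap_gap N w)\<^sup>2 \<partial>M) \<longlonglongrightarrow> 0"
proof (rule tendsto_zero_of_bounds)
  show "0 \<le> (\<integral>w. (tap_gap N w)\<^sup>2 \<partial>M)" for N by simp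
  fix e :: real assume e: "0 < e"
  have Q: "0 \<le> fourth_moment_bound" by (simp add: fourth_moment_bound_def)
  \<comment> \<open>Large enough for the fourth moment term to be at most \<open>e\<close>.\<close>
  define K where "K = sqrt (fourth_moment_bound / e) + 1"
  have K: "0 < K" using Q e by (simp add: K_def add_nonneg_pos)
  have "fourth_moment_bound / e = (sqrt (fourth_moment_bound / e))\<^sup>2" using Q e by simp
  also have "\<dots> \<le> K\<^sup>2" unfolding K_def using Q e by (intro power_mono) auto
  finally have le: "fourth_moment_bound / K\<^sup>2 \<le> e" using e K by (simp add: field_simps)
  show "\<exists>k. k \<longlonglongrightarrow> 0 \<and> eventually (\<lambda>N. (\<integral>w. (tap_gap N w)\<^sup>2 \<partial>M) \<le> e + k N) sequentially"
  proof (intro exI conjI)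
    show "(\<lambda>N. K * (\<integral>w. \<bar>tap_gap N w\<bar> \<partial>M)) \<longlonglongrightarrow> 0"
      using tendsto_mult_left[OF tap_gap_mean_abs_tendsto[OF q lim], of K] by simp
    show "eventually (\<lambda>N. (\<integral>w. (tap_gap N w)\<^sup>2 \<partial>M) \<le> e + K * (\<integral>w. \<bar>tap_gap N w\<bar> \<partial>M)) sequentially"
      using eventually_ge_at_top[of 1]
    proof eventually_elim
      case (elim N)
      show ?case
        using tap_gap_square_mean(2)[OF elim K tap_gap_mean(1)[OF elim q fixed_point[OF q lim]]] le by linarith
    qed
  qed
qed

end

theorem theorem2:
  fixes \<beta> :: "nat \<Rightarrow> real" and h q :: real
    and M :: "'a measure" and g :: "nat list \<Rightarrow> 'a \<Rightarrow> real"
  assumes "summable (\<lambda>k. 2 ^ (k + 2) * (\<beta> (k + 2))\<^sup>2)"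
    and "prob_space M"
    and "prob_space.indep_vars M (\<lambda>_. borel) g {js. 2 \<le> length js \<and> set js \<subseteq> {1..}}"
    and "\<And>js. 2 \<le> length js \<Longrightarrow> set js \<subseteq> {1..} \<Longrightarrow>
           distributed M lborel (g js) std_normal_density"
    and "q \<in> {0..1}"
    and "(\<lambda>N. \<integral>\<omega>. gibbs_avg2 \<beta> h (\<lambda>js. g js \<omega>) N (\<lambda>\<sigma> \<tau>. (overlap N \<sigma> \<tau> - q)\<^sup>2) \<partial>M)
           \<longlonglongrightarrow> 0"
  shows "(\<forall>N. integrable M (\<lambda>\<omega>.
            (tap_free_energy \<beta> h (\<lambda>js. g js \<omega>) N (magnetization \<beta> h (\<lambda>js. g js \<omega>) N)
             - free_energy \<beta> h (\<lambda>js. g js \<omega>) N)\<^sup>2)) \<and>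
         (\<lambda>N. \<integral>\<omega>.
            (tap_free_energy \<beta> h (\<lambda>js. g js \<omega>) N (magnetization \<beta> h (\<lambda>js. g js \<omega>) N)
             - free_energy \<beta> h (\<lambda>js. g js \<omega>) N)\<^sup>2 \<partial>M) \<longlonglongrightarrow> 0"
proof -
  interpret prob_space M by (rule assms(2))
  interpret spin_glass \<beta> M g h
    by unfold_locales (use assms(1,3,4) in auto)
  have q: "0 \<le> q" "q \<le> 1" using assms(5) by auto
  have lim: "overlap_var q \<longlonglongrightarrow> 0"
    using assms(6) unfolding gibbs_avg2_gibbs by (simp add: overlap_var_def[abs_def])
  show ?thesis
    using integrable_tap_gap_square[OF q lim] tap_gap_square_tendsto[OF q lim] by (simp add: tap_gap_def)
qed

end
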